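(* Let $(T,\eta,\mu)$ be a cartesian monad on a category $\mathcal{C}$ with pullbacks. Then the functor $rep_T: Gph(T)\to Exp(\mathcal{C})$ over $\mathcal{C}$ is a strong morphism of lax monoidal fibrations and a morphism of bifibrations. Moreover, the image of $rep_T$ is contained in $p_{ca}:Cart(\mathcal{C})\to\mathcal{C}$.
   Context: A monad is cartesian if its functor preserves pullbacks and its unit and multiplication are cartesian natural transformations (all naturality squares are pullbacks). In a bifibration, prone means cartesian and supine means cocartesian (opcartesian) morphism; a morphism of bifibrations over $\mathcal{C}$ is a functor over $\mathcal{C}$ preserving prone and supine morphisms. Lax monoidal fibrations. A lax monoidal fibration is a fibration $p:\mathcal{E}\to\mathbf{B}$ with functors $\otimes:\mathcal{E}\times_{\mathbf{B}}\mathcal{E}\to\mathcal{E}$ and $I:\mathbf{B}\to\mathcal{E}$ over $\mathbf{B}$ (not required to preserve prone morphisms) and natural transformations with vertical components $\alpha:A\otimes(B\otimes C)\to(A\otimes B)\otimes C$, $\lambda_A:A\to I_O\otimes A$, $\rho_A:A\otimes I_O\to A$ (for $A,B,C$ in the fibre over $O$), satisfying the pentagon axiom, $(\rho_A\otimes 1_B)\circ\alpha_{A,I_O,B}\circ(1_A\otimes\lambda_B)=1_{A\otimes B}$, and $\rho_{I_O}=\lambda_{I_O}^{-1}$. A morphism of lax monoidal fibrations over the same base is a functor $F$ over $\mathbf{B}$ with fibred natural transformations $\varphi_0:I'_O\to F(I_O)$ and $\varphi_2:F(A)\otimes' F(B)\to F(A\otimes B)$ such that $F(\lambda_A)=\varphi_2\circ(\varphi_0\otimes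 1)\circ\lambda'_{F(A)}$, $F(\rho_A)\circ\varphi_2\circ(1\otimes\varphi_0)=\rho'_{F(A)}$, and $F(\alpha)\circ\varphi_2\circ(1\otimes'\varphi_2)=\varphi_2\circ(\varphi_2\otimes' 1)\circ\alpha'$. It is strong if $\varphi_0,\varphi_2$ are isomorphisms and $F$ preserves prone morphisms. $T$-graphs. An object of $Gph(T)$ over $O\in\mathcal{C}$ is a span $O\xleftarrow{\gamma}A\xrightarrow{\delta}T(O)$ in $\mathcal{C}$. A morphism over $u:O\to Q$ to $(B,\gamma,\delta)$ over $Q$ is $h:A\to B$ with $\gamma h=u\gamma$, $\delta h=T(u)\delta$. $p_T:Gph(T)\to\mathcal{C}$ sends $(h,u)$ to $u$; it is a bifibration. Tensor over $O$: $A\otimes_O B=A\times_{T(O)}T(B)$, the pullback of $\delta_A$ and $T(\gamma_B)$, with $\gamma_\otimes=\gamma_A\pi_1$ and $\delta_\otimes=\mu_O T(\delta_B)\pi_2$; unit $I_O=(O\xleftarrow{1}O\xrightarrow{\eta_O}T(O))$; coherence morphisms are the canonical ones given by universal properties of pullbacks. The fibration $Exp(\mathcal{C})$. For $u:O\to Q$ in $\mathcal{C}$, $u^*:\mathcal{C}_{/Q}\to\mathcal{C}_{/O}$ is the pullback functor. An object of $Exp(\mathcal{C})$ over $O$ is a functor $P:\mathcal{C}_{/O}\to\mathcal{C}_{/O}$; a morphism from $P$ to $R:\mathcal{C}_{/Q}\to\mathcal{C}_{/Q}$ over $u$ is a natural transformation $\tau:Pu^*\to u^*R$; composition of $\tau$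 over $u:O\to Q$ and $\sigma: Rv^*\to v^*S$ over $v:Q\to Z$ is $P(vu)^*\cong Pu^*v^*\to u^*Rv^*\to u^*v^*S\cong(vu)^*S$. The projection $p_{exp}:Exp(\mathcal{C})\to\mathcal{C}$ is a bifibration and a lax monoidal fibration with tensor given by composition of functors (on morphisms $\sigma:P_1u^*\to u^*P_0$, $\tau:Q_1u^*\to u^*Q_0$ the tensor is $P_1Q_1u^*\xrightarrow{P_1\tau}P_1u^*Q_0\xrightarrow{\sigma_{Q_0}}u^*P_0Q_0$), unit the identity functors, and identity coherence. $Cart(\mathcal{C})$ is the subcategory of $Exp(\mathcal{C})$ whose objects are the pullback-preserving functors and whose morphisms are the cartesian natural transformations; $p_{ca}$ is the restriction of $p_{exp}$. The functor $rep_T$. For $A$ in $Gph(T)_O$ and $d:X\to O$, let $A\star X=A\times_{T(O)}T(X)$ be the pullback of $\delta$ and $T(d)$, regarded as an object over $O$ via $A\star X\to A\xrightarrow{\gamma}O$. Then $rep_T(A)=A\star(-):\mathcal{C}_{/O}\to\mathcal{C}_{/O}$. For $(h,u):A\to B$ over $u:O\to Q$ and $d^Y:Y\to Q$ with pullback projection $u^Y:u^*(Y)\to Y$, the component $rep_T(h,u)_Y:A\star u^*(Y)\to u^*(B\star Y)$ is the unique morphism over $O$ whose composite with $u^*(B\star Y)\to B\star Y$ is the morphism $h\star_u u^Y: A\times_{T(O)}T(u^*(Y))\to B\times_{T(Q)}T(Y)$ induced by $h$ and $T(u^Y)$. The coherence data of $rep_T$ are the canonical maps: $\varphi_0:X\to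 I_O\star X$ induced by $d$ and $\eta_X$, and $\varphi_2:A\star(B\star X)\to(A\otimes B)\star X$ induced by the projections and $\mu_X$. *)

theory Defs
  imports "HOL-Library.FuncSet"
begin

section \<open>Categories, functors, natural transformations\<close>

record ('o, 'a) cat =
  Obj :: "'o set"
  Arr :: "'a set"
  Dom :: "'a \<Rightarrow> 'o"
  Cod :: "'a \<Rightarrow> 'o"
  Ide :: "'o \<Rightarrow> 'a"
  Comp :: "'a \<Rightarrow> 'a \<Rightarrow> 'a"  (infixl "\<cdot>\<index>" 70)

definition Hom :: "('o, 'a) cat \<Rightarrow> 'o \<Rightarrow> 'o \<Rightarrow> 'a set" where
  "Hom C x y = {f \<in> Arr C. Dom C f = x \<and> Cod C f = y}"

locale category =
  fixes C :: "('o, 'a) cat" (structure)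
  assumes Dom_Obj: "f \<in> Arr C \<Longrightarrow> Dom C f \<in> Obj C"
    and Cod_Obj: "f \<in> Arr C \<Longrightarrow> Cod C f \<in> Obj C"
    and Ide_Hom: "x \<in> Obj C \<Longrightarrow> Ide C x \<in> Hom C x x"
    and Comp_Hom: "f \<in> Hom C x y \<Longrightarrow> g \<in> Hom C y z \<Longrightarrow> g \<cdot> f \<in> Hom C x z"
    and Ide_left: "f \<in> Arr C \<Longrightarrow> Ide C (Cod C f) \<cdot> f = f"
    and Ide_right: "f \<in> Arr C \<Longrightarrow> f \<cdot> Ide C (Dom C f) = f"
    and Comp_assoc: "f \<in> Hom C w x \<Longrightarrow> g \<in> Hom C x y \<Longrightarrow> h \<in> Hom C y z \<Longrightarrow>
      (h \<cdot> g) \<cdot> f = h \<cdot> (g \<cdot> f)"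

definition iso :: "('o, 'a) cat \<Rightarrow> 'a \<Rightarrow> bool" where
  "iso C f \<longleftrightarrow> f \<in> Arr C \<and> (\<exists>g \<in> Hom C (Cod C f) (Dom C f).
     g \<cdot>\<^bsub>C\<^esub> f = Ide C (Dom C f) \<and> f \<cdot>\<^bsub>C\<^esub> g = Ide C (Cod C f))"

definition subcategory :: "('o, 'a) cat \<Rightarrow> ('o, 'a) cat \<Rightarrow> bool" where
  "subcategory D E \<longleftrightarrow> category D \<and> category E \<and> Obj D \<subseteq> Obj E \<and> Arr D \<subseteq> Arr E \<and>
     (\<forall>f \<in> Arr D. Dom D f = Dom E f \<and> Cod D f = Cod E f) \<and>
     (\<forall>x \<in> Obj D. Ide D x = Ide E x) \<and>
     (\<forall>f \<in> Arr D. \<forall>g \<in> Arr D. Dom D g = Cod D f \<longrightarrow> g \<cdot>\<^bsub>D\<^esub> f = g \<cdot>\<^bsub>E\<^esub> f)"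

record ('o, 'a, 'p, 'b) ftr =
  onO :: "'o \<Rightarrow> 'p"
  onA :: "'a \<Rightarrow> 'b"

locale is_functor = A: category A + B: category B
  for A :: "('o, 'a) cat" and B :: "('p, 'b) cat" and F :: "('o, 'a, 'p, 'b) ftr" +
  assumes onO_Obj: "x \<in> Obj A \<Longrightarrow> onO F x \<in> Obj B"
    and onA_Hom: "f \<in> Hom A x y \<Longrightarrow> onA F f \<in> Hom B (onO F x) (onO F y)"
    and onA_Ide: "x \<in> Obj A \<Longrightarrow> onA F (Ide A x) = Ide B (onO F x)"
    and onA_Comp: "f \<in> Hom A x y \<Longrightarrow> g \<in> Hom A y z \<Longrightarrow>
      onA F (g \<cdot>\<^bsub>A\<^esub> f) = onA F g \<cdot>\<^bsub>B\<^esub> onA F f"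

text \<open>Identity and composite functors are made extensional (set to \<open>undefined\<close> outside the
  source category), so that the strict unit and associativity laws for functors which are
  themselves extensional are equalities of records.\<close>

definition id_ftr :: "('o, 'a) cat \<Rightarrow> ('o, 'a, 'o, 'a) ftr" where
  "id_ftr A = \<lparr>onO = (\<lambda>x \<in> Obj A. x), onA = (\<lambda>f \<in> Arr A. f)\<rparr>"

definition comp_ftr ::
  "('o, 'a) cat \<Rightarrow> ('p, 'b, 'q, 'c) ftr \<Rightarrow> ('o, 'a, 'p, 'b) ftr \<Rightarrow> ('o, 'a, 'q, 'c) ftr" where
  "comp_ftr A G F =
     \<lparr>onO = (\<lambda>x \<in> Obj A. onO G (onO F x)), onA = (\<lambda>f \<in> Arr A. onA G (onA F f))\<rparr>"

locale nat_trans = F: is_functor A B F + G: is_functor A B G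
  for A :: "('o, 'a) cat" and B :: "('p, 'b) cat"
    and F G :: "('o, 'a, 'p, 'b) ftr" and t :: "'o \<Rightarrow> 'b" +
  assumes component: "x \<in> Obj A \<Longrightarrow> t x \<in> Hom B (onO F x) (onO G x)"
    and natural: "f \<in> Hom A x y \<Longrightarrow> t y \<cdot>\<^bsub>B\<^esub> onA F f = onA G f \<cdot>\<^bsub>B\<^esub> t x"

section \<open>Pullbacks and cartesian monads\<close>

text \<open>\<open>p\<close> and \<open>q\<close> are the projections of a pullback of the cospan \<open>f\<close>, \<open>g\<close>, with \<open>f \<cdot> p = g \<cdot> q\<close>.\<close>

definition is_pullback :: "('o, 'a) cat \<Rightarrow> 'a \<Rightarrow> 'a \<Rightarrow> 'a \<Rightarrow> 'a \<Rightarrow> bool" where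
  "is_pullback C f g p q \<longleftrightarrow>
     f \<in> Arr C \<and> g \<in> Arr C \<and> p \<in> Arr C \<and> q \<in> Arr C \<and>
     Cod C f = Cod C g \<and> Dom C p = Dom C q \<and> Cod C p = Dom C f \<and> Cod C q = Dom C g \<and>
     f \<cdot>\<^bsub>C\<^esub> p = g \<cdot>\<^bsub>C\<^esub> q \<and>
     (\<forall>a \<in> Arr C. \<forall>b \<in> Arr C.
        Dom C a = Dom C b \<and> Cod C a = Dom C f \<and> Cod C b = Dom C g \<and>
        f \<cdot>\<^bsub>C\<^esub> a = g \<cdot>\<^bsub>C\<^esub> b \<longrightarrow>
        (\<exists>!m. m \<in> Hom C (Dom C a) (Dom C p) \<and> p \<cdot>\<^bsub>C\<^esub> m = a \<and> q \<cdot>\<^bsub>C\<^esub> m = b))"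

text \<open>A category with pullbacks comes with an arbitrary (not normalised) choice \<open>pb\<close> of the
  two projections.\<close>

locale category_with_pullbacks = category C
  for C :: "('o, 'a) cat" and pb :: "'a \<Rightarrow> 'a \<Rightarrow> 'a \<times> 'a" +
  assumes pb: "f \<in> Arr C \<Longrightarrow> g \<in> Arr C \<Longrightarrow> Cod C f = Cod C g \<Longrightarrow>
    is_pullback C f g (fst (pb f g)) (snd (pb f g))"

definition preserves_pullbacks ::
  "('o, 'a) cat \<Rightarrow> ('p, 'b) cat \<Rightarrow> ('o, 'a, 'p, 'b) ftr \<Rightarrow> bool" where
  "preserves_pullbacks A B F \<longleftrightarrow> (\<forall>f g p q. is_pullback A f g p q \<longrightarrow>
     is_pullback B (onA F f) (onA F g) (onA F p) (onA F q))"

definition cartesian_nat_trans ::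
  "('o, 'a) cat \<Rightarrow> ('p, 'b) cat \<Rightarrow> ('o, 'a, 'p, 'b) ftr \<Rightarrow> ('o, 'a, 'p, 'b) ftr \<Rightarrow>
   ('o \<Rightarrow> 'b) \<Rightarrow> bool" where
  "cartesian_nat_trans A B F G t \<longleftrightarrow> nat_trans A B F G t \<and>
     (\<forall>f \<in> Arr A. is_pullback B (t (Cod A f)) (onA G f) (onA F f) (t (Dom A f)))"

locale is_monad = T: is_functor C C T
  + unit: nat_trans C C "id_ftr C" T \<eta> + mult: nat_trans C C "comp_ftr C T T" T \<mu>
  for C :: "('o, 'a) cat" and T :: "('o, 'a, 'o, 'a) ftr" and \<eta> \<mu> :: "'o \<Rightarrow> 'a" +
  assumes unit_left: "x \<in> Obj C \<Longrightarrow> \<mu> x \<cdot>\<^bsub>C\<^esub> \<eta> (onO T x) = Ide C (onO T x)"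
    and unit_right: "x \<in> Obj C \<Longrightarrow> \<mu> x \<cdot>\<^bsub>C\<^esub> onA T (\<eta> x) = Ide C (onO T x)"
    and mult_assoc: "x \<in> Obj C \<Longrightarrow> \<mu> x \<cdot>\<^bsub>C\<^esub> \<mu> (onO T x) = \<mu> x \<cdot>\<^bsub>C\<^esub> onA T (\<mu> x)"

locale cartesian_monad = is_monad C T \<eta> \<mu>
  for C :: "('o, 'a) cat" and T :: "('o, 'a, 'o, 'a) ftr" and \<eta> \<mu> :: "'o \<Rightarrow> 'a" +
  assumes T_pullbacks: "preserves_pullbacks C C T"
    and unit_cartesian: "cartesian_nat_trans C C (id_ftr C) T \<eta>"
    and mult_cartesian: "cartesian_nat_trans C C (comp_ftr C T T) T \<mu>"

section \<open>Fibrations and bifibrations\<close>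

definition prone :: "('x, 'e) cat \<Rightarrow> ('o, 'a) cat \<Rightarrow> ('x, 'e, 'o, 'a) ftr \<Rightarrow> 'e \<Rightarrow> bool" where
  "prone E B p f \<longleftrightarrow> f \<in> Arr E \<and>
     (\<forall>g \<in> Arr E. \<forall>w \<in> Hom B (onO p (Dom E g)) (onO p (Dom E f)).
        Cod E g = Cod E f \<and> onA p g = onA p f \<cdot>\<^bsub>B\<^esub> w \<longrightarrow>
        (\<exists>!h. h \<in> Hom E (Dom E g) (Dom E f) \<and> onA p h = w \<and> f \<cdot>\<^bsub>E\<^esub> h = g))"

definition supine :: "('x, 'e) cat \<Rightarrow> ('o, 'a) cat \<Rightarrow> ('x, 'e, 'o, 'a) ftr \<Rightarrow> 'e \<Rightarrow> bool" where
  "supine E B p f \<longleftrightarrow> f \<in> Arr E \<and>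
     (\<forall>g \<in> Arr E. \<forall>w \<in> Hom B (onO p (Cod E f)) (onO p (Cod E g)).
        Dom E g = Dom E f \<and> onA p g = w \<cdot>\<^bsub>B\<^esub> onA p f \<longrightarrow>
        (\<exists>!h. h \<in> Hom E (Cod E f) (Cod E g) \<and> onA p h = w \<and> h \<cdot>\<^bsub>E\<^esub> f = g))"

definition fibration :: "('x, 'e) cat \<Rightarrow> ('o, 'a) cat \<Rightarrow> ('x, 'e, 'o, 'a) ftr \<Rightarrow> bool" where
  "fibration E B p \<longleftrightarrow> is_functor E B p \<and>
     (\<forall>y \<in> Obj E. \<forall>u \<in> Arr B. Cod B u = onO p y \<longrightarrow>
        (\<exists>f. prone E B p f \<and> Cod E f = y \<and> onA p f = u))"

definition opfibration :: "('x, 'e) cat \<Rightarrow> ('o, 'a) cat \<Rightarrow> ('x, 'e, 'o, 'a) ftr \<Rightarrow> bool" where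
  "opfibration E B p \<longleftrightarrow> is_functor E B p \<and>
     (\<forall>x \<in> Obj E. \<forall>u \<in> Arr B. Dom B u = onO p x \<longrightarrow>
        (\<exists>f. supine E B p f \<and> Dom E f = x \<and> onA p f = u))"

definition bifibration :: "('x, 'e) cat \<Rightarrow> ('o, 'a) cat \<Rightarrow> ('x, 'e, 'o, 'a) ftr \<Rightarrow> bool" where
  "bifibration E B p \<longleftrightarrow> fibration E B p \<and> opfibration E B p"

definition functor_over ::
  "('o, 'a) cat \<Rightarrow> ('x, 'e) cat \<Rightarrow> ('x, 'e, 'o, 'a) ftr \<Rightarrow>
   ('y, 'd) cat \<Rightarrow> ('y, 'd, 'o, 'a) ftr \<Rightarrow> ('x, 'e, 'y, 'd) ftr \<Rightarrow> bool" where
  "functor_over B E p E' p' F \<longleftrightarrow>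
     is_functor E B p \<and> is_functor E' B p' \<and> is_functor E E' F \<and>
     (\<forall>x \<in> Obj E. onO p' (onO F x) = onO p x) \<and>
     (\<forall>f \<in> Arr E. onA p' (onA F f) = onA p f)"

definition preserves_prone ::
  "('o, 'a) cat \<Rightarrow> ('x, 'e) cat \<Rightarrow> ('x, 'e, 'o, 'a) ftr \<Rightarrow>
   ('y, 'd) cat \<Rightarrow> ('y, 'd, 'o, 'a) ftr \<Rightarrow> ('x, 'e, 'y, 'd) ftr \<Rightarrow> bool" where
  "preserves_prone B E p E' p' F \<longleftrightarrow> (\<forall>f. prone E B p f \<longrightarrow> prone E' B p' (onA F f))"

definition preserves_supine ::
  "('o, 'a) cat \<Rightarrow> ('x, 'e) cat \<Rightarrow> ('x, 'e, 'o, 'a) ftr \<Rightarrow>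
   ('y, 'd) cat \<Rightarrow> ('y, 'd, 'o, 'a) ftr \<Rightarrow> ('x, 'e, 'y, 'd) ftr \<Rightarrow> bool" where
  "preserves_supine B E p E' p' F \<longleftrightarrow> (\<forall>f. supine E B p f \<longrightarrow> supine E' B p' (onA F f))"

definition bifibration_morphism ::
  "('o, 'a) cat \<Rightarrow> ('x, 'e) cat \<Rightarrow> ('x, 'e, 'o, 'a) ftr \<Rightarrow>
   ('y, 'd) cat \<Rightarrow> ('y, 'd, 'o, 'a) ftr \<Rightarrow> ('x, 'e, 'y, 'd) ftr \<Rightarrow> bool" where
  "bifibration_morphism B E p E' p' F \<longleftrightarrow>
     bifibration E B p \<and> bifibration E' B p' \<and> functor_over B E p E' p' F \<and>
     preserves_prone B E p E' p' F \<and> preserves_supine B E p E' p' F"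

section \<open>Lax monoidal fibrations\<close>

definition fibre_product :: "('x, 'e) cat \<Rightarrow> ('x, 'e, 'o, 'a) ftr \<Rightarrow> ('x \<times> 'x, 'e \<times> 'e) cat" where
  "fibre_product E p = \<lparr>
     Obj = {(x, y). x \<in> Obj E \<and> y \<in> Obj E \<and> onO p x = onO p y},
     Arr = {(f, g). f \<in> Arr E \<and> g \<in> Arr E \<and> onA p f = onA p g},
     Dom = (\<lambda>(f, g). (Dom E f, Dom E g)),
     Cod = (\<lambda>(f, g). (Cod E f, Cod E g)),
     Ide = (\<lambda>(x, y). (Ide E x, Ide E y)),
     Comp = (\<lambda>(f', g') (f, g). (f' \<cdot>\<^bsub>E\<^esub> f, g' \<cdot>\<^bsub>E\<^esub> g))\<rparr>"

record ('o, 'a, 'x, 'e) lmf =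
  base :: "('o, 'a) cat"
  total :: "('x, 'e) cat"
  proj :: "('x, 'e, 'o, 'a) ftr"
  tensor :: "('x \<times> 'x, 'e \<times> 'e, 'x, 'e) ftr"
  unit :: "('o, 'a, 'x, 'e) ftr"
  assoc :: "'x \<Rightarrow> 'x \<Rightarrow> 'x \<Rightarrow> 'e"
  lunit :: "'x \<Rightarrow> 'e"
  runit :: "'x \<Rightarrow> 'e"

abbreviation tensO :: "('o, 'a, 'x, 'e) lmf \<Rightarrow> 'x \<Rightarrow> 'x \<Rightarrow> 'x"  (infixl "\<otimes>\<index>" 75) where
  "x \<otimes>\<^bsub>M\<^esub> y \<equiv> onO (tensor M) (x, y)"

abbreviation tensA :: "('o, 'a, 'x, 'e) lmf \<Rightarrow> 'e \<Rightarrow> 'e \<Rightarrow> 'e"  (infixl "\<odot>\<index>" 75) where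
  "f \<odot>\<^bsub>M\<^esub> g \<equiv> onA (tensor M) (f, g)"

definition vertical :: "('o, 'a, 'x, 'e) lmf \<Rightarrow> 'x \<Rightarrow> 'x \<Rightarrow> 'e set" where
  "vertical M x y = {f \<in> Hom (total M) x y. onA (proj M) f = Ide (base M) (onO (proj M) x)}"

definition fib :: "('o, 'a, 'x, 'e) lmf \<Rightarrow> 'o \<Rightarrow> 'x set" where
  "fib M U = {x \<in> Obj (total M). onO (proj M) x = U}"

locale lax_monoidal_fibration =
  fixes M :: "('o, 'a, 'x, 'e) lmf" (structure)
  assumes fibration: "fibration (total M) (base M) (proj M)"
    and tensor_functor: "is_functor (fibre_product (total M) (proj M)) (total M) (tensor M)"
    and tensor_over: "x \<in> fib M U \<Longrightarrow> y \<in> fib M U \<Longrightarrow> x \<otimes> y \<in> fib M U"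
      "\<lbrakk>f \<in> Arr (total M); g \<in> Arr (total M); onA (proj M) f = onA (proj M) g\<rbrakk> \<Longrightarrow>
         onA (proj M) (f \<odot> g) = onA (proj M) f"
    and unit_functor: "is_functor (base M) (total M) (unit M)"
    and unit_over: "U \<in> Obj (base M) \<Longrightarrow> onO (unit M) U \<in> fib M U"
      "u \<in> Arr (base M) \<Longrightarrow> onA (proj M) (onA (unit M) u) = u"
    and assoc_vertical: "\<lbrakk>x \<in> fib M U; y \<in> fib M U; z \<in> fib M U\<rbrakk> \<Longrightarrow>
         assoc M x y z \<in> vertical M (x \<otimes> (y \<otimes> z)) ((x \<otimes> y) \<otimes> z)"
    and assoc_natural: "\<lbrakk>f \<in> Hom (total M) x x'; g \<in> Hom (total M) y y'; h \<in> Hom (total M) z z';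
         onA (proj M) f = onA (proj M) g; onA (proj M) g = onA (proj M) h\<rbrakk> \<Longrightarrow>
         assoc M x' y' z' \<cdot>\<^bsub>total M\<^esub> (f \<odot> (g \<odot> h)) =
         ((f \<odot> g) \<odot> h) \<cdot>\<^bsub>total M\<^esub> assoc M x y z"
    and lunit_vertical: "x \<in> fib M U \<Longrightarrow> lunit M x \<in> vertical M x (onO (unit M) U \<otimes> x)"
    and lunit_natural: "f \<in> Hom (total M) x x' \<Longrightarrow>
         lunit M x' \<cdot>\<^bsub>total M\<^esub> f =
         (onA (unit M) (onA (proj M) f) \<odot> f) \<cdot>\<^bsub>total M\<^esub> lunit M x"
    and runit_vertical: "x \<in> fib M U \<Longrightarrow> runit M x \<in> vertical M (x \<otimes> onO (unit M) U) x"
    and runit_natural: "f \<in> Hom (total M) x x' \<Longrightarrow>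
         runit M x' \<cdot>\<^bsub>total M\<^esub> (f \<odot> onA (unit M) (onA (proj M) f)) =
         f \<cdot>\<^bsub>total M\<^esub> runit M x"
    and pentagon: "\<lbrakk>w \<in> fib M U; x \<in> fib M U; y \<in> fib M U; z \<in> fib M U\<rbrakk> \<Longrightarrow>
         assoc M (w \<otimes> x) y z \<cdot>\<^bsub>total M\<^esub> assoc M w x (y \<otimes> z) =
         (assoc M w x y \<odot> Ide (total M) z) \<cdot>\<^bsub>total M\<^esub> assoc M w (x \<otimes> y) z
           \<cdot>\<^bsub>total M\<^esub> (Ide (total M) w \<odot> assoc M x y z)"
    and triangle: "\<lbrakk>x \<in> fib M U; y \<in> fib M U\<rbrakk> \<Longrightarrow>
         (runit M x \<odot> Ide (total M) y) \<cdot>\<^bsub>total M\<^esub> assoc M x (onO (unit M) U) y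
           \<cdot>\<^bsub>total M\<^esub> (Ide (total M) x \<odot> lunit M y) = Ide (total M) (x \<otimes> y)"
    and unit_inverse: "U \<in> Obj (base M) \<Longrightarrow>
         runit M (onO (unit M) U) \<cdot>\<^bsub>total M\<^esub> lunit M (onO (unit M) U)
           = Ide (total M) (onO (unit M) U)"
      "U \<in> Obj (base M) \<Longrightarrow>
         lunit M (onO (unit M) U) \<cdot>\<^bsub>total M\<^esub> runit M (onO (unit M) U)
           = Ide (total M) (onO (unit M) U \<otimes> onO (unit M) U)"

text \<open>A morphism from \<open>M\<close> to \<open>N\<close> over a common base.  In the usual notation \<open>M = (\<E>, \<otimes>, I)\<close> and
  \<open>N = (\<E>', \<otimes>', I')\<close>; \<open>\<phi>0 U : I'\<^sub>U \<rightarrow> F I\<^sub>U\<close> and \<open>\<phi>2 x y : F x \<otimes>' F y \<rightarrow> F (x \<otimes> y)\<close>.\<close>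

locale lax_monoidal_fibration_morphism =
  M: lax_monoidal_fibration M + N: lax_monoidal_fibration N
  for M :: "('o, 'a, 'x, 'e) lmf" and N :: "('o, 'a, 'y, 'd) lmf"
    and F :: "('x, 'e, 'y, 'd) ftr" and \<phi>0 :: "'o \<Rightarrow> 'd" and \<phi>2 :: "'x \<Rightarrow> 'x \<Rightarrow> 'd" +
  assumes same_base: "base N = base M"
    and over: "functor_over (base M) (total M) (proj M) (total N) (proj N) F"
    and phi0_vertical: "U \<in> Obj (base M) \<Longrightarrow>
         \<phi>0 U \<in> vertical N (onO (unit N) U) (onO F (onO (unit M) U))"
    and phi0_natural: "u \<in> Hom (base M) U V \<Longrightarrow>
         \<phi>0 V \<cdot>\<^bsub>total N\<^esub> onA (unit N) u = onA F (onA (unit M) u) \<cdot>\<^bsub>total N\<^esub> \<phi>0 U"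
    and phi2_vertical: "\<lbrakk>x \<in> fib M U; y \<in> fib M U\<rbrakk> \<Longrightarrow>
         \<phi>2 x y \<in> vertical N (onO F x \<otimes>\<^bsub>N\<^esub> onO F y) (onO F (x \<otimes>\<^bsub>M\<^esub> y))"
    and phi2_natural: "\<lbrakk>f \<in> Hom (total M) x x'; g \<in> Hom (total M) y y';
         onA (proj M) f = onA (proj M) g\<rbrakk> \<Longrightarrow>
         \<phi>2 x' y' \<cdot>\<^bsub>total N\<^esub> (onA F f \<odot>\<^bsub>N\<^esub> onA F g) =
         onA F (f \<odot>\<^bsub>M\<^esub> g) \<cdot>\<^bsub>total N\<^esub> \<phi>2 x y"
    and lunit_coherence: "x \<in> fib M U \<Longrightarrow>
         onA F (lunit M x) =
         \<phi>2 (onO (unit M) U) x \<cdot>\<^bsub>total N\<^esub> (\<phi>0 U \<odot>\<^bsub>N\<^esub> Ide (total N) (onO F x))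
           \<cdot>\<^bsub>total N\<^esub> lunit N (onO F x)"
    and runit_coherence: "x \<in> fib M U \<Longrightarrow>
         onA F (runit M x) \<cdot>\<^bsub>total N\<^esub> \<phi>2 x (onO (unit M) U)
           \<cdot>\<^bsub>total N\<^esub> (Ide (total N) (onO F x) \<odot>\<^bsub>N\<^esub> \<phi>0 U) =
         runit N (onO F x)"
    and assoc_coherence: "\<lbrakk>x \<in> fib M U; y \<in> fib M U; z \<in> fib M U\<rbrakk> \<Longrightarrow>
         onA F (assoc M x y z) \<cdot>\<^bsub>total N\<^esub> \<phi>2 x (y \<otimes>\<^bsub>M\<^esub> z)
           \<cdot>\<^bsub>total N\<^esub> (Ide (total N) (onO F x) \<odot>\<^bsub>N\<^esub> \<phi>2 y z) =
         \<phi>2 (x \<otimes>\<^bsub>M\<^esub> y) z \<cdot>\<^bsub>total N\<^esub> (\<phi>2 x y \<odot>\<^bsub>N\<^esub> Ide (total N) (onO F z))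
           \<cdot>\<^bsub>total N\<^esub> assoc N (onO F x) (onO F y) (onO F z)"

locale strong_lax_monoidal_fibration_morphism = lax_monoidal_fibration_morphism M N F \<phi>0 \<phi>2
  for M :: "('o, 'a, 'x, 'e) lmf" and N :: "('o, 'a, 'y, 'd) lmf"
    and F :: "('x, 'e, 'y, 'd) ftr" and \<phi>0 :: "'o \<Rightarrow> 'd" and \<phi>2 :: "'x \<Rightarrow> 'x \<Rightarrow> 'd" +
  assumes phi0_iso: "U \<in> Obj (base M) \<Longrightarrow> iso (total N) (\<phi>0 U)"
    and phi2_iso: "\<lbrakk>x \<in> fib M U; y \<in> fib M U\<rbrakk> \<Longrightarrow> iso (total N) (\<phi>2 x y)"
    and prone: "preserves_prone (base M) (total M) (proj M) (total N) (proj N) F"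

section \<open>Slices and pullback functors\<close>

text \<open>An object of the slice over \<open>U\<close> is an arrow \<open>d\<close> into \<open>U\<close>; an arrow is a triple \<open>(d, f, d')\<close>
  with \<open>d' \<cdot> f = d\<close>.\<close>

definition slice :: "('o, 'a) cat \<Rightarrow> 'o \<Rightarrow> ('a, 'a \<times> 'a \<times> 'a) cat" where
  "slice C U = \<lparr>
     Obj = {d \<in> Arr C. Cod C d = U},
     Arr = {(d, f, d'). d \<in> Arr C \<and> Cod C d = U \<and> d' \<in> Arr C \<and> Cod C d' = U \<and>
              f \<in> Hom C (Dom C d) (Dom C d') \<and> d' \<cdot>\<^bsub>C\<^esub> f = d},
     Dom = (\<lambda>(d, f, d'). d),
     Cod = (\<lambda>(d, f, d'). d'),
     Ide = (\<lambda>d. (d, Ide C (Dom C d), d)),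
     Comp = (\<lambda>(d', g, d'') (d, f, _). (d, g \<cdot>\<^bsub>C\<^esub> f, d''))\<rparr>"

type_synonym 'a slice_ftr = "('a, 'a \<times> 'a \<times> 'a, 'a, 'a \<times> 'a \<times> 'a) ftr"

context
  fixes C :: "('o, 'a) cat" (structure) and pb :: "'a \<Rightarrow> 'a \<Rightarrow> 'a \<times> 'a"
begin

definition pb1 :: "'a \<Rightarrow> 'a \<Rightarrow> 'a" where "pb1 f g = fst (pb f g)"
definition pb2 :: "'a \<Rightarrow> 'a \<Rightarrow> 'a" where "pb2 f g = snd (pb f g)"

text \<open>The arrow into the chosen pullback of \<open>f\<close>, \<open>g\<close> induced by \<open>a\<close>, \<open>b\<close> with \<open>f \<cdot> a = g \<cdot> b\<close>.\<close>

definition pairing :: "'a \<Rightarrow> 'a \<Rightarrow> 'a \<Rightarrow> 'a \<Rightarrow> 'a" where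
  "pairing f g a b =
     (THE m. m \<in> Hom C (Dom C a) (Dom C (pb1 f g)) \<and> pb1 f g \<cdot> m = a \<and> pb2 f g \<cdot> m = b)"

text \<open>For \<open>u : U \<rightarrow> V\<close>, \<open>w\<close> over \<open>U\<close>, \<open>z\<close> over \<open>V\<close> and \<open>k\<close> from the domain of \<open>w\<close> to that of \<open>z\<close>
  with \<open>z \<cdot> k = u \<cdot> w\<close>: the arrow \<open>w \<rightarrow> u\<^sup>*(z)\<close> over \<open>U\<close> whose composite with the projection
  of the pullback is \<open>k\<close>.  Here \<open>u\<^sup>*(z) = pb1 u z\<close>, and its projection to \<open>z\<close> is \<open>pb2 u z\<close>.\<close>

definition into_pull :: "'a \<Rightarrow> 'a \<Rightarrow> 'a \<Rightarrow> 'a \<Rightarrow> 'a \<times> 'a \<times> 'a" where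
  "into_pull u w z k = (w, pairing u z w k, pb1 u z)"

definition pull :: "'a \<Rightarrow> 'a slice_ftr" where
  "pull u = \<lparr>
     onO = (\<lambda>d \<in> Obj (slice C (Cod C u)). pb1 u d),
     onA = (\<lambda>(d, f, d') \<in> Arr (slice C (Cod C u)). into_pull u (pb1 u d) d' (f \<cdot> pb2 u d))\<rparr>"

text \<open>The canonical isomorphisms \<open>(v u)\<^sup>* \<rightarrow> u\<^sup>* v\<^sup>*\<close> and \<open>u\<^sup>* v\<^sup>* \<rightarrow> (v u)\<^sup>*\<close> at \<open>z\<close>,
  and \<open>1\<^sub>U\<^sup>* \<rightarrow> 1\<close> and \<open>1 \<rightarrow> 1\<^sub>U\<^sup>*\<close> at \<open>d\<close>.\<close>

definition pull_split :: "'a \<Rightarrow> 'a \<Rightarrow> 'a \<Rightarrow> 'a \<times> 'a \<times> 'a" where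
  "pull_split u v z = into_pull u (pb1 (v \<cdot> u) z) (pb1 v z)
     (pairing v z (u \<cdot> pb1 (v \<cdot> u) z) (pb2 (v \<cdot> u) z))"

definition pull_merge :: "'a \<Rightarrow> 'a \<Rightarrow> 'a \<Rightarrow> 'a \<times> 'a \<times> 'a" where
  "pull_merge u v z =
     into_pull (v \<cdot> u) (pb1 u (pb1 v z)) z (pb2 v z \<cdot> pb2 u (pb1 v z))"

definition from_pull_ide :: "'o \<Rightarrow> 'a \<Rightarrow> 'a \<times> 'a \<times> 'a" where
  "from_pull_ide U d = (pb1 (Ide C U) d, pb2 (Ide C U) d, d)"

definition to_pull_ide :: "'o \<Rightarrow> 'a \<Rightarrow> 'a \<times> 'a \<times> 'a" where
  "to_pull_ide U d = into_pull (Ide C U) d d (Ide C (Dom C d))"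

end

section \<open>The fibration of endofunctors of slices\<close>

text \<open>An object is a pair \<open>(U, P)\<close>, an arrow is \<open>((U, P), u, \<tau>, (V, R))\<close>.  Functors and component
  families are extensional, so that their equality is the intended one.\<close>

type_synonym ('o, 'a) exp_obj = "'o \<times> 'a slice_ftr"
type_synonym ('o, 'a) exp_arr =
  "('o, 'a) exp_obj \<times> 'a \<times> ('a \<Rightarrow> 'a \<times> 'a \<times> 'a) \<times> ('o, 'a) exp_obj"

context
  fixes C :: "('o, 'a) cat" (structure) and pb :: "'a \<Rightarrow> 'a \<Rightarrow> 'a \<times> 'a"
begin

definition exp_objs :: "('o, 'a) exp_obj set" where
  "exp_objs = {(U, P). U \<in> Obj C \<and> is_functor (slice C U) (slice C U) P \<and>
     onO P \<in> extensional (Obj (slice C U)) \<and> onA P \<in> extensional (Arr (slice C U))}"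

definition exp_arrs :: "('o, 'a) exp_arr set" where
  "exp_arrs = {((U, P), u, \<tau>, (V, R)). (U, P) \<in> exp_objs \<and> (V, R) \<in> exp_objs \<and> u \<in> Hom C U V \<and>
     nat_trans (slice C V) (slice C U)
       (comp_ftr (slice C V) P (pull C pb u)) (comp_ftr (slice C V) (pull C pb u) R) \<tau> \<and>
     \<tau> \<in> extensional (Obj (slice C V))}"

text \<open>A natural transformation \<open>\<sigma> : P \<rightarrow> R\<close> between endofunctors of the slice over \<open>U\<close>, as a
  vertical arrow: \<open>P 1\<^sub>U\<^sup>* \<cong> P \<rightarrow> R \<cong> 1\<^sub>U\<^sup>* R\<close>.\<close>

definition exp_vert ::
  "'o \<Rightarrow> 'a slice_ftr \<Rightarrow> ('a \<Rightarrow> 'a \<times> 'a \<times> 'a) \<Rightarrow> 'a slice_ftr \<Rightarrow> ('o, 'a) exp_arr" where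
  "exp_vert U P \<sigma> R = ((U, P), Ide C U,
     (\<lambda>d \<in> Obj (slice C U).
        to_pull_ide C pb U (onO R d) \<cdot>\<^bsub>slice C U\<^esub> \<sigma> d
          \<cdot>\<^bsub>slice C U\<^esub> onA P (from_pull_ide C pb U d)),
     (U, R))"

definition exp_ide :: "('o, 'a) exp_obj \<Rightarrow> ('o, 'a) exp_arr" where
  "exp_ide = (\<lambda>(U, P). exp_vert U P (\<lambda>d. Ide (slice C U) (onO P d)) P)"

fun exp_comp :: "('o, 'a) exp_arr \<Rightarrow> ('o, 'a) exp_arr \<Rightarrow> ('o, 'a) exp_arr" where
  "exp_comp (_, v, \<sigma>, (W, S)) ((U, P), u, \<tau>, _) = ((U, P), v \<cdot> u,
     (\<lambda>z \<in> Obj (slice C W).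
        pull_merge C pb u v (onO S z)
          \<cdot>\<^bsub>slice C U\<^esub> onA (pull C pb u) (\<sigma> z)
          \<cdot>\<^bsub>slice C U\<^esub> \<tau> (pb1 pb v z)
          \<cdot>\<^bsub>slice C U\<^esub> onA P (pull_split C pb u v z)),
     (W, S))"

definition Exp :: "(('o, 'a) exp_obj, ('o, 'a) exp_arr) cat" where
  "Exp = \<lparr>Obj = exp_objs, Arr = exp_arrs,
     Dom = (\<lambda>(P, u, \<tau>, R). P), Cod = (\<lambda>(P, u, \<tau>, R). R),
     Ide = exp_ide, Comp = exp_comp\<rparr>"

definition p_exp :: "(('o, 'a) exp_obj, ('o, 'a) exp_arr, 'o, 'a) ftr" where
  "p_exp = \<lparr>onO = (\<lambda>(U, P). U), onA = (\<lambda>(P, u, \<tau>, R). u)\<rparr>"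

fun exp_tensO :: "('o, 'a) exp_obj \<times> ('o, 'a) exp_obj \<Rightarrow> ('o, 'a) exp_obj" where
  "exp_tensO ((U, P), (_, Q)) = (U, comp_ftr (slice C U) P Q)"

fun exp_tensA :: "('o, 'a) exp_arr \<times> ('o, 'a) exp_arr \<Rightarrow> ('o, 'a) exp_arr" where
  "exp_tensA (((U, P1), u, \<sigma>, (V, P0)), ((_, Q1), _, \<tau>, (_, Q0))) =
     ((U, comp_ftr (slice C U) P1 Q1), u,
      (\<lambda>d \<in> Obj (slice C V). \<sigma> (onO Q0 d) \<cdot>\<^bsub>slice C U\<^esub> onA P1 (\<tau> d)),
      (V, comp_ftr (slice C V) P0 Q0))"

definition exp_unit :: "('o, 'a, ('o, 'a) exp_obj, ('o, 'a) exp_arr) ftr" where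
  "exp_unit = \<lparr>
     onO = (\<lambda>U. (U, id_ftr (slice C U))),
     onA = (\<lambda>u. ((Dom C u, id_ftr (slice C (Dom C u))), u,
        (\<lambda>d \<in> Obj (slice C (Cod C u)). Ide (slice C (Dom C u)) (onO (pull C pb u) d)),
        (Cod C u, id_ftr (slice C (Cod C u)))))\<rparr>"

text \<open>Composition of extensional functors is strictly associative and unital, so the coherence
  arrows are identities.\<close>

definition Exp_lmf :: "('o, 'a, ('o, 'a) exp_obj, ('o, 'a) exp_arr) lmf" where
  "Exp_lmf = \<lparr>base = C, total = Exp, proj = p_exp,
     tensor = \<lparr>onO = exp_tensO, onA = exp_tensA\<rparr>, unit = exp_unit,
     assoc = (\<lambda>P Q R. exp_ide (exp_tensO (P, exp_tensO (Q, R)))),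
     lunit = exp_ide, runit = exp_ide\<rparr>"

definition Cart :: "(('o, 'a) exp_obj, ('o, 'a) exp_arr) cat" where
  "Cart = Exp \<lparr>
     Obj := {(U, P) \<in> exp_objs. preserves_pullbacks (slice C U) (slice C U) P},
     Arr := {((U, P), u, \<tau>, (V, R)) \<in> exp_arrs.
        preserves_pullbacks (slice C U) (slice C U) P \<and>
        preserves_pullbacks (slice C V) (slice C V) R \<and>
        cartesian_nat_trans (slice C V) (slice C U)
          (comp_ftr (slice C V) P (pull C pb u)) (comp_ftr (slice C V) (pull C pb u) R) \<tau>}\<rparr>"

end

section \<open>The fibration of T-graphs\<close>

text \<open>A \<open>T\<close>-graph over \<open>U\<close> is a pair \<open>(\<gamma>, \<delta>)\<close> of arrows \<open>\<gamma> : A \<rightarrow> U\<close> and \<open>\<delta> : A \<rightarrow> T U\<close> with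
  common domain; \<open>A\<close> and \<open>U\<close> are recovered as the domain and codomain of \<open>\<gamma>\<close>.  An arrow \<open>(h, u)\<close>
  is stored together with its source and target.\<close>

type_synonym 'a gph_obj = "'a \<times> 'a"
type_synonym 'a gph_arr = "'a gph_obj \<times> ('a \<times> 'a) \<times> 'a gph_obj"

context
  fixes C :: "('o, 'a) cat" (structure) and pb :: "'a \<Rightarrow> 'a \<Rightarrow> 'a \<times> 'a"
    and T :: "('o, 'a, 'o, 'a) ftr" and \<eta> \<mu> :: "'o \<Rightarrow> 'a"
begin

definition gph_objs :: "'a gph_obj set" where
  "gph_objs = {(\<gamma>, \<delta>). \<gamma> \<in> Arr C \<and> \<delta> \<in> Arr C \<and> Dom C \<gamma> = Dom C \<delta> \<and> Cod C \<delta> = onO T (Cod C \<gamma>)}"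

definition Gph :: "('a gph_obj, 'a gph_arr) cat" where
  "Gph = \<lparr>
     Obj = gph_objs,
     Arr = {((\<gamma>, \<delta>), (h, u), (\<gamma>', \<delta>')). (\<gamma>, \<delta>) \<in> gph_objs \<and> (\<gamma>', \<delta>') \<in> gph_objs \<and>
              u \<in> Hom C (Cod C \<gamma>) (Cod C \<gamma>') \<and> h \<in> Hom C (Dom C \<gamma>) (Dom C \<gamma>') \<and>
              \<gamma>' \<cdot> h = u \<cdot> \<gamma> \<and> \<delta>' \<cdot> h = onA T u \<cdot> \<delta>},
     Dom = (\<lambda>(A, hu, B). A),
     Cod = (\<lambda>(A, hu, B). B),
     Ide = (\<lambda>(\<gamma>, \<delta>). ((\<gamma>, \<delta>), (Ide C (Dom C \<gamma>), Ide C (Cod C \<gamma>)), (\<gamma>, \<delta>))),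
     Comp = (\<lambda>(_, (h', u'), B') (A, (h, u), _). (A, (h' \<cdot> h, u' \<cdot> u), B'))\<rparr>"

definition p_gph :: "('a gph_obj, 'a gph_arr, 'o, 'a) ftr" where
  "p_gph = \<lparr>onO = (\<lambda>(\<gamma>, \<delta>). Cod C \<gamma>), onA = (\<lambda>(A, (h, u), B). u)\<rparr>"

text \<open>The projections of \<open>A \<otimes> B = A \<times>\<^bsub>T(U)\<^esub> T(B)\<close> are \<open>gph_pr1 A B\<close> to \<open>A\<close> and \<open>gph_pr2 A B\<close>
  to \<open>T(B)\<close>.\<close>

definition gph_pr1 :: "'a gph_obj \<Rightarrow> 'a gph_obj \<Rightarrow> 'a" where
  "gph_pr1 A B = pb1 pb (snd A) (onA T (fst B))"

definition gph_pr2 :: "'a gph_obj \<Rightarrow> 'a gph_obj \<Rightarrow> 'a" where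
  "gph_pr2 A B = pb2 pb (snd A) (onA T (fst B))"

definition gph_pairing :: "'a gph_obj \<Rightarrow> 'a gph_obj \<Rightarrow> 'a \<Rightarrow> 'a \<Rightarrow> 'a" where
  "gph_pairing A B a b = pairing C pb (snd A) (onA T (fst B)) a b"

definition gph_tensO :: "'a gph_obj \<Rightarrow> 'a gph_obj \<Rightarrow> 'a gph_obj" where
  "gph_tensO A B = (fst A \<cdot> gph_pr1 A B,
     \<mu> (Cod C (fst A)) \<cdot> onA T (snd B) \<cdot> gph_pr2 A B)"

fun gph_tensA :: "'a gph_arr \<times> 'a gph_arr \<Rightarrow> 'a gph_arr" where
  "gph_tensA ((A, (h, u), A'), (B, (k, _), B')) =
     (gph_tensO A B,
      (gph_pairing A' B' (h \<cdot> gph_pr1 A B) (onA T k \<cdot> gph_pr2 A B), u),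
      gph_tensO A' B')"

definition gph_unitO :: "'o \<Rightarrow> 'a gph_obj" where
  "gph_unitO U = (Ide C U, \<eta> U)"

definition gph_unit :: "('o, 'a, 'a gph_obj, 'a gph_arr) ftr" where
  "gph_unit = \<lparr>onO = gph_unitO,
     onA = (\<lambda>u. (gph_unitO (Dom C u), (u, u), gph_unitO (Cod C u)))\<rparr>"

text \<open>On generalised elements: \<open>\<alpha>(a, (b, c)) = ((a, b), \<mu> c)\<close>, \<open>\<lambda>(a) = (\<gamma> a, \<eta> a)\<close> and
  \<open>\<rho>(a, x) = a\<close>.\<close>

definition gph_assoc :: "'a gph_obj \<Rightarrow> 'a gph_obj \<Rightarrow> 'a gph_obj \<Rightarrow> 'a gph_arr" where
  "gph_assoc A B D =
     (gph_tensO A (gph_tensO B D),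
      (gph_pairing (gph_tensO A B) D
         (gph_pairing A B
            (gph_pr1 A (gph_tensO B D))
            (onA T (gph_pr1 B D) \<cdot> gph_pr2 A (gph_tensO B D)))
         (\<mu> (Dom C (fst D)) \<cdot> onA T (gph_pr2 B D) \<cdot> gph_pr2 A (gph_tensO B D)),
       Ide C (Cod C (fst A))),
      gph_tensO (gph_tensO A B) D)"

definition gph_lunit :: "'a gph_obj \<Rightarrow> 'a gph_arr" where
  "gph_lunit A = (let I = gph_unitO (Cod C (fst A)) in
     (A, (gph_pairing I A (fst A) (\<eta> (Dom C (fst A))), Ide C (Cod C (fst A))), gph_tensO I A))"

definition gph_runit :: "'a gph_obj \<Rightarrow> 'a gph_arr" where
  "gph_runit A = (let I = gph_unitO (Cod C (fst A)) in
     (gph_tensO A I, (gph_pr1 A I, Ide C (Cod C (fst A))), A))"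

definition Gph_lmf :: "('o, 'a, 'a gph_obj, 'a gph_arr) lmf" where
  "Gph_lmf = \<lparr>base = C, total = Gph, proj = p_gph,
     tensor = \<lparr>onO = (\<lambda>(A, B). gph_tensO A B), onA = gph_tensA\<rparr>, unit = gph_unit,
     assoc = gph_assoc, lunit = gph_lunit, runit = gph_runit\<rparr>"

section \<open>The representation functor\<close>

text \<open>\<open>A \<star> X\<close> for \<open>d : X \<rightarrow> U\<close>: its projections \<open>star_pr1 A d\<close> to \<open>A\<close> and \<open>star_pr2 A d\<close> to \<open>T(X)\<close>,
  its structure map \<open>starO A d\<close>, and the functor \<open>A \<star> (-)\<close>.\<close>

definition star_pr1 :: "'a gph_obj \<Rightarrow> 'a \<Rightarrow> 'a" where
  "star_pr1 A d = pb1 pb (snd A) (onA T d)"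

definition star_pr2 :: "'a gph_obj \<Rightarrow> 'a \<Rightarrow> 'a" where
  "star_pr2 A d = pb2 pb (snd A) (onA T d)"

definition star_pairing :: "'a gph_obj \<Rightarrow> 'a \<Rightarrow> 'a \<Rightarrow> 'a \<Rightarrow> 'a" where
  "star_pairing A d a b = pairing C pb (snd A) (onA T d) a b"

definition starO :: "'a gph_obj \<Rightarrow> 'a \<Rightarrow> 'a" where
  "starO A d = fst A \<cdot> star_pr1 A d"

definition star :: "'a gph_obj \<Rightarrow> 'a slice_ftr" where
  "star A = \<lparr>
     onO = (\<lambda>d \<in> Obj (slice C (Cod C (fst A))). starO A d),
     onA = (\<lambda>(d, f, d') \<in> Arr (slice C (Cod C (fst A))).
        (starO A d,
         star_pairing A d' (star_pr1 A d) (onA T f \<cdot> star_pr2 A d),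
         starO A d'))\<rparr>"

definition repO :: "'a gph_obj \<Rightarrow> ('o, 'a) exp_obj" where
  "repO A = (Cod C (fst A), star A)"

fun repA :: "'a gph_arr \<Rightarrow> ('o, 'a) exp_arr" where
  "repA (A, (h, u), B) = (repO A, u,
     (\<lambda>d \<in> Obj (slice C (Cod C (fst B))).
        into_pull C pb u (starO A (pb1 pb u d)) (starO B d)
          (star_pairing B d
             (h \<cdot> star_pr1 A (pb1 pb u d))
             (onA T (pb2 pb u d) \<cdot> star_pr2 A (pb1 pb u d)))),
     repO B)"

definition rep :: "('a gph_obj, 'a gph_arr, ('o, 'a) exp_obj, ('o, 'a) exp_arr) ftr" where
  "rep = \<lparr>onO = repO, onA = repA\<rparr>"

text \<open>On generalised elements: \<open>X \<rightarrow> I\<^sub>U \<star> X\<close> is \<open>x \<mapsto> (d x, \<eta> x)\<close>, and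
  \<open>A \<star> (B \<star> X) \<rightarrow> (A \<otimes> B) \<star> X\<close> is \<open>(a, (b, x)) \<mapsto> ((a, b), \<mu> x)\<close>.\<close>

definition rep_phi0 :: "'o \<Rightarrow> ('o, 'a) exp_arr" where
  "rep_phi0 U = exp_vert C pb U (id_ftr (slice C U))
     (\<lambda>d. (d, star_pairing (gph_unitO U) d d (\<eta> (Dom C d)), starO (gph_unitO U) d))
     (star (gph_unitO U))"

definition rep_phi2 :: "'a gph_obj \<Rightarrow> 'a gph_obj \<Rightarrow> ('o, 'a) exp_arr" where
  "rep_phi2 A B = (let U = Cod C (fst A) in
     exp_vert C pb U (comp_ftr (slice C U) (star A) (star B))
       (\<lambda>d. (starO A (starO B d),
          star_pairing (gph_tensO A B) d
            (gph_pairing A B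
               (star_pr1 A (starO B d))
               (onA T (star_pr1 B d) \<cdot> star_pr2 A (starO B d)))
            (\<mu> (Dom C d) \<cdot> onA T (star_pr2 B d) \<cdot> star_pr2 A (starO B d)),
          starO (gph_tensO A B) d))
       (star (gph_tensO A B)))"

end

end

theory Submission
  imports Defs
begin

text \<open>An arrow \<open>\<tau> : P u\<^sup>* \<rightarrow> u\<^sup>* R\<close> of \<open>Exp\<close> over \<open>u : U \<rightarrow> V\<close>
  amounts to an equivariant action \<open>a\<close> sending every \<open>f : x \<rightarrow> z\<close> over \<open>u\<close>
  (that is, \<open>z f = u x\<close>) to some \<open>a f : P x \<rightarrow> R z\<close> over \<open>u\<close>.  In these terms
  composition is \<open>(b a) (g f) = b g \<cdot> a f\<close>, the identity of \<open>P\<close> is \<open>P\<close> itself, and the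
  tensor is \<open>(a \<otimes> b) f = a (b f)\<close>, so all laws of \<open>Exp\<close> become immediate.  Such an
  arrow is prone if the squares \<open>P x \<rightarrow> R (u x)\<close> over \<open>u\<close> are pullbacks, and supine if
  the maps \<open>P (u\<^sup>* z) \<rightarrow> R z\<close> are isomorphisms.

  The functor \<open>rep\<close> turns \<open>(h, u) : A \<rightarrow> B\<close> into the action \<open>f \<mapsto> h \<star> T f\<close>.  A prone
  arrow of T-graphs exhibits \<open>A\<close> as the limit of \<open>B\<close> along \<open>u\<close> and \<open>T u\<close>, and a supine
  one has \<open>h\<close> invertible; both criteria then follow from universal properties of pullbacks.
  The tensor of T-graphs is a star product as well, so its associativity and unit maps are the
  components of \<open>\<phi>2\<close> and \<open>\<phi>0\<close> at structure maps of graphs, and the coherence laws of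
  \<open>Gph\<close> and those of \<open>rep\<close> are instances of the same identities.\<close>

section \<open>Arrows over a base arrow and slices\<close>

text \<open>Pullbacks are chosen arbitrarily, so \<open>(v u)^*\<close> and \<open>u^* v^*\<close>
  agree only up to isomorphism, and composition in \<open>Exp\<close> inserts
  \<open>pull_split\<close> and \<open>pull_merge\<close>. On components, associativity would be a
  diagram of such comparisons. An action is defined on every square over \<open>u\<close>, not just
  on \<open>u^* z \<rightarrow> z\<close>, so chosen pullbacks enter only when it is encoded
  (\<open>of_action\<close>) or composed (\<open>comp_action\<close>).

  Behind this is the adjunction of \<open>\<Sigma>_u\<close>, composition with \<open>u\<close>
  (\<open>post_ftr\<close>), and \<open>u^*\<close>. An action is at once a mate
  \<open>\<Sigma>_u P \<rightarrow> R \<Sigma>_u\<close>, read off at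
  \<open>x \<rightarrow> u x\<close>, and a mate \<open>\<Sigma>_u P u^* \<rightarrow> R\<close>,
  read off at \<open>u^* z \<rightarrow> z\<close>. The first form explains the criterion for prone
  arrows and the lift \<open>u^* R \<Sigma>_u\<close>, the second the criterion for supine arrows
  and the lift \<open>\<Sigma>_u P u^*\<close>.

  Cartesianness of \<open>\<eta>\<close> makes \<open>\<phi>0\<close> invertible. Cartesianness of
  \<open>\<mu>\<close> and preservation of pullbacks by \<open>T\<close> do this for
  \<open>\<phi>2\<close>; the latter also gives preservation of supine arrows and the image in
  \<open>Cart\<close>.\<close>

definition arr_over :: "('o, 'a) cat \<Rightarrow> 'a \<Rightarrow> 'a \<Rightarrow> 'a \<Rightarrow> 'a \<Rightarrow> bool" where
  "arr_over C u x f z \<longleftrightarrow> u \<in> Arr C \<and> x \<in> Arr C \<and> z \<in> Arr C \<and> f \<in> Arr C \<and>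
     Cod C x = Dom C u \<and> Cod C z = Cod C u \<and> Dom C f = Dom C x \<and> Cod C f = Dom C z \<and>
     z \<cdot>\<^bsub>C\<^esub> f = u \<cdot>\<^bsub>C\<^esub> x"

text \<open>Arrows of a slice are triples that record source and target. For a functor the outer
  entries of the image triple are forced (\<open>slice_functor_onA\<close>), so all equations can be
  stated for the middle entry, an arrow of \<open>C\<close>.\<close>

definition mor :: "'a slice_ftr \<Rightarrow> 'a \<Rightarrow> 'a \<Rightarrow> 'a \<Rightarrow> 'a" where
  "mor P x f y = fst (snd (onA P (x, f, y)))"

text \<open>Common shape of \<open>pull\<close>, \<open>star\<close> and \<open>post_ftr\<close>.
  Restricting both maps to the slice provides the extensionality that \<open>exp_objs\<close>
  demands of its functors (\<open>exp_objs_slice_ftr\<close>).\<close>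

definition slice_ftr ::
  "('o, 'a) cat \<Rightarrow> 'o \<Rightarrow> ('a \<Rightarrow> 'a) \<Rightarrow> ('a \<Rightarrow> 'a \<Rightarrow> 'a \<Rightarrow> 'a) \<Rightarrow> 'a slice_ftr" where
  "slice_ftr C U ob mo = \<lparr>
     onO = (\<lambda>x \<in> Obj (slice C U). ob x),
     onA = (\<lambda>(x, f, y) \<in> Arr (slice C U). (ob x, mo x f y, ob y))\<rparr>"

text \<open>Tensors of arrows of T-graphs are to be rewritten by \<open>gph_tens_simps\<close>
  instead, whose right-hand side is a \<open>star_map\<close>.\<close>

declare gph_tensA.simps [simp del]

lemma proneD:
  "\<lbrakk>prone E B p f; g \<in> Arr E; w \<in> Hom B (onO p (Dom E g)) (onO p (Dom E f)); Cod E g = Cod E f;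
     onA p g = onA p f \<cdot>\<^bsub>B\<^esub> w\<rbrakk> \<Longrightarrow>
   \<exists>!h. h \<in> Hom E (Dom E g) (Dom E f) \<and> onA p h = w \<and> f \<cdot>\<^bsub>E\<^esub> h = g"
  by (simp add: prone_def)

lemma supineD:
  "\<lbrakk>supine E B p f; g \<in> Arr E; w \<in> Hom B (onO p (Cod E f)) (onO p (Cod E g)); Dom E g = Dom E f;
     onA p g = w \<cdot>\<^bsub>B\<^esub> onA p f\<rbrakk> \<Longrightarrow>
   \<exists>!h. h \<in> Hom E (Cod E f) (Cod E g) \<and> onA p h = w \<and> h \<cdot>\<^bsub>E\<^esub> f = g"
  by (simp add: supine_def)

lemma slice_simps [simp]:
  "d \<in> Obj (slice C U) \<longleftrightarrow> d \<in> Arr C \<and> Cod C d = U"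
  "Dom (slice C U) (d, f, d') = d"
  "Cod (slice C U) (d, f, d') = d'"
  "Ide (slice C U) d = (d, Ide C (Dom C d), d)"
  "(e, g, e') \<cdot>\<^bsub>slice C U\<^esub> (d, f, d') = (d, g \<cdot>\<^bsub>C\<^esub> f, e')"
  by (simp_all add: slice_def)

context category
begin

lemmas Obj_simps [simp] = Dom_Obj Cod_Obj

lemma Ide_simps [simp]:
  assumes "x \<in> Obj C"
  shows "Ide C x \<in> Arr C" "Dom C (Ide C x) = x" "Cod C (Ide C x) = x"
  using Ide_Hom[OF assms] by (auto simp: Hom_def)

lemma Comp_simps [simp]:
  assumes "f \<in> Arr C" "g \<in> Arr C" "Dom C g = Cod C f"
  shows "g \<cdot> f \<in> Arr C" "Dom C (g \<cdot> f) = Dom C f" "Cod C (g \<cdot> f) = Cod C g"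
  using Comp_Hom[of f "Dom C f" "Cod C f" g "Cod C g"] assms by (auto simp: Hom_def)

lemma Ide_Comp [simp]:
  "f \<in> Arr C \<Longrightarrow> Cod C f = x \<Longrightarrow> Ide C x \<cdot> f = f"
  "f \<in> Arr C \<Longrightarrow> Dom C f = x \<Longrightarrow> f \<cdot> Ide C x = f"
  using Ide_left Ide_right by auto

lemma Comp_assoc' [simp]:
  "\<lbrakk>f \<in> Arr C; g \<in> Arr C; h \<in> Arr C; Dom C g = Cod C f; Dom C h = Cod C g\<rbrakk>
    \<Longrightarrow> (h \<cdot> g) \<cdot> f = h \<cdot> (g \<cdot> f)"
  by (rule Comp_assoc[of f "Dom C f" "Cod C f" g "Cod C g" h "Cod C h"]) (auto simp: Hom_def)

text \<open>With \<open>Comp_assoc'\<close> as a rewrite rule every composite is nested to the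
  right, so an equation for \<open>h \<cdot> g\<close> no longer matches once something is composed
  on the right. This supplies the form that does.\<close>

lemma Comp_reassoc:
  "\<lbrakk>h \<cdot> g = k; f \<in> Arr C; g \<in> Arr C; h \<in> Arr C; Dom C g = Cod C f; Dom C h = Cod C g\<rbrakk>
    \<Longrightarrow> h \<cdot> (g \<cdot> f) = k \<cdot> f"
  using Comp_assoc' by metis

text \<open>The tenth conclusion is the ninth in right-nested form. Many proofs hand only
  \<open>arr_overD(1-8)\<close> to the simplifier, so that \<open>z \<cdot> f\<close> is not
  rewritten to \<open>u \<cdot> x\<close>.\<close>

lemma arr_overD:
  assumes "arr_over C u x f z"
  shows "u \<in> Arr C" "x \<in> Arr C" "z \<in> Arr C" "f \<in> Arr C" "Cod C x = Dom C u" "Cod C z = Cod C u"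
    "Dom C f = Dom C x" "Cod C f = Dom C z" "z \<cdot> f = u \<cdot> x"
    "\<lbrakk>k \<in> Arr C; Cod C k = Dom C x\<rbrakk> \<Longrightarrow> z \<cdot> (f \<cdot> k) = u \<cdot> (x \<cdot> k)"
proof -
  show *: "u \<in> Arr C" "x \<in> Arr C" "z \<in> Arr C" "f \<in> Arr C" "Cod C x = Dom C u" "Cod C z = Cod C u"
    "Dom C f = Dom C x" "Cod C f = Dom C z" "z \<cdot> f = u \<cdot> x"
    using assms by (auto simp: arr_over_def)
  show "z \<cdot> (f \<cdot> k) = u \<cdot> (x \<cdot> k)" if "k \<in> Arr C" "Cod C k = Dom C x"
    using that * by (simp add: Comp_reassoc[of z f "u \<cdot> x"])
qed

lemma arr_overI:
  assumes "u \<in> Arr C" "x \<in> Arr C" "z \<in> Arr C" "f \<in> Arr C" "Cod C x = Dom C u" "Cod C z = Cod C u"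
    "Dom C f = Dom C x" "Cod C f = Dom C z" "z \<cdot> f = u \<cdot> x"
  shows "arr_over C u x f z"
  using assms by (auto simp: arr_over_def)

lemma arr_over_comp:
  assumes "arr_over C u x f y" "arr_over C v y g z"
  shows "arr_over C (v \<cdot> u) x (g \<cdot> f) z"
  using arr_overD[OF assms(1)] arr_overD[OF assms(2)] by (intro arr_overI) auto

lemma arr_over_comp_left:
  assumes "arr_over C u x f y" "arr_over C (Ide C (Cod C u)) y g z"
  shows "arr_over C u x (g \<cdot> f) z"
  using arr_over_comp[OF assms] arr_overD(1)[OF assms(1)] by simp

lemma arr_over_comp_right:
  assumes "arr_over C (Ide C (Dom C u)) x f y" "arr_over C u y g z"
  shows "arr_over C u x (g \<cdot> f) z"
  using arr_over_comp[OF assms] arr_overD(1)[OF assms(2)] by simp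

lemma arr_over_ide:
  "x \<in> Arr C \<Longrightarrow> Cod C x = U \<Longrightarrow> Dom C x = X \<Longrightarrow> arr_over C (Ide C U) x (Ide C X) x"
  by (intro arr_overI) auto

text \<open>The cocartesian square out of \<open>x\<close>: every square over \<open>u\<close> out
  of \<open>x\<close> is this one followed by an arrow of the slice over the codomain of
  \<open>u\<close>. Its counterpart into \<open>z\<close> is
  \<open>arr_over_projection\<close>.\<close>

lemma arr_over_post:
  assumes "u \<in> Arr C" "x \<in> Arr C" "Cod C x = Dom C u"
  shows "arr_over C u x (Ide C (Dom C x)) (u \<cdot> x)"
  using assms by (intro arr_overI) auto

text \<open>A slice arrow is a square over an identity, so slice arrows and squares over
  \<open>u\<close> share one calculus. The conjunct \<open>U \<in> Obj C\<close> ties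
  \<open>Ide C U\<close> to \<open>U\<close>: away from objects \<open>Ide\<close> is
  unspecified.\<close>

lemma Arr_slice: "(d, f, d') \<in> Arr (slice C U) \<longleftrightarrow> U \<in> Obj C \<and> arr_over C (Ide C U) d f d'"
proof -
  have "d \<in> Arr C \<Longrightarrow> Cod C d = U \<Longrightarrow> U \<in> Obj C \<and> Ide C U \<cdot> d = d"
    using Cod_Obj Ide_left by metis
  moreover have "U \<in> Obj C \<Longrightarrow> Ide C U \<in> Arr C \<and> Dom C (Ide C U) = U \<and> Cod C (Ide C U) = U"
    by simp
  ultimately show ?thesis
    by (simp add: slice_def Hom_def arr_over_def del: Ide_simps Ide_Comp Comp_simps) metis
qed

lemma Arr_sliceE:
  assumes "t \<in> Arr (slice C U)"
  obtains d f d' where "t = (d, f, d')" "U \<in> Obj C" "arr_over C (Ide C U) d f d'"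
  using assms Arr_slice by (metis prod_cases3)

lemma Hom_slice: "t \<in> Hom (slice C U) d d' \<longleftrightarrow>
    (\<exists>f. t = (d, f, d') \<and> U \<in> Obj C \<and> arr_over C (Ide C U) d f d')"
  by (cases t) (auto simp: Hom_def Arr_slice)

lemma category_slice:
  assumes "U \<in> Obj C"
  shows "category (slice C U)"
proof
  fix f assume "f \<in> Arr (slice C U)"
  then obtain x h y where *: "f = (x, h, y)" "arr_over C (Ide C U) x h y" by (elim Arr_sliceE)
  show "Dom (slice C U) f \<in> Obj (slice C U)" "Cod (slice C U) f \<in> Obj (slice C U)"
    "Ide (slice C U) (Cod (slice C U) f) \<cdot>\<^bsub>slice C U\<^esub> f = f"
    "f \<cdot>\<^bsub>slice C U\<^esub> Ide (slice C U) (Dom (slice C U) f) = f"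
    using *(1) arr_overD[OF *(2)] assms by auto
next
  fix x assume "x \<in> Obj (slice C U)"
  then show "Ide (slice C U) x \<in> Hom (slice C U) x x"
    using assms by (auto simp: Hom_slice intro!: arr_over_ide)
next
  fix f g x y z
  assume "f \<in> Hom (slice C U) x y" "g \<in> Hom (slice C U) y z"
  then show "g \<cdot>\<^bsub>slice C U\<^esub> f \<in> Hom (slice C U) x z"
    using assms arr_over_comp_left[of "Ide C U"] by (auto simp: Hom_slice)
next
  fix f g h w x y z
  assume "f \<in> Hom (slice C U) w x" "g \<in> Hom (slice C U) x y" "h \<in> Hom (slice C U) y z"
  then obtain f' g' h' where *: "f = (w, f', x)" "g = (x, g', y)" "h = (y, h', z)"
    and a: "arr_over C (Ide C U) w f' x" "arr_over C (Ide C U) x g' y" "arr_over C (Ide C U) y h' z"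
    by (auto simp: Hom_slice)
  show "(h \<cdot>\<^bsub>slice C U\<^esub> g) \<cdot>\<^bsub>slice C U\<^esub> f = h \<cdot>\<^bsub>slice C U\<^esub> (g \<cdot>\<^bsub>slice C U\<^esub> f)"
    using arr_overD[OF a(1)] arr_overD[OF a(2)] arr_overD[OF a(3)] by (simp add: *)
qed

lemma slice_ftr_onO [simp]:
  "x \<in> Arr C \<Longrightarrow> Cod C x = U \<Longrightarrow> onO (slice_ftr C U ob mo) x = ob x"
  by (simp add: slice_ftr_def)

lemma slice_ftr_onA:
  "arr_over C (Ide C U) x f y \<Longrightarrow> U \<in> Obj C \<Longrightarrow>
    onA (slice_ftr C U ob mo) (x, f, y) = (ob x, mo x f y, ob y)"
  by (simp add: slice_ftr_def Arr_slice)

lemma slice_ftr_mor [simp]: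
  "arr_over C (Ide C U) x f y \<Longrightarrow> U \<in> Obj C \<Longrightarrow> mor (slice_ftr C U ob mo) x f y = mo x f y"
  by (simp add: mor_def slice_ftr_onA)

lemma is_functor_sliceI:
  assumes "U \<in> Obj C" "V \<in> Obj C"
    and ob: "\<And>x. x \<in> Arr C \<Longrightarrow> Cod C x = U \<Longrightarrow> onO P x \<in> Arr C \<and> Cod C (onO P x) = V"
    and mo: "\<And>x f y. arr_over C (Ide C U) x f y \<Longrightarrow>
      onA P (x, f, y) = (onO P x, mor P x f y, onO P y) \<and>
      arr_over C (Ide C V) (onO P x) (mor P x f y) (onO P y)"
    and ide: "\<And>x. x \<in> Arr C \<Longrightarrow> Cod C x = U \<Longrightarrow>
      mor P x (Ide C (Dom C x)) x = Ide C (Dom C (onO P x))"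
    and comp: "\<And>x f y g z. arr_over C (Ide C U) x f y \<Longrightarrow> arr_over C (Ide C U) y g z \<Longrightarrow>
      mor P x (g \<cdot> f) z = mor P y g z \<cdot> mor P x f y"
  shows "is_functor (slice C U) (slice C V) P"
proof -
  interpret A: category "slice C U" using category_slice assms by simp
  interpret B: category "slice C V" using category_slice assms by simp
  show ?thesis
  proof
    fix f g x y z assume fg: "f \<in> Hom (slice C U) x y" "g \<in> Hom (slice C U) y z"
    then obtain f' g' where *: "f = (x, f', y)" "g = (y, g', z)"
      "arr_over C (Ide C U) x f' y" "arr_over C (Ide C U) y g' z"
      by (auto simp: Hom_slice)
    have "arr_over C (Ide C U) x (g' \<cdot> f') z"
      using arr_over_comp_left[of "Ide C U"] * assms(1) by simp
    then show "onA P (g \<cdot>\<^bsub>slice C U\<^esub> f) = onA P g \<cdot>\<^bsub>slice C V\<^esub> onA P f"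
      using * mo comp by simp
  next
    fix x assume "x \<in> Obj (slice C U)"
    then show "onA P (Ide (slice C U) x) = Ide (slice C V) (onO P x)"
      using mo[OF arr_over_ide] ide assms by simp
  qed (use ob mo assms in \<open>auto simp: Hom_slice\<close>)
qed

lemma
  assumes "is_functor (slice C U) (slice C V) P" "U \<in> Obj C"
  shows slice_functor_obj: "x \<in> Arr C \<Longrightarrow> Cod C x = U \<Longrightarrow> onO P x \<in> Arr C"
      "x \<in> Arr C \<Longrightarrow> Cod C x = U \<Longrightarrow> Cod C (onO P x) = V"
    and slice_functor_onA: "arr_over C (Ide C U) x f y \<Longrightarrow>
      onA P (x, f, y) = (onO P x, mor P x f y, onO P y)"
    and slice_functor_mor: "arr_over C (Ide C U) x f y \<Longrightarrow>
      arr_over C (Ide C V) (onO P x) (mor P x f y) (onO P y)"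
    and slice_functor_comp: "arr_over C (Ide C U) x f y \<Longrightarrow> arr_over C (Ide C U) y g z \<Longrightarrow>
      mor P x (g \<cdot> f) z = mor P y g z \<cdot> mor P x f y"
    and slice_functor_ide: "x \<in> Arr C \<Longrightarrow> Cod C x = U \<Longrightarrow> Dom C x = X \<Longrightarrow>
      mor P x (Ide C X) x = Ide C (Dom C (onO P x))"
proof -
  interpret is_functor "slice C U" "slice C V" P by (rule assms)
  show "x \<in> Arr C \<Longrightarrow> Cod C x = U \<Longrightarrow> onO P x \<in> Arr C"
      "x \<in> Arr C \<Longrightarrow> Cod C x = U \<Longrightarrow> Cod C (onO P x) = V"
    using onO_Obj[of x] by auto
  have *: "onA P (x, f, y) = (onO P x, mor P x f y, onO P y) \<and>
      arr_over C (Ide C V) (onO P x) (mor P x f y) (onO P y)"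
    if "arr_over C (Ide C U) x f y" for x f y
    using onA_Hom[of "(x, f, y)" x y] that assms(2) by (auto simp: Hom_slice mor_def)
  then show "arr_over C (Ide C U) x f y \<Longrightarrow> onA P (x, f, y) = (onO P x, mor P x f y, onO P y)"
    "arr_over C (Ide C U) x f y \<Longrightarrow> arr_over C (Ide C V) (onO P x) (mor P x f y) (onO P y)"
    by blast+
  show "mor P x (g \<cdot> f) z = mor P y g z \<cdot> mor P x f y"
    if "arr_over C (Ide C U) x f y" "arr_over C (Ide C U) y g z"
    using onA_Comp[of "(x, f, y)" x y "(y, g, z)" z] that assms(2)
      arr_over_comp_left[of "Ide C U" x f y g z]
    by (simp add: Hom_slice *)
  show "mor P x (Ide C X) x = Ide C (Dom C (onO P x))"
    if "x \<in> Arr C" "Cod C x = U" "Dom C x = X"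
    using onA_Ide[of x] that by (simp add: mor_def)
qed

section \<open>The universal property of pullbacks in an arbitrary category\<close>

lemma is_pullbackI:
  assumes "f \<in> Arr C" "g \<in> Arr C" "p \<in> Arr C" "q \<in> Arr C"
    "Cod C f = Cod C g" "Dom C p = Dom C q" "Cod C p = Dom C f" "Cod C q = Dom C g"
    "f \<cdot> p = g \<cdot> q"
    and ex: "\<And>a b. \<lbrakk>a \<in> Arr C; b \<in> Arr C; Dom C a = Dom C b; Cod C a = Dom C f; Cod C b = Dom C g;
       f \<cdot> a = g \<cdot> b\<rbrakk> \<Longrightarrow> \<exists>m. m \<in> Arr C \<and> Dom C m = Dom C a \<and> Cod C m = Dom C p \<and> p \<cdot> m = a \<and>
         q \<cdot> m = b"
    and mono: "\<And>m n. \<lbrakk>m \<in> Arr C; n \<in> Arr C; Dom C m = Dom C n; Cod C m = Dom C p; Cod C n = Dom C p;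
       p \<cdot> m = p \<cdot> n; q \<cdot> m = q \<cdot> n\<rbrakk> \<Longrightarrow> m = n"
  shows "is_pullback C f g p q"
proof -
  have "\<exists>!m. m \<in> Hom C (Dom C a) (Dom C p) \<and> p \<cdot> m = a \<and> q \<cdot> m = b"
    if ab: "a \<in> Arr C" "b \<in> Arr C" "Dom C a = Dom C b \<and> Cod C a = Dom C f \<and> Cod C b = Dom C g \<and>
       f \<cdot> a = g \<cdot> b" for a b
  proof -
    obtain m where m: "m \<in> Arr C" "Dom C m = Dom C a" "Cod C m = Dom C p" "p \<cdot> m = a" "q \<cdot> m = b"
      using ex[of a b] ab by blast
    show ?thesis
    proof (intro ex1I[of _ m] conjI)
      show "m \<in> Hom C (Dom C a) (Dom C p)" "p \<cdot> m = a" "q \<cdot> m = b"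
        using m by (simp_all add: Hom_def)
    next
      fix n assume "n \<in> Hom C (Dom C a) (Dom C p) \<and> p \<cdot> n = a \<and> q \<cdot> n = b"
      then have n: "n \<in> Arr C" "Dom C n = Dom C a" "Cod C n = Dom C p" "p \<cdot> n = a" "q \<cdot> n = b"
        unfolding Hom_def by blast+
      show "n = m"
        by (rule mono) (simp_all only: n m)
    qed
  qed
  note ex1 = this
  show ?thesis unfolding is_pullback_def
    by (intro conjI ballI impI) ((rule ex1; assumption) | rule assms(1-9))+
qed

lemma is_pullbackD:
  assumes "is_pullback C f g p q"
  shows "f \<in> Arr C" "g \<in> Arr C" "p \<in> Arr C" "q \<in> Arr C"
    "Cod C f = Cod C g" "Dom C p = Dom C q" "Cod C p = Dom C f" "Cod C q = Dom C g"
    "f \<cdot> p = g \<cdot> q"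
  using assms unfolding is_pullback_def by blast+

lemma is_pullback_ex1:
  assumes "is_pullback C f g p q" "a \<in> Arr C" "b \<in> Arr C" "Dom C a = Dom C b"
    "Cod C a = Dom C f" "Cod C b = Dom C g" "f \<cdot> a = g \<cdot> b"
  shows "\<exists>!m. m \<in> Hom C (Dom C a) (Dom C p) \<and> p \<cdot> m = a \<and> q \<cdot> m = b"
  using assms unfolding is_pullback_def by blast

lemma is_pullbackE:
  assumes "is_pullback C f g p q" "a \<in> Arr C" "b \<in> Arr C" "Dom C a = Dom C b"
    "Cod C a = Dom C f" "Cod C b = Dom C g" "f \<cdot> a = g \<cdot> b"
  obtains m where "m \<in> Arr C" "Dom C m = Dom C a" "Cod C m = Dom C p" "p \<cdot> m = a" "q \<cdot> m = b"
proof -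
  obtain m where "m \<in> Hom C (Dom C a) (Dom C p)" "p \<cdot> m = a" "q \<cdot> m = b"
    using is_pullback_ex1[OF assms] by blast
  then show ?thesis using that[of m] unfolding Hom_def by blast
qed

text \<open>Joint monicity of the projections. Together with \<open>is_pullbackE\<close> it splits
  unique existence into the two halves in which \<open>is_pullbackI\<close> asks for it. Equations
  between arrows into a pullback are from here on checked on projections.\<close>

lemma is_pullback_mono:
  assumes pb: "is_pullback C f g p q" and m: "m \<in> Arr C" "n \<in> Arr C" "Dom C m = Dom C n"
    "Cod C m = Dom C p" "Cod C n = Dom C p" "p \<cdot> m = p \<cdot> n" "q \<cdot> m = q \<cdot> n"
  shows "m = n"
proof -
  note [simp] = is_pullbackD(1-8)[OF pb]
  have "f \<cdot> (p \<cdot> m) = g \<cdot> (q \<cdot> m)"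
    using is_pullbackD(9)[OF pb] m
    by (simp add: Comp_reassoc[of f p "g \<cdot> q"])
  then have "\<exists>!k. k \<in> Hom C (Dom C (p \<cdot> m)) (Dom C p) \<and> p \<cdot> k = p \<cdot> m \<and> q \<cdot> k = q \<cdot> m"
    by (intro is_pullback_ex1[OF pb]) (use m in simp_all)
  moreover have "m \<in> Hom C (Dom C (p \<cdot> m)) (Dom C p)" "n \<in> Hom C (Dom C (p \<cdot> m)) (Dom C p)"
    using m(1-5) by (simp_all add: Hom_def)
  ultimately show ?thesis using m(6,7) by metis
qed

lemma is_pullback_sym:
  assumes "is_pullback C f g p q"
  shows "is_pullback C g f q p"
proof (rule is_pullbackI)
  note D = is_pullbackD[OF assms]
  show "\<exists>m. m \<in> Arr C \<and> Dom C m = Dom C a \<and> Cod C m = Dom C q \<and> q \<cdot> m = a \<and> p \<cdot> m = b"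
    if "a \<in> Arr C" "b \<in> Arr C" "Dom C a = Dom C b" "Cod C a = Dom C g" "Cod C b = Dom C f"
      "g \<cdot> a = f \<cdot> b" for a b
    by (rule is_pullbackE[OF assms, of b a]) (use that D in auto)
  show "m = n" if "m \<in> Arr C" "n \<in> Arr C" "Dom C m = Dom C n" "Cod C m = Dom C q"
    "Cod C n = Dom C q" "q \<cdot> m = q \<cdot> n" "p \<cdot> m = p \<cdot> n" for m n
    using is_pullback_mono[OF assms, of m n] that D by simp
qed (use is_pullbackD[OF assms] in auto)

section \<open>Pullbacks\<close>

lemma isoE:
  assumes "iso C f"
  obtains g where "f \<in> Arr C" "g \<in> Arr C" "Dom C g = Cod C f" "Cod C g = Dom C f"
    "g \<cdot> f = Ide C (Dom C f)" "f \<cdot> g = Ide C (Cod C f)"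
  using assms unfolding iso_def Hom_def by blast

lemma isoI:
  assumes "f \<in> Arr C" "g \<in> Arr C" "Dom C g = Cod C f" "Cod C g = Dom C f"
    "g \<cdot> f = Ide C (Dom C f)" "f \<cdot> g = Ide C (Cod C f)"
  shows "iso C f"
  using assms unfolding iso_def Hom_def by blast

text \<open>A split epimorphism that is monic is invertible: \<open>m (s m) = m\<close>, and
  \<open>m\<close> cancels. The section \<open>s\<close> comes out of a universal property and the
  cancellation out of joint monicity, so \<open>s m = 1\<close> never has to be computed on
  projections.\<close>

lemma isoI_mono:
  assumes "m \<in> Arr C" "s \<in> Arr C" "Dom C s = Cod C m" "Cod C s = Dom C m" "m \<cdot> s = Ide C (Cod C m)"
    and mono: "\<And>a b. a \<in> Arr C \<Longrightarrow> b \<in> Arr C \<Longrightarrow> Dom C a = Dom C b \<Longrightarrow> Cod C a = Dom C m \<Longrightarrow>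
      Cod C b = Dom C m \<Longrightarrow> m \<cdot> a = m \<cdot> b \<Longrightarrow> a = b"
  shows "iso C m"
proof -
  have "s \<cdot> m = Ide C (Dom C m)"
    by (rule mono) (use assms(1-4) in \<open>simp_all add: Comp_reassoc[OF assms(5)]\<close>)
  then show ?thesis using assms(1-5) by (intro isoI[of m s]) simp_all
qed

lemma iso_Ide: "x \<in> Obj C \<Longrightarrow> iso C (Ide C x)"
  by (rule isoI[of _ "Ide C x"]) simp_all

text \<open>The invertible arrows \<open>f\<close> and \<open>q\<close> are opposite sides. The
  mediating arrow can only be \<open>q^{-1} b\<close>, and its composite with \<open>p\<close> is
  \<open>a\<close> because \<open>f\<close> cancels.\<close>

lemma is_pullback_parallel_isos:
  assumes f: "iso C f" and q: "iso C q" and gp: "g \<in> Arr C" "p \<in> Arr C"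
    and T: "Cod C f = Cod C g" "Dom C p = Dom C q" "Cod C p = Dom C f" "Cod C q = Dom C g"
    and eq: "f \<cdot> p = g \<cdot> q"
  shows "is_pullback C f g p q"
proof -
  obtain f' where f': "f \<in> Arr C" "f' \<in> Arr C" "Dom C f' = Cod C f" "Cod C f' = Dom C f"
    "f' \<cdot> f = Ide C (Dom C f)" "f \<cdot> f' = Ide C (Cod C f)" using f by (rule isoE)
  obtain q' where q': "q \<in> Arr C" "q' \<in> Arr C" "Dom C q' = Cod C q" "Cod C q' = Dom C q"
    "q' \<cdot> q = Ide C (Dom C q)" "q \<cdot> q' = Ide C (Cod C q)" using q by (rule isoE)
  show ?thesis
  proof (rule is_pullbackI)
    fix a b
    assume ab: "a \<in> Arr C" "b \<in> Arr C" "Dom C a = Dom C b" "Cod C a = Dom C f" "Cod C b = Dom C g"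
      "f \<cdot> a = g \<cdot> b"
    have "f \<cdot> (p \<cdot> (q' \<cdot> b)) = g \<cdot> (q \<cdot> (q' \<cdot> b))"
      using f' q' gp T ab eq by (simp add: Comp_reassoc[of f p "g \<cdot> q"])
    also have "\<dots> = f \<cdot> a"
      using f' q' gp T ab by (simp add: Comp_reassoc[OF q'(6)])
    finally have e: "f \<cdot> (p \<cdot> (q' \<cdot> b)) = f \<cdot> a" .
    have "p \<cdot> (q' \<cdot> b) = f' \<cdot> (f \<cdot> (p \<cdot> (q' \<cdot> b)))"
      using f'(1-4) q'(1-4) gp T ab(1-5) by (simp add: Comp_reassoc[OF f'(5)])
    also have "\<dots> = a"
      unfolding e using f'(1-4) gp T ab(1-5) by (simp add: Comp_reassoc[OF f'(5)])
    finally show "\<exists>m. m \<in> Arr C \<and> Dom C m = Dom C a \<and> Cod C m = Dom C p \<and> p \<cdot> m = a \<and> q \<cdot> m = b"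
      using f' q' gp T ab by (intro exI[of _ "q' \<cdot> b"]) (simp add: Comp_reassoc[OF q'(6)])
  next
    fix m n
    assume mn: "m \<in> Arr C" "n \<in> Arr C" "Dom C m = Dom C n" "Cod C m = Dom C p" "Cod C n = Dom C p"
      "p \<cdot> m = p \<cdot> n" "q \<cdot> m = q \<cdot> n"
    have "m = q' \<cdot> (q \<cdot> m)"
      using q' T mn(1-5) by (simp add: Comp_reassoc[OF q'(5)])
    also have "\<dots> = n"
      unfolding mn(7) using q' T mn(1-5) by (simp add: Comp_reassoc[OF q'(5)])
    finally show "m = n" .
  qed (use f' q' gp T eq in simp_all)
qed

lemma is_pullback_paste:
  assumes 1: "is_pullback C f g p q" and 2: "is_pullback C q g' a b"
  shows "is_pullback C f (g \<cdot> g') (p \<cdot> a) b"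
proof -
  note [simp] = is_pullbackD(1-8)[OF 1] is_pullbackD(1-8)[OF 2]
  note e1 = is_pullbackD(9)[OF 1] and e2 = is_pullbackD(9)[OF 2]
  have [simp]: "Cod C g' = Dom C g" using is_pullbackD(8)[OF 1] is_pullbackD(5)[OF 2] by simp
  show ?thesis
  proof (rule is_pullbackI)
    show "f \<cdot> (p \<cdot> a) = (g \<cdot> g') \<cdot> b"
      using e2 by (simp add: Comp_reassoc[OF e1])
  next
    fix c d
    assume cd: "c \<in> Arr C" "d \<in> Arr C" "Dom C c = Dom C d" "Cod C c = Dom C f"
      "Cod C d = Dom C (g \<cdot> g')" "f \<cdot> c = (g \<cdot> g') \<cdot> d"
    obtain m where m: "m \<in> Arr C" "Dom C m = Dom C c" "Cod C m = Dom C p" "p \<cdot> m = c" "q \<cdot> m =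
      g' \<cdot> d"
      using is_pullbackE[OF 1, of c "g' \<cdot> d"] cd by auto
    obtain n where n: "n \<in> Arr C" "Dom C n = Dom C m" "Cod C n = Dom C a" "a \<cdot> n = m" "b \<cdot> n = d"
      using is_pullbackE[OF 2, of m d] cd m by auto
    show "\<exists>m. m \<in> Arr C \<and> Dom C m = Dom C c \<and> Cod C m = Dom C (p \<cdot> a) \<and> (p \<cdot> a) \<cdot> m = c \<and> b \<cdot> m = d"
      using m n by (intro exI[of _ n]) simp
  next
    fix m n
    assume mn: "m \<in> Arr C" "n \<in> Arr C" "Dom C m = Dom C n" "Cod C m = Dom C (p \<cdot> a)"
      "Cod C n = Dom C (p \<cdot> a)" "(p \<cdot> a) \<cdot> m = (p \<cdot> a) \<cdot> n" "b \<cdot> m = b \<cdot> n"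
    have "q \<cdot> (a \<cdot> m) = q \<cdot> (a \<cdot> n)"
      using mn by (simp add: Comp_reassoc[OF e2])
    then have "a \<cdot> m = a \<cdot> n"
      using mn by - (rule is_pullback_mono[OF 1], simp_all)
    then show "m = n"
      using mn by - (rule is_pullback_mono[OF 2], simp_all)
  qed simp_all
qed

text \<open>With \<open>is_pullback_paste\<close> this is the pasting lemma. Commutativity
  \<open>e2\<close> of the square to be recognised is a separate hypothesis, because the outer
  rectangle gives it only after composition with \<open>g\<close>.\<close>

lemma is_pullback_cancel:
  assumes 1: "is_pullback C f g p q" and 2: "is_pullback C f (g \<cdot> g') (p \<cdot> a) b"
    and g': "g' \<in> Arr C" "Cod C g' = Dom C g" "a \<in> Arr C" "Cod C a = Dom C p" and e2: "q \<cdot> a =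
      g' \<cdot> b"
  shows "is_pullback C q g' a b"
proof -
  note [simp] = is_pullbackD(1-8)[OF 1] g'
  note e1 = is_pullbackD(9)[OF 1]
  have [simp]: "b \<in> Arr C" "Cod C b = Dom C g'" "Dom C b = Dom C a"
    using is_pullbackD(4,6,8)[OF 2] by simp_all
  show ?thesis
  proof (rule is_pullbackI)
    fix c d
    assume cd: "c \<in> Arr C" "d \<in> Arr C" "Dom C c = Dom C d" "Cod C c = Dom C q"
      "Cod C d = Dom C g'" "q \<cdot> c = g' \<cdot> d"
    have "f \<cdot> (p \<cdot> c) = (g \<cdot> g') \<cdot> d"
      using cd by (simp add: Comp_reassoc[OF e1])
    then obtain m where m: "m \<in> Arr C" "Dom C m = Dom C c" "Cod C m = Dom C a"
      "(p \<cdot> a) \<cdot> m = p \<cdot> c" "b \<cdot> m = d"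
      using is_pullbackE[OF 2, of "p \<cdot> c" d] cd by auto
    have "a \<cdot> m = c"
      using m cd by - (rule is_pullback_mono[OF 1], simp_all add: Comp_reassoc[OF e2])
    then show "\<exists>m. m \<in> Arr C \<and> Dom C m = Dom C c \<and> Cod C m = Dom C a \<and> a \<cdot> m = c \<and> b \<cdot> m = d"
      using m by (intro exI[of _ m]) simp
  next
    fix m n
    assume mn: "m \<in> Arr C" "n \<in> Arr C" "Dom C m = Dom C n" "Cod C m = Dom C a"
      "Cod C n = Dom C a" "a \<cdot> m = a \<cdot> n" "b \<cdot> m = b \<cdot> n"
    show "m = n"
      using mn by - (rule is_pullback_mono[OF 2], simp_all)
  qed (use e2 in simp_all)
qed

text \<open>The forgetful functor of a slice preserves and reflects pullbacks: a cone in
  \<open>C\<close> on \<open>f\<close> and \<open>g\<close> carries exactly one structure map to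
  \<open>U\<close> that makes both of its legs slice arrows.\<close>

lemma is_pullback_slice:
  assumes U: "U \<in> Obj C" and f: "arr_over C (Ide C U) x f z" and g: "arr_over C (Ide C U) y g z"
    and p: "arr_over C (Ide C U) w p x" and q: "arr_over C (Ide C U) w q y"
  shows "is_pullback (slice C U) (x, f, z) (y, g, z) (w, p, x) (w, q, y) \<longleftrightarrow> is_pullback C f g p q"
proof -
  interpret S: category "slice C U" using U by (rule category_slice)
  note [simp] = arr_overD[OF f] arr_overD[OF g] arr_overD[OF p] arr_overD[OF q] U
  have A: "(x, f, z) \<in> Arr (slice C U)" "(y, g, z) \<in> Arr (slice C U)"
    "(w, p, x) \<in> Arr (slice C U)" "(w, q, y) \<in> Arr (slice C U)"
    using f g p q by (simp_all add: Arr_slice)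
  show ?thesis
  proof
    assume L: "is_pullback (slice C U) (x, f, z) (y, g, z) (w, p, x) (w, q, y)"
    have eq: "f \<cdot> p = g \<cdot> q" using S.is_pullbackD(9)[OF L] by simp
    show "is_pullback C f g p q"
    proof (rule is_pullbackI)
      fix a b
      assume ab: "a \<in> Arr C" "b \<in> Arr C" "Dom C a = Dom C b" "Cod C a = Dom C f" "Cod C b = Dom C g"
        "f \<cdot> a = g \<cdot> b"
      \<comment> \<open>The structure map of the cone is \<open>x \<cdot> a\<close>; it has to agree
        with \<open>y \<cdot> b\<close> for \<open>b\<close> to be a slice arrow as well.\<close>
      have "y \<cdot> b = z \<cdot> (g \<cdot> b)" using ab(1-5) by simp
      also have "\<dots> = x \<cdot> a" unfolding ab(6)[symmetric] using ab(1-5) by simp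
      finally have "arr_over C (Ide C U) (x \<cdot> a) a x" "arr_over C (Ide C U) (x \<cdot> a) b y"
        using ab(1-5) by (auto intro!: arr_overI)
      then obtain m where m: "m \<in> Arr (slice C U)" "Dom (slice C U) m = x \<cdot> a" "Cod (slice C U) m =
        w"
        "(w, p, x) \<cdot>\<^bsub>slice C U\<^esub> m = (x \<cdot> a, a, x)" "(w, q, y) \<cdot>\<^bsub>slice C U\<^esub> m = (x \<cdot> a, b, y)"
        using S.is_pullbackE[OF L, of "(x \<cdot> a, a, x)" "(x \<cdot> a, b, y)"] ab(6)
        by (auto simp: Arr_slice)
      from m(1) obtain d m' e where *: "m = (d, m', e)" "arr_over C (Ide C U) d m' e"
        by (elim Arr_sliceE)
      show "\<exists>m. m \<in> Arr C \<and> Dom C m = Dom C a \<and> Cod C m = Dom C p \<and> p \<cdot> m = a \<and> q \<cdot> m = b"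
        using m * arr_overD[OF *(2)] ab(1-5) by (intro exI[of _ m']) simp
    next
      fix m n
      assume mn: "m \<in> Arr C" "n \<in> Arr C" "Dom C m = Dom C n" "Cod C m = Dom C p" "Cod C n = Dom C p"
        "p \<cdot> m = p \<cdot> n" "q \<cdot> m = q \<cdot> n"
      have "w \<cdot> m = x \<cdot> (p \<cdot> m)" "w \<cdot> n = x \<cdot> (p \<cdot> n)" using mn(1-5) by simp_all
      then have w: "w \<cdot> m = w \<cdot> n" using mn(6) by simp
      then have "arr_over C (Ide C U) (w \<cdot> m) m w" "arr_over C (Ide C U) (w \<cdot> m) n w"
        using mn(1-5) by (auto intro!: arr_overI)
      then have "(w \<cdot> m, m, w) = (w \<cdot> m, n, w)"
        using mn(6,7) by - (rule S.is_pullback_mono[OF L], simp_all add: Arr_slice)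
      then show "m = n" by simp
    qed (use eq in simp_all)
  next
    assume R: "is_pullback C f g p q"
    note eq = is_pullbackD(9)[OF R]
    show "is_pullback (slice C U) (x, f, z) (y, g, z) (w, p, x) (w, q, y)"
    proof (rule S.is_pullbackI)
      fix a b
      assume ab: "a \<in> Arr (slice C U)" "b \<in> Arr (slice C U)" "Dom (slice C U) a = Dom (slice C U) b"
        "Cod (slice C U) a = Dom (slice C U) (x, f, z)" "Cod (slice C U) b =
          Dom (slice C U) (y, g, z)"
        "(x, f, z) \<cdot>\<^bsub>slice C U\<^esub> a = (y, g, z) \<cdot>\<^bsub>slice C U\<^esub> b"
      obtain d a' b' where *: "a = (d, a', x)" "b = (d, b', y)"
        "arr_over C (Ide C U) d a' x" "arr_over C (Ide C U) d b' y"
        using ab(1-5) by (cases a; cases b) (simp add: Arr_slice)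
      note [simp] = arr_overD[OF *(3)] arr_overD[OF *(4)]
      obtain m where m: "m \<in> Arr C" "Dom C m = Dom C a'" "Cod C m = Dom C p" "p \<cdot> m = a'" "q \<cdot> m =
        b'"
        using is_pullbackE[OF R, of a' b'] ab(6) by (auto simp: *)
      have "w \<cdot> m = x \<cdot> (p \<cdot> m)" using m(1-3) by simp
      also have "\<dots> = d" using m by simp
      finally have "arr_over C (Ide C U) d m w" using m(1-3) by (intro arr_overI) simp_all
      then show "\<exists>m. m \<in> Arr (slice C U) \<and> Dom (slice C U) m = Dom (slice C U) a \<and>
          Cod (slice C U) m = Dom (slice C U) (w, p, x) \<and>
          (w, p, x) \<cdot>\<^bsub>slice C U\<^esub> m = a \<and> (w, q, y) \<cdot>\<^bsub>slice C U\<^esub> m = b"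
        using m by (intro exI[of _ "(d, m, w)"]) (simp add: * Arr_slice)
    next
      fix a b
      assume ab: "a \<in> Arr (slice C U)" "b \<in> Arr (slice C U)" "Dom (slice C U) a = Dom (slice C U) b"
        "Cod (slice C U) a = Dom (slice C U) (w, p, x)" "Cod (slice C U) b =
          Dom (slice C U) (w, p, x)"
        "(w, p, x) \<cdot>\<^bsub>slice C U\<^esub> a = (w, p, x) \<cdot>\<^bsub>slice C U\<^esub> b"
        "(w, q, y) \<cdot>\<^bsub>slice C U\<^esub> a = (w, q, y) \<cdot>\<^bsub>slice C U\<^esub> b"
      obtain d a' b' where *: "a = (d, a', w)" "b = (d, b', w)"
        "arr_over C (Ide C U) d a' w" "arr_over C (Ide C U) d b' w"
        using ab(1-5) by (cases a; cases b) (simp add: Arr_slice)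
      note [simp] = arr_overD[OF *(3)] arr_overD[OF *(4)]
      have "a' = b'"
        using ab(6,7) by - (rule is_pullback_mono[OF R], simp_all add: *)
      then show "a = b" by (simp add: *)
    qed (use A eq in simp_all)
  qed
qed

lemma is_pullback_sliceE:
  assumes U: "U \<in> Obj C" and P: "is_pullback (slice C U) F G P Q"
  obtains x y z w f g p q where "F = (x, f, z)" "G = (y, g, z)" "P = (w, p, x)" "Q = (w, q, y)"
    "arr_over C (Ide C U) x f z" "arr_over C (Ide C U) y g z"
    "arr_over C (Ide C U) w p x" "arr_over C (Ide C U) w q y" "is_pullback C f g p q"
proof -
  interpret S: category "slice C U" using U by (rule category_slice)
  obtain x f z y g z' w p x' w' q y' where *: "F = (x, f, z)" "G = (y, g, z')" "P = (w, p, x')"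
    "Q = (w', q, y')"
    by (cases F, cases G, cases P, cases Q)
  with S.is_pullbackD[OF P] have "z' = z" "x' = x" "w' = w" "y' = y"
    and "arr_over C (Ide C U) x f z" "arr_over C (Ide C U) y g z"
    "arr_over C (Ide C U) w p x" "arr_over C (Ide C U) w q y"
    by (simp_all add: Arr_slice)
  then show ?thesis
    using that[of x f z y g w p q] * P is_pullback_slice[OF U] by simp
qed

end

section \<open>Chosen pullbacks and the pullback functors\<close>

locale pullback_category = category_with_pullbacks C pb
  for C :: "('o, 'a) cat" (structure) and pb :: "'a \<Rightarrow> 'a \<Rightarrow> 'a \<times> 'a"
begin

abbreviation "p1 \<equiv> pb1 pb"
abbreviation "p2 \<equiv> pb2 pb"
abbreviation "pr \<equiv> pairing C pb"

lemma chosen_pullback: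
  "u \<in> Arr C \<Longrightarrow> z \<in> Arr C \<Longrightarrow> Cod C u = Cod C z \<Longrightarrow> is_pullback C u z (p1 u z) (p2 u z)"
  using pb by (simp add: pb1_def pb2_def)

lemma projections [simp]:
  assumes "u \<in> Arr C" "z \<in> Arr C" "Cod C u = Cod C z"
  shows "p1 u z \<in> Arr C" "p2 u z \<in> Arr C" "Dom C (p2 u z) = Dom C (p1 u z)"
    "Cod C (p1 u z) = Dom C u" "Cod C (p2 u z) = Dom C z" "z \<cdot> p2 u z = u \<cdot> p1 u z"
  using is_pullbackD[OF chosen_pullback[OF assms]] by simp_all

lemma projections_reassoc [simp]:
  assumes "u \<in> Arr C" "z \<in> Arr C" "Cod C u = Cod C z" "k \<in> Arr C" "Cod C k = Dom C (p1 u z)"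
  shows "z \<cdot> (p2 u z \<cdot> k) = u \<cdot> (p1 u z \<cdot> k)"
  using assms by (simp add: Comp_reassoc[OF projections(6)])

lemma arr_over_projection:
  assumes "u \<in> Arr C" "z \<in> Arr C" "Cod C z = Cod C u"
  shows "arr_over C u (p1 u z) (p2 u z) z"
  using assms by (intro arr_overI) simp_all

lemma pairing_all:
  assumes "u \<in> Arr C" "z \<in> Arr C" "Cod C u = Cod C z" "a \<in> Arr C" "b \<in> Arr C" "Dom C b = Dom C a"
    "Cod C a = Dom C u" "Cod C b = Dom C z" "u \<cdot> a = z \<cdot> b"
  shows "pr u z a b \<in> Arr C \<and> Dom C (pr u z a b) = Dom C a \<and> Cod C (pr u z a b) = Dom C (p1 u z) \<and>
    p1 u z \<cdot> pr u z a b = a \<and> p2 u z \<cdot> pr u z a b = b"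
  using theI'[OF is_pullback_ex1[OF chosen_pullback[OF assms(1-3)], of a b]] assms
  unfolding pairing_def Hom_def by auto

lemma pairing_simps [simp]:
  assumes "u \<in> Arr C" "z \<in> Arr C" "Cod C u = Cod C z" "a \<in> Arr C" "b \<in> Arr C" "Dom C b = Dom C a"
    "Cod C a = Dom C u" "Cod C b = Dom C z" "u \<cdot> a = z \<cdot> b"
  shows "pr u z a b \<in> Arr C" "Dom C (pr u z a b) = Dom C a" "Cod C (pr u z a b) = Dom C (p1 u z)"
    "p1 u z \<cdot> pr u z a b = a" "p2 u z \<cdot> pr u z a b = b"
    "k \<in> Arr C \<Longrightarrow> Cod C k = Dom C a \<Longrightarrow> p1 u z \<cdot> (pr u z a b \<cdot> k) = a \<cdot> k"
    "k \<in> Arr C \<Longrightarrow> Cod C k = Dom C a \<Longrightarrow> p2 u z \<cdot> (pr u z a b \<cdot> k) = b \<cdot> k"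
proof -
  note * = pairing_all[OF assms]
  then show "pr u z a b \<in> Arr C" "Dom C (pr u z a b) = Dom C a"
    "Cod C (pr u z a b) = Dom C (p1 u z)" "p1 u z \<cdot> pr u z a b = a" "p2 u z \<cdot> pr u z a b = b"
    by blast+
  then show "k \<in> Arr C \<Longrightarrow> Cod C k = Dom C a \<Longrightarrow> p1 u z \<cdot> (pr u z a b \<cdot> k) = a \<cdot> k"
    "k \<in> Arr C \<Longrightarrow> Cod C k = Dom C a \<Longrightarrow> p2 u z \<cdot> (pr u z a b \<cdot> k) = b \<cdot> k"
    using assms by (simp_all add: Comp_reassoc)
qed

lemma projections_mono:
  assumes "u \<in> Arr C" "z \<in> Arr C" "Cod C u = Cod C z" "m \<in> Arr C" "n \<in> Arr C" "Dom C m = Dom C n"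
    "Cod C m = Dom C (p1 u z)" "Cod C n = Dom C (p1 u z)" "p1 u z \<cdot> m = p1 u z \<cdot> n"
    "p2 u z \<cdot> m = p2 u z \<cdot> n"
  shows "m = n"
  using assms by - (rule is_pullback_mono[OF chosen_pullback[OF assms(1-3)]], simp_all)

lemma arr_over_pairing:
  assumes "arr_over C u w k z"
  shows "arr_over C (Ide C (Dom C u)) w (pr u z w k) (p1 u z)"
    and "p2 u z \<cdot> pr u z w k = k" "p1 u z \<cdot> pr u z w k = w"
    and "pr u z w k \<in> Arr C" "Dom C (pr u z w k) = Dom C w" "Cod C (pr u z w k) = Dom C (p1 u z)"
  using arr_overD[OF assms] by (auto intro!: arr_overI)

lemma arr_over_pairing_eqI:
  assumes "arr_over C u w k z" "m \<in> Arr C" "Dom C m = Dom C w" "Cod C m = Dom C (p1 u z)"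
    "p1 u z \<cdot> m = w" "p2 u z \<cdot> m = k"
  shows "m = pr u z w k"
  using assms arr_overD[OF assms(1)] arr_over_pairing[OF assms(1)]
  by - (rule projections_mono[of u z], simp_all)

lemma pull_eq: "pull C pb u = slice_ftr C (Cod C u) (p1 u) (\<lambda>d f d'. pr u d' (p1 u d) (f \<cdot> p2 u d))"
  by (simp add: pull_def slice_ftr_def into_pull_def)

lemma arr_over_pull:
  assumes u: "u \<in> Arr C" and f: "arr_over C (Ide C (Cod C u)) d f d'"
  shows "arr_over C u (p1 u d) (f \<cdot> p2 u d) d'"
  using arr_overD[OF f] u by (intro arr_overI) simp_all

lemma pull_simps [simp]:
  assumes u: "u \<in> Arr C"
  shows "d \<in> Arr C \<Longrightarrow> Cod C d = Cod C u \<Longrightarrow> onO (pull C pb u) d = p1 u d"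
    and "arr_over C (Ide C (Cod C u)) d f d' \<Longrightarrow>
      mor (pull C pb u) d f d' = pr u d' (p1 u d) (f \<cdot> p2 u d)"
  using assms by (auto simp: pull_eq)

lemma is_functor_pull:
  assumes u: "u \<in> Arr C"
  shows "is_functor (slice C (Cod C u)) (slice C (Dom C u)) (pull C pb u)"
proof (rule is_functor_sliceI)
  fix x f y assume f: "arr_over C (Ide C (Cod C u)) x f y"
  note f' = arr_over_pull[OF u f]
  show "onA (pull C pb u) (x, f, y) =
        (onO (pull C pb u) x, mor (pull C pb u) x f y, onO (pull C pb u) y) \<and>
      arr_over C (Ide C (Dom C u)) (onO (pull C pb u) x) (mor (pull C pb u) x f y) (onO (pull C pb
        u) y)"
    using u f arr_over_pairing(1)[OF f'] arr_overD[OF f] by (simp add: pull_eq slice_ftr_onA)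
next
  fix x assume x: "x \<in> Arr C" "Cod C x = Cod C u"
  then have "mor (pull C pb u) x (Ide C (Dom C x)) x = pr u x (p1 u x) (p2 u x)"
    using u arr_over_ide[of x "Cod C u"] by simp
  also have "\<dots> = Ide C (Dom C (p1 u x))"
    using x u by - (rule projections_mono[of u x], simp_all)
  finally show "mor (pull C pb u) x (Ide C (Dom C x)) x = Ide C (Dom C (onO (pull C pb u) x))"
    using x u by simp
next
  fix x f y g z assume f: "arr_over C (Ide C (Cod C u)) x f y" and g: "arr_over C (Ide C (Cod C u))
    y g z"
  have gf: "arr_over C (Ide C (Cod C u)) x (g \<cdot> f) z"
    using arr_over_comp_left[OF f] g u by simp
  note [simp] = arr_overD[OF f] arr_overD[OF g] u
    arr_over_pairing[OF arr_over_pull[OF u f]] arr_over_pairing[OF arr_over_pull[OF u g]]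
    arr_over_pairing[OF arr_over_pull[OF u gf]]
  show "mor (pull C pb u) x (g \<cdot> f) z = mor (pull C pb u) y g z \<cdot> mor (pull C pb u) x f y"
    unfolding pull_simps(2)[OF u f] pull_simps(2)[OF u g] pull_simps(2)[OF u gf]
    by (rule projections_mono[of u z]) simp_all
qed (use u in simp_all)

end

section \<open>Actions\<close>

text \<open>The arguments \<open>x\<close> and \<open>z\<close> are recorded because
  \<open>f\<close>, an arrow of \<open>C\<close>, determines only their domains. Nothing is required
  of triples that are not squares over \<open>u\<close>, so two actions count as equal when they
  agree on squares; compare \<open>of_action_cong\<close> and
  \<open>of_action_inject\<close>.\<close>

definition action ::
  "('o, 'a) cat \<Rightarrow> 'a slice_ftr \<Rightarrow> 'a \<Rightarrow> 'a slice_ftr \<Rightarrow> ('a \<Rightarrow> 'a \<Rightarrow> 'a \<Rightarrow> 'a) \<Rightarrow> bool" where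
  "action C P u R a \<longleftrightarrow>
     (\<forall>x f z. arr_over C u x f z \<longrightarrow> arr_over C u (onO P x) (a x f z) (onO R z)) \<and>
     (\<forall>x' g x f z. arr_over C (Ide C (Dom C u)) x' g x \<longrightarrow> arr_over C u x f z \<longrightarrow>
        a x' (f \<cdot>\<^bsub>C\<^esub> g) z = a x f z \<cdot>\<^bsub>C\<^esub> mor P x' g x) \<and>
     (\<forall>x f z g z'. arr_over C u x f z \<longrightarrow> arr_over C (Ide C (Cod C u)) z g z' \<longrightarrow>
        a x (g \<cdot>\<^bsub>C\<^esub> f) z' = mor R z g z' \<cdot>\<^bsub>C\<^esub> a x f z)"

text \<open>The component at \<open>z\<close> evaluates the action at one square only, the chosen
  pullback square of \<open>u\<close> and \<open>z\<close>, and factors the result through the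
  pullback of \<open>R z\<close> along \<open>u\<close>.\<close>

definition of_action ::
  "('o, 'a) cat \<Rightarrow> ('a \<Rightarrow> 'a \<Rightarrow> 'a \<times> 'a) \<Rightarrow> 'a slice_ftr \<Rightarrow> 'a \<Rightarrow> 'a slice_ftr \<Rightarrow>
    ('a \<Rightarrow> 'a \<Rightarrow> 'a \<Rightarrow> 'a) \<Rightarrow> ('o, 'a) exp_arr" where
  "of_action C pb P u R a = ((Dom C u, P), u,
     (\<lambda>z \<in> Obj (slice C (Cod C u)).
        into_pull C pb u (onO P (pb1 pb u z)) (onO R z) (a (pb1 pb u z) (pb2 pb u z) z)),
     (Cod C u, R))"

definition comp_action ::
  "('o, 'a) cat \<Rightarrow> ('a \<Rightarrow> 'a \<Rightarrow> 'a \<times> 'a) \<Rightarrow> 'a \<Rightarrow> 'a \<Rightarrow>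
    ('a \<Rightarrow> 'a \<Rightarrow> 'a \<Rightarrow> 'a) \<Rightarrow> ('a \<Rightarrow> 'a \<Rightarrow> 'a \<Rightarrow> 'a) \<Rightarrow> 'a \<Rightarrow> 'a \<Rightarrow> 'a \<Rightarrow> 'a" where
  "comp_action C pb u v b a = (\<lambda>x h z.
     b (pb1 pb v z) (pb2 pb v z) z \<cdot>\<^bsub>C\<^esub> a x (pairing C pb v z (u \<cdot>\<^bsub>C\<^esub> x) h) (pb1 pb v z))"

lemma actionD:
  assumes "action C P u R a"
  shows "arr_over C u x f z \<Longrightarrow> arr_over C u (onO P x) (a x f z) (onO R z)"
    and "arr_over C (Ide C (Dom C u)) x' g x \<Longrightarrow> arr_over C u x f z \<Longrightarrow>
      a x' (f \<cdot>\<^bsub>C\<^esub> g) z = a x f z \<cdot>\<^bsub>C\<^esub> mor P x' g x"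
    and "arr_over C u x f z \<Longrightarrow> arr_over C (Ide C (Cod C u)) z k z' \<Longrightarrow>
      a x (k \<cdot>\<^bsub>C\<^esub> f) z' = mor R z k z' \<cdot>\<^bsub>C\<^esub> a x f z"
  using assms unfolding action_def by blast+

lemma is_functor_comp:
  assumes "is_functor A B F" "is_functor B D G"
  shows "is_functor A D (comp_ftr A G F)"
proof -
  interpret F: is_functor A B F by fact
  interpret G: is_functor B D G by fact
  show ?thesis
  proof
    fix x assume "x \<in> Obj A"
    then show "onO (comp_ftr A G F) x \<in> Obj D"
      by (simp add: comp_ftr_def F.onO_Obj G.onO_Obj)
    show "onA (comp_ftr A G F) (Ide A x) = Ide D (onO (comp_ftr A G F) x)"
      using \<open>x \<in> Obj A\<close> F.A.Ide_Hom[of x]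
      by (simp add: comp_ftr_def F.onA_Ide G.onA_Ide F.onO_Obj Hom_def)
  next
    fix f x y assume f: "f \<in> Hom A x y"
    then have "f \<in> Arr A" "x \<in> Obj A" "y \<in> Obj A"
      using F.A.Dom_Obj F.A.Cod_Obj by (auto simp: Hom_def)
    then show "onA (comp_ftr A G F) f \<in> Hom D (onO (comp_ftr A G F) x) (onO (comp_ftr A G F) y)"
      using G.onA_Hom[OF F.onA_Hom[OF f]] by (simp add: comp_ftr_def)
  next
    fix f g x y z assume fg: "f \<in> Hom A x y" "g \<in> Hom A y z"
    then have "f \<in> Arr A" "g \<in> Arr A" "g \<cdot>\<^bsub>A\<^esub> f \<in> Arr A"
      using F.A.Comp_Hom[OF fg] by (auto simp: Hom_def)
    then show "onA (comp_ftr A G F) (g \<cdot>\<^bsub>A\<^esub> f) =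
        onA (comp_ftr A G F) g \<cdot>\<^bsub>D\<^esub> onA (comp_ftr A G F) f"
      using F.onA_Comp[OF fg] G.onA_Comp[OF F.onA_Hom[OF fg(1)] F.onA_Hom[OF fg(2)]]
      by (simp add: comp_ftr_def)
  qed
qed

lemma is_functor_id:
  assumes "category A"
  shows "is_functor A A (id_ftr A)"
proof -
  interpret category A by fact
  show ?thesis
  proof
    fix x assume "x \<in> Obj A"
    then show "onO (id_ftr A) x \<in> Obj A" "onA (id_ftr A) (Ide A x) = Ide A (onO (id_ftr A) x)"
      using Ide_Hom[of x] by (auto simp: id_ftr_def Hom_def)
  next
    fix f x y assume f: "f \<in> Hom A x y"
    then have "f \<in> Arr A" "x \<in> Obj A" "y \<in> Obj A"
      using Dom_Obj Cod_Obj by (auto simp: Hom_def)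
    then show "onA (id_ftr A) f \<in> Hom A (onO (id_ftr A) x) (onO (id_ftr A) y)"
      using f by (simp add: id_ftr_def)
  next
    fix f g x y z assume fg: "f \<in> Hom A x y" "g \<in> Hom A y z"
    then have "f \<in> Arr A" "g \<in> Arr A" "g \<cdot>\<^bsub>A\<^esub> f \<in> Arr A"
      using Comp_Hom[OF fg] by (auto simp: Hom_def)
    then show "onA (id_ftr A) (g \<cdot>\<^bsub>A\<^esub> f) = onA (id_ftr A) g \<cdot>\<^bsub>A\<^esub> onA (id_ftr A) f"
      by (simp add: id_ftr_def)
  qed
qed

section \<open>Composition and identity of slice endofunctors\<close>

context category
begin

lemma exp_objsD:
  assumes "(U, P) \<in> exp_objs C"
  shows "U \<in> Obj C" "is_functor (slice C U) (slice C U) P"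
    "onO P \<in> extensional (Obj (slice C U))" "onA P \<in> extensional (Arr (slice C U))"
  using assms by (auto simp: exp_objs_def)

lemma comp_ftr_simps [simp]:
  "x \<in> Arr C \<Longrightarrow> Cod C x = U \<Longrightarrow> onO (comp_ftr (slice C U) P Q) x = onO P (onO Q x)"
  "arr_over C (Ide C U) x f y \<Longrightarrow> U \<in> Obj C \<Longrightarrow> is_functor (slice C U) (slice C V) Q \<Longrightarrow>
    mor (comp_ftr (slice C U) P Q) x f y = mor P (onO Q x) (mor Q x f y) (onO Q y)"
  "arr_over C (Ide C U) x f y \<Longrightarrow> U \<in> Obj C \<Longrightarrow>
    onA (comp_ftr (slice C U) P Q) (x, f, y) = onA P (onA Q (x, f, y))"
proof -
  show "x \<in> Arr C \<Longrightarrow> Cod C x = U \<Longrightarrow> onO (comp_ftr (slice C U) P Q) x = onO P (onO Q x)"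
    by (simp add: comp_ftr_def)
  show A: "onA (comp_ftr (slice C U) P Q) (x, f, y) = onA P (onA Q (x, f, y))"
    if "arr_over C (Ide C U) x f y" "U \<in> Obj C"
    using that by (simp add: comp_ftr_def Arr_slice)
  show "mor (comp_ftr (slice C U) P Q) x f y = mor P (onO Q x) (mor Q x f y) (onO Q y)"
    if "arr_over C (Ide C U) x f y" "U \<in> Obj C" "is_functor (slice C U) (slice C V) Q"
    using A[OF that(1,2)] slice_functor_onA[OF that(3,2,1)]
      by (simp add: mor_def[of "comp_ftr _ _ _"] mor_def[of P])
qed

lemma id_ftr_simps [simp]:
  "x \<in> Arr C \<Longrightarrow> Cod C x = U \<Longrightarrow> onO (id_ftr (slice C U)) x = x"
  "arr_over C (Ide C U) x f y \<Longrightarrow> U \<in> Obj C \<Longrightarrow> mor (id_ftr (slice C U)) x f y = f"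
  by (auto simp: id_ftr_def mor_def Arr_slice)

lemma exp_objs_comp:
  "(U, P) \<in> exp_objs C \<Longrightarrow> (U, Q) \<in> exp_objs C \<Longrightarrow> (U, comp_ftr (slice C U) P Q) \<in> exp_objs C"
  using is_functor_comp[of "slice C U" "slice C U" Q "slice C U" P]
  by (simp add: exp_objs_def comp_ftr_def del: slice_simps(1))

lemma exp_objs_id: "U \<in> Obj C \<Longrightarrow> (U, id_ftr (slice C U)) \<in> exp_objs C"
  using is_functor_id[OF category_slice]
  by (simp add: exp_objs_def id_ftr_def del: slice_simps(1))

lemma exp_objs_slice_ftr:
  "U \<in> Obj C \<Longrightarrow> is_functor (slice C U) (slice C U) (slice_ftr C U ob mo) \<Longrightarrow>
    (U, slice_ftr C U ob mo) \<in> exp_objs C"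
  by (simp add: exp_objs_def slice_ftr_def del: slice_simps(1))

lemma comp_ftr_assoc:
  assumes "is_functor A B F" "is_functor B D G"
  shows "comp_ftr A H (comp_ftr A G F) = comp_ftr A (comp_ftr B H G) F"
proof -
  interpret F: is_functor A B F by fact
  have "onA F f \<in> Arr B" if "f \<in> Arr A" for f
    using F.onA_Hom[of f "Dom A f" "Cod A f"] that by (simp add: Hom_def)
  then show ?thesis
    using F.onO_Obj by (auto simp: comp_ftr_def fun_eq_iff restrict_def)
qed

text \<open>These are equations of records: off the slice both sides are \<open>undefined\<close>,
  by the two extensionality clauses of \<open>exp_objs\<close>.\<close>

lemma comp_ftr_id:
  assumes "(U, P) \<in> exp_objs C"
  shows "comp_ftr (slice C U) P (id_ftr (slice C U)) = P"
    and "comp_ftr (slice C U) (id_ftr (slice C U)) P = P"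
proof -
  interpret P: is_functor "slice C U" "slice C U" P using exp_objsD[OF assms] by simp
  have A: "onA P f \<in> Arr (slice C U)" if "f \<in> Arr (slice C U)" for f
    using P.onA_Hom[of f "Dom (slice C U) f" "Cod (slice C U) f"] that by (simp add: Hom_def)
  note E = exp_objsD(3,4)[OF assms, unfolded extensional_def]
  show "comp_ftr (slice C U) P (id_ftr (slice C U)) = P"
    using E by (cases P)
      (auto simp: comp_ftr_def id_ftr_def fun_eq_iff restrict_def simp del: slice_simps(1))
  show "comp_ftr (slice C U) (id_ftr (slice C U)) P = P"
    using E A P.onO_Obj by (cases P)
      (auto simp: comp_ftr_def id_ftr_def fun_eq_iff restrict_def simp del: slice_simps(1))
qed

end

section \<open>The correspondence between actions and arrows of \<open>Exp\<close>\<close>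

context pullback_category
begin

lemma arr_over_proj_left:
  assumes u: "u \<in> Arr C" and f: "arr_over C (Ide C (Cod C u)) d f d'"
  shows "arr_over C (Ide C (Dom C u)) (p1 u d) (pr u d' (p1 u d) (f \<cdot> p2 u d)) (p1 u d')"
  using arr_over_pairing(1)[OF arr_over_pull[OF u f]] .

text \<open>Naturality at \<open>f : d \<rightarrow> d'\<close> is checked on the two projections of
  the pullback of \<open>R d'\<close> along \<open>u\<close>. On the second, both paths equal the
  action at \<open>f \<cdot> p2 u d\<close>, a square over \<open>u\<close> into \<open>d'\<close>,
  one path by each equivariance law.\<close>

lemma of_action_arr:
  assumes u: "u \<in> Arr C" and P: "(Dom C u, P) \<in> exp_objs C" and R: "(Cod C u, R) \<in> exp_objs C"
    and a: "action C P u R a"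
  shows "of_action C pb P u R a \<in> exp_arrs C pb"
proof -
  let ?U = "Dom C u" and ?V = "Cod C u"
  note P' = exp_objsD(1,2)[OF P] and R' = exp_objsD(1,2)[OF R]
  let ?t = "\<lambda>z \<in> Obj (slice C ?V). into_pull C pb u (onO P (p1 u z)) (onO R z) (a (p1 u z) (p2 u z)
    z)"
  have az: "arr_over C u (onO P (p1 u z)) (a (p1 u z) (p2 u z) z) (onO R z)"
    if "z \<in> Arr C" "Cod C z = ?V" for z
    using actionD(1)[OF a] arr_over_projection u that by simp
  have "nat_trans (slice C ?V) (slice C ?U)
       (comp_ftr (slice C ?V) P (pull C pb u)) (comp_ftr (slice C ?V) (pull C pb u) R) ?t"
  proof (intro nat_trans.intro nat_trans_axioms.intro)
    show "is_functor (slice C ?V) (slice C ?U) (comp_ftr (slice C ?V) P (pull C pb u))"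
      using is_functor_comp[OF is_functor_pull P'(2)] u by simp
    show "is_functor (slice C ?V) (slice C ?U) (comp_ftr (slice C ?V) (pull C pb u) R)"
      using is_functor_comp[OF R'(2) is_functor_pull] u by simp
  next
    fix z assume "z \<in> Obj (slice C ?V)"
    then have z: "z \<in> Arr C" "Cod C z = ?V" by simp_all
    then show "?t z \<in> Hom (slice C ?U) (onO (comp_ftr (slice C ?V) P (pull C pb u)) z)
      (onO (comp_ftr (slice C ?V) (pull C pb u) R) z)"
      using arr_over_pairing(1)[OF az[OF z]] u slice_functor_obj[OF R'(2,1)]
      by (simp add: Hom_slice into_pull_def)
  next
    fix t d d' assume "t \<in> Hom (slice C ?V) d d'"
    then obtain f where t: "t = (d, f, d')" and f: "arr_over C (Ide C ?V) d f d'"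
      by (auto simp: Hom_slice)
    note [simp] = arr_overD[OF f] u
    let ?f = "pr u d' (p1 u d) (f \<cdot> p2 u d)"
    have f': "arr_over C (Ide C ?U) (p1 u d) ?f (p1 u d')"
      using arr_over_proj_left[OF u f] .
    have ad: "arr_over C u (onO P (p1 u d)) (a (p1 u d) (p2 u d) d) (onO R d)"
      and ad': "arr_over C u (onO P (p1 u d')) (a (p1 u d') (p2 u d') d') (onO R d')"
      by (simp_all add: az)
    note Pf = slice_functor_mor[OF P'(2,1) f'] and Rf = slice_functor_mor[OF R'(2,1) f]
    have e1: "a (p1 u d') (p2 u d') d' \<cdot> mor P (p1 u d) ?f (p1 u d') = a (p1 u d) (f \<cdot> p2 u d) d'"
      using actionD(2)[OF a f', of "p2 u d'" d'] arr_over_projection[of u d']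
        arr_over_pairing(2)[OF arr_over_pull[OF u f]] by simp
    have e2: "mor R d f d' \<cdot> a (p1 u d) (p2 u d) d = a (p1 u d) (f \<cdot> p2 u d) d'"
      using actionD(3)[OF a, of "p1 u d" "p2 u d" d f d'] arr_over_projection[of u d] f by simp
    note [simp] = arr_overD(1-9)[OF ad] arr_overD(1-9)[OF ad'] arr_overD[OF Pf] arr_overD[OF Rf]
      arr_over_pairing(2-)[OF ad] arr_over_pairing(2-)[OF ad'] arr_overD(1-9)[OF f']
      arr_over_pairing(2-)[OF arr_over_pull[OF u Rf]]
    have "pr u (onO R d') (onO P (p1 u d')) (a (p1 u d') (p2 u d') d')
      \<cdot> mor P (p1 u d) ?f (p1 u d') =
      pr u (onO R d') (p1 u (onO R d)) (mor R d f d' \<cdot> p2 u (onO R d))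
       \<cdot> pr u (onO R d) (onO P (p1 u d)) (a (p1 u d) (p2 u d) d)"
      by (rule projections_mono[of u "onO R d'"]) (simp_all add: e1 e2)
    then show "?t d' \<cdot>\<^bsub>slice C ?U\<^esub> onA (comp_ftr (slice C ?V) P (pull C pb u)) t =
      onA (comp_ftr (slice C ?V) (pull C pb u) R) t \<cdot>\<^bsub>slice C ?U\<^esub> ?t d"
      using f f' Rf P' R' slice_functor_onA[OF is_functor_pull[OF u] _ f] slice_functor_onA[OF
        is_functor_pull[OF u] _ Rf]
        slice_functor_onA[OF P'(2,1) f'] slice_functor_onA[OF R'(2,1) f]
      by (simp add: t into_pull_def)
  qed
  then show ?thesis
    using u P R by (auto simp: exp_arrs_def of_action_def Hom_def)
qed

lemma of_action_cong:
  assumes "u \<in> Arr C" "\<And>x f z. arr_over C u x f z \<Longrightarrow> a x f z = b x f z"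
  shows "of_action C pb P u R a = of_action C pb P u R b"
  using assms arr_over_projection[of u] by (auto simp: of_action_def restrict_def fun_eq_iff)

text \<open>Surjectivity of the encoding. With \<open>of_action_inject\<close>, actions taken up to
  their values on squares present the arrows of \<open>Exp\<close> faithfully, so any statement
  about arrows can be proved on actions.\<close>

lemma exp_arrsE:
  assumes "E \<in> exp_arrs C pb"
  obtains P u R a where "E = of_action C pb P u R a" "u \<in> Arr C" "(Dom C u, P) \<in> exp_objs C"
    "(Cod C u, R) \<in> exp_objs C" "action C P u R a"
proof -
  obtain U P u \<tau> V R where E: "E = ((U, P), u, \<tau>, (V, R))"
    by (metis prod_cases4 surj_pair)
  from assms have P: "(U, P) \<in> exp_objs C" and R: "(V, R) \<in> exp_objs C"
    and u: "u \<in> Arr C" "Dom C u = U" "Cod C u = V"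
    and nt: "nat_trans (slice C V) (slice C U)
       (comp_ftr (slice C V) P (pull C pb u)) (comp_ftr (slice C V) (pull C pb u) R) \<tau>"
    and ext: "\<tau> \<in> extensional (Obj (slice C V))"
    by (auto simp: E exp_arrs_def Hom_def)
  note [simp] = u
  interpret nt: nat_trans "slice C V" "slice C U"
    "comp_ftr (slice C V) P (pull C pb u)" "comp_ftr (slice C V) (pull C pb u) R" \<tau> by (rule nt)
  note P' = exp_objsD(1,2)[OF P] and R' = exp_objsD(1,2)[OF R]
  define t where "t z = fst (snd (\<tau> z))" for z
  have t: "\<tau> z = (onO P (p1 u z), t z, p1 u (onO R z))"
      "arr_over C (Ide C U) (onO P (p1 u z)) (t z) (p1 u (onO R z))"
    if "z \<in> Arr C" "Cod C z = V" for z
    using nt.component[of z] that slice_functor_obj[OF R'(2,1)] by (auto simp: Hom_slice t_def)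
  have nat: "t z' \<cdot> mor P (p1 u z) (pr u z' (p1 u z) (g \<cdot> p2 u z)) (p1 u z') =
       pr u (onO R z') (p1 u (onO R z)) (mor R z g z' \<cdot> p2 u (onO R z)) \<cdot> t z"
    if g: "arr_over C (Ide C V) z g z'" for z g z'
  proof -
    note [simp] = arr_overD[OF g] u
    have g': "arr_over C (Ide C U) (p1 u z) (pr u z' (p1 u z) (g \<cdot> p2 u z)) (p1 u z')"
      using arr_over_proj_left[of u] g by simp
    have gV: "arr_over C (Ide C (Cod C u)) z g z'" using g by simp
    note Rg = slice_functor_mor[OF R'(2,1) g]
    have RgV: "arr_over C (Ide C (Cod C u)) (onO R z) (mor R z g z') (onO R z')" using Rg by simp
    show ?thesis
      using nt.natural[of "(z, g, z')" z z'] g t[of z] t[of z'] Rg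
        slice_functor_onA[OF is_functor_pull[OF u(1)] _ gV] slice_functor_onA[OF is_functor_pull[OF
          u(1)] _ RgV]
        slice_functor_onA[OF P'(2,1) g'] slice_functor_onA[OF R'(2,1) g] P' R'
      by (simp add: Hom_slice)
  qed
  \<comment> \<open>The mate of \<open>\<tau>\<close>: factor \<open>f\<close> through
    \<open>u^* z\<close>, apply \<open>P\<close>, then the component at \<open>z\<close>, then
    project to \<open>R z\<close>. Equivariance in the source is functoriality of \<open>P\<close>;
    in the target it is naturality of \<open>\<tau>\<close>, the fact \<open>nat\<close>.\<close>
  define a where "a x f z = p2 u (onO R z) \<cdot> (t z \<cdot> mor P x (pr u z x f) (p1 u z))" for x f z
  have "action C P u R a"
    unfolding action_def
  proof (intro conjI allI impI)
    fix x f z assume f: "arr_over C u x f z"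
    note [simp] = arr_overD[OF f] arr_overD[OF t(2)[of z]]
    have "arr_over C (Ide C U) x (pr u z x f) (p1 u z)"
      using arr_over_pairing(1)[OF f] by simp
    note [simp] = arr_overD[OF slice_functor_mor[OF P'(2,1) this]]
    show "arr_over C u (onO P x) (a x f z) (onO R z)"
      using slice_functor_obj[OF R'(2,1)] P' R'
      unfolding a_def by (intro arr_overI) simp_all
  next
    fix x' g x f z assume g: "arr_over C (Ide C (Dom C u)) x' g x" and f: "arr_over C u x f z"
    then have g: "arr_over C (Ide C U) x' g x" by simp
    note [simp] = arr_overD[OF f] arr_overD[OF g] arr_overD[OF t(2)[of z]]
      arr_over_pairing(2-)[OF f]
    have p: "arr_over C (Ide C U) x (pr u z x f) (p1 u z)"
      using arr_over_pairing(1)[OF f] by simp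
    have fg: "arr_over C u x' (f \<cdot> g) z" using arr_over_comp_right[OF _ f] g by simp
    have e: "pr u z x f \<cdot> g = pr u z x' (f \<cdot> g)"
      by (rule arr_over_pairing_eqI[OF fg]) (simp_all add: P')
    note [simp] = arr_overD[OF slice_functor_mor[OF P'(2,1) p]] arr_overD[OF slice_functor_mor[OF
      P'(2,1) g]]
    show "a x' (f \<cdot> g) z = a x f z \<cdot> mor P x' g x"
      using slice_functor_obj[OF R'(2,1)] P' R' slice_functor_comp[OF P'(2,1) g p]
      unfolding a_def e[symmetric] by simp
  next
    fix x f z g z' assume f: "arr_over C u x f z" and "arr_over C (Ide C (Cod C u)) z g z'"
    then have g: "arr_over C (Ide C V) z g z'" by simp
    note [simp] = arr_overD[OF f] arr_overD[OF g] arr_overD[OF t(2)[of z]] arr_overD[OF t(2)[of z']]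
      arr_over_pairing(2-)[OF f]
    have p: "arr_over C (Ide C U) x (pr u z x f) (p1 u z)"
      using arr_over_pairing(1)[OF f] by simp
    have gf: "arr_over C u x (g \<cdot> f) z'" using arr_over_comp_left[OF f] g by simp
    have gV: "arr_over C (Ide C (Cod C u)) z g z'" using g by simp
    note gp = arr_over_pull[OF u(1) gV]
    note Rg = slice_functor_mor[OF R'(2,1) g]
    have RgV: "arr_over C (Ide C (Cod C u)) (onO R z) (mor R z g z') (onO R z')" using Rg by simp
    have g': "arr_over C (Ide C U) (p1 u z) (pr u z' (p1 u z) (g \<cdot> p2 u z)) (p1 u z')"
      using arr_over_proj_left[OF u(1) gV] by simp
    have e: "pr u z' x (g \<cdot> f) = pr u z' (p1 u z) (g \<cdot> p2 u z) \<cdot> pr u z x f"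
      by (rule arr_over_pairing_eqI[OF gf, symmetric])
        (simp_all add: P' R' arr_over_pairing(2-)[OF gp])
    note [simp] = arr_overD[OF slice_functor_mor[OF P'(2,1) p]] arr_overD[OF slice_functor_mor[OF
      P'(2,1) g']]
      arr_overD[OF Rg] arr_over_pairing(2-)[OF arr_over_pull[OF u(1) RgV]]
    have "a x (g \<cdot> f) z' = p2 u (onO R z') \<cdot> ((t z' \<cdot> mor P (p1 u z) (pr u z' (p1 u z) (g
      \<cdot> p2 u z)) (p1 u z'))
        \<cdot> mor P x (pr u z x f) (p1 u z))"
      using P' R' unfolding a_def e slice_functor_comp[OF P'(2,1) p g'] by simp
    also have "\<dots> = (p2 u (onO R z') \<cdot> pr u (onO R z') (p1 u (onO R z)) (mor R z g z'
      \<cdot> p2 u (onO R z)))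
        \<cdot> (t z \<cdot> mor P x (pr u z x f) (p1 u z))"
      using P' R' unfolding nat[OF g] by simp
    also have "\<dots> = mor R z g z' \<cdot> a x f z"
      using P' R' by (simp add: a_def)
    finally show "a x (g \<cdot> f) z' = mor R z g z' \<cdot> a x f z" .
  qed
  moreover have "E = of_action C pb P u R a"
  proof -
    have "\<tau> z = into_pull C pb u (onO P (p1 u z)) (onO R z) (a (p1 u z) (p2 u z) z)"
      if z: "z \<in> Arr C" "Cod C z = V" for z
    proof -
      note [simp] = z arr_overD[OF t(2)[OF z]] slice_functor_obj[OF R'(2,1)] slice_functor_obj[OF
        P'(2,1)]
      \<comment> \<open>At the universal square the factorisation through \<open>u^* z\<close> is an
        identity, which leaves \<open>p2 \<cdot> t z\<close>; pairing this with the structure map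
        gives back \<open>t z\<close>.\<close>
      have i: "pr u z (p1 u z) (p2 u z) = Ide C (Dom C (p1 u z))"
        by (rule arr_over_pairing_eqI[OF arr_over_projection, symmetric]) simp_all
      have "a (p1 u z) (p2 u z) z = p2 u (onO R z) \<cdot> t z"
        unfolding a_def i by (simp add: slice_functor_ide[OF P'(2,1)])
      moreover have "t z = pr u (onO R z) (onO P (p1 u z)) (p2 u (onO R z) \<cdot> t z)"
        using P' by (intro arr_over_pairing_eqI) (simp_all add: arr_over_def)
      ultimately show ?thesis using t(1)[OF z] by (simp add: into_pull_def)
    qed
    then have "\<tau> = (\<lambda>z \<in> Obj (slice C V). into_pull C pb u (onO P (p1 u z)) (onO R z)
        (a (p1 u z) (p2 u z) z))"
      using ext by (auto simp: extensional_def fun_eq_iff)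
    then show ?thesis by (simp add: E of_action_def)
  qed
  ultimately show ?thesis using that[of P u R a] P R by simp
qed

text \<open>\<^term>\<open>comp_action\<close> factors \<open>h\<close> through the chosen
  pullback; equivariance makes the value independent of the factorisation.\<close>

lemma comp_action_eq:
  assumes a: "action C P u R a" and b: "action C R v S b" and uv: "Dom C v = Cod C u"
    and R: "(Cod C u, R) \<in> exp_objs C"
    and f: "arr_over C u x f y" and g: "arr_over C v y g z"
  shows "comp_action C pb u v b a x (g \<cdot> f) z = b y g z \<cdot> a x f y"
proof -
  note R' = exp_objsD(1,2)[OF R]
  have p: "arr_over C (Ide C (Cod C u)) y (pr v z y g) (p1 v z)"
    using arr_over_pairing(1)[OF g] uv by simp
  note [simp] = uv arr_overD[OF f] arr_overD[OF g] arr_over_pairing(2-)[OF g]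
    arr_overD[OF actionD(1)[OF a f]] arr_overD[OF actionD(1)[OF b g]]
    arr_overD[OF slice_functor_mor[OF R'(2,1) p]]
  have "arr_over C (v \<cdot> u) x (g \<cdot> f) z" using arr_over_comp[OF f g] .
  then have gf: "arr_over C v (u \<cdot> x) (g \<cdot> f) z"
    by (simp add: arr_over_def)
  have e: "pr v z (u \<cdot> x) (g \<cdot> f) = pr v z y g \<cdot> f"
    by (rule arr_over_pairing_eqI[OF gf, symmetric]) simp_all
  have e1: "b (p1 v z) (p2 v z) z \<cdot> mor R y (pr v z y g) (p1 v z) = b y g z"
    using actionD(2)[OF b, of y "pr v z y g" "p1 v z" "p2 v z" z] p arr_over_projection[of v z]
      by simp
  have "arr_over C v (onO R (p1 v z)) (b (p1 v z) (p2 v z) z) (onO S z)"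
    using actionD(1)[OF b] arr_over_projection[of v z] by simp
  note [simp] = arr_overD[OF this]
  have e2: "a x (pr v z y g \<cdot> f) (p1 v z) = mor R y (pr v z y g) (p1 v z) \<cdot> a x f y"
    using actionD(3)[OF a f p] .
  show ?thesis
    unfolding comp_action_def e e2 by (simp add: Comp_reassoc[OF e1])
qed

text \<open>Every square over \<open>v \<cdot> u\<close> splits into one over \<open>u\<close>
  followed by one over \<open>v\<close>, with \<open>v^* z\<close> in the middle. As
  \<open>comp_action_eq\<close> holds for any such splitting, equations between composite actions
  are checked on split squares.\<close>

lemma arr_over_factor:
  assumes "arr_over C (v \<cdot> u) x h z" "u \<in> Arr C" "v \<in> Arr C" "Dom C v = Cod C u"
  shows "arr_over C u x (pr v z (u \<cdot> x) h) (p1 v z)" "arr_over C v (p1 v z) (p2 v z) z"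
    "p2 v z \<cdot> pr v z (u \<cdot> x) h = h"
proof -
  note [simp] = assms(2-4) arr_overD[OF assms(1)]
  have "arr_over C v (u \<cdot> x) h z" by (intro arr_overI) simp_all
  note * = arr_over_pairing[OF this]
  show "arr_over C u x (pr v z (u \<cdot> x) h) (p1 v z)" using * by (intro arr_overI) simp_all
  show "arr_over C v (p1 v z) (p2 v z) z" by (simp add: arr_over_projection)
  show "p2 v z \<cdot> pr v z (u \<cdot> x) h = h" using * by simp
qed

lemma comp_action_action:
  assumes u: "u \<in> Arr C" "v \<in> Arr C" "Dom C v = Cod C u"
    and a: "action C P u R a" and b: "action C R v S b" and P: "(Dom C u, P) \<in> exp_objs C"
    and R: "(Cod C u, R) \<in> exp_objs C" and S: "(Cod C v, S) \<in> exp_objs C"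
  shows "action C P (v \<cdot> u) S (comp_action C pb u v b a)"
  unfolding action_def
proof (intro conjI allI impI)
  note [simp] = u
  fix x h z assume h: "arr_over C (v \<cdot> u) x h z"
  note fac = arr_over_factor[OF h u]
  show "arr_over C (v \<cdot> u) (onO P x) (comp_action C pb u v b a x h z) (onO S z)"
    using comp_action_eq[OF a b u(3) R fac(1,2)] fac(3)
      arr_over_comp[OF actionD(1)[OF a fac(1)] actionD(1)[OF b fac(2)]] by simp
  note [simp] = arr_overD[OF actionD(1)[OF a fac(1)]] arr_overD[OF actionD(1)[OF b fac(2)]]
    arr_overD(2-8)[OF fac(1)] arr_overD(2-8)[OF fac(2)]
  show "comp_action C pb u v b a x' (h \<cdot> g) z = comp_action C pb u v b a x h z \<cdot> mor P x' g x"
    if "arr_over C (Ide C (Dom C (v \<cdot> u))) x' g x" for x' g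
  proof -
    have g: "arr_over C (Ide C (Dom C u)) x' g x" using that by simp
    note [simp] = arr_overD[OF g] arr_overD[OF slice_functor_mor[OF exp_objsD(2,1)[OF P] g]]
    have "comp_action C pb u v b a x' (p2 v z \<cdot> (pr v z (u \<cdot> x) h \<cdot> g)) z =
        b (p1 v z) (p2 v z) z \<cdot> (a x (pr v z (u \<cdot> x) h) (p1 v z) \<cdot> mor P x' g x)"
      using comp_action_eq[OF a b u(3) R arr_over_comp_right[OF g fac(1)] fac(2)]
        actionD(2)[OF a g fac(1)] by simp
    moreover have "p2 v z \<cdot> (pr v z (u \<cdot> x) h \<cdot> g) = h \<cdot> g"
      by (rule Comp_reassoc[OF fac(3)]) simp_all
    ultimately show ?thesis
      using comp_action_eq[OF a b u(3) R fac(1,2)] fac(3) by simp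
  qed
  show "comp_action C pb u v b a x (g \<cdot> h) z' = mor S z g z' \<cdot> comp_action C pb u v b a x h z"
    if "arr_over C (Ide C (Cod C (v \<cdot> u))) z g z'" for g z'
  proof -
    have g: "arr_over C (Ide C (Cod C v)) z g z'" using that by simp
    note [simp] = arr_overD[OF g] arr_overD[OF slice_functor_mor[OF exp_objsD(2,1)[OF S] g]]
    \<comment> \<open>Here \<open>g \<cdot> h\<close> is split through \<open>v^* z\<close>, not
      through \<open>v^* z'\<close> as the definition of \<open>comp_action\<close> would have it;
      then only the action \<open>b\<close> sees \<open>g\<close>.\<close>
    have "comp_action C pb u v b a x (g \<cdot> h) z' =
      comp_action C pb u v b a x ((g \<cdot> p2 v z) \<cdot> pr v z (u \<cdot> x) h) z'"
      using fac(3) by simp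
    also have "\<dots> = b (p1 v z) (g \<cdot> p2 v z) z' \<cdot> a x (pr v z (u \<cdot> x) h) (p1 v z)"
      by (rule comp_action_eq[OF a b u(3) R fac(1) arr_over_comp_left[OF fac(2) g]])
    also have "\<dots> = mor S z g z' \<cdot> (b (p1 v z) (p2 v z) z \<cdot> a x (pr v z (u \<cdot> x) h) (p1 v z))"
      using actionD(3)[OF b fac(2) g] by simp
    finally show ?thesis
      using comp_action_eq[OF a b u(3) R fac(1,2)] fac(3) by simp
  qed
qed

end

section \<open>The category of slice endofunctors\<close>

text \<open>The left adjoint \<open>\<Sigma>_u\<close> of \<open>pull\<close>. Prone and supine
  lifts in \<open>Exp\<close> are built by conjugating with this pair.\<close>

definition post_ftr :: "('o, 'a) cat \<Rightarrow> 'a \<Rightarrow> 'a slice_ftr" where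
  "post_ftr C u = slice_ftr C (Dom C u) (\<lambda>x. u \<cdot>\<^bsub>C\<^esub> x) (\<lambda>x f y. f)"

context category
begin

lemma is_functor_post:
  assumes u: "u \<in> Arr C"
  shows "is_functor (slice C (Dom C u)) (slice C (Cod C u)) (post_ftr C u)"
proof (rule is_functor_sliceI)
  fix x f y assume f: "arr_over C (Ide C (Dom C u)) x f y"
  note [simp] = u arr_overD[OF f]
  have "arr_over C (Ide C (Cod C u)) (u \<cdot> x) f (u \<cdot> y)"
    by (intro arr_overI) simp_all
  then show "onA (post_ftr C u) (x, f, y) =
    (onO (post_ftr C u) x, mor (post_ftr C u) x f y, onO (post_ftr C u) y)
      \<and> arr_over C (Ide C (Cod C u)) (onO (post_ftr C u) x) (mor (post_ftr C u) x f y) (onO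
        (post_ftr C u) y)"
    using f by (simp add: post_ftr_def slice_ftr_onA)
next
  fix x f y g z assume f: "arr_over C (Ide C (Dom C u)) x f y" and g: "arr_over C (Ide C (Dom C u))
    y g z"
  then have "arr_over C (Ide C (Dom C u)) x (g \<cdot> f) z" using arr_over_comp_left[OF f] u by simp
  then show "mor (post_ftr C u) x (g \<cdot> f) z = mor (post_ftr C u) y g z \<cdot> mor (post_ftr C u) x f y"
    using u f g by (simp add: post_ftr_def)
qed (use u arr_over_ide in \<open>simp_all add: post_ftr_def\<close>)

lemma post_ftr_simps [simp]:
  assumes "u \<in> Arr C"
  shows "x \<in> Arr C \<Longrightarrow> Cod C x = Dom C u \<Longrightarrow> onO (post_ftr C u) x = u \<cdot> x"
    "arr_over C (Ide C (Dom C u)) x f y \<Longrightarrow> mor (post_ftr C u) x f y = f"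
  using assms by (simp_all add: post_ftr_def)

lemma arr_over_post_mor:
  assumes u: "u \<in> Arr C" and f: "arr_over C (Ide C (Dom C u)) x f y"
  shows "arr_over C (Ide C (Cod C u)) (u \<cdot> x) f (u \<cdot> y)"
  using u arr_overD[OF f] by (intro arr_overI) simp_all

lemma exp_objs_comp_ftr:
  "U \<in> Obj C \<Longrightarrow> is_functor (slice C U) (slice C U) (comp_ftr (slice C U) G F) \<Longrightarrow>
    (U, comp_ftr (slice C U) G F) \<in> exp_objs C"
  by (simp add: exp_objs_def comp_ftr_def del: slice_simps(1))

end

section \<open>Composition and identities of \<open>Exp\<close> computed on actions\<close>

context pullback_category
begin

abbreviation "oa \<equiv> of_action C pb"

definition acts :: "'a slice_ftr \<Rightarrow> 'a \<Rightarrow> 'a slice_ftr \<Rightarrow> ('a \<Rightarrow> 'a \<Rightarrow> 'a \<Rightarrow> 'a) \<Rightarrow> bool" where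
  "acts P u R a \<longleftrightarrow> u \<in> Arr C \<and> (Dom C u, P) \<in> exp_objs C \<and> (Cod C u, R) \<in> exp_objs C \<and>
    action C P u R a"

lemma actsD:
  assumes "acts P u R a"
  shows "u \<in> Arr C" "(Dom C u, P) \<in> exp_objs C" "(Cod C u, R) \<in> exp_objs C" "action C P u R a"
    "is_functor (slice C (Dom C u)) (slice C (Dom C u)) P"
    "is_functor (slice C (Cod C u)) (slice C (Cod C u)) R"
  using assms exp_objsD(2) by (auto simp: acts_def)

lemma acts_over: "acts P u R a \<Longrightarrow> arr_over C u x f z \<Longrightarrow> arr_over C u (onO P x) (a x f z) (onO R z)"
  using actionD(1) by (auto simp: acts_def)

lemma acts_pre:
  "acts P u R a \<Longrightarrow> arr_over C (Ide C (Dom C u)) x' g x \<Longrightarrow> arr_over C u x f z \<Longrightarrow>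
      a x' (f \<cdot> g) z = a x f z \<cdot> mor P x' g x"
  using actionD(2) by (auto simp: acts_def)

lemma acts_post:
  "acts P u R a \<Longrightarrow> arr_over C u x f z \<Longrightarrow> arr_over C (Ide C (Cod C u)) z g z' \<Longrightarrow>
      a x (g \<cdot> f) z' = mor R z g z' \<cdot> a x f z"
  using actionD(3) by (auto simp: acts_def)

lemma acts_mor:
  assumes "acts P u R a"
  shows "arr_over C (Ide C (Dom C u)) x f y \<Longrightarrow>
     arr_over C (Ide C (Dom C u)) (onO P x) (mor P x f y) (onO P y)"
  and "arr_over C (Ide C (Cod C u)) x f y \<Longrightarrow>
     arr_over C (Ide C (Cod C u)) (onO R x) (mor R x f y) (onO R y)"
  using slice_functor_mor[OF actsD(5)[OF assms]] slice_functor_mor[OF actsD(6)[OF assms]]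
    actsD(1)[OF assms] by simp_all

lemma acts_obj:
  assumes "acts P u R a"
  shows "x \<in> Arr C \<Longrightarrow> Cod C x = Dom C u \<Longrightarrow> onO P x \<in> Arr C"
    "x \<in> Arr C \<Longrightarrow> Cod C x = Dom C u \<Longrightarrow> Cod C (onO P x) = Dom C u"
    "x \<in> Arr C \<Longrightarrow> Cod C x = Cod C u \<Longrightarrow> onO R x \<in> Arr C"
    "x \<in> Arr C \<Longrightarrow> Cod C x = Cod C u \<Longrightarrow> Cod C (onO R x) = Cod C u"
  using slice_functor_obj[OF actsD(5)[OF assms]] slice_functor_obj[OF actsD(6)[OF assms]]
    actsD(1)[OF assms] by simp_all

text \<open>The square factors as a slice arrow \<open>x \<rightarrow> u^* z\<close> followed by the
  universal square of \<open>z\<close>. Hence an action is determined by its values at universal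
  squares, which are all that \<open>of_action\<close> records.\<close>

lemma acts_canonical:
  assumes "acts P u R a" "arr_over C u x f z"
  shows "a x f z = a (p1 u z) (p2 u z) z \<cdot> mor P x (pr u z x f) (p1 u z)"
  using acts_pre[OF assms(1) arr_over_pairing(1)[OF assms(2)], of "p2 u z" z]
    arr_over_pairing(2)[OF assms(2)] arr_over_projection[of u z] arr_overD[OF assms(2)] by simp

text \<open>At universal squares the second projection undoes the pairing in
  \<open>of_action\<close>; \<open>acts_canonical\<close> carries the equality to all
  squares.\<close>

lemma of_action_inject:
  assumes a: "acts P u R a" and b: "acts P u R b" and eq: "oa P u R a = oa P u R b"
    and f: "arr_over C u x f z"
  shows "a x f z = b x f z"
proof -
  note [simp] = arr_overD[OF f]
  have c: "arr_over C u (p1 u z) (p2 u z) z" by (simp add: arr_over_projection)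
  have "fst (snd (snd (oa P u R a))) z = fst (snd (snd (oa P u R b))) z"
    by (simp only: eq)
  then have "pr u (onO R z) (onO P (p1 u z)) (a (p1 u z) (p2 u z) z) =
      pr u (onO R z) (onO P (p1 u z)) (b (p1 u z) (p2 u z) z)"
    unfolding of_action_def by (simp add: into_pull_def)
  then have "p2 u (onO R z) \<cdot> pr u (onO R z) (onO P (p1 u z)) (a (p1 u z) (p2 u z) z) =
      p2 u (onO R z) \<cdot> pr u (onO R z) (onO P (p1 u z)) (b (p1 u z) (p2 u z) z)"
    by (simp only:)
  then have "a (p1 u z) (p2 u z) z = b (p1 u z) (p2 u z) z"
    by (simp only: arr_over_pairing(2)[OF acts_over[OF a c]] arr_over_pairing(2)[OF acts_over[OF b
      c]])
  then show ?thesis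
    using acts_canonical[OF a f] acts_canonical[OF b f] by simp
qed

lemma of_action_projections [simp]:
  "Dom (Exp C pb) (oa P u R a) = (Dom C u, P)" "Cod (Exp C pb) (oa P u R a) = (Cod C u, R)"
  "onA p_exp (oa P u R a) = u"
  by (simp_all add: Exp_def of_action_def p_exp_def)

lemma onO_p_exp [simp]: "onO p_exp (U, P) = U"
  by (simp add: p_exp_def)

lemma of_action_in_Arr: "acts P u R a \<Longrightarrow> oa P u R a \<in> Arr (Exp C pb)"
  using of_action_arr by (auto simp: acts_def Exp_def)

lemma Arr_ExpE:
  assumes "E \<in> Arr (Exp C pb)"
  obtains P u R a where "E = oa P u R a" "acts P u R a"
proof -
  have "E \<in> exp_arrs C pb" using assms by (simp add: Exp_def)
  then obtain P u R a where "E = oa P u R a" "u \<in> Arr C" "(Dom C u, P) \<in> exp_objs C"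
    "(Cod C u, R) \<in> exp_objs C" "action C P u R a"
    by (rule exp_arrsE)
  then show ?thesis using that[of P u R a] unfolding acts_def by blast
qed

lemma Hom_ExpE:
  assumes "E \<in> Hom (Exp C pb) X Y"
  obtains P u R a where "E = oa P u R a" "acts P u R a" "X = (Dom C u, P)" "Y = (Cod C u, R)"
proof -
  have E: "E \<in> Arr (Exp C pb)" "Dom (Exp C pb) E = X" "Cod (Exp C pb) E = Y"
    using assms unfolding Hom_def by blast+
  obtain P u R a where "E = oa P u R a" "acts P u R a" using E(1) by (rule Arr_ExpE)
  then show ?thesis using that[of P u R a] E(2,3) by simp
qed

text \<open>The left side is the composite defining composition in \<open>Exp\<close>:
  \<open>P\<close> of \<open>pull_split\<close>, the component of \<open>a\<close>, the pullback
  along \<open>u\<close> of the component of \<open>b\<close>, and \<open>pull_merge\<close>.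
  Comparing both projections of the pullback along \<open>v \<cdot> u\<close> settles the coherence
  of the chosen pullbacks once and for all; the second projection is \<open>acts_canonical\<close>
  for \<open>a\<close>.\<close>

lemma exp_comp_component:
  assumes a: "acts P u R a" and b: "acts R v S b" and uv: "Dom C v = Cod C u"
    and z: "z \<in> Arr C" "Cod C z = Cod C v"
  shows "pr (v \<cdot> u) (onO S z) (p1 u (p1 v (onO S z))) (p2 v (onO S z) \<cdot> p2 u (p1 v (onO S z)))
    \<cdot> (pr u (p1 v (onO S z)) (p1 u (onO R (p1 v z))) (pr v (onO S z) (onO R (p1 v z)) (b (p1 v z)
      (p2 v z) z)
          \<cdot> p2 u (onO R (p1 v z)))
    \<cdot> (pr u (onO R (p1 v z)) (onO P (p1 u (p1 v z))) (a (p1 u (p1 v z)) (p2 u (p1 v z)) (p1 v z))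
    \<cdot> mor P (p1 (v \<cdot> u) z) (pr u (p1 v z) (p1 (v \<cdot> u) z) (pr v z (u \<cdot> p1 (v \<cdot> u) z) (p2 (v \<cdot> u) z)))
         (p1 u (p1 v z)))) =
    pr (v \<cdot> u) (onO S z) (onO P (p1 (v \<cdot> u) z)) (b (p1 v z) (p2 v z) z
      \<cdot> a (p1 (v \<cdot> u) z) (pr v z (u \<cdot> p1 (v \<cdot> u) z) (p2 (v \<cdot> u) z)) (p1 v z))"
    (is "?k1 \<cdot> (?k2 \<cdot> (?k3 \<cdot> ?k4)) = ?k")
proof -
  note [simp] = actsD(1)[OF a] actsD(1)[OF b] uv z acts_obj[OF a] acts_obj(3,4)[OF b]
  define w h y where "w = p1 (v \<cdot> u) z" and "h = p2 (v \<cdot> u) z" and "y = p1 v z"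
  have wh: "arr_over C (v \<cdot> u) w h z" by (simp add: w_def h_def arr_over_projection)
  note fac = arr_over_factor[OF wh actsD(1)[OF a] actsD(1)[OF b] uv, folded y_def]
  have y[simp]: "y \<in> Arr C" "Cod C y = Cod C u" by (simp_all add: y_def)
  define m where "m = pr v z (u \<cdot> w) h"
  note fac = fac[folded m_def]
  have b0: "arr_over C v (onO R y) (b y (p2 v z) z) (onO S z)" using acts_over[OF b fac(2)] .
  have py: "arr_over C u (p1 u y) (p2 u y) y" by (simp add: arr_over_projection)
  have a0: "arr_over C u (onO P (p1 u y)) (a (p1 u y) (p2 u y) y) (onO R y)"
    using acts_over[OF a py] .
  note k4 = acts_mor(1)[OF a arr_over_pairing(1)[OF fac(1)]]
  note k3 = arr_over_pairing[OF a0]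
  have n1: "arr_over C (Ide C (Cod C u)) (onO R y) (pr v (onO S z) (onO R y) (b y (p2 v z) z)) (p1 v
    (onO S z))"
    using arr_over_pairing(1)[OF b0] by simp
  note k2 = arr_over_pairing[OF arr_over_pull[OF _ n1]]
  have "arr_over C (v \<cdot> u) (p1 u (p1 v (onO S z))) (p2 v (onO S z)
    \<cdot> p2 u (p1 v (onO S z))) (onO S z)"
    using arr_over_comp[OF arr_over_projection[of u "p1 v (onO S z)"] arr_over_projection[of v "onO
      S z"]] by simp
  note k1 = arr_over_pairing[OF this]
  have aw: "a w m y = a (p1 u y) (p2 u y) y \<cdot> mor P w (pr u y w m) (p1 u y)"
    using acts_canonical[OF a fac(1)] .
  have k: "arr_over C (v \<cdot> u) (onO P w) (b y (p2 v z) z \<cdot> a w m y) (onO S z)"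
    using arr_over_comp[OF acts_over[OF a fac(1)] b0] .
  note [simp] = arr_overD(1-9)[OF b0] arr_overD(1-9)[OF a0] arr_overD[OF k4] k3(2-)
    arr_overD[OF k3(1)] arr_over_pairing(2-)[OF b0] k2(2-) arr_overD(1-9)[OF k2(1)] k1(2-)
      arr_overD(1-9)[OF k1(1)]
  show ?thesis
    unfolding w_def[symmetric] h_def[symmetric] y_def[symmetric] m_def[symmetric]
  proof (rule arr_over_pairing_eqI[OF k])
    let ?K = "pr (v \<cdot> u) (onO S z) (p1 u (p1 v (onO S z))) (p2 v (onO S z) \<cdot> p2 u (p1 v (onO S z)))"
    let ?X = "pr u (p1 v (onO S z)) (p1 u (onO R y)) (pr v (onO S z) (onO R y) (b y (p2 v z) z)
      \<cdot> p2 u (onO R y))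
      \<cdot> (pr u (onO R y) (onO P (p1 u y)) (a (p1 u y) (p2 u y) y) \<cdot> mor P w (pr u y w m) (p1 u y))"
    show "p1 (v \<cdot> u) (onO S z) \<cdot> (?K \<cdot> ?X) = onO P w"
      by (subst Comp_reassoc[OF k1(3)]; simp add: Comp_reassoc[OF k2(3)] Comp_reassoc[OF k3(3)])
    show "p2 (v \<cdot> u) (onO S z) \<cdot> (?K \<cdot> ?X) = b y (p2 v z) z \<cdot> a w m y"
      by (subst Comp_reassoc[OF k1(2)]; simp add: aw Comp_reassoc[OF k2(2)] Comp_reassoc[OF k3(2)])
  qed simp_all
qed

lemma arr_over_factorE:
  assumes "arr_over C (v \<cdot> u) x h z" "u \<in> Arr C" "v \<in> Arr C" "Dom C v = Cod C u"
  obtains y k q where "arr_over C u x k y" "arr_over C v y q z" "h = q \<cdot> k"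
  using arr_over_factor[OF assms] by metis

lemma Exp_comp:
  assumes a: "acts P u R a" and b: "acts R v S b" and uv: "Dom C v = Cod C u"
  shows "oa R v S b \<cdot>\<^bsub>Exp C pb\<^esub> oa P u R a = oa P (v \<cdot> u) S (comp_action C pb u v b a)"
    and "acts P (v \<cdot> u) S (comp_action C pb u v b a)"
proof -
  note [simp] = actsD(1)[OF a] actsD(1)[OF b] uv acts_obj[OF a] acts_obj(3,4)[OF b]
  show "acts P (v \<cdot> u) S (comp_action C pb u v b a)"
    using comp_action_action[OF actsD(1)[OF a] actsD(1)[OF b] uv actsD(4)[OF a] actsD(4)[OF b]]
      actsD(2,3)[OF a] actsD(3)[OF b] by (simp add: acts_def)
  have "pull_merge C pb u v (onO S z) \<cdot>\<^bsub>slice C (Dom C u)\<^esub>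
      onA (pull C pb u) (into_pull C pb v (onO R (p1 v z)) (onO S z) (b (p1 v z) (p2 v z) z))
      \<cdot>\<^bsub>slice C (Dom C u)\<^esub> into_pull C pb u (onO P (p1 u (p1 v z))) (onO R (p1 v z)) (a (p1 u (p1 v
        z)) (p2 u (p1 v z)) (p1 v z))
      \<cdot>\<^bsub>slice C (Dom C u)\<^esub> onA P (pull_split C pb u v z) =
    into_pull C pb (v \<cdot> u) (onO P (p1 (v \<cdot> u) z)) (onO S z) (comp_action C pb u v b a (p1 (v
      \<cdot> u) z) (p2 (v \<cdot> u) z) z)"
    if z: "z \<in> Arr C" "Cod C z = Cod C v" for z
  proof -
    note [simp] = z
    have wh: "arr_over C (v \<cdot> u) (p1 (v \<cdot> u) z) (p2 (v \<cdot> u) z) z" by (simp add: arr_over_projection)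
    note fac = arr_over_factor[OF wh actsD(1)[OF a] actsD(1)[OF b] uv]
    have n1: "arr_over C (Ide C (Cod C u)) (onO R (p1 v z)) (pr v (onO S z) (onO R (p1 v z)) (b (p1
      v z) (p2 v z) z)) (p1 v (onO S z))"
      using arr_over_pairing(1)[OF acts_over[OF b fac(2)]] by simp
    have py: "arr_over C u (p1 u (p1 v z)) (p2 u (p1 v z)) (p1 v z)"
      by (simp add: arr_over_projection)
    note k4 = acts_mor(1)[OF a arr_over_pairing(1)[OF fac(1)]]
    note k3 = arr_over_pairing(1)[OF acts_over[OF a py]]
    note k2 = arr_over_pairing(1)[OF arr_over_pull[OF actsD(1)[OF a] n1]]
    have "arr_over C (v \<cdot> u) (p1 u (p1 v (onO S z))) (p2 v (onO S z)
      \<cdot> p2 u (p1 v (onO S z))) (onO S z)"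
      using arr_over_comp[OF arr_over_projection[of u "p1 v (onO S z)"] arr_over_projection[of v
        "onO S z"]] by simp
    note k1 = arr_over_pairing(1)[OF this]
    show ?thesis
      using exp_comp_component[OF a b uv z] slice_functor_onA[OF is_functor_pull _ n1] k1 k2 k3 k4
        slice_functor_onA[OF actsD(5)[OF a] _ arr_over_pairing(1)[OF fac(1)]] n1
      by (simp add: pull_merge_def pull_split_def into_pull_def comp_action_def arr_overD)
  qed
  then show "oa R v S b \<cdot>\<^bsub>Exp C pb\<^esub> oa P u R a = oa P (v \<cdot> u) S (comp_action C pb u v b a)"
    by (auto simp: Exp_def of_action_def restrict_def fun_eq_iff)
qed

text \<open>A natural transformation over one object acts on a slice arrow by the diagonal of its
  naturality square.\<close>

lemma acts_vert:
  assumes P: "(U, P) \<in> exp_objs C" and R: "(U, R) \<in> exp_objs C"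
    and s: "\<And>d. d \<in> Arr C \<Longrightarrow> Cod C d = U \<Longrightarrow> arr_over C (Ide C U) (onO P d) (s d) (onO R d)"
    and nat: "\<And>x f y. arr_over C (Ide C U) x f y \<Longrightarrow> s y \<cdot> mor P x f y = mor R x f y \<cdot> s x"
  shows "acts P (Ide C U) R (\<lambda>x f z. s z \<cdot> mor P x f z)"
proof -
  note P' = exp_objsD(1,2)[OF P] and R' = exp_objsD(1,2)[OF R]
  have [simp]: "U \<in> Obj C" by (rule P')
  have "action C P (Ide C U) R (\<lambda>x f z. s z \<cdot> mor P x f z)"
    unfolding action_def
  proof (intro conjI allI impI)
    fix x f z assume f: "arr_over C (Ide C U) x f z"
    note [simp] = arr_overD[OF f]
    show "arr_over C (Ide C U) (onO P x) (s z \<cdot> mor P x f z) (onO R z)"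
      using arr_over_comp_left[OF slice_functor_mor[OF P'(2,1) f]] s[of z] by simp
    show "s z \<cdot> mor P x' (f \<cdot> g) z = (s z \<cdot> mor P x f z) \<cdot> mor P x' g x"
      if "arr_over C (Ide C (Dom C (Ide C U))) x' g x" for x' g
    proof -
      have g: "arr_over C (Ide C U) x' g x" using that by simp
      show ?thesis
        using arr_overD[OF slice_functor_mor[OF P'(2,1) f]] arr_overD[OF slice_functor_mor[OF
          P'(2,1) g]] arr_overD[OF s[of z]]
        by (simp add: slice_functor_comp[OF P'(2,1) g f])
    qed
    show "s z' \<cdot> mor P x (g \<cdot> f) z' = mor R z g z' \<cdot> (s z \<cdot> mor P x f z)"
      if "arr_over C (Ide C (Cod C (Ide C U))) z g z'" for g z'
    proof -
      have g: "arr_over C (Ide C U) z g z'" using that by simp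
      note [simp] = arr_overD[OF g]
      show ?thesis
        using arr_overD[OF slice_functor_mor[OF P'(2,1) f]] arr_overD[OF slice_functor_mor[OF
          P'(2,1) g]] arr_overD[OF s[of z]]
          arr_overD[OF slice_functor_mor[OF R'(2,1) g]] arr_overD[OF s[of z']]
        by (simp add: slice_functor_comp[OF P'(2,1) f g] Comp_reassoc[OF nat[OF g]])
    qed
  qed
  then show ?thesis using P R by (simp add: acts_def)
qed

text \<open>The comparisons with the pullback functor of an identity are absorbed by the encoding:
  \<open>from_pull_ide\<close> is the universal square over \<open>Ide C U\<close>, and
  \<open>to_pull_ide\<close> is a pairing with an identity.\<close>

lemma exp_vert_eq:
  assumes P: "(U, P) \<in> exp_objs C" and R: "(U, R) \<in> exp_objs C"
    and s: "\<And>d. d \<in> Arr C \<Longrightarrow> Cod C d = U \<Longrightarrow> arr_over C (Ide C U) (onO P d) (s d) (onO R d)"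
    and sig: "\<And>d. d \<in> Arr C \<Longrightarrow> Cod C d = U \<Longrightarrow> \<sigma> d = (onO P d, s d, onO R d)"
  shows "exp_vert C pb U P \<sigma> R = oa P (Ide C U) R (\<lambda>x f z. s z \<cdot> mor P x f z)"
proof -
  note P' = exp_objsD(1,2)[OF P] and R' = exp_objsD(1,2)[OF R]
  have U[simp]: "U \<in> Obj C" by (rule P')
  have "to_pull_ide C pb U (onO R d) \<cdot>\<^bsub>slice C U\<^esub> \<sigma> d \<cdot>\<^bsub>slice C U\<^esub> onA P (from_pull_ide C pb U d) =
      into_pull C pb (Ide C U) (onO P (p1 (Ide C U) d)) (onO R d) (s d
        \<cdot> mor P (p1 (Ide C U) d) (p2 (Ide C U) d) d)"
    if d: "d \<in> Arr C" "Cod C d = U" for d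
  proof -
    note [simp] = d slice_functor_obj[OF R'(2,1)] arr_overD[OF s[OF d]]
    have f: "arr_over C (Ide C U) (p1 (Ide C U) d) (p2 (Ide C U) d) d"
      by (simp add: arr_over_projection)
    note [simp] = arr_overD[OF slice_functor_mor[OF P'(2,1) f]]
    have i: "arr_over C (Ide C U) (onO R d) (Ide C (Dom C (onO R d))) (onO R d)"
      by (intro arr_over_ide) simp_all
    note [simp] = arr_over_pairing(2-)[OF i]
    have k: "arr_over C (Ide C U) (onO P (p1 (Ide C U) d)) (s d
      \<cdot> mor P (p1 (Ide C U) d) (p2 (Ide C U) d) d) (onO R d)"
      by (intro arr_overI) simp_all
    have "pr (Ide C U) (onO R d) (onO R d) (Ide C (Dom C (onO R d))) \<cdot> (s d
      \<cdot> mor P (p1 (Ide C U) d) (p2 (Ide C U) d) d) =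
      pr (Ide C U) (onO R d) (onO P (p1 (Ide C U) d)) (s d
        \<cdot> mor P (p1 (Ide C U) d) (p2 (Ide C U) d) d)"
      by (rule arr_over_pairing_eqI[OF k]) simp_all
    then show ?thesis
      using slice_functor_onA[OF P'(2,1) f]
      by (simp add: to_pull_ide_def from_pull_ide_def into_pull_def sig)
  qed
  then show ?thesis
    by (simp add: exp_vert_def of_action_def restrict_def fun_eq_iff)
qed

lemma acts_ide: "(U, P) \<in> exp_objs C \<Longrightarrow> acts P (Ide C U) P (mor P)"
  and exp_ide_eq: "(U, P) \<in> exp_objs C \<Longrightarrow> exp_ide C pb (U, P) = oa P (Ide C U) P (mor P)"
proof -
  assume P: "(U, P) \<in> exp_objs C"
  note P' = exp_objsD(1,2)[OF P]
  have [simp]: "U \<in> Obj C" by (rule P')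
  note [simp] = slice_functor_obj[OF P'(2,1)]
  show A: "acts P (Ide C U) P (mor P)"
    unfolding acts_def action_def using P P' slice_functor_mor[OF P'(2,1)] slice_functor_comp[OF
      P'(2,1)] by simp
  have s: "arr_over C (Ide C U) (onO P d) (Ide C (Dom C (onO P d))) (onO P d)" if "d \<in> Arr C" "Cod C
    d = U" for d
    using that by (intro arr_over_ide) simp_all
  have "exp_ide C pb (U, P) = oa P (Ide C U) P (\<lambda>x f z. Ide C (Dom C (onO P z)) \<cdot> mor P x f z)"
    unfolding exp_ide_def using exp_vert_eq[OF P P s] by simp
  also have "\<dots> = oa P (Ide C U) P (mor P)"
    using arr_overD[OF slice_functor_mor[OF P'(2,1)]] by (intro of_action_cong) simp_all
  finally show "exp_ide C pb (U, P) = oa P (Ide C U) P (mor P)" .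
qed

lemma Ide_Exp: "(U, P) \<in> exp_objs C \<Longrightarrow> Ide (Exp C pb) (U, P) = oa P (Ide C U) P (mor P)"
  using exp_ide_eq by (simp add: Exp_def)

lemma Obj_Exp [simp]: "X \<in> Obj (Exp C pb) \<longleftrightarrow> X \<in> exp_objs C"
  by (simp add: Exp_def)

lemma comp_action_acts_eq:
  assumes a: "acts P u R a" and b: "acts R v S b" and uv: "Dom C v = Cod C u"
    and "arr_over C u x f y" "arr_over C v y g z"
  shows "comp_action C pb u v b a x (g \<cdot> f) z = b y g z \<cdot> a x f y"
  using comp_action_eq[OF actsD(4)[OF a] actsD(4)[OF b] uv actsD(3)[OF a]] assms by simp

lemma category_Exp: "category (Exp C pb)"
proof
  fix E assume "E \<in> Arr (Exp C pb)"
  then obtain P u R a where E: "E = oa P u R a" and a: "acts P u R a" by (rule Arr_ExpE)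
  note [simp] = actsD(1-3)[OF a]
  show "Dom (Exp C pb) E \<in> Obj (Exp C pb)" "Cod (Exp C pb) E \<in> Obj (Exp C pb)"
    using a by (simp_all add: E)
  have i: "acts R (Ide C (Cod C u)) R (mor R)" "acts P (Ide C (Dom C u)) P (mor P)"
    by (simp_all add: acts_ide)
  have "comp_action C pb u (Ide C (Cod C u)) (mor R) a x f z =
    a x f z" if f: "arr_over C u x f z" for x f z
    using comp_action_acts_eq[OF a i(1) _ f arr_over_ide[of z "Cod C u"]] arr_overD[OF f]
      arr_overD[OF acts_over[OF a f]] slice_functor_ide[OF actsD(6)[OF a]] by simp
  then show "Ide (Exp C pb) (Cod (Exp C pb) E) \<cdot>\<^bsub>Exp C pb\<^esub> E = E"
    using Exp_comp(1)[OF a i(1)] of_action_cong[of u "comp_action C pb u (Ide C (Cod C u)) (mor R)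
      a" a]
    by (simp add: E Ide_Exp)
  have "comp_action C pb (Ide C (Dom C u)) u a (mor P) x f z =
    a x f z" if f: "arr_over C u x f z" for x f z
    using comp_action_acts_eq[OF i(2) a _ arr_over_ide[of x "Dom C u"] f] arr_overD[OF f]
      arr_overD[OF acts_over[OF a f]] slice_functor_ide[OF actsD(5)[OF a]] by simp
  then show "E \<cdot>\<^bsub>Exp C pb\<^esub> Ide (Exp C pb) (Dom (Exp C pb) E) = E"
    using Exp_comp(1)[OF i(2) a] of_action_cong[of u "comp_action C pb (Ide C (Dom C u)) u a (mor
      P)" a]
    by (simp add: E Ide_Exp)
next
  fix X assume "X \<in> Obj (Exp C pb)"
  then obtain U P where X: "X = (U, P)" "(U, P) \<in> exp_objs C" by (cases X) simp
  then show "Ide (Exp C pb) X \<in> Hom (Exp C pb) X X"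
    using of_action_in_Arr[OF acts_ide[OF X(2)]] exp_objsD(1)[OF X(2)]
      by (simp add: Hom_def Ide_Exp)
next
  fix F G X Y Z assume "F \<in> Hom (Exp C pb) X Y" "G \<in> Hom (Exp C pb) Y Z"
  then obtain P u R a v S b where *: "F = oa P u R a" "acts P u R a" "X = (Dom C u, P)" "Y =
    (Cod C u, R)"
    "G = oa R v S b" "acts R v S b" "Dom C v = Cod C u" "Z = (Cod C v, S)"
    by (elim Hom_ExpE) auto
  show "G \<cdot>\<^bsub>Exp C pb\<^esub> F \<in> Hom (Exp C pb) X Z"
    using Exp_comp[OF *(2,6,7)] * actsD(1)[OF *(2)] actsD(1)[OF *(6)] of_action_in_Arr[OF
      Exp_comp(2)[OF *(2,6,7)]]
    by (simp add: Hom_def)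
next
  fix F G H W X Y Z assume "F \<in> Hom (Exp C pb) W X" "G \<in> Hom (Exp C pb) X Y" "H \<in> Hom (Exp C pb) Y
    Z"
  then obtain P u Q a v R b w S c where *: "F = oa P u Q a" "G = oa Q v R b" "H = oa R w S c"
    and a: "acts P u Q a" and b: "acts Q v R b" and c: "acts R w S c"
    and [simp]: "Dom C v = Cod C u" "Dom C w = Cod C v"
    by (elim Hom_ExpE) auto
  note [simp] = actsD(1)[OF a] actsD(1)[OF b] actsD(1)[OF c]
  note ba = Exp_comp[OF a b] and cb = Exp_comp[OF b c]
  have "comp_action C pb u (w \<cdot> v) (comp_action C pb v w c b) a x h z =
      comp_action C pb (v \<cdot> u) w c (comp_action C pb u v b a) x h z"
    if hx: "arr_over C ((w \<cdot> v) \<cdot> u) x h z" for x h z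
  proof -
    \<comment> \<open>\<open>h\<close> is split twice, into squares over \<open>u\<close>,
      \<open>v\<close> and \<open>w\<close>. Both bracketings then evaluate to the composite of the
      three values, and only associativity in \<open>C\<close> remains.\<close>
    obtain y k q where k: "arr_over C u x k y" and q: "arr_over C (w \<cdot> v) y q z" and h: "h = q \<cdot> k"
      using hx by (rule arr_over_factorE) simp_all
    obtain y' k' q' where k': "arr_over C v y k' y'" and q': "arr_over C w y' q' z" and h': "q =
      q' \<cdot> k'"
      using q by (rule arr_over_factorE) simp_all
    have "comp_action C pb u (w \<cdot> v) (comp_action C pb v w c b) a x (q \<cdot> k) z =
        (c y' q' z \<cdot> b y k' y') \<cdot> a x k y"
      using comp_action_acts_eq[OF a cb(2) _ k q] comp_action_acts_eq[OF b c _ k' q']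
        by (simp add: h')
    also have "\<dots> = c y' q' z \<cdot> (b y k' y' \<cdot> a x k y)"
      using arr_overD(1-8)[OF acts_over[OF a k]] arr_overD(1-8)[OF acts_over[OF b k']]
        arr_overD(1-8)[OF acts_over[OF c q']] by simp
    also have "\<dots> = comp_action C pb (v \<cdot> u) w c (comp_action C pb u v b a) x (q' \<cdot> (k' \<cdot> k)) z"
      using comp_action_acts_eq[OF ba(2) c _ arr_over_comp[OF k k'] q'] comp_action_acts_eq[OF a b _
        k k'] by simp
    also have "q' \<cdot> (k' \<cdot> k) = h"
      using arr_overD(1-8)[OF k] arr_overD(1-8)[OF k'] arr_overD(1-8)[OF q'] by (simp add: h h')
    finally show ?thesis by (simp add: h)
  qed
  then show "(H \<cdot>\<^bsub>Exp C pb\<^esub> G) \<cdot>\<^bsub>Exp C pb\<^esub> F = H \<cdot>\<^bsub>Exp C pb\<^esub> (G \<cdot>\<^bsub>Exp C pb\<^esub> F)"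
    using of_action_cong[of "(w \<cdot> v) \<cdot> u" "comp_action C pb u (w \<cdot> v) (comp_action C pb v w c b) a"
        "comp_action C pb (v \<cdot> u) w c (comp_action C pb u v b a)" P S]
    by (simp add: * ba cb Exp_comp(1)[OF a cb(2)] Exp_comp(1)[OF ba(2) c])
qed

lemma is_functor_p_exp: "is_functor (Exp C pb) C p_exp"
proof (intro is_functor.intro is_functor_axioms.intro)
  show "category (Exp C pb)" by (rule category_Exp)
  show "category C" by unfold_locales
  show "onO p_exp X \<in> Obj C" if "X \<in> Obj (Exp C pb)" for X
    using that exp_objsD(1) by (cases X) simp
  show "onA p_exp (Ide (Exp C pb) X) = Ide C (onO p_exp X)" if "X \<in> Obj (Exp C pb)" for X
    using that by (cases X) (simp add: Ide_Exp)
  show "onA p_exp F \<in> Hom C (onO p_exp X) (onO p_exp Y)" if "F \<in> Hom (Exp C pb) X Y" for F X Y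
    using that by (elim Hom_ExpE) (simp add: Hom_def actsD)
  show "onA p_exp (G \<cdot>\<^bsub>Exp C pb\<^esub> F) = onA p_exp G \<cdot> onA p_exp F"
    if FG: "F \<in> Hom (Exp C pb) X Y" "G \<in> Hom (Exp C pb) Y Z" for F G X Y Z
  proof -
    from FG obtain P u R a v S b where *: "F = oa P u R a" "acts P u R a"
      "G = oa R v S b" "acts R v S b" "Dom C v = Cod C u"
      by (elim Hom_ExpE) auto
    then show ?thesis using Exp_comp(1)[OF *(2,4,5)] by simp
  qed
qed

section \<open>The bifibration of slice endofunctors\<close>

text \<open>By equivariance \<open>a\<close> is determined by the family
  \<open>e y : P y \<rightarrow> R (u \<cdot> y)\<close>, its values at the squares of
  \<open>arr_over_post\<close>. To factor an action \<open>c\<close> over \<open>u \<cdot> w\<close>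
  through \<open>a\<close>, the value at \<open>g\<close> has to be the arrow into the pullback
  \<open>P y\<close> given by \<open>w \<cdot> Q x\<close> and \<open>c x g (u \<cdot> y)\<close>;
  joint monicity yields its equivariance and its uniqueness.\<close>

lemma prone_Exp:
  assumes a: "acts P u R a"
    and lim: "\<And>x. x \<in> Arr C \<Longrightarrow> Cod C x = Dom C u \<Longrightarrow>
      is_pullback C u (onO R (u \<cdot> x)) (onO P x) (a x (Ide C (Dom C x)) (u \<cdot> x))"
  shows "prone (Exp C pb) C p_exp (oa P u R a)"
  unfolding prone_def
proof (intro conjI ballI impI)
  show "oa P u R a \<in> Arr (Exp C pb)" by (rule of_action_in_Arr[OF a])
next
  fix G w assume G: "G \<in> Arr (Exp C pb)"
    and w: "w \<in> Hom C (onO p_exp (Dom (Exp C pb) G)) (onO p_exp (Dom (Exp C pb) (oa P u R a)))"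
    and cod: "Cod (Exp C pb) G = Cod (Exp C pb) (oa P u R a) \<and>
      onA p_exp G = onA p_exp (oa P u R a) \<cdot> w"
  from G obtain Q t R' c where G: "G = oa Q t R' c" and c: "acts Q t R' c" by (rule Arr_ExpE)
  have [simp]: "R' = R" and t: "t = u \<cdot> w" and w: "w \<in> Arr C" "Dom C w = Dom C t" "Cod C w =
    Dom C u"
    using cod w by (simp_all add: G Hom_def)
  note [simp] = w(1,3) actsD(1)[OF a]
  have c: "acts Q (u \<cdot> w) R c" using c by (simp add: t)
  define e where "e y = a y (Ide C (Dom C y)) (u \<cdot> y)" for y
  have e: "arr_over C u (onO P y) (e y) (onO R (u \<cdot> y))" "is_pullback C u (onO R (u
    \<cdot> y)) (onO P y) (e y)"
    if "y \<in> Arr C" "Cod C y = Dom C u" for y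
    using acts_over[OF a arr_over_post[of u y]] lim[OF that] that by (simp_all add: e_def)
  \<comment> \<open>Naturality of \<open>e\<close> as a transformation
    \<open>\<Sigma>_u P \<rightarrow> R \<Sigma>_u\<close>: both sides are the value of
    \<open>a\<close> at \<open>k\<close>, read as a square over \<open>u\<close> from
    \<open>y\<close> to \<open>u \<cdot> y'\<close>.\<close>
  have enat: "e y' \<cdot> mor P y k y' = mor R (u \<cdot> y) k (u \<cdot> y') \<cdot> e y"
    if k: "arr_over C (Ide C (Dom C u)) y k y'" for y k y'
  proof -
    note [simp] = arr_overD[OF k]
    have k': "arr_over C (Ide C (Cod C u)) (u \<cdot> y) k (u \<cdot> y')"
      using arr_over_post_mor[OF _ k] by simp
    show ?thesis
      using acts_pre[OF a k arr_over_post[of u y']] acts_post[OF a arr_over_post[of u y] k']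
      by (simp add: e_def)
  qed
  have Qo: "onO Q x \<in> Arr C" "Cod C (onO Q x) = Dom C w" if "x \<in> Arr C" "Cod C x = Dom C w" for x
    using acts_obj(1,2)[OF c, of x] that by simp_all
  have lift: "arr_over C (u \<cdot> w) x g (u \<cdot> y)" if g: "arr_over C w x g y" for x g y
    using arr_overD[OF g] by (intro arr_overI) simp_all
  have ex: "\<exists>m. m \<in> Arr C \<and> Dom C m = Dom C (w \<cdot> onO Q x) \<and> Cod C m = Dom C (onO P y) \<and>
      onO P y \<cdot> m = w \<cdot> onO Q x \<and> e y \<cdot> m = c x g (u \<cdot> y)" if g: "arr_over C w x g y" for x g y
  proof -
    note [simp] = arr_overD[OF g] arr_overD(1-9)[OF acts_over[OF c lift[OF g]]] Qo
    have y: "y \<in> Arr C" "Cod C y = Dom C u" by simp_all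
    show ?thesis
      by (rule is_pullbackE[OF e(2)[OF y], of "w \<cdot> onO Q x" "c x g (u \<cdot> y)"]) (simp_all, blast)
  qed
  \<comment> \<open>\<open>SOME\<close> turns the mediating arrows into a function of
    \<open>x\<close>, \<open>g\<close>, \<open>y\<close>; off the squares over \<open>w\<close> its
    value is arbitrary, which an action permits.\<close>
  define d where "d x g y = (SOME m. m \<in> Arr C \<and> Dom C m = Dom C (w \<cdot> onO Q x) \<and>
    Cod C m = Dom C (onO P y) \<and>
      onO P y \<cdot> m = w \<cdot> onO Q x \<and> e y \<cdot> m = c x g (u \<cdot> y))" for x g y
  have d: "arr_over C w (onO Q x) (d x g y) (onO P y)" "e y \<cdot> d x g y = c x g (u \<cdot> y)"
    if g: "arr_over C w x g y" for x g y
    using someI_ex[OF ex[OF g]] arr_overD[OF g] Qo[of x] acts_obj(1,2)[OF a, of y]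
    unfolding d_def[symmetric] arr_over_def by simp_all
  have mono: "m = n" if "y \<in> Arr C" "Cod C y = Dom C u" "m \<in> Arr C" "n \<in> Arr C" "Dom C m = Dom C n"
    "Cod C m = Dom C (onO P y)" "Cod C n = Dom C (onO P y)"
    "onO P y \<cdot> m = onO P y \<cdot> n" "e y \<cdot> m = e y \<cdot> n" for y m n
    by (rule is_pullback_mono[OF e(2)[OF that(1,2)] that(3-9)])
  have "action C Q w P d"
    unfolding action_def
  proof (intro conjI allI impI)
    fix x g y assume g: "arr_over C w x g y"
    show "arr_over C w (onO Q x) (d x g y) (onO P y)" by (rule d[OF g])
    note [simp] = arr_overD[OF g] arr_overD[OF d(1)[OF g]] Qo acts_obj(1,2)[OF a]
    show "d x' (g \<cdot> k) y = d x g y \<cdot> mor Q x' k x" if k: "arr_over C (Ide C (Dom C w)) x' k x" for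
      x' k
    proof -
      have gk: "arr_over C w x' (g \<cdot> k) y" by (rule arr_over_comp_right[OF k g])
      have k': "arr_over C (Ide C (Dom C (u \<cdot> w))) x' k x" using k by simp
      note [simp] = arr_overD[OF k] arr_overD[OF d(1)[OF gk]] arr_overD[OF acts_mor(1)[OF c k']]
        arr_overD[OF e(1)[of y]]
      show ?thesis
        by (rule mono[of y])
          (simp_all add: d(2)[OF gk] acts_pre[OF c k' lift[OF g]] Comp_reassoc[OF d(2)[OF g]])
    qed
    show "d x (k \<cdot> g) y' = mor P y k y'
      \<cdot> d x g y" if k: "arr_over C (Ide C (Cod C w)) y k y'" for k y'
    proof -
      have k: "arr_over C (Ide C (Dom C u)) y k y'" using k by simp
      have kg: "arr_over C w x (k \<cdot> g) y'" using arr_over_comp_left[OF g] k by simp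
      have k': "arr_over C (Ide C (Cod C (u \<cdot> w))) (u \<cdot> y) k (u \<cdot> y')"
        using arr_over_post_mor[OF _ k] by simp
      note [simp] = arr_overD[OF k] arr_overD[OF d(1)[OF kg]] arr_overD[OF acts_mor(1)[OF a k]]
        arr_overD(1-9)[OF e(1)[of y]] arr_overD(1-9)[OF e(1)[of y']] arr_overD(1-9)[OF
          acts_mor(2)[OF c k']]
      have "e y' \<cdot> d x (k \<cdot> g) y' = mor R (u \<cdot> y) k (u \<cdot> y') \<cdot> c x g (u \<cdot> y)"
        using acts_post[OF c lift[OF g] k'] by (simp add: d(2)[OF kg])
      also have "\<dots> = mor R (u \<cdot> y) k (u \<cdot> y') \<cdot> (e y \<cdot> d x g y)"
        by (simp only: d(2)[OF g])
      also have "\<dots> = e y' \<cdot> (mor P y k y' \<cdot> d x g y)"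
        by (simp add: Comp_reassoc[OF enat[OF k]])
      finally show ?thesis
        by - (rule mono[of y'], simp_all)
    qed
  qed
  then have d': "acts Q w P d"
    using actsD(2)[OF a] actsD(2)[OF c] by (simp add: acts_def)
  have comp: "comp_action C pb w u a d x h z = c x h z" if h: "arr_over C (u \<cdot> w) x h z" for x h z
  proof -
    obtain y k q where k: "arr_over C w x k y" and q: "arr_over C u y q z" and hq: "h = q \<cdot> k"
      using h by (rule arr_over_factorE) simp_all
    note [simp] = arr_overD[OF k] arr_overD[OF q] acts_obj[OF a]
    \<comment> \<open>A square \<open>q\<close> over \<open>u\<close> out of \<open>y\<close> is
      read as a slice arrow out of \<open>u \<cdot> y\<close>, which expresses
      \<open>a y q z\<close> through \<open>e y\<close>.\<close>
    have q': "arr_over C (Ide C (Cod C (u \<cdot> w))) (u \<cdot> y) q z" by (intro arr_overI) simp_all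
    then have q'': "arr_over C (Ide C (Cod C u)) (u \<cdot> y) q z" by simp
    note [simp] = arr_overD(1-9)[OF acts_mor(2)[OF a q'']] arr_overD(1-9)[OF e(1)[of y]]
       arr_overD(1-9)[OF d(1)[OF k]]
    have "comp_action C pb w u a d x h z = a y q z \<cdot> d x k y"
      using comp_action_acts_eq[OF d' a _ k q] by (simp add: hq)
    also have "a y q z = mor R (u \<cdot> y) q z \<cdot> e y"
      using acts_post[OF a arr_over_post[of u y] q''] by (simp add: e_def)
    also have "\<dots> \<cdot> d x k y = mor R (u \<cdot> y) q z \<cdot> (e y \<cdot> d x k y)" by simp
    also have "\<dots> = mor R (u \<cdot> y) q z \<cdot> c x k (u \<cdot> y)" by (simp only: d(2)[OF k])
    also have "\<dots> = c x h z"
      using acts_post[OF c lift[OF k] q'] by (simp add: hq)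
    finally show ?thesis .
  qed
  show "\<exists>!H. H \<in> Hom (Exp C pb) (Dom (Exp C pb) G) (Dom (Exp C pb) (oa P u R a)) \<and> onA p_exp H = w \<and>
      oa P u R a \<cdot>\<^bsub>Exp C pb\<^esub> H = G"
  proof (intro ex1I[of _ "oa Q w P d"] conjI)
    show "oa Q w P d \<in> Hom (Exp C pb) (Dom (Exp C pb) G) (Dom (Exp C pb) (oa P u R a))"
      using of_action_in_Arr[OF d'] by (simp add: G Hom_def t)
    show "oa P u R a \<cdot>\<^bsub>Exp C pb\<^esub> oa Q w P d = G"
      using Exp_comp(1)[OF d' a] of_action_cong[of "u \<cdot> w" "comp_action C pb w u a d" c] comp
        by (simp add: G t)
  next
    fix H assume "H \<in> Hom (Exp C pb) (Dom (Exp C pb) G) (Dom (Exp C pb) (oa P u R a)) \<and>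
      onA p_exp H = w \<and>
      oa P u R a \<cdot>\<^bsub>Exp C pb\<^esub> H = G"
    then have H: "H \<in> Hom (Exp C pb) (Dom (Exp C pb) G) (Dom (Exp C pb) (oa P u R a))" "onA p_exp H =
      w"
      "oa P u R a \<cdot>\<^bsub>Exp C pb\<^esub> H = G" by blast+
    from H(1,2) obtain b where Hb: "H = oa Q w P b" and b: "acts Q w P b"
      by (elim Hom_ExpE) (simp add: G)
    have eq: "oa Q (u \<cdot> w) R (comp_action C pb w u a b) = oa Q (u \<cdot> w) R c"
      using H(3) Exp_comp(1)[OF b a] by (simp add: Hb G t)
    \<comment> \<open>Composing with the square of \<open>arr_over_post\<close> at \<open>y\<close>
      turns \<open>e y \<cdot> b x g y\<close> into a value of the composite action, which is
      \<open>c\<close>.\<close>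
    have "b x g y = d x g y" if g: "arr_over C w x g y" for x g y
    proof -
      note [simp] = arr_overD[OF g] acts_obj[OF a] Qo
      have y: "arr_over C u y (Ide C (Dom C y)) (u \<cdot> y)" by (intro arr_over_post) simp_all
      have "e y \<cdot> b x g y = comp_action C pb w u a b x g (u \<cdot> y)"
        using comp_action_acts_eq[OF b a _ g y] by (simp add: e_def)
      also have "\<dots> = c x g (u \<cdot> y)"
        using of_action_inject[OF Exp_comp(2)[OF b a] c eq lift[OF g]] by simp
      finally show ?thesis
        using arr_overD[OF acts_over[OF b g]] arr_overD[OF d(1)[OF g]] d(2)[OF g]
        by - (rule mono[of y], simp_all)
    qed
    then show "H = oa Q w P d"
      unfolding Hb by (intro of_action_cong) simp_all
  qed simp
qed

text \<open>By \<open>acts_canonical\<close>, \<open>a\<close> is determined by the arrows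
  \<open>e y : P (u^* y) \<rightarrow> R y\<close>, its values at universal squares. An action
  \<open>c\<close> over \<open>w \<cdot> u\<close> factors through \<open>a\<close> by evaluating
  \<open>c\<close> at the universal square of \<open>y\<close> followed by \<open>g\<close> and
  precomposing with the inverse of \<open>e y\<close>. Since \<open>e y\<close> can be cancelled on
  the right, equivariance in the source and uniqueness follow.\<close>

lemma supine_Exp:
  assumes a: "acts P u R a"
    and iso: "\<And>z. z \<in> Arr C \<Longrightarrow> Cod C z = Cod C u \<Longrightarrow> iso C (a (p1 u z) (p2 u z) z)"
  shows "supine (Exp C pb) C p_exp (oa P u R a)"
  unfolding supine_def
proof (intro conjI ballI impI)
  show "oa P u R a \<in> Arr (Exp C pb)" by (rule of_action_in_Arr[OF a])
next
  fix G w assume G: "G \<in> Arr (Exp C pb)"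
    and w: "w \<in> Hom C (onO p_exp (Cod (Exp C pb) (oa P u R a))) (onO p_exp (Cod (Exp C pb) G))"
    and dom: "Dom (Exp C pb) G = Dom (Exp C pb) (oa P u R a) \<and>
      onA p_exp G = w \<cdot> onA p_exp (oa P u R a)"
  from G obtain P' t S c where G: "G = oa P' t S c" and c: "acts P' t S c" by (rule Arr_ExpE)
  have [simp]: "P' = P" and t: "t = w \<cdot> u" and w: "w \<in> Arr C" "Cod C w = Cod C t" "Dom C w =
    Cod C u"
    using dom w by (simp_all add: G Hom_def)
  note [simp] = w(1,3) actsD(1)[OF a]
  have c: "acts P (w \<cdot> u) S c" using c by (simp add: t)
  define e where "e y = a (p1 u y) (p2 u y) y" for y
  define i where "i y = (SOME j. j \<in> Arr C \<and> Dom C j = Cod C (e y) \<and> Cod C j = Dom C (e y) \<and>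
     j \<cdot> e y = Ide C (Dom C (e y)) \<and> e y \<cdot> j = Ide C (Cod C (e y)))" for y
  have e: "arr_over C u (onO P (p1 u y)) (e y) (onO R y)"
    if "y \<in> Arr C" "Cod C y = Cod C u" for y
    using acts_over[OF a arr_over_projection[of u y]] that by (simp add: e_def)
  have i: "i y \<in> Arr C" "Dom C (i y) = Dom C (onO R y)" "Cod C (i y) = Dom C (onO P (p1 u y))"
    "i y \<cdot> e y = Ide C (Dom C (onO P (p1 u y)))" "e y \<cdot> i y = Ide C (Dom C (onO R y))"
    if y: "y \<in> Arr C" "Cod C y = Cod C u" for y
  proof -
    have "\<exists>j. j \<in> Arr C \<and> Dom C j = Cod C (e y) \<and> Cod C j = Dom C (e y) \<and>
       j \<cdot> e y = Ide C (Dom C (e y)) \<and> e y \<cdot> j = Ide C (Cod C (e y))"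
      using iso[OF y] unfolding e_def[symmetric] by (rule isoE) blast
    from someI_ex[OF this] show "i y \<in> Arr C" "Dom C (i y) = Dom C (onO R y)" "Cod C (i y) =
      Dom C (onO P (p1 u y))"
      "i y \<cdot> e y = Ide C (Dom C (onO P (p1 u y)))" "e y \<cdot> i y = Ide C (Dom C (onO R y))"
      unfolding i_def[symmetric] using arr_overD(7,8)[OF e[OF y]] by simp_all
  qed
  have lift: "arr_over C (w \<cdot> u) (p1 u y) (g \<cdot> p2 u y) z" if g: "arr_over C w y g z" for y g z
    using arr_over_comp[OF arr_over_projection[of u y] g] arr_overD[OF g] by simp
  define d where "d y g z = c (p1 u y) (g \<cdot> p2 u y) z \<cdot> i y" for y g z
  have d: "arr_over C w (onO R y) (d y g z) (onO S z)" "d y g z \<cdot> e y = c (p1 u y) (g \<cdot> p2 u y) z"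
    if g: "arr_over C w y g z" for y g z
  proof -
    note [simp] = arr_overD[OF g] e[of y] i[of y] acts_obj[OF a] arr_overD[OF acts_over[OF c lift[OF
      g]]]
    note E = arr_overD(1-8)[OF e[of y]]
    \<comment> \<open>The inverse turns the square of \<open>e y\<close> around; with the square of
      \<open>c\<close> this puts \<open>d y g z\<close> over \<open>w\<close>.\<close>
    have "u \<cdot> (onO P (p1 u y) \<cdot> i y) = onO R y \<cdot> (e y \<cdot> i y)"
      using E by (simp del: i(5) add: Comp_reassoc[OF arr_overD(9)[OF e[of y], symmetric]])
    then show "arr_over C w (onO R y) (d y g z) (onO S z)"
      unfolding d_def by (intro arr_overI) simp_all
    show "d y g z \<cdot> e y = c (p1 u y) (g \<cdot> p2 u y) z"
      unfolding d_def using E by simp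
  qed
  have epi: "m = n" if "y \<in> Arr C" "Cod C y = Cod C u" "m \<in> Arr C" "n \<in> Arr C"
    "Dom C m = Dom C (onO R y)" "Dom C n = Dom C (onO R y)" "m \<cdot> e y = n \<cdot> e y" for y m n
  proof -
    note E = arr_overD(1-8)[OF e[OF that(1,2)]] i[OF that(1,2)]
    have "(m \<cdot> e y) \<cdot> i y = (n \<cdot> e y) \<cdot> i y" by (simp only: that(7))
    then show ?thesis using that(1-6) E by simp
  qed
  have "action C R w S d"
    unfolding action_def
  proof (intro conjI allI impI)
    fix y g z assume g: "arr_over C w y g z"
    show "arr_over C w (onO R y) (d y g z) (onO S z)" by (rule d[OF g])
    note [simp] = arr_overD(1-8)[OF g] arr_overD(1-8)[OF d(1)[OF g]] acts_obj[OF a]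
    show "d y' (g \<cdot> k) z = d y g z \<cdot> mor R y' k y" if "arr_over C (Ide C (Dom C w)) y' k y" for y' k
    proof -
      have k: "arr_over C (Ide C (Cod C u)) y' k y" using that by simp
      have gk: "arr_over C w y' (g \<cdot> k) z" by (rule arr_over_comp_right[OF that g])
      note [simp] = arr_overD(1-8)[OF k] arr_overD(1-8)[OF d(1)[OF gk]] arr_overD(1-8)[OF
        acts_mor(2)[OF a k]]
        arr_overD(1-8)[OF e[of y]] arr_overD(1-8)[OF e[of y']]
      have k': "arr_over C (Ide C (Dom C u)) (p1 u y') (pr u y (p1 u y') (k \<cdot> p2 u y')) (p1 u y)"
        by (rule arr_over_proj_left[OF _ k]) simp
      have k'': "arr_over C (Ide C (Dom C (w \<cdot> u))) (p1 u y') (pr u y (p1 u y') (k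
        \<cdot> p2 u y')) (p1 u y)"
        using k' by simp
      let ?P = "mor P (p1 u y') (pr u y (p1 u y') (k \<cdot> p2 u y')) (p1 u y)"
      note [simp] = arr_overD(1-8)[OF acts_mor(1)[OF a k']]
      have py: "arr_over C u (p1 u y) (p2 u y) y" "arr_over C u (p1 u y') (p2 u y') y'"
        by (simp_all add: arr_over_projection)
      have p: "p2 u y \<cdot> pr u y (p1 u y') (k \<cdot> p2 u y') = k \<cdot> p2 u y'"
        by (rule arr_over_pairing(2)[OF arr_over_pull[OF _ k]]) simp
      \<comment> \<open>Naturality of \<open>e\<close>: both sides are the value of \<open>a\<close>
        at the square \<open>k \<cdot> p2 u y'\<close>.\<close>
      have n: "mor R y' k y \<cdot> e y' = e y \<cdot> ?P"
        using acts_post[OF a py(2) k] acts_pre[OF a k' py(1)] by (simp add: e_def p)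
      have "(d y g z \<cdot> mor R y' k y) \<cdot> e y' = d y g z \<cdot> (e y \<cdot> ?P)"
        by (simp add: n)
      also have "\<dots> = c (p1 u y) (g \<cdot> p2 u y) z \<cdot> ?P"
        by (rule Comp_reassoc[OF d(2)[OF g]]) simp_all
      also have "\<dots> = c (p1 u y') ((g \<cdot> p2 u y) \<cdot> pr u y (p1 u y') (k \<cdot> p2 u y')) z"
        using acts_pre[OF c k'' lift[OF g]] by simp
      also have "(g \<cdot> p2 u y) \<cdot> pr u y (p1 u y') (k \<cdot> p2 u y') = (g \<cdot> k) \<cdot> p2 u y'"
        using arr_over_pairing(4-6)[OF arr_over_pull[OF _ k]] by (simp add: p)
      also have "c (p1 u y') \<dots> z = d y' (g \<cdot> k) z \<cdot> e y'"
        by (rule d(2)[OF gk, symmetric])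
      finally show ?thesis
        by - (rule epi[of y', symmetric], simp_all)
    qed
    show "d y (k \<cdot> g) z' = mor S z k z' \<cdot> d y g z" if "arr_over C (Ide C (Cod C w)) z k z'" for k z'
    proof -
      have k: "arr_over C (Ide C (Cod C (w \<cdot> u))) z k z'" using that by simp
      note [simp] = arr_overD(1-8)[OF k] arr_overD(1-8)[OF acts_mor(2)[OF c k]]
         arr_overD(1-8)[OF acts_over[OF c lift[OF g]]] i[of y]
      show ?thesis using acts_post[OF c lift[OF g] k] by (simp add: d_def)
    qed
  qed
  then have d': "acts R w S d"
    using actsD(3)[OF a] actsD(3)[OF c] by (simp add: acts_def)
  have comp: "comp_action C pb u w d a x h z = c x h z" if h: "arr_over C (w \<cdot> u) x h z" for x h z
  proof -
    obtain y k q where k: "arr_over C u x k y" and q: "arr_over C w y q z" and hq: "h = q \<cdot> k"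
      using h by (rule arr_over_factorE) simp_all
    note [simp] = arr_overD(1-8)[OF k] arr_overD(1-8)[OF q] acts_obj[OF a] arr_overD(1-8)[OF d(1)[OF
      q]]
      arr_overD(1-8)[OF e[of y]]
    have k': "arr_over C (Ide C (Dom C u)) x (pr u y x k) (p1 u y)"
      by (rule arr_over_pairing(1)[OF k])
    then have k'': "arr_over C (Ide C (Dom C (w \<cdot> u))) x (pr u y x k) (p1 u y)" by simp
    note [simp] = arr_overD(1-8)[OF acts_mor(1)[OF a k']] arr_over_pairing(2,4-6)[OF k]
    have "comp_action C pb u w d a x h z = d y q z \<cdot> a x k y"
      using comp_action_acts_eq[OF a d' _ k q] by (simp add: hq)
    also have "a x k y = e y \<cdot> mor P x (pr u y x k) (p1 u y)"
      using acts_canonical[OF a k] by (simp add: e_def)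
    also have "d y q z \<cdot> \<dots> = c (p1 u y) (q \<cdot> p2 u y) z \<cdot> mor P x (pr u y x k) (p1 u y)"
      by (rule Comp_reassoc[OF d(2)[OF q]]) simp_all
    also have "\<dots> = c x h z"
      using acts_pre[OF c k'' lift[OF q]] by (simp add: hq)
    finally show ?thesis .
  qed
  show "\<exists>!H. H \<in> Hom (Exp C pb) (Cod (Exp C pb) (oa P u R a)) (Cod (Exp C pb) G) \<and> onA p_exp H = w \<and>
      H \<cdot>\<^bsub>Exp C pb\<^esub> oa P u R a = G"
  proof (intro ex1I[of _ "oa R w S d"] conjI)
    show "oa R w S d \<in> Hom (Exp C pb) (Cod (Exp C pb) (oa P u R a)) (Cod (Exp C pb) G)"
      using of_action_in_Arr[OF d'] by (simp add: G Hom_def t)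
    show "oa R w S d \<cdot>\<^bsub>Exp C pb\<^esub> oa P u R a = G"
      using Exp_comp(1)[OF a d'] of_action_cong[of "w \<cdot> u" "comp_action C pb u w d a" c] comp
        by (simp add: G t)
  next
    fix H assume "H \<in> Hom (Exp C pb) (Cod (Exp C pb) (oa P u R a)) (Cod (Exp C pb) G) \<and>
      onA p_exp H = w \<and>
      H \<cdot>\<^bsub>Exp C pb\<^esub> oa P u R a = G"
    then have H: "H \<in> Hom (Exp C pb) (Cod (Exp C pb) (oa P u R a)) (Cod (Exp C pb) G)" "onA p_exp H =
      w"
      "H \<cdot>\<^bsub>Exp C pb\<^esub> oa P u R a = G" by blast+
    from H(1,2) obtain b where Hb: "H = oa R w S b" and b: "acts R w S b"
      by (elim Hom_ExpE) (simp add: G)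
    have eq: "oa P (w \<cdot> u) S (comp_action C pb u w b a) = oa P (w \<cdot> u) S c"
      using H(3) Exp_comp(1)[OF a b] by (simp add: Hb G t)
    have "b y g z = d y g z" if g: "arr_over C w y g z" for y g z
    proof -
      note [simp] = arr_overD(1-8)[OF g] acts_obj[OF a] arr_overD(1-8)[OF acts_over[OF b g]]
        arr_overD(1-8)[OF d(1)[OF g]]
      have y: "arr_over C u (p1 u y) (p2 u y) y" by (intro arr_over_projection) simp_all
      have "b y g z \<cdot> e y = comp_action C pb u w b a (p1 u y) (g \<cdot> p2 u y) z"
        using comp_action_acts_eq[OF a b _ y g] by (simp add: e_def)
      also have "\<dots> = d y g z \<cdot> e y"
        using of_action_inject[OF Exp_comp(2)[OF a b] c eq lift[OF g]] by (simp add: d(2)[OF g])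
      finally show ?thesis
        by - (rule epi[of y], simp_all)
    qed
    then show "H = oa R w S d"
      unfolding Hb by (intro of_action_cong) simp_all
  qed simp
qed

text \<open>The prone lift of \<open>R\<close> along \<open>u\<close> is
  \<open>u^* R \<Sigma>_u\<close>. A square over \<open>u\<close> from \<open>x\<close> to
  \<open>z\<close> is a slice arrow \<open>u \<cdot> x \<rightarrow> z\<close>, and the action
  applies \<open>R\<close> to it after projecting to \<open>R (u \<cdot> x)\<close>. At the squares
  of \<open>arr_over_post\<close> it is this projection, so the pullback that
  \<open>prone_Exp\<close> asks for is a chosen one.\<close>

lemma fibration_Exp: "fibration (Exp C pb) C p_exp"
  unfolding fibration_def
proof (intro conjI ballI impI)
  show "is_functor (Exp C pb) C p_exp" by (rule is_functor_p_exp)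
next
  fix Y u assume "Y \<in> Obj (Exp C pb)" and u: "u \<in> Arr C" and "Cod C u = onO p_exp Y"
  then obtain R where Y: "Y = (Cod C u, R)" and R: "(Cod C u, R) \<in> exp_objs C" by (cases Y) simp
  note [simp] = u
  note R' = exp_objsD(2,1)[OF R]
  let ?RS = "comp_ftr (slice C (Dom C u)) R (post_ftr C u)"
  let ?P = "comp_ftr (slice C (Dom C u)) (pull C pb u) ?RS"
  have F: "is_functor (slice C (Dom C u)) (slice C (Cod C u)) ?RS"
    by (rule is_functor_comp[OF is_functor_post[OF u] R'(1)])
  have "is_functor (slice C (Dom C u)) (slice C (Dom C u)) ?P"
    by (rule is_functor_comp[OF F is_functor_pull[OF u]])
  then have P: "(Dom C u, ?P) \<in> exp_objs C" by (intro exp_objs_comp_ftr) simp_all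
  note [simp] = slice_functor_obj[OF R']
  have Po: "onO ?P x = p1 u (onO R (u \<cdot> x))" if "x \<in> Arr C" "Cod C x = Dom C u" for x
    using that by simp
  have Pm: "mor ?P x f y = pr u (onO R (u \<cdot> y)) (p1 u (onO R (u \<cdot> x))) (mor R (u \<cdot> x) f (u \<cdot> y)
    \<cdot> p2 u (onO R (u \<cdot> x)))"
    and Rf: "arr_over C (Ide C (Cod C u)) (onO R (u \<cdot> x)) (mor R (u \<cdot> x) f (u \<cdot> y)) (onO R (u \<cdot> y))"
    if f: "arr_over C (Ide C (Dom C u)) x f y" for x f y
  proof -
    note f' = arr_over_post_mor[OF u f] and [simp] = arr_overD(1-8)[OF f]
    show Rf: "arr_over C (Ide C (Cod C u)) (onO R (u \<cdot> x)) (mor R (u \<cdot> x) f (u \<cdot> y)) (onO R (u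
      \<cdot> y))"
      by (rule slice_functor_mor[OF R' f'])
    show "mor ?P x f y = pr u (onO R (u \<cdot> y)) (p1 u (onO R (u \<cdot> x))) (mor R (u \<cdot> x) f (u \<cdot> y)
      \<cdot> p2 u (onO R (u \<cdot> x)))"
      using f F Rf is_functor_post[OF u] by simp
  qed
  define a where "a x f z = mor R (u \<cdot> x) f z \<cdot> p2 u (onO R (u \<cdot> x))" for x f z
  have ov: "arr_over C (Ide C (Cod C u)) (u \<cdot> x) f z" if f: "arr_over C u x f z" for x f z
    using arr_overD[OF f] by (intro arr_overI) simp_all
  have "action C ?P u R a"
    unfolding action_def
  proof (intro conjI allI impI)
    fix x f z assume f: "arr_over C u x f z"
    note [simp] = arr_overD(1-9)[OF f] arr_overD[OF slice_functor_mor[OF R' ov[OF f]]]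
    show "arr_over C u (onO ?P x) (a x f z) (onO R z)"
      unfolding a_def by (intro arr_overI) simp_all
    show "a x' (f \<cdot> g) z = a x f z \<cdot> mor ?P x' g x" if g: "arr_over C (Ide C (Dom C u)) x' g x" for
      x' g
    proof -
      note g' = arr_over_post_mor[OF u g]
      note [simp] = arr_overD(1-8)[OF g] arr_overD(1-8)[OF Rf[OF g]]
      note k = arr_over_pull[OF u Rf[OF g]]
      show ?thesis
        unfolding a_def Pm[OF g] slice_functor_comp[OF R' g' ov[OF f]]
        by (simp add: arr_over_pairing(2,4-6)[OF k])
    qed
    show "a x (g \<cdot> f) z' = mor R z g z'
      \<cdot> a x f z" if g: "arr_over C (Ide C (Cod C u)) z g z'" for g z'
      unfolding a_def slice_functor_comp[OF R' ov[OF f] g]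
        using arr_overD(1-8)[OF slice_functor_mor[OF R' g]] by simp
  qed
  then have a: "acts ?P u R a" using P R by (simp add: acts_def)
  have "prone (Exp C pb) C p_exp (oa ?P u R a)"
  proof (rule prone_Exp[OF a])
    fix x assume x: "x \<in> Arr C" "Cod C x = Dom C u"
    then have ax: "a x (Ide C (Dom C x)) (u \<cdot> x) = p2 u (onO R (u \<cdot> x))"
      unfolding a_def by (simp add: slice_functor_ide[OF R'])
    show "is_pullback C u (onO R (u \<cdot> x)) (onO ?P x) (a x (Ide C (Dom C x)) (u \<cdot> x))"
      unfolding Po[OF x] ax by (rule chosen_pullback) (use x in simp_all)
  qed
  then show "\<exists>f. prone (Exp C pb) C p_exp f \<and> Cod (Exp C pb) f = Y \<and> onA p_exp f = u"
    by (intro exI[of _ "oa ?P u R a"]) (simp add: Y)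
qed

text \<open>The supine lift of \<open>P\<close> along \<open>u\<close> is
  \<open>\<Sigma>_u P u^*\<close>, acting by \<open>P\<close> of the factorisation of a square
  through \<open>u^* z\<close>. At universal squares that factorisation is an identity, so
  \<open>supine_Exp\<close> applies at once.\<close>

lemma opfibration_Exp: "opfibration (Exp C pb) C p_exp"
  unfolding opfibration_def
proof (intro conjI ballI impI)
  show "is_functor (Exp C pb) C p_exp" by (rule is_functor_p_exp)
next
  fix X u assume "X \<in> Obj (Exp C pb)" and u: "u \<in> Arr C" and "Dom C u = onO p_exp X"
  then obtain P where X: "X = (Dom C u, P)" and P: "(Dom C u, P) \<in> exp_objs C" by (cases X) simp
  note [simp] = u
  note P' = exp_objsD(2,1)[OF P]
  let ?PU = "comp_ftr (slice C (Cod C u)) P (pull C pb u)"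
  let ?R = "comp_ftr (slice C (Cod C u)) (post_ftr C u) ?PU"
  have F: "is_functor (slice C (Cod C u)) (slice C (Dom C u)) ?PU"
    by (rule is_functor_comp[OF is_functor_pull[OF u] P'(1)])
  have "is_functor (slice C (Cod C u)) (slice C (Cod C u)) ?R"
    by (rule is_functor_comp[OF F is_functor_post[OF u]])
  then have R: "(Cod C u, ?R) \<in> exp_objs C" by (intro exp_objs_comp_ftr) simp_all
  note [simp] = slice_functor_obj[OF P']
  have Rm: "mor ?R y f z = mor P (p1 u y) (pr u z (p1 u y) (f \<cdot> p2 u y)) (p1 u z)"
    if f: "arr_over C (Ide C (Cod C u)) y f z" for y f z
  proof -
    note f' = arr_over_proj_left[OF u f] and [simp] = arr_overD(1-8)[OF f]
    show ?thesis
      using f F is_functor_pull[OF u] slice_functor_mor[OF P' f'] by simp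
  qed
  define a where "a x f z = mor P x (pr u z x f) (p1 u z)" for x f z
  have "action C P u ?R a"
    unfolding action_def
  proof (intro conjI allI impI)
    fix x f z assume f: "arr_over C u x f z"
    note p = arr_over_pairing[OF f]
    note [simp] = arr_overD(1-9)[OF f] arr_overD[OF slice_functor_mor[OF P' p(1)]]
    show "arr_over C u (onO P x) (a x f z) (onO ?R z)"
      unfolding a_def by (intro arr_overI) simp_all
    show "a x' (f \<cdot> g) z = a x f z \<cdot> mor P x' g x" if g: "arr_over C (Ide C (Dom C u)) x' g x" for
      x' g
    proof -
      have fg: "arr_over C u x' (f \<cdot> g) z" by (rule arr_over_comp_right[OF g f])
      have e: "pr u z x f \<cdot> g = pr u z x' (f \<cdot> g)"
        by (rule arr_over_pairing_eqI[OF fg])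
          (use p(4-6) arr_overD[OF g] in \<open>simp_all add: Comp_reassoc[OF p(2)] Comp_reassoc[OF
            p(3)]\<close>)
      show ?thesis
        by (simp only: a_def slice_functor_comp[OF P' g p(1), symmetric] e)
    qed
    show "a x (g \<cdot> f) z' = mor ?R z g z'
      \<cdot> a x f z" if g: "arr_over C (Ide C (Cod C u)) z g z'" for g z'
    proof -
      note q = arr_over_proj_left[OF u g] and q' = arr_over_pairing[OF arr_over_pull[OF u g]]
      have gf: "arr_over C u x (g \<cdot> f) z'" by (rule arr_over_comp_left[OF f g])
      note [simp] = arr_overD[OF g] arr_overD[OF f] p(2-6) q'(2-6)
      have e: "pr u z' (p1 u z) (g \<cdot> p2 u z) \<cdot> pr u z x f = pr u z' x (g \<cdot> f)"
        by (rule arr_over_pairing_eqI[OF gf])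
          simp_all
      show ?thesis
        by (simp only: a_def Rm[OF g] slice_functor_comp[OF P' p(1) q, symmetric] e)
    qed
  qed
  then have a: "acts P u ?R a" using P R by (simp add: acts_def)
  have "supine (Exp C pb) C p_exp (oa P u ?R a)"
  proof (rule supine_Exp[OF a])
    fix z assume z: "z \<in> Arr C" "Cod C z = Cod C u"
    then have "pr u z (p1 u z) (p2 u z) = Ide C (Dom C (p1 u z))"
      by (intro arr_over_pairing_eqI[OF arr_over_projection, symmetric]) simp_all
    then have "a (p1 u z) (p2 u z) z = Ide C (Dom C (onO P (p1 u z)))"
      unfolding a_def using z by (simp add: slice_functor_ide[OF P'])
    then show "iso C (a (p1 u z) (p2 u z) z)"
      using z by (simp add: iso_Ide)
  qed
  then show "\<exists>f. supine (Exp C pb) C p_exp f \<and> Dom (Exp C pb) f = X \<and> onA p_exp f = u"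
    by (intro exI[of _ "oa P u ?R a"]) (simp add: X)
qed

lemma bifibration_Exp: "bifibration (Exp C pb) C p_exp"
  by (simp add: bifibration_def fibration_Exp opfibration_Exp)

end

section \<open>The lax monoidal structure of slice endofunctors\<close>

lemma fibre_product_simps [simp]:
  "(x, y) \<in> Obj (fibre_product E p) \<longleftrightarrow> x \<in> Obj E \<and> y \<in> Obj E \<and> onO p x = onO p y"
  "(f, g) \<in> Arr (fibre_product E p) \<longleftrightarrow> f \<in> Arr E \<and> g \<in> Arr E \<and> onA p f = onA p g"
  "Dom (fibre_product E p) (f, g) = (Dom E f, Dom E g)"
  "Cod (fibre_product E p) (f, g) = (Cod E f, Cod E g)"
  "Ide (fibre_product E p) (x, y) = (Ide E x, Ide E y)"
  "(f', g') \<cdot>\<^bsub>fibre_product E p\<^esub> (f, g) = (f' \<cdot>\<^bsub>E\<^esub> f, g' \<cdot>\<^bsub>E\<^esub> g)"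
  by (simp_all add: fibre_product_def)

lemma Hom_fibre_product:
  "(f, g) \<in> Hom (fibre_product E p) (x, y) (x', y') \<longleftrightarrow>
     f \<in> Hom E x x' \<and> g \<in> Hom E y y' \<and> onA p f = onA p g"
  by (auto simp: Hom_def)

lemma category_fibre_product:
  assumes "is_functor E B p"
  shows "category (fibre_product E p)"
proof -
  interpret p: is_functor E B p by fact
  have pA: "Dom B (onA p f) = onO p (Dom E f)" "Cod B (onA p f) =
    onO p (Cod E f)" if "f \<in> Arr E" for f
    using p.onA_Hom[of f "Dom E f" "Cod E f"] that by (simp_all add: Hom_def)
  show ?thesis
  proof
    fix F assume "F \<in> Arr (fibre_product E p)"
    then obtain f g where F: "F = (f, g)" and fg: "f \<in> Arr E" "g \<in> Arr E" "onA p f = onA p g"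
      by (cases F) simp
    have "onO p (Dom E f) = onO p (Dom E g)" "onO p (Cod E f) = onO p (Cod E g)"
      using pA[OF fg(1)] pA[OF fg(2)] unfolding fg(3) by (simp_all only:)
    then show "Dom (fibre_product E p) F \<in> Obj (fibre_product E p)"
      "Cod (fibre_product E p) F \<in> Obj (fibre_product E p)"
      "Ide (fibre_product E p) (Cod (fibre_product E p) F) \<cdot>\<^bsub>fibre_product E p\<^esub> F = F"
      "F \<cdot>\<^bsub>fibre_product E p\<^esub> Ide (fibre_product E p) (Dom (fibre_product E p) F) = F"
      using fg(1,2) by (simp_all add: F)
  next
    fix X assume "X \<in> Obj (fibre_product E p)"
    then show "Ide (fibre_product E p) X \<in> Hom (fibre_product E p) X X"
      using p.A.Ide_Hom by (cases X) (simp add: Hom_fibre_product p.onA_Ide)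
  next
    fix F G X Y Z
    assume FG: "F \<in> Hom (fibre_product E p) X Y" "G \<in> Hom (fibre_product E p) Y Z"
    obtain f f' g g' x x' y y' z z' where *: "F = (f, f')" "G = (g, g')" "X = (x, x')" "Y =
      (y, y')" "Z = (z, z')"
      by (cases F, cases G, cases X, cases Y, cases Z)
    have h: "f \<in> Hom E x y" "f' \<in> Hom E x' y'" "g \<in> Hom E y z" "g' \<in> Hom E y' z'"
      "onA p f = onA p f'" "onA p g = onA p g'"
      using FG by (simp_all add: * Hom_fibre_product)
    show "G \<cdot>\<^bsub>fibre_product E p\<^esub> F \<in> Hom (fibre_product E p) X Z"
      using p.onA_Comp[OF h(1,3)] p.onA_Comp[OF h(2,4)] p.A.Comp_Hom[OF h(1,3)] p.A.Comp_Hom[OF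
        h(2,4)] h(5,6)
      by (simp add: * Hom_fibre_product)
  next
    fix F G H W X Y Z
    assume FGH: "F \<in> Hom (fibre_product E p) W X" "G \<in> Hom (fibre_product E p) X Y"
      "H \<in> Hom (fibre_product E p) Y Z"
    obtain f f' g g' h h' w w' x x' y y' z z' where *: "F = (f, f')" "G = (g, g')" "H = (h, h')"
      "W = (w, w')" "X = (x, x')" "Y = (y, y')" "Z = (z, z')"
      by (cases F, cases G, cases H, cases W, cases X, cases Y, cases Z)
    have h: "f \<in> Hom E w x" "f' \<in> Hom E w' x'" "g \<in> Hom E x y" "g' \<in> Hom E x' y'"
       "h \<in> Hom E y z" "h' \<in> Hom E y' z'"
      using FGH by (simp_all add: * Hom_fibre_product)
    show "(H \<cdot>\<^bsub>fibre_product E p\<^esub> G) \<cdot>\<^bsub>fibre_product E p\<^esub> F =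
        H \<cdot>\<^bsub>fibre_product E p\<^esub> (G \<cdot>\<^bsub>fibre_product E p\<^esub> F)"
      using p.A.Comp_assoc[OF h(1,3,5)] p.A.Comp_assoc[OF h(2,4,6)] by (simp add: *)
  qed
qed

context pullback_category
begin

text \<open>Componentwise the tensor takes \<open>P1\<close> of the component of \<open>b\<close>
  and then the component of \<open>a\<close> at \<open>Q0 d\<close>. By
  \<open>acts_canonical\<close> this is the value of \<open>a\<close> at the square produced by
  \<open>b\<close>, which is the short form of the tensor on actions.\<close>

lemma
  assumes a: "acts P1 u P0 a" and b: "acts Q1 u Q0 b"
  shows acts_tens: "acts (comp_ftr (slice C (Dom C u)) P1 Q1) u (comp_ftr (slice C (Cod C u)) P0 Q0)
      (\<lambda>x f z. a (onO Q1 x) (b x f z) (onO Q0 z))" (is "acts ?P u ?Q ?c")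
    and exp_tensA_eq: "exp_tensA C (oa P1 u P0 a, oa Q1 u Q0 b) =
      oa (comp_ftr (slice C (Dom C u)) P1 Q1) u (comp_ftr (slice C (Cod C u)) P0 Q0)
        (\<lambda>x f z. a (onO Q1 x) (b x f z) (onO Q0 z))"
proof -
  note [simp] = actsD(1)[OF a]
  have "action C ?P u ?Q ?c"
    unfolding action_def
  proof (intro conjI allI impI)
    fix x f z assume f: "arr_over C u x f z"
    note bf = acts_over[OF b f]
    note [simp] = arr_overD(1-8)[OF f]
    show "arr_over C u (onO ?P x) (a (onO Q1 x) (b x f z) (onO Q0 z)) (onO ?Q z)"
      using acts_over[OF a bf] by simp
    show "a (onO Q1 x') (b x' (f \<cdot> g) z) (onO Q0 z) =
      a (onO Q1 x) (b x f z) (onO Q0 z) \<cdot> mor ?P x' g x"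
      if g: "arr_over C (Ide C (Dom C u)) x' g x" for x' g
      unfolding acts_pre[OF b g f] acts_pre[OF a acts_mor(1)[OF b g] bf]
      using g actsD(5)[OF b] by simp
    show "a (onO Q1 x) (b x (g \<cdot> f) z') (onO Q0 z') =
      mor ?Q z g z' \<cdot> a (onO Q1 x) (b x f z) (onO Q0 z)"
      if g: "arr_over C (Ide C (Cod C u)) z g z'" for g z'
      unfolding acts_post[OF b f g] acts_post[OF a bf acts_mor(2)[OF b g]]
      using g actsD(6)[OF b] by simp
  qed
  then show "acts ?P u ?Q ?c"
    using exp_objs_comp[OF actsD(2)[OF a] actsD(2)[OF b]] exp_objs_comp[OF actsD(3)[OF a]
      actsD(3)[OF b]]
    by (simp add: acts_def)
  have "into_pull C pb u (onO P1 (p1 u (onO Q0 d))) (onO P0 (onO Q0 d)) (a (p1 u (onO Q0 d)) (p2 u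
    (onO Q0 d)) (onO Q0 d))
      \<cdot>\<^bsub>slice C (Dom C u)\<^esub> onA P1 (into_pull C pb u (onO Q1 (p1 u d)) (onO Q0 d) (b (p1 u d) (p2 u
        d) d)) =
    into_pull C pb u (onO P1 (onO Q1 (p1 u d))) (onO P0 (onO Q0 d))
      (a (onO Q1 (p1 u d)) (b (p1 u d) (p2 u d) d) (onO Q0 d))"
    if d: "d \<in> Arr C" "Cod C d = Cod C u" for d
  proof -
    note [simp] = d acts_obj[OF a] acts_obj[OF b]
    have k: "arr_over C u (onO Q1 (p1 u d)) (b (p1 u d) (p2 u d) d) (onO Q0 d)"
      using acts_over[OF b arr_over_projection[of u d]] by simp
    note k' = arr_over_pairing[OF k] and ak = acts_over[OF a k] and mk =
      acts_mor(1)[OF a arr_over_pairing(1)[OF k]]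
    have c: "arr_over C u (onO P1 (p1 u (onO Q0 d))) (a (p1 u (onO Q0 d)) (p2 u (onO Q0 d)) (onO Q0
      d)) (onO P0 (onO Q0 d))"
      using acts_over[OF a arr_over_projection[of u "onO Q0 d"]] by simp
    note [simp] = arr_overD[OF ak] arr_overD[OF c] arr_overD[OF mk] arr_over_pairing(2-)[OF c]
    let ?m = "mor P1 (onO Q1 (p1 u d)) (pr u (onO Q0 d) (onO Q1 (p1 u d)) (b (p1 u d) (p2 u d) d))
      (p1 u (onO Q0 d))"
    have "pr u (onO P0 (onO Q0 d)) (onO P1 (p1 u (onO Q0 d))) (a (p1 u (onO Q0 d)) (p2 u (onO Q0 d))
      (onO Q0 d)) \<cdot> ?m =
      pr u (onO P0 (onO Q0 d)) (onO P1 (onO Q1 (p1 u d))) (a (onO Q1 (p1 u d)) (b (p1 u d) (p2 u d)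
        d) (onO Q0 d))"
      by (rule arr_over_pairing_eqI[OF ak]) (simp_all add: acts_canonical[OF a k])
    then show ?thesis
      using slice_functor_onA[OF actsD(5)[OF a] _ k'(1)] by (simp add: into_pull_def)
  qed
  then show "exp_tensA C (oa P1 u P0 a, oa Q1 u Q0 b) = oa ?P u ?Q ?c"
    using acts_obj(3,4)[OF b] acts_obj(3,4)[OF a]
    by (simp add: of_action_def restrict_def fun_eq_iff)
qed

lemma acts_unit: "u \<in> Arr C \<Longrightarrow> acts (id_ftr (slice C (Dom C u))) u (id_ftr (slice C (Cod C u))) (\<lambda>x f
  z. f)"
proof -
  assume u: "u \<in> Arr C"
  have "action C (id_ftr (slice C (Dom C u))) u (id_ftr (slice C (Cod C u))) (\<lambda>x f z. f)"
    unfolding action_def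
  proof (intro conjI allI impI)
    fix x f z assume f: "arr_over C u x f z"
    show "arr_over C u (onO (id_ftr (slice C (Dom C u))) x) f (onO (id_ftr (slice C (Cod C u))) z)"
      using f arr_overD(1-8)[OF f] by simp
  qed (use u in simp_all)
  then show ?thesis using u by (simp add: acts_def exp_objs_id)
qed

lemma exp_unit_eq:
  assumes u: "u \<in> Arr C"
  shows "onA (exp_unit C pb) u = oa (id_ftr (slice C (Dom C u))) u (id_ftr (slice C (Cod C u))) (\<lambda>x
    f z. f)"
proof -
  have "pr u d (p1 u d) (p2 u d) = Ide C (Dom C (p1 u d))" if "d \<in> Arr C" "Cod C d = Cod C u" for d
    using u that by (intro arr_over_pairing_eqI[OF arr_over_projection, symmetric]) simp_all
  then show ?thesis
    using u by (simp add: exp_unit_def of_action_def into_pull_def restrict_def fun_eq_iff)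
qed

lemma onO_exp_unit [simp]: "onO (exp_unit C pb) U = (U, id_ftr (slice C U))"
  by (simp add: exp_unit_def)

lemma is_functor_exp_unit: "is_functor C (Exp C pb) (exp_unit C pb)"
proof (intro is_functor.intro is_functor_axioms.intro)
  show "category C" by unfold_locales
  show "category (Exp C pb)" by (rule category_Exp)
  show "onO (exp_unit C pb) U \<in> Obj (Exp C pb)" if "U \<in> Obj C" for U
    using that by (simp add: exp_objs_id)
  show "onA (exp_unit C pb) u \<in> Hom (Exp C pb) (onO (exp_unit C pb) U) (onO (exp_unit C pb) V)"
    if "u \<in> Hom C U V" for u U V
    using that of_action_in_Arr[OF acts_unit[of u]] by (auto simp: Hom_def exp_unit_eq)
  show "onA (exp_unit C pb) (Ide C U) = Ide (Exp C pb) (onO (exp_unit C pb) U)" if "U \<in> Obj C" for U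
    using that by (simp add: exp_unit_eq Ide_Exp exp_objs_id) (intro of_action_cong, simp_all)
  show "onA (exp_unit C pb) (v \<cdot> u) = onA (exp_unit C pb) v \<cdot>\<^bsub>Exp C pb\<^esub> onA (exp_unit C pb) u"
    if "u \<in> Hom C U V" "v \<in> Hom C V W" for u v U V W
  proof -
    have [simp]: "u \<in> Arr C" "v \<in> Arr C" "Dom C v = Cod C u"
      using that by (simp_all add: Hom_def)
    note u = acts_unit[of u, simplified] and v = acts_unit[of v, simplified]
    have "comp_action C pb u v (\<lambda>x f z. f) (\<lambda>x f z. f) x f z =
      f" if "arr_over C (v \<cdot> u) x f z" for x f z
      using that by (rule arr_over_factorE) (simp_all add: comp_action_acts_eq[OF u v])
    then show ?thesis
      using Exp_comp(1)[OF u v] of_action_cong[of "v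
        \<cdot> u" "comp_action C pb u v (\<lambda>x f z. f) (\<lambda>x f z. f)" "\<lambda>x f z. f"]
      by (simp add: exp_unit_eq)
  qed
qed

lemma is_functor_exp_tens:
  "is_functor (fibre_product (Exp C pb) p_exp) (Exp C pb) \<lparr>onO = exp_tensO C, onA = exp_tensA C\<rparr>"
  (is "is_functor ?D ?E ?T")
proof (intro is_functor.intro is_functor_axioms.intro)
  show "category ?D" by (rule category_fibre_product[OF is_functor_p_exp])
  show "category ?E" by (rule category_Exp)
  show "onO ?T X \<in> Obj ?E" if "X \<in> Obj ?D" for X
    using that by (cases X; cases "fst X"; cases "snd X") (simp add: exp_objs_comp)
  show "onA ?T F \<in> Hom ?E (onO ?T X) (onO ?T Y)" if "F \<in> Hom ?D X Y" for F X Y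
  proof -
    obtain F1 F2 X1 X2 Y1 Y2 where *: "F = (F1, F2)" "X = (X1, X2)" "Y = (Y1, Y2)"
      by (cases F, cases X, cases Y)
    then have h: "F1 \<in> Hom ?E X1 Y1" "F2 \<in> Hom ?E X2 Y2" "onA p_exp F1 = onA p_exp F2"
      using that by (simp_all add: Hom_fibre_product)
    obtain P1 u P0 a where 1: "F1 = oa P1 u P0 a" "acts P1 u P0 a" "X1 = (Dom C u, P1)" "Y1 =
      (Cod C u, P0)"
      using h(1) by (rule Hom_ExpE)
    obtain Q1 u' Q0 b where 2: "F2 = oa Q1 u' Q0 b" "acts Q1 u' Q0 b" "X2 = (Dom C u', Q1)" "Y2 =
      (Cod C u', Q0)"
      using h(2) by (rule Hom_ExpE)
    have [simp]: "u' = u" using h(3) 1 2 by simp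
    show ?thesis
      using 1 2 exp_tensA_eq[OF 1(2)] of_action_in_Arr[OF acts_tens[OF 1(2)]]
        by (simp add: * Hom_def)
  qed
  show "onA ?T (Ide ?D X) = Ide ?E (onO ?T X)" if X: "X \<in> Obj ?D" for X
  proof -
    obtain U P Q where *: "X = ((U, P), (U, Q))" and PQ: "(U, P) \<in> exp_objs C" "(U, Q) \<in> exp_objs C"
      using X by (cases X; cases "fst X"; cases "snd X") simp
    have [simp]: "U \<in> Obj C" using exp_objsD(1)[OF PQ(1)] .
    show ?thesis
      using PQ exp_tensA_eq[OF acts_ide[OF PQ(1)] acts_ide[OF PQ(2)]] exp_objs_comp[OF PQ]
      by (simp add: * Ide_Exp) (intro of_action_cong, use exp_objsD[OF PQ(2)] in simp_all)
  qed
  show "onA ?T (G \<cdot>\<^bsub>?D\<^esub> F) = onA ?T G \<cdot>\<^bsub>?E\<^esub> onA ?T F"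
    if FG: "F \<in> Hom ?D X Y" "G \<in> Hom ?D Y Z" for F G X Y Z
  proof -
    obtain F1 F2 X1 X2 Y1 Y2 G1 G2 Z1 Z2 where *: "F = (F1, F2)" "X = (X1, X2)" "Y = (Y1, Y2)" "G =
      (G1, G2)" "Z = (Z1, Z2)"
      by (cases F, cases X, cases Y, cases G, cases Z)
    then have h: "F1 \<in> Hom ?E X1 Y1" "F2 \<in> Hom ?E X2 Y2" "onA p_exp F1 = onA p_exp F2"
      "G1 \<in> Hom ?E Y1 Z1" "G2 \<in> Hom ?E Y2 Z2" "onA p_exp G1 = onA p_exp G2"
      using FG by (simp_all add: Hom_fibre_product)
    obtain P u P' a where 1: "F1 = oa P u P' a" and a: "acts P u P' a" and Y1: "Y1 = (Cod C u, P')"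
      using h(1) by (rule Hom_ExpE)
    obtain Q u' Q' b where 2: "F2 = oa Q u' Q' b" and b: "acts Q u' Q' b" and Y2: "Y2 =
      (Cod C u', Q')"
      using h(2) by (rule Hom_ExpE)
    obtain P'1 v P'' a' where 3: "G1 = oa P'1 v P'' a'" and a': "acts P'1 v P'' a'" and Y1': "Y1 =
      (Dom C v, P'1)"
      using h(4) by (rule Hom_ExpE)
    obtain Q'1 v' Q'' b' where 4: "G2 = oa Q'1 v' Q'' b'" and b': "acts Q'1 v' Q'' b'" and Y2': "Y2 =
      (Dom C v', Q'1)"
      using h(5) by (rule Hom_ExpE)
    have [simp]: "u' = u" "v' = v" "P'1 = P'" "Q'1 = Q'" and uv: "Dom C v = Cod C u"
      using h(3,6) 1 2 3 4 Y1 Y2 Y1' Y2' by simp_all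
    note b = b[simplified] and a' = a'[simplified] and b' = b'[simplified]
    note [simp] = actsD(1)[OF a] actsD(1)[OF a'] uv
    have t: "acts (comp_ftr (slice C (Cod C u)) P' Q') v (comp_ftr (slice C (Cod C v)) P'' Q'')
      (\<lambda>x f z. a' (onO Q' x) (b' x f z) (onO Q'' z))"
      using acts_tens[OF a' b'] by simp
    \<comment> \<open>The interchange law: on a split square \<open>q \<cdot> k\<close> both sides
      are \<open>a' (b' q) \<cdot> a (b k)\<close>.\<close>
    have "comp_action C pb u v a' a (onO Q x) (comp_action C pb u v b' b x f z) (onO Q'' z) =
      comp_action C pb u v (\<lambda>x f z. a' (onO Q' x) (b' x f z) (onO Q'' z)) (\<lambda>x f z. a (onO Q x) (b x
        f z) (onO Q' z)) x f z"
      if f: "arr_over C (v \<cdot> u) x f z" for x f z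
    proof -
      obtain y k q where k: "arr_over C u x k y" and q: "arr_over C v y q z" and f: "f = q \<cdot> k"
        using f by (rule arr_over_factorE) simp_all
      show ?thesis
        unfolding f comp_action_acts_eq[OF b b' uv k q] comp_action_acts_eq[OF acts_tens[OF a b] t
          uv k q]
          comp_action_acts_eq[OF a a' uv acts_over[OF b k] acts_over[OF b' q]] by (rule refl)
    qed
    then have "oa (comp_ftr (slice C (Dom C u)) P Q) (v \<cdot> u) (comp_ftr (slice C (Cod C v)) P'' Q'')
       (\<lambda>x f z. comp_action C pb u v a' a (onO Q x) (comp_action C pb u v b' b x f z) (onO Q'' z)) =
       oa (comp_ftr (slice C (Dom C u)) P Q) (v \<cdot> u) (comp_ftr (slice C (Cod C v)) P'' Q'')
       (comp_action C pb u v (\<lambda>x f z. a' (onO Q' x) (b' x f z) (onO Q'' z)) (\<lambda>x f z. a (onO Q x) (b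
         x f z) (onO Q' z)))"
      by (intro of_action_cong) simp_all
    then show ?thesis
      using Exp_comp(1)[OF a a' uv] Exp_comp(1)[OF b b' uv] exp_tensA_eq[OF Exp_comp(2)[OF a a' uv]
        Exp_comp(2)[OF b b' uv]]
        exp_tensA_eq[OF a b] exp_tensA_eq[OF a' b'] Exp_comp(1)[OF acts_tens[OF a b] t uv]
      by (simp add: * 1 2 3 4)
  qed
qed

lemma exp_tensO_assoc:
  assumes "(U, P) \<in> exp_objs C" "(U, Q) \<in> exp_objs C" "(U, R) \<in> exp_objs C"
  shows "comp_ftr (slice C U) P (comp_ftr (slice C U) Q R) =
    comp_ftr (slice C U) (comp_ftr (slice C U) P Q) R"
  by (rule comp_ftr_assoc[OF exp_objsD(2)[OF assms(3)] exp_objsD(2)[OF assms(2)]])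

lemma Exp_lmf_simps [simp]:
  "base (Exp_lmf C pb) = C" "total (Exp_lmf C pb) = Exp C pb" "proj (Exp_lmf C pb) = p_exp"
  "tensor (Exp_lmf C pb) = \<lparr>onO = exp_tensO C, onA = exp_tensA C\<rparr>"
  "unit (Exp_lmf C pb) = exp_unit C pb"
  "(U, P) \<in> exp_objs C \<Longrightarrow> lunit (Exp_lmf C pb) (U, P) = Ide (Exp C pb) (U, P)"
  "(U, P) \<in> exp_objs C \<Longrightarrow> runit (Exp_lmf C pb) (U, P) = Ide (Exp C pb) (U, P)"
  "assoc (Exp_lmf C pb) (U, P) (U, Q) (U, R) =
     Ide (Exp C pb) (U, comp_ftr (slice C U) P (comp_ftr (slice C U) Q R))"
  by (simp_all add: Exp_lmf_def Exp_def)

lemma fib_Exp: "X \<in> fib (Exp_lmf C pb) U \<longleftrightarrow> (\<exists>P. X = (U, P) \<and> (U, P) \<in> exp_objs C)"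
  by (cases X) (auto simp: fib_def)

lemma exp_tensA_assoc:
  assumes a: "acts P u P' a" and b: "acts Q u Q' b" and c: "acts R u R' c"
  shows "exp_tensA C (oa P u P' a, exp_tensA C (oa Q u Q' b, oa R u R' c)) =
    exp_tensA C (exp_tensA C (oa P u P' a, oa Q u Q' b), oa R u R' c)"
  unfolding exp_tensA_eq[OF a b] exp_tensA_eq[OF b c] exp_tensA_eq[OF a acts_tens[OF b c]]
    exp_tensA_eq[OF acts_tens[OF a b] c]
    exp_tensO_assoc[OF actsD(2)[OF a] actsD(2)[OF b] actsD(2)[OF c]]
    exp_tensO_assoc[OF actsD(3)[OF a] actsD(3)[OF b] actsD(3)[OF c]]
  using actsD(1)[OF a] by (intro of_action_cong) (simp_all add: arr_overD(2,3,5,6))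

lemma exp_tensA_unit:
  assumes a: "acts P u P' a"
  shows "exp_tensA C (onA (exp_unit C pb) u, oa P u P' a) = oa P u P' a"
    and "exp_tensA C (oa P u P' a, onA (exp_unit C pb) u) = oa P u P' a"
proof -
  note [simp] = actsD(1)[OF a]
  show "exp_tensA C (onA (exp_unit C pb) u, oa P u P' a) = oa P u P' a"
    using exp_tensA_eq[OF acts_unit a] comp_ftr_id[OF actsD(2)[OF a]] comp_ftr_id[OF actsD(3)[OF a]]
    by (simp add: exp_unit_eq)
  show "exp_tensA C (oa P u P' a, onA (exp_unit C pb) u) = oa P u P' a"
    using exp_tensA_eq[OF a acts_unit] comp_ftr_id[OF actsD(2)[OF a]] comp_ftr_id[OF actsD(3)[OF a]]
    by (simp add: exp_unit_eq) (intro of_action_cong, simp_all add: arr_overD(2,3,5,6))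
qed

lemma exp_tensA_Ide:
  assumes "(U, P) \<in> exp_objs C" "(U, Q) \<in> exp_objs C"
  shows "exp_tensA C (Ide (Exp C pb) (U, P), Ide (Exp C pb) (U, Q)) =
    Ide (Exp C pb) (U, comp_ftr (slice C U) P Q)"
proof -
  interpret T: is_functor "fibre_product (Exp C pb) p_exp" "Exp C pb" "\<lparr>onO = exp_tensO C, onA =
    exp_tensA C\<rparr>"
    by (rule is_functor_exp_tens)
  show ?thesis using T.onA_Ide[of "((U, P), (U, Q))"] assms by simp
qed

text \<open>All coherence arrows are identities. They have the required source and target because
  extensional functors compose strictly associatively and unitally, and they are natural because the
  tensor of arrows is strict as well (\<open>exp_tensA_assoc\<close>,
  \<open>exp_tensA_unit\<close>).\<close>

lemma lax_monoidal_fibration_Exp: "lax_monoidal_fibration (Exp_lmf C pb)"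
proof -
  let ?N = "Exp_lmf C pb"
  interpret E: category "Exp C pb" by (rule category_Exp)
  interpret I: is_functor C "Exp C pb" "exp_unit C pb" by (rule is_functor_exp_unit)
  have vert: "Ide (Exp C pb) (U, P) \<in> vertical ?N (U, P) (U, P)" if "(U, P) \<in> exp_objs C" for U P
    using that E.Ide_Hom[of "(U, P)"] by (simp add: vertical_def Ide_Exp)
  show ?thesis
  proof (rule lax_monoidal_fibration.intro)
    show "fibration (total ?N) (base ?N) (proj ?N)"
      by (simp add: fibration_Exp)
    show "is_functor (fibre_product (total ?N) (proj ?N)) (total ?N)
        (tensor ?N)"
      using is_functor_exp_tens by simp
    show "is_functor (base ?N) (total ?N) (unit ?N)"
      using is_functor_exp_unit by simp
  next
    fix X Y U assume "X \<in> fib ?N U" "Y \<in> fib ?N U"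
    then show "onO (tensor ?N) (X, Y) \<in> fib ?N U"
      by (auto simp: fib_Exp exp_objs_comp)
  next
    fix F G assume "F \<in> Arr (total ?N)" "G \<in> Arr (total ?N)"
      "onA (proj ?N) F = onA (proj ?N) G"
    then show "onA (proj ?N) (onA (tensor ?N) (F, G)) = onA (proj ?N) F"
      by (auto elim!: Arr_ExpE simp: exp_tensA_eq)
  next
    fix U assume "U \<in> Obj (base ?N)"
    then have U: "U \<in> Obj C" by simp
    then show "onO (unit ?N) U \<in> fib ?N U"
      by (simp add: fib_Exp exp_objs_id)
    note i = exp_objs_id[OF U]
    note e = E.Ide_simps[of "(U, id_ftr (slice C U))"] E.Ide_Comp(1)[of "Ide (Exp C pb) (U, id_ftr
      (slice C U))"]
    show "runit ?N (onO (unit ?N) U) \<cdot>\<^bsub>total ?N\<^esub>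
        lunit ?N (onO (unit ?N) U) = Ide (total ?N) (onO (unit ?N) U)"
      using i e by simp
    show "lunit ?N (onO (unit ?N) U) \<cdot>\<^bsub>total ?N\<^esub>
        runit ?N (onO (unit ?N) U) =
        Ide (total ?N) (onO (tensor ?N)
          (onO (unit ?N) U, onO (unit ?N) U))"
      using i e by (simp add: comp_ftr_id)
  next
    fix u assume "u \<in> Arr (base ?N)"
    then show "onA (proj ?N) (onA (unit ?N) u) = u"
      by (simp add: exp_unit_eq)
  next
    fix X Y Z U assume "X \<in> fib ?N U" "Y \<in> fib ?N U" "Z \<in> fib ?N U"
    then show "assoc ?N X Y Z \<in> vertical ?N
        (onO (tensor ?N) (X, onO (tensor ?N) (Y, Z)))
        (onO (tensor ?N) (onO (tensor ?N) (X, Y), Z))"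
      using vert by (auto simp: fib_Exp exp_objs_comp exp_tensO_assoc)
  next
    fix F G H X X' Y Y' Z Z'
    assume F: "F \<in> Hom (total ?N) X X'" and G: "G \<in> Hom (total ?N) Y Y'"
      and H: "H \<in> Hom (total ?N) Z Z'"
      and eq: "onA (proj ?N) F = onA (proj ?N) G"
        "onA (proj ?N) G = onA (proj ?N) H"
    obtain P u P' a where 1: "F = oa P u P' a" and a: "acts P u P' a" and X: "X = (Dom C u, P)" "X' =
      (Cod C u, P')"
      using F[simplified] by (rule Hom_ExpE)
    obtain Q v Q' b where 2: "G = oa Q v Q' b" and b: "acts Q v Q' b" and Y: "Y = (Dom C v, Q)" "Y' =
      (Cod C v, Q')"
      using G[simplified] by (rule Hom_ExpE)
    obtain R w R' c where 3: "H = oa R w R' c" and c: "acts R w R' c" and Z: "Z = (Dom C w, R)" "Z' =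
      (Cod C w, R')"
      using H[simplified] by (rule Hom_ExpE)
    have [simp]: "v = u" "w = u" using eq by (simp_all add: 1 2 3)
    note b = b[simplified] and c = c[simplified]
    note abc = acts_tens[OF a acts_tens[OF b c]] acts_tens[OF acts_tens[OF a b] c]
    note t = exp_tensA_assoc[OF a b c] exp_tensA_eq[OF acts_tens[OF a b] c] exp_tensA_eq[OF a b]
    note s = exp_tensO_assoc[OF actsD(2)[OF a] actsD(2)[OF b] actsD(2)[OF c]]
      exp_tensO_assoc[OF actsD(3)[OF a] actsD(3)[OF b] actsD(3)[OF c]]
    show "assoc ?N X' Y' Z' \<cdot>\<^bsub>total ?N\<^esub>
         onA (tensor ?N) (F, onA (tensor ?N) (G, H)) =
       onA (tensor ?N) (onA (tensor ?N) (F, G), H) \<cdot>\<^bsub>total ?N\<^esub>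
         assoc ?N X Y Z"
      using of_action_in_Arr[OF abc(2)] by (simp add: 1 2 3 X Y Z t s)
  next
    fix X U assume "X \<in> fib ?N U"
    then show "lunit ?N X \<in> vertical ?N X
          (onO (tensor ?N) (onO (unit ?N) U, X))"
      "runit ?N X \<in> vertical ?N
          (onO (tensor ?N) (X, onO (unit ?N) U)) X"
      using vert by (auto simp: fib_Exp comp_ftr_id)
  next
    fix F X X' assume F: "F \<in> Hom (total ?N) X X'"
    obtain P u P' a where 1: "F = oa P u P' a" and a: "acts P u P' a" and X: "X = (Dom C u, P)" "X' =
      (Cod C u, P')"
      using F[simplified] by (rule Hom_ExpE)
    show "lunit ?N X' \<cdot>\<^bsub>total ?N\<^esub> F =
        onA (tensor ?N) (onA (unit ?N) (onA (proj ?N) F), F)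
          \<cdot>\<^bsub>total ?N\<^esub> lunit ?N X"
      "runit ?N X' \<cdot>\<^bsub>total ?N\<^esub>
         onA (tensor ?N) (F, onA (unit ?N) (onA (proj ?N) F)) =
       F \<cdot>\<^bsub>total ?N\<^esub> runit ?N X"
      using of_action_in_Arr[OF a] actsD(2,3)[OF a] exp_tensA_unit[OF a] by (simp_all add: 1 X)
  next
    fix W X Y Z U assume "W \<in> fib ?N U" "X \<in> fib ?N U"
      "Y \<in> fib ?N U" "Z \<in> fib ?N U"
    then obtain P Q R S where o: "W = (U, P)" "X = (U, Q)" "Y = (U, R)" "Z = (U, S)"
      and PQ: "(U, P) \<in> exp_objs C" "(U, Q) \<in> exp_objs C" "(U, R) \<in> exp_objs C" "(U, S) \<in> exp_objs
        C"
      by (auto simp: fib_Exp)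
    note c = exp_objs_comp
    let ?c = "comp_ftr (slice C U)"
    note s = exp_tensO_assoc[OF PQ(1,2,3), symmetric] exp_tensO_assoc[OF PQ(2,3,4), symmetric]
      exp_tensO_assoc[OF PQ(1,2) c[OF PQ(3,4)], symmetric] exp_tensO_assoc[OF PQ(1) c[OF PQ(2,3)]
        PQ(4), symmetric]
    have A: "(U, ?c P (?c Q (?c R S))) \<in> exp_objs C" "(U, ?c P (?c Q R)) \<in> exp_objs C" "(U, ?c Q (?c
      R S)) \<in> exp_objs C"
      using PQ by (simp_all add: c)
    show "assoc ?N (onO (tensor ?N) (W, X)) Y Z \<cdot>\<^bsub>total ?N\<^esub>
        assoc ?N W X (onO (tensor ?N) (Y, Z)) =
      onA (tensor ?N) (assoc ?N W X Y, Ide (total ?N) Z)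
        \<cdot>\<^bsub>total ?N\<^esub> assoc ?N W (onO (tensor ?N) (X, Y)) Z
        \<cdot>\<^bsub>total ?N\<^esub> onA (tensor ?N) (Ide (total ?N) W, assoc ?N X Y Z)"
      using A PQ by (simp add: o s exp_tensA_Ide)
  next
    fix X Y U assume "X \<in> fib ?N U" "Y \<in> fib ?N U"
    then obtain P Q where o: "X = (U, P)" "Y = (U, Q)"
      and PQ: "(U, P) \<in> exp_objs C" "(U, Q) \<in> exp_objs C"
      by (auto simp: fib_Exp)
    show "onA (tensor ?N) (runit ?N X, Ide (total ?N) Y)
        \<cdot>\<^bsub>total ?N\<^esub> assoc ?N X (onO (unit ?N) U) Y
        \<cdot>\<^bsub>total ?N\<^esub> onA (tensor ?N) (Ide (total ?N) X, lunit ?N Y) =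
      Ide (total ?N) (onO (tensor ?N) (X, Y))"
      using PQ exp_objs_comp[OF PQ] by (simp add: o exp_tensA_Ide comp_ftr_id)
  qed
qed

section \<open>Cartesian natural transformations\<close>

text \<open>The naturality square of the transformation at \<open>g\<close>, with the projections
  from \<open>u^* R\<close> to \<open>R\<close> attached. The projection squares are pullbacks, so
  by pasting this is equivalent to cartesianness (\<open>cartesian_nat_trans_iff\<close>), and
  \<open>u^* R\<close> is no longer mentioned.\<close>

definition cart_action :: "'a slice_ftr \<Rightarrow> 'a \<Rightarrow> 'a slice_ftr \<Rightarrow> ('a \<Rightarrow> 'a \<Rightarrow> 'a \<Rightarrow> 'a) \<Rightarrow> bool" where
  "cart_action P u R a \<longleftrightarrow> (\<forall>z g z'. arr_over C (Ide C (Cod C u)) z g z' \<longrightarrow>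
     is_pullback C (mor R z g z') (a (p1 u z') (p2 u z') z') (a (p1 u z) (p2 u z) z)
       (mor P (p1 u z) (pr u z' (p1 u z) (g \<cdot> p2 u z)) (p1 u z')))"

text \<open>\<open>u^* z\<close> is a pullback of \<open>u\<close> and
  \<open>z = z' \<cdot> g\<close>; cancelling the chosen pullback of \<open>u\<close> and
  \<open>z'\<close> leaves the square on \<open>g\<close>.\<close>

lemma is_pullback_pull:
  assumes u: "u \<in> Arr C" and g: "arr_over C (Ide C (Cod C u)) z g z'"
  shows "is_pullback C g (p2 u z') (p2 u z) (pr u z' (p1 u z) (g \<cdot> p2 u z))"
proof -
  note [simp] = u arr_overD[OF g] arr_over_pairing(2-)[OF arr_over_pull[OF u g]]
  have zg: "z' \<cdot> g = z" by simp
  have "is_pullback C (p2 u z') g (pr u z' (p1 u z) (g \<cdot> p2 u z)) (p2 u z)"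
  proof (rule is_pullback_cancel[OF chosen_pullback[of u z']])
    show "is_pullback C u (z' \<cdot> g) (p1 u z' \<cdot> pr u z' (p1 u z) (g \<cdot> p2 u z)) (p2 u z)"
      unfolding zg by (simp add: chosen_pullback)
  qed simp_all
  then show ?thesis by (rule is_pullback_sym)
qed

lemma iso_pairing:
  assumes p: "is_pullback C u z x f"
  shows "iso C (pr u z x f)"
proof -
  note D = is_pullbackD[OF p]
  have xf: "arr_over C u x f z" using D by (simp add: arr_over_def)
  note [simp] = D(1-8) arr_overD(9-10)[OF xf] arr_over_pairing(2-)[OF xf]
  obtain n where n: "n \<in> Arr C" "Dom C n = Dom C (p1 u z)" "Cod C n = Dom C x" "x \<cdot> n =
    p1 u z" "f \<cdot> n = p2 u z"
    by (rule is_pullbackE[OF p, of "p1 u z" "p2 u z"]) simp_all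
  note [simp] = n(1-3)
  show ?thesis
  proof (rule isoI[of _ n])
    show "n \<cdot> pr u z x f = Ide C (Dom C (pr u z x f))"
      by (rule is_pullback_mono[OF p]) (simp_all add: Comp_reassoc[OF n(4)] Comp_reassoc[OF n(5)])
    show "pr u z x f \<cdot> n = Ide C (Cod C (pr u z x f))"
      by (rule projections_mono[of u z]) (simp_all add: n(4,5))
  qed simp_all
qed

lemma iso_mor:
  assumes P: "is_functor (slice C U) (slice C V) P" "U \<in> Obj C" "V \<in> Obj C"
    and f: "arr_over C (Ide C U) x f y" "iso C f"
  shows "iso C (mor P x f y)"
proof -
  obtain g where g: "f \<in> Arr C" "g \<in> Arr C" "Dom C g = Cod C f" "Cod C g = Dom C f"
    "g \<cdot> f = Ide C (Dom C f)" "f \<cdot> g = Ide C (Cod C f)"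
    using f(2) by (rule isoE)
  note F = arr_overD(2-9)[OF f(1)]
  have yf: "y \<cdot> f = x" using F P(2) by simp
  \<comment> \<open>The inverse of \<open>f\<close> in \<open>C\<close> is again over
    \<open>U\<close>, hence an inverse in the slice, where functoriality of \<open>P\<close>
    applies.\<close>
  have "x \<cdot> g = (y \<cdot> f) \<cdot> g" by (simp only: yf)
  also have "\<dots> = y" using F(1-7) g(2-6) P(2) by simp
  finally have "y = x \<cdot> g" by (rule sym)
  then have g': "arr_over C (Ide C U) y g x"
    using F g(2-4) P(2) by (intro arr_overI) simp_all
  note [simp] = arr_overD(1-8)[OF slice_functor_mor[OF P(1,2) f(1)]] arr_overD(1-8)[OF
    slice_functor_mor[OF P(1,2) g']]
  show ?thesis
    using slice_functor_comp[OF P(1,2) f(1) g'] slice_functor_comp[OF P(1,2) g' f(1)]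
      slice_functor_ide[OF P(1,2)] F g P(2,3)
    by (intro isoI[of _ "mor P y g x"]) simp_all
qed

lemma preserves_pullbacks_sliceI:
  assumes "is_functor (slice C U) (slice C V) P" "U \<in> Obj C" "V \<in> Obj C"
    and pbk: "\<And>x f z y g w p q. arr_over C (Ide C U) x f z \<Longrightarrow> arr_over C (Ide C U) y g z \<Longrightarrow>
      arr_over C (Ide C U) w p x \<Longrightarrow> arr_over C (Ide C U) w q y \<Longrightarrow> is_pullback C f g p q \<Longrightarrow>
      is_pullback C (mor P x f z) (mor P y g z) (mor P w p x) (mor P w q y)"
  shows "preserves_pullbacks (slice C U) (slice C V) P"
  unfolding preserves_pullbacks_def
proof (intro allI impI)
  fix F G H K assume "is_pullback (slice C U) F G H K"
  then obtain x y z w f g p q where *: "F = (x, f, z)" "G = (y, g, z)" "H = (w, p, x)" "K =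
    (w, q, y)"
    and f: "arr_over C (Ide C U) x f z" and g: "arr_over C (Ide C U) y g z"
    and p: "arr_over C (Ide C U) w p x" and q: "arr_over C (Ide C U) w q y" and "is_pullback C f g p
      q"
    by (rule is_pullback_sliceE[OF assms(2)])
  then show "is_pullback (slice C V) (onA P F) (onA P G) (onA P H) (onA P K)"
    using is_pullback_slice[OF assms(3) slice_functor_mor[OF assms(1,2) f] slice_functor_mor[OF
      assms(1,2) g]
        slice_functor_mor[OF assms(1,2) p] slice_functor_mor[OF assms(1,2) q]] pbk[OF f g p q]
    by (simp add: * slice_functor_onA[OF assms(1,2)])
qed

lemma cartesian_nat_trans_iff:
  assumes a: "acts P u R a"
  defines "\<tau> \<equiv> (\<lambda>z \<in> Obj (slice C (Cod C u)).
        into_pull C pb u (onO P (p1 u z)) (onO R z) (a (p1 u z) (p2 u z) z))"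
  shows "cartesian_nat_trans (slice C (Cod C u)) (slice C (Dom C u))
      (comp_ftr (slice C (Cod C u)) P (pull C pb u)) (comp_ftr (slice C (Cod C u)) (pull C pb u) R)
        \<tau>
    \<longleftrightarrow> cart_action P u R a"
proof -
  let ?V = "slice C (Cod C u)" and ?U = "slice C (Dom C u)"
  note u[simp] = actsD(1)[OF a]
  note [simp] = acts_obj[OF a]
  have nt: "nat_trans ?V ?U (comp_ftr ?V P (pull C pb u)) (comp_ftr ?V (pull C pb u) R) \<tau>"
    using of_action_arr[OF u actsD(2-4)[OF a]] by (simp add: of_action_def exp_arrs_def \<tau>_def)
  have "is_pullback ?U (\<tau> z') (onA (comp_ftr ?V (pull C pb u) R) (z, g, z'))
      (onA (comp_ftr ?V P (pull C pb u)) (z, g, z')) (\<tau> z) \<longleftrightarrow>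
    is_pullback C (mor R z g z') (a (p1 u z') (p2 u z') z') (a (p1 u z) (p2 u z) z)
       (mor P (p1 u z) (pr u z' (p1 u z) (g \<cdot> p2 u z)) (p1 u z'))" (is "?L \<longleftrightarrow> ?R")
    if g: "arr_over C (Ide C (Cod C u)) z g z'" for z g z'
  proof -
    note [simp] = arr_overD[OF g]
    have z: "arr_over C u (onO P (p1 u z)) (a (p1 u z) (p2 u z) z) (onO R z)"
      and z': "arr_over C u (onO P (p1 u z')) (a (p1 u z') (p2 u z') z') (onO R z')"
      by (rule acts_over[OF a arr_over_projection]; simp)+
    note Rg = acts_mor(2)[OF a g]
    note ug = arr_over_proj_left[OF u g] and uRg = arr_over_proj_left[OF u Rg]
    note Pg = acts_mor(1)[OF a ug]
    let ?m = "pr u (onO R z') (p1 u (onO R z)) (mor R z g z' \<cdot> p2 u (onO R z))"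
    let ?t = "pr u (onO R z) (onO P (p1 u z)) (a (p1 u z) (p2 u z) z)"
    let ?t' = "pr u (onO R z') (onO P (p1 u z')) (a (p1 u z') (p2 u z') z')"
    let ?p = "mor P (p1 u z) (pr u z' (p1 u z) (g \<cdot> p2 u z)) (p1 u z')"
    have nat: "?m \<cdot> ?t = ?t' \<cdot> ?p"
      using nat_trans.natural[OF nt, of "(z, g, z')" z z'] g slice_functor_onA[OF is_functor_pull[OF
        u] _ g]
        slice_functor_onA[OF is_functor_pull[OF u] _ Rg] pull_simps(2)[OF u Rg] slice_functor_onA[OF
          actsD(5)[OF a] _ ug] slice_functor_onA[OF actsD(6)[OF a] _ g]
      by (simp add: \<tau>_def into_pull_def Hom_slice)
    have "?L \<longleftrightarrow> is_pullback C ?t' ?m ?p ?t"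
      using is_pullback_slice[OF _ arr_over_pairing(1)[OF z'] uRg Pg arr_over_pairing(1)[OF z]]
        g slice_functor_onA[OF is_functor_pull[OF u] _ g] slice_functor_onA[OF is_functor_pull[OF u]
          _ Rg] pull_simps(2)[OF u Rg]
        slice_functor_onA[OF actsD(5)[OF a] _ ug] slice_functor_onA[OF actsD(6)[OF a] _ g]
      by (simp add: \<tau>_def into_pull_def)
    also have "\<dots> \<longleftrightarrow> is_pullback C ?m ?t' ?t ?p"
      using is_pullback_sym by blast
    \<comment> \<open>The square of projections at \<open>g\<close> is a pullback, so attaching it
      does not change whether the naturality square is one; the projections then undo the pairings
      in the components.\<close>
    also have "\<dots> \<longleftrightarrow> is_pullback C (mor R z g z') (p2 u (onO R z') \<cdot> ?t') (p2 u (onO R z) \<cdot> ?t) ?p"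
    proof
      show "is_pullback C (mor R z g z') (p2 u (onO R z') \<cdot> ?t') (p2 u (onO R z) \<cdot> ?t) ?p"
        if "is_pullback C ?m ?t' ?t ?p"
        by (rule is_pullback_paste[OF is_pullback_pull[OF u Rg] that])
      show "is_pullback C ?m ?t' ?t ?p"
        if "is_pullback C (mor R z g z') (p2 u (onO R z') \<cdot> ?t') (p2 u (onO R z) \<cdot> ?t) ?p"
        by (rule is_pullback_cancel[OF is_pullback_pull[OF u Rg] that])
          (use nat arr_over_pairing(4-6)[OF z] arr_over_pairing(4-6)[OF z'] in simp_all)
    qed
    also have "\<dots> \<longleftrightarrow> ?R"
      by (simp only: arr_over_pairing(2)[OF z] arr_over_pairing(2)[OF z'])
    finally show ?thesis .
  qed
  note iff = this
  let ?pb = "\<lambda>f. is_pullback ?U (\<tau> (Cod ?V f)) (onA (comp_ftr ?V (pull C pb u) R) f)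
           (onA (comp_ftr ?V P (pull C pb u)) f) (\<tau> (Dom ?V f))"
  have "(\<forall>f \<in> Arr ?V. ?pb f) \<longleftrightarrow> (\<forall>z g z'. arr_over C (Ide C (Cod C u)) z g z' \<longrightarrow> ?pb (z, g, z'))"
    using Arr_slice[of _ _ _ "Cod C u"] Cod_Obj[OF u] by (metis prod_cases3)
  then show ?thesis
    unfolding cartesian_nat_trans_def cart_action_def using nt iff by simp
qed

section \<open>The subcategory \<open>Cart\<close>\<close>

lemma Obj_Cart: "(U, P) \<in> Obj (Cart C pb) \<longleftrightarrow>
  (U, P) \<in> exp_objs C \<and> preserves_pullbacks (slice C U) (slice C U) P"
  by (simp add: Cart_def)

lemma Arr_Cart:
  assumes a: "acts P u R a"
  shows "oa P u R a \<in> Arr (Cart C pb) \<longleftrightarrow>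
    (Dom C u, P) \<in> Obj (Cart C pb) \<and> (Cod C u, R) \<in> Obj (Cart C pb)
      \<and> cart_action P u R a"
  using cartesian_nat_trans_iff[OF a] of_action_arr[OF actsD(1-4)[OF a]] actsD(2,3)[OF a]
  unfolding Obj_Cart by (simp add: Cart_def of_action_def)

lemma Arr_CartE:
  assumes "E \<in> Arr (Cart C pb)"
  obtains P u R a where "E = oa P u R a" "acts P u R a" "(Dom C u, P) \<in> Obj (Cart C pb)"
    "(Cod C u, R) \<in> Obj (Cart C pb)" "cart_action P u R a"
proof -
  have "E \<in> Arr (Exp C pb)" using assms by (auto simp: Cart_def Exp_def)
  then obtain P u R a where E: "E = oa P u R a" and a: "acts P u R a" by (rule Arr_ExpE)
  then show ?thesis using assms Arr_Cart[OF a] that[OF E a] by simp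
qed

text \<open>The arrows \<open>p2 (Ide C U) y\<close> are pullbacks of an identity, hence invertible;
  the square has \<open>P\<close> of two such arrows as opposite sides.\<close>

lemma cart_action_ide:
  assumes P: "(U, P) \<in> exp_objs C"
  shows "cart_action P (Ide C U) P (mor P)"
  unfolding cart_action_def
proof (intro allI impI)
  note P' = exp_objsD(2,1)[OF P]
  note [simp] = P'(2)
  fix z g z' assume "arr_over C (Ide C (Cod C (Ide C U))) z g z'"
  then have g: "arr_over C (Ide C U) z g z'" by simp
  have gU: "arr_over C (Ide C (Cod C (Ide C U))) z g z'" using g by simp
  note [simp] = arr_overD[OF g]
  let ?k = "pr (Ide C U) z' (p1 (Ide C U) z) (g \<cdot> p2 (Ide C U) z)"
  have k: "arr_over C (Ide C U) (p1 (Ide C U) z) ?k (p1 (Ide C U) z')"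
    using arr_over_proj_left[OF _ gU] by simp
  have pz: "arr_over C (Ide C U) (p1 (Ide C U) y) (p2 (Ide C U) y) y" and iz: "iso C (p2 (Ide C U)
    y)"
    if y: "y \<in> Arr C" "Cod C y = U" for y
  proof -
    note [simp] = y
    show "arr_over C (Ide C U) (p1 (Ide C U) y) (p2 (Ide C U) y) y"
      by (simp add: arr_over_projection)
    have i: "arr_over C (Ide C U) y (Ide C (Dom C y)) y" by (intro arr_over_ide) simp_all
    note [simp] = arr_over_pairing(2-)[OF i]
    show "iso C (p2 (Ide C U) y)"
    proof (rule isoI[of _ "pr (Ide C U) y y (Ide C (Dom C y))"])
      have e: "y \<cdot> p2 (Ide C U) y = p1 (Ide C U) y" by simp
      show "pr (Ide C U) y y (Ide C (Dom C y)) \<cdot> p2 (Ide C U) y = Ide C (Dom C (p2 (Ide C U) y))"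
        by (rule projections_mono[of "Ide C U" y]) simp_all
    qed simp_all
  qed
  have "g \<cdot> p2 (Ide C U) z = p2 (Ide C U) z' \<cdot> ?k"
    by (rule arr_over_pairing(2)[OF arr_over_pull[OF _ gU], symmetric]) simp
  then have e: "mor P z g z' \<cdot> mor P (p1 (Ide C U) z) (p2 (Ide C U) z) z =
    mor P (p1 (Ide C U) z') (p2 (Ide C U) z') z' \<cdot> mor P (p1 (Ide C U) z) ?k (p1 (Ide C U) z')"
    using slice_functor_comp[OF P' pz[of z] g] slice_functor_comp[OF P' k pz[of z']] by simp
  note [simp] = arr_overD(1-8)[OF slice_functor_mor[OF P' k]] arr_overD(1-8)[OF slice_functor_mor[OF
    P' g]]
    arr_overD(1-8)[OF slice_functor_mor[OF P' pz[of z]]] arr_overD(1-8)[OF slice_functor_mor[OF P'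
      pz[of z']]]
  show "is_pullback C (mor P z g z') (mor P (p1 (Ide C U) z') (p2 (Ide C U) z') z')
     (mor P (p1 (Ide C U) z) (p2 (Ide C U) z) z) (mor P (p1 (Ide C U) z) ?k (p1 (Ide C U) z'))"
    by (rule is_pullback_sym, rule is_pullback_parallel_isos)
      (use e in \<open>simp_all add: iso_mor[OF P' P'(2) pz iz]\<close>)
qed

text \<open>The squares of \<open>a\<close> and \<open>b\<close> paste to a pullback, but one built
  from the iterated pullbacks along \<open>v\<close> and then \<open>u\<close>. Transport along the
  comparison with the chosen pullback along \<open>v \<cdot> u\<close> adds a square with two
  invertible sides.\<close>

lemma cart_action_comp:
  assumes a: "acts P u R a" and b: "acts R v S b" and uv: "Dom C v = Cod C u"
    and ca: "cart_action P u R a" and cb: "cart_action R v S b"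
  shows "cart_action P (v \<cdot> u) S (comp_action C pb u v b a)"
  unfolding cart_action_def
proof (intro allI impI)
  note [simp] = actsD(1)[OF a] actsD(1)[OF b] uv acts_obj[OF a]
  note P' = actsD(5)[OF a] Dom_Obj[OF actsD(1)[OF a]]
  fix z g z' assume "arr_over C (Ide C (Cod C (v \<cdot> u))) z g z'"
  then have g: "arr_over C (Ide C (Cod C v)) z g z'" by simp
  have gvu: "arr_over C (Ide C (Cod C (v \<cdot> u))) z g z'" using g by simp
  note [simp] = arr_overD[OF g]
  have vg: "arr_over C (Ide C (Cod C u)) (p1 v z) (pr v z' (p1 v z) (g \<cdot> p2 v z)) (p1 v z')"
    using arr_over_proj_left[OF _ g] by simp
  define k where "k = pr v z' (p1 v z) (g \<cdot> p2 v z)"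
  note vg = vg[folded k_def]
  define l where "l = pr u (p1 v z') (p1 u (p1 v z)) (k \<cdot> p2 u (p1 v z))"
  have l: "arr_over C (Ide C (Dom C u)) (p1 u (p1 v z)) l (p1 u (p1 v z'))"
    unfolding l_def by (rule arr_over_proj_left[OF _ vg]) simp
  define n where "n = pr (v \<cdot> u) z' (p1 (v \<cdot> u) z) (g \<cdot> p2 (v \<cdot> u) z)"
  have n: "arr_over C (Ide C (Dom C u)) (p1 (v \<cdot> u) z) n (p1 (v \<cdot> u) z')"
    using arr_over_proj_left[OF _ gvu] by (simp add: n_def)
  \<comment> \<open>\<open>s y\<close> is the comparison from \<open>(v u)^* y\<close> to
    \<open>u^* v^* y\<close>, and \<open>m y\<close> is its composite with the projection to
    \<open>v^* y\<close>.\<close>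
  define m where "m y = pr v y (u \<cdot> p1 (v \<cdot> u) y) (p2 (v \<cdot> u) y)" for y
  define s where "s y = pr u (p1 v y) (p1 (v \<cdot> u) y) (m y)" for y
  have m: "arr_over C u (p1 (v \<cdot> u) y) (m y) (p1 v y)" "p2 v y \<cdot> m y = p2 (v \<cdot> u) y"
    and s: "arr_over C (Ide C (Dom C u)) (p1 (v \<cdot> u) y) (s y) (p1 u (p1 v y))"
      "p2 u (p1 v y) \<cdot> s y = m y" "p1 u (p1 v y) \<cdot> s y = p1 (v \<cdot> u) y" and iso_s: "iso C (s y)"
    and ca_y: "comp_action C pb u v b a (p1 (v \<cdot> u) y) (p2 (v \<cdot> u) y) y = b (p1 v y) (p2 v y) y \<cdot>
      (a (p1 u (p1 v y)) (p2 u (p1 v y)) (p1 v y) \<cdot> mor P (p1 (v \<cdot> u) y) (s y) (p1 u (p1 v y)))"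
    if y: "y \<in> Arr C" "Cod C y = Cod C v" for y
  proof -
    note [simp] = y
    have wh: "arr_over C (v \<cdot> u) (p1 (v \<cdot> u) y) (p2 (v \<cdot> u) y) y" by (simp add: arr_over_projection)
    note fac = arr_over_factor[OF wh actsD(1)[OF a] actsD(1)[OF b] uv, folded m_def]
    show m: "arr_over C u (p1 (v \<cdot> u) y) (m y) (p1 v y)" and m2: "p2 v y \<cdot> m y = p2 (v \<cdot> u) y"
      using fac by simp_all
    show "arr_over C (Ide C (Dom C u)) (p1 (v \<cdot> u) y) (s y) (p1 u (p1 v y))"
      "p2 u (p1 v y) \<cdot> s y = m y" "p1 u (p1 v y) \<cdot> s y = p1 (v \<cdot> u) y"
      unfolding s_def by (rule arr_over_pairing[OF m])+
    \<comment> \<open>Cancelling the chosen pullback of \<open>v\<close> and \<open>y\<close> shows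
      that \<open>(v u)^* y\<close> is also a pullback of \<open>v^* y\<close> along
      \<open>u\<close>, hence isomorphic to the chosen one.\<close>
    have "is_pullback C (p1 v y) u (m y) (p1 (v \<cdot> u) y)"
    proof (rule is_pullback_cancel[OF is_pullback_sym[OF chosen_pullback[of v y]]])
      show "is_pullback C y (v \<cdot> u) (p2 v y \<cdot> m y) (p1 (v \<cdot> u) y)"
        unfolding m2 by (rule is_pullback_sym[OF chosen_pullback]) simp_all
    qed (use arr_overD[OF m] in simp_all)
    then show "iso C (s y)"
      unfolding s_def by (rule iso_pairing[OF is_pullback_sym])
    have "comp_action C pb u v b a (p1 (v \<cdot> u) y) (p2 v y \<cdot> m y) y =
      b (p1 v y) (p2 v y) y \<cdot> a (p1 (v \<cdot> u) y) (m y) (p1 v y)"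
      by (rule comp_action_acts_eq[OF a b uv fac(1,2)])
    then show "comp_action C pb u v b a (p1 (v \<cdot> u) y) (p2 (v \<cdot> u) y) y = b (p1 v y) (p2 v y) y \<cdot>
      (a (p1 u (p1 v y)) (p2 u (p1 v y)) (p1 v y) \<cdot> mor P (p1 (v \<cdot> u) y) (s y) (p1 u (p1 v y)))"
      unfolding m2 s_def acts_canonical[OF a m] .
  qed
  have "is_pullback C (mor S z g z') (b (p1 v z') (p2 v z') z') (b (p1 v z) (p2 v z) z) (mor R (p1 v
    z) k (p1 v z'))"
    using cb g unfolding cart_action_def k_def by blast
  \<comment> \<open>The pasted square is the one for iterated pullbacks; what follows replaces these
    by pullbacks along \<open>v \<cdot> u\<close>.\<close>
  from is_pullback_paste[OF this] have 1: "is_pullback C (mor S z g z')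
      (b (p1 v z') (p2 v z') z' \<cdot> a (p1 u (p1 v z')) (p2 u (p1 v z')) (p1 v z'))
      (b (p1 v z) (p2 v z) z \<cdot> a (p1 u (p1 v z)) (p2 u (p1 v z)) (p1 v z))
      (mor P (p1 u (p1 v z)) l (p1 u (p1 v z')))"
    using ca vg unfolding cart_action_def l_def by blast
  have over: "arr_over C v (onO R (p1 v y)) (b (p1 v y) (p2 v y) y) (onO S y)"
    "arr_over C u (onO P (p1 u (p1 v y))) (a (p1 u (p1 v y)) (p2 u (p1 v y)) (p1 v y)) (onO R (p1 v
      y))"
    if "y \<in> Arr C" "Cod C y = Cod C v" for y
    using acts_over[OF b arr_over_projection[of v y]] acts_over[OF a arr_over_projection[of u "p1 v
      y"]] that by simp_all
  \<comment> \<open>Naturality of the comparison \<open>s\<close>, checked on the projections of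
    both chosen pullbacks.\<close>
  have "l \<cdot> s z = s z' \<cdot> n"
  proof -
    note N = arr_over_pairing(2,3)[OF arr_over_pull[OF _ gvu], folded n_def]
      and L = arr_over_pairing(2,3)[OF arr_over_pull[OF _ vg], folded l_def]
      and K = arr_over_pairing(2,3)[OF arr_over_pull[OF _ g], folded k_def]
    note [simp] = arr_overD(1-8)[OF l] arr_overD(1-8)[OF n] arr_overD(1-8)[OF s(1)[of z]]
      arr_overD(1-8)[OF s(1)[of z']] arr_overD(1-8)[OF vg] arr_overD(1-8)[OF m(1)[of z]]
        arr_overD(1-8)[OF m(1)[of z']]
    have pm: "p1 v y \<cdot> m y = u \<cdot> p1 (v \<cdot> u) y" if "y \<in> Arr C" "Cod C y = Cod C v" for y
      using arr_overD(9)[OF m(1)[OF that]] .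
    have km: "k \<cdot> m z = m z' \<cdot> n"
    proof (rule projections_mono[of v z'])
      have "p1 v z' \<cdot> (k \<cdot> m z) = p1 v z \<cdot> m z"
        using K by (simp add: Comp_reassoc[OF K(2)])
      also have "\<dots> = (u \<cdot> p1 (v \<cdot> u) z') \<cdot> n"
        using N by (simp add: pm)
      also have "\<dots> = p1 v z' \<cdot> (m z' \<cdot> n)"
        unfolding pm[of z', simplified, symmetric] by simp
      finally show "p1 v z' \<cdot> (k \<cdot> m z) = p1 v z' \<cdot> (m z' \<cdot> n)" .
      show "p2 v z' \<cdot> (k \<cdot> m z) = p2 v z' \<cdot> (m z' \<cdot> n)"
        using N by (simp add: Comp_reassoc[OF K(1)] Comp_reassoc[OF m(2)[of z']] m(2)[of z])
    qed simp_all
    show ?thesis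
    proof (rule projections_mono[of u "p1 v z'"])
      show "p1 u (p1 v z') \<cdot> (l \<cdot> s z) = p1 u (p1 v z') \<cdot> (s z' \<cdot> n)"
        using N by (simp add: Comp_reassoc[OF L(2)] Comp_reassoc[OF s(3)[of z']] s(3)[of z])
      show "p2 u (p1 v z') \<cdot> (l \<cdot> s z) = p2 u (p1 v z') \<cdot> (s z' \<cdot> n)"
        by (simp add: Comp_reassoc[OF L(1)] Comp_reassoc[OF s(2)[of z']] s(2)[of z] km)
    qed simp_all
  qed
  then have e: "mor P (p1 u (p1 v z)) l (p1 u (p1 v z')) \<cdot> mor P (p1 (v
    \<cdot> u) z) (s z) (p1 u (p1 v z)) =
      mor P (p1 (v \<cdot> u) z') (s z') (p1 u (p1 v z')) \<cdot> mor P (p1 (v \<cdot> u) z) n (p1 (v \<cdot> u) z')"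
    using slice_functor_comp[OF P' s(1)[of z] l] slice_functor_comp[OF P' n s(1)[of z']] by simp
  note Pm = arr_overD(1-8)[OF slice_functor_mor[OF P' l]] arr_overD(1-8)[OF slice_functor_mor[OF P'
    n]]
    arr_overD(1-8)[OF slice_functor_mor[OF P' s(1)[of z]]] arr_overD(1-8)[OF slice_functor_mor[OF P'
      s(1)[of z']]]
  have "is_pullback C (mor P (p1 (v
    \<cdot> u) z') (s z') (p1 u (p1 v z'))) (mor P (p1 u (p1 v z)) l (p1 u (p1 v z')))
    (mor P (p1 (v \<cdot> u) z) n (p1 (v \<cdot> u) z')) (mor P (p1 (v \<cdot> u) z) (s z) (p1 u (p1 v z)))"
    by (rule is_pullback_parallel_isos)
      (use e Pm in \<open>simp_all add: iso_mor[OF P' P'(2) s(1) iso_s]\<close>)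
  from is_pullback_paste[OF 1 is_pullback_sym[OF this]]
  show "is_pullback C (mor S z g z') (comp_action C pb u v b a (p1 (v \<cdot> u) z') (p2 (v \<cdot> u) z') z')
        (comp_action C pb u v b a (p1 (v \<cdot> u) z) (p2 (v \<cdot> u) z) z)
        (mor P (p1 (v \<cdot> u) z) (pr (v \<cdot> u) z' (p1 (v \<cdot> u) z) (g \<cdot> p2 (v \<cdot> u) z)) (p1 (v \<cdot> u) z'))"
    using arr_overD(1-8)[OF over(1)[of z]] arr_overD(1-8)[OF over(1)[of z']]
      arr_overD(1-8)[OF over(2)[of z]] arr_overD(1-8)[OF over(2)[of z']] Pm
    by (simp add: ca_y n_def)
qed

lemma Cart_simps [simp]:
  "Dom (Cart C pb) = Dom (Exp C pb)" "Cod (Cart C pb) = Cod (Exp C pb)" "Ide (Cart C pb) =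
    Ide (Exp C pb)"
  "Comp (Cart C pb) = Comp (Exp C pb)"
  by (simp_all add: Cart_def)

lemma subcategory_Cart: "subcategory (Cart C pb) (Exp C pb)"
proof -
  interpret E: category "Exp C pb" by (rule category_Exp)
  have O: "Obj (Cart C pb) \<subseteq> Obj (Exp C pb)" and A: "Arr (Cart C pb) \<subseteq> Arr (Exp C pb)"
    by (auto simp: Cart_def Exp_def)
  have H: "Hom (Cart C pb) X Y \<subseteq> Hom (Exp C pb) X Y" for X Y
    using A by (auto simp: Hom_def)
  have "category (Cart C pb)"
  proof
    fix F assume F: "F \<in> Arr (Cart C pb)"
    then show "Dom (Cart C pb) F \<in> Obj (Cart C pb)" "Cod (Cart C pb) F \<in> Obj (Cart C pb)"
      by (auto elim: Arr_CartE)
    show "Ide (Cart C pb) (Cod (Cart C pb) F) \<cdot>\<^bsub>Cart C pb\<^esub> F =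
      F" "F \<cdot>\<^bsub>Cart C pb\<^esub> Ide (Cart C pb) (Dom (Cart C pb) F) = F"
      using F A by auto
  next
    fix X assume X: "X \<in> Obj (Cart C pb)"
    obtain U P where XP: "X = (U, P)" by (cases X)
    have P: "(U, P) \<in> exp_objs C" using X by (simp add: XP Obj_Cart)
    show "Ide (Cart C pb) X \<in> Hom (Cart C pb) X X"
      using X Arr_Cart[OF acts_ide[OF P]] cart_action_ide[OF P] exp_objsD(1)[OF P]
      by (simp add: XP Ide_Exp[OF P] Hom_def)
  next
    fix F G X Y Z assume FG: "F \<in> Hom (Cart C pb) X Y" "G \<in> Hom (Cart C pb) Y Z"
    then have F: "F \<in> Arr (Cart C pb)" "Cod (Exp C pb) F = Y" "Dom (Exp C pb) F = X"
      and G: "G \<in> Arr (Cart C pb)" "Dom (Exp C pb) G = Y" "Cod (Exp C pb) G = Z"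
        by (simp_all add: Hom_def)
    obtain P u R a where 1: "F = oa P u R a" and a: "acts P u R a" "cart_action P u R a" "(Dom C u,
      P) \<in> Obj (Cart C pb)"
      using F(1) by (rule Arr_CartE)
    obtain R' v S b where 2: "G = oa R' v S b" and b: "acts R' v S b" "cart_action R' v S b" "(Cod C
      v, S) \<in> Obj (Cart C pb)"
      using G(1) by (rule Arr_CartE)
    have [simp]: "R' = R" and uv: "Dom C v = Cod C u" using F(2) G(2) by (auto simp: 1 2)
    note b = b[simplified] and c = Exp_comp[OF a(1) b(1)[simplified] uv]
    show "G \<cdot>\<^bsub>Cart C pb\<^esub> F \<in> Hom (Cart C pb) X Z"
      using F G a(3) b(3) Arr_Cart[OF c(2)] cart_action_comp[OF a(1) b(1) uv a(2) b(2)] c(1) uv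
        actsD(1)[OF a(1)] actsD(1)[OF b(1)]
      by (simp add: 1 2 Hom_def)
  next
    fix F G K W X Y Z assume "F \<in> Hom (Cart C pb) W X" "G \<in> Hom (Cart C pb) X Y" "K \<in> Hom (Cart C
      pb) Y Z"
    then have "F \<in> Hom (Exp C pb) W X" "G \<in> Hom (Exp C pb) X Y" "K \<in> Hom (Exp C pb) Y Z" using H
      by blast+
    then show "(K \<cdot>\<^bsub>Cart C pb\<^esub> G) \<cdot>\<^bsub>Cart C pb\<^esub> F = K \<cdot>\<^bsub>Cart C pb\<^esub> (G \<cdot>\<^bsub>Cart C pb\<^esub> F)"
      using E.Comp_assoc by simp
  qed
  then show ?thesis
    unfolding subcategory_def using O A category_Exp by simp
qed

section \<open>Vertical arrows\<close>

definition vertical_nat :: "'o \<Rightarrow> 'a slice_ftr \<Rightarrow> 'a slice_ftr \<Rightarrow> ('a \<Rightarrow> 'a) \<Rightarrow> bool" where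
  "vertical_nat U P R s \<longleftrightarrow> (U, P) \<in> exp_objs C \<and> (U, R) \<in> exp_objs C \<and>
     (\<forall>d \<in> Arr C. Cod C d = U \<longrightarrow> arr_over C (Ide C U) (onO P d) (s d) (onO R d)) \<and>
     (\<forall>x f y. arr_over C (Ide C U) x f y \<longrightarrow> s y \<cdot> mor P x f y = mor R x f y \<cdot> s x)"

text \<open>\<open>\<phi>0\<close>, \<open>\<phi>2\<close> and the images under \<open>rep\<close>
  of the coherence arrows of T-graphs all have this form. The lemmas of this section compute
  identities, composites and tensors of such arrows componentwise, which turns the coherence laws of
  \<open>rep\<close> into equations in \<open>C\<close>.\<close>

definition vert :: "'o \<Rightarrow> 'a slice_ftr \<Rightarrow> 'a slice_ftr \<Rightarrow> ('a \<Rightarrow> 'a) \<Rightarrow> ('o, 'a) exp_arr" where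
  "vert U P R s = oa P (Ide C U) R (\<lambda>x f z. s z \<cdot> mor P x f z)"

lemma vertical_natD:
  assumes "vertical_nat U P R s"
  shows "U \<in> Obj C" "(U, P) \<in> exp_objs C" "(U, R) \<in> exp_objs C"
    "d \<in> Arr C \<Longrightarrow> Cod C d = U \<Longrightarrow> arr_over C (Ide C U) (onO P d) (s d) (onO R d)"
    "arr_over C (Ide C U) x f y \<Longrightarrow> s y \<cdot> mor P x f y = mor R x f y \<cdot> s x"
    "is_functor (slice C U) (slice C U) P" "is_functor (slice C U) (slice C U) R"
  using assms exp_objsD unfolding vertical_nat_def by blast+

lemma vert_acts:
  assumes "vertical_nat U P R s"
  shows "acts P (Ide C U) R (\<lambda>x f z. s z \<cdot> mor P x f z)"
  using vertical_natD[OF assms] by (intro acts_vert)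

lemma vert_cong:
  assumes "\<And>z. z \<in> Arr C \<Longrightarrow> Cod C z = U \<Longrightarrow> s z = t z" "U \<in> Obj C"
  shows "vert U P R s = vert U P R t"
  unfolding vert_def using assms by (intro of_action_cong) (simp_all add: arr_overD(3,6))

lemma exp_vert_vert:
  assumes s: "vertical_nat U P R s"
    and "\<And>d. d \<in> Arr C \<Longrightarrow> Cod C d = U \<Longrightarrow> \<sigma> d = (onO P d, s d, onO R d)"
  shows "exp_vert C pb U P \<sigma> R = vert U P R s"
  unfolding vert_def by (rule exp_vert_eq[OF vertical_natD(2-4)[OF s] assms(2)])

lemma vert_comp_left:
  assumes s: "vertical_nat (Cod C u) R S s" and a: "acts P u R a"
  shows "vert (Cod C u) R S s \<cdot>\<^bsub>Exp C pb\<^esub> oa P u R a = oa P u S (\<lambda>x f z. s z \<cdot> a x f z)"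
proof -
  note [simp] = actsD(1)[OF a]
  have c: "Dom C (Ide C (Cod C u)) = Cod C u" by simp
  note S = vertical_natD[OF s]
  have "comp_action C pb u (Ide C (Cod C u)) (\<lambda>x f z. s z \<cdot> mor R x f z) a x f z = s z \<cdot> a x f z"
    if f: "arr_over C u x f z" for x f z
  proof -
    note [simp] = arr_overD(1-8)[OF f] arr_overD(1-8)[OF acts_over[OF a f]] arr_overD(1-8)[OF
      S(4)[of z]]
    have i: "arr_over C (Ide C (Cod C u)) z (Ide C (Dom C z)) z" by (intro arr_over_ide) simp_all
    show ?thesis
      using comp_action_acts_eq[OF a vert_acts[OF s] c f i]
        by (simp add: slice_functor_ide[OF S(6,1)])
  qed
  then show ?thesis
    unfolding vert_def Exp_comp(1)[OF a vert_acts[OF s] c] by simp (rule of_action_cong, simp_all)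
qed

lemma vert_comp_right:
  assumes s: "vertical_nat (Dom C u) P R s" and b: "acts R u S b"
  shows "oa R u S b \<cdot>\<^bsub>Exp C pb\<^esub> vert (Dom C u) P R s = oa P u S (\<lambda>x f z. b x f z \<cdot> s x)"
proof -
  note [simp] = actsD(1)[OF b]
  have c: "Dom C u = Cod C (Ide C (Dom C u))" by simp
  note S = vertical_natD[OF s]
  have "comp_action C pb (Ide C (Dom C u)) u b (\<lambda>x f z. s z \<cdot> mor P x f z) x f z = b x f z \<cdot> s x"
    if f: "arr_over C u x f z" for x f z
  proof -
    note [simp] = arr_overD(1-8)[OF f] arr_overD(1-8)[OF acts_over[OF b f]] arr_overD(1-8)[OF
      S(4)[of x]]
    have i: "arr_over C (Ide C (Dom C u)) x (Ide C (Dom C x)) x" by (intro arr_over_ide) simp_all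
    show ?thesis
      using comp_action_acts_eq[OF vert_acts[OF s] b c i f]
        by (simp add: slice_functor_ide[OF S(6,1)])
  qed
  then show ?thesis
    unfolding vert_def Exp_comp(1)[OF vert_acts[OF s] b c] by simp (rule of_action_cong, simp_all)
qed

lemma vertical_nat_comp:
  assumes s: "vertical_nat U P R s" and t: "vertical_nat U R S t"
  shows "vertical_nat U P S (\<lambda>z. t z \<cdot> s z)"
    and "vert U R S t \<cdot>\<^bsub>Exp C pb\<^esub> vert U P R s = vert U P S (\<lambda>z. t z \<cdot> s z)"
proof -
  note S = vertical_natD[OF s] and Tt = vertical_natD[OF t]
  note [simp] = S(1)
  have nat: "(t y \<cdot> s y) \<cdot> mor P x f y =
    mor S x f y \<cdot> (t x \<cdot> s x)" if f: "arr_over C (Ide C U) x f y" for x f y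
  proof -
    note [simp] = arr_overD(1-8)[OF f] arr_overD(1-8)[OF S(4)[of x]] arr_overD(1-8)[OF S(4)[of y]]
      arr_overD(1-8)[OF Tt(4)[of x]] arr_overD(1-8)[OF Tt(4)[of y]] arr_overD(1-8)[OF
        slice_functor_mor[OF S(6,1) f]]
      arr_overD(1-8)[OF slice_functor_mor[OF S(7,1) f]] arr_overD(1-8)[OF slice_functor_mor[OF
        Tt(7,1) f]]
    show ?thesis by (simp add: S(5)[OF f] Comp_reassoc[OF Tt(5)[OF f]])
  qed
  show "vertical_nat U P S (\<lambda>z. t z \<cdot> s z)"
    using arr_over_comp_left[OF S(4)] Tt(4) S(2) Tt(3) nat by (simp add: vertical_nat_def)
  have "vert U R S t \<cdot>\<^bsub>Exp C pb\<^esub> vert U P R s =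
    oa P (Ide C U) S (\<lambda>x f z. t z \<cdot> (s z \<cdot> mor P x f z))"
    using vert_comp_left[of "Ide C U" R S t] t vert_acts[OF s] by (simp add: vert_def)
  also have "\<dots> = vert U P S (\<lambda>z. t z \<cdot> s z)"
    unfolding vert_def
  proof (rule of_action_cong)
    fix x f z assume f: "arr_over C (Ide C U) x f z"
    note [simp] = arr_overD(1-8)[OF f] arr_overD(1-8)[OF S(4)[of z]]
      arr_overD(1-8)[OF Tt(4)[of z]] arr_overD(1-8)[OF slice_functor_mor[OF S(6,1) f]]
    show "t z \<cdot> (s z \<cdot> mor P x f z) = (t z \<cdot> s z) \<cdot> mor P x f z" by simp
  qed simp
  finally show "vert U R S t \<cdot>\<^bsub>Exp C pb\<^esub> vert U P R s = vert U P S (\<lambda>z. t z \<cdot> s z)" .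
qed

lemma vert_ide:
  assumes P: "(U, P) \<in> exp_objs C"
  shows "vertical_nat U P P (\<lambda>z. Ide C (Dom C (onO P z)))"
    and "Ide (Exp C pb) (U, P) = vert U P P (\<lambda>z. Ide C (Dom C (onO P z)))"
proof -
  note P' = exp_objsD(2,1)[OF P]
  note [simp] = P'(2) slice_functor_obj[OF P']
  have "Ide C (Dom C (onO P y)) \<cdot> mor P x f y = mor P x f y \<and>
    mor P x f y \<cdot> Ide C (Dom C (onO P x)) = mor P x f y"
    if f: "arr_over C (Ide C U) x f y" for x f y
    using arr_overD(1-8)[OF slice_functor_mor[OF P' f]] by simp
  then show "vertical_nat U P P (\<lambda>z. Ide C (Dom C (onO P z)))"
    and "Ide (Exp C pb) (U, P) = vert U P P (\<lambda>z. Ide C (Dom C (onO P z)))"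
    using P unfolding vert_def Ide_Exp[OF P]
    by (auto simp: vertical_nat_def intro!: arr_over_ide of_action_cong)
qed

lemma vert_in_Hom:
  assumes "vertical_nat U P R s"
  shows "vert U P R s \<in> vertical (Exp_lmf C pb) (U, P) (U, R)"
  using of_action_in_Arr[OF vert_acts[OF assms]] vertical_natD(1)[OF assms]
  by (simp add: vertical_def Hom_def vert_def)

lemma iso_vert:
  assumes s: "vertical_nat U P R s" and iso: "\<And>z. z \<in> Arr C \<Longrightarrow> Cod C z = U \<Longrightarrow> iso C (s z)"
  shows "iso (Exp C pb) (vert U P R s)"
proof -
  interpret E: category "Exp C pb" by (rule category_Exp)
  note S = vertical_natD[OF s]
  note [simp] = S(1)
  \<comment> \<open>The implication under the existential makes the statement total in
    \<open>z\<close>, as \<open>choice\<close> needs.\<close>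
  have "\<forall>z. \<exists>j. z \<in> Arr C \<and> Cod C z = U \<longrightarrow> (j \<in> Arr C \<and> Dom C j = Dom C (onO R z) \<and>
    Cod C j = Dom C (onO P z) \<and>
       j \<cdot> s z = Ide C (Dom C (onO P z)) \<and> s z \<cdot> j = Ide C (Dom C (onO R z)))"
  proof (intro allI)
    fix z show "\<exists>j. z \<in> Arr C \<and> Cod C z = U \<longrightarrow> (j \<in> Arr C \<and> Dom C j = Dom C (onO R z) \<and>
      Cod C j = Dom C (onO P z) \<and>
       j \<cdot> s z = Ide C (Dom C (onO P z)) \<and> s z \<cdot> j = Ide C (Dom C (onO R z)))"
    proof (cases "z \<in> Arr C \<and> Cod C z = U")
      case True
      then have "iso C (s z)" using iso by blast
      then obtain j where "j \<in> Arr C" "Dom C j = Cod C (s z)" "Cod C j = Dom C (s z)"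
        "j \<cdot> s z = Ide C (Dom C (s z))" "s z \<cdot> j = Ide C (Cod C (s z))"
        by (rule isoE)
      then show ?thesis using arr_overD(7,8)[OF S(4)[of z]] True by (intro exI[of _ j]) simp
    qed blast
  qed
  then obtain i where i': "\<forall>z. z \<in> Arr C \<and> Cod C z = U \<longrightarrow> (i z \<in> Arr C \<and>
    Dom C (i z) = Dom C (onO R z) \<and>
     Cod C (i z) = Dom C (onO P z) \<and> i z \<cdot> s z = Ide C (Dom C (onO P z)) \<and>
       s z \<cdot> i z = Ide C (Dom C (onO R z)))"
    by (rule choice[THEN exE])
  have i: "i z \<in> Arr C" "Dom C (i z) = Dom C (onO R z)" "Cod C (i z) = Dom C (onO P z)"
    "i z \<cdot> s z = Ide C (Dom C (onO P z))" "s z \<cdot> i z = Ide C (Dom C (onO R z))"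
    if "z \<in> Arr C" "Cod C z = U" for z using i' that by blast+
  have "vertical_nat U R P i"
    unfolding vertical_nat_def
  proof (intro conjI ballI allI impI S(2,3))
    fix d assume d: "d \<in> Arr C" "Cod C d = U"
    note [simp] = d arr_overD(1-8)[OF S(4)[of d]] i
    have e: "onO R d \<cdot> s d = onO P d" using arr_overD(9)[OF S(4)[OF d]] by simp
    have "onO P d \<cdot> i d = (onO R d \<cdot> s d) \<cdot> i d" by (simp only: e)
    also have "\<dots> = onO R d" by simp
    finally show "arr_over C (Ide C U) (onO R d) (i d) (onO P d)"
      by (intro arr_overI) simp_all
  next
    fix x f y assume f: "arr_over C (Ide C U) x f y"
    note [simp] = arr_overD(1-8)[OF f] arr_overD(1-8)[OF S(4)[of x]] arr_overD(1-8)[OF S(4)[of y]]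
      arr_overD(1-8)[OF slice_functor_mor[OF S(6,1) f]] arr_overD(1-8)[OF slice_functor_mor[OF
        S(7,1) f]] i
    have "i y \<cdot> mor R x f y = i y \<cdot> ((mor R x f y \<cdot> s x) \<cdot> i x)" by simp
    also have "\<dots> = (i y \<cdot> s y) \<cdot> (mor P x f y \<cdot> i x)"
      unfolding S(5)[OF f, symmetric] by (simp del: i(4,5))
    also have "\<dots> = mor P x f y \<cdot> i x" by simp
    finally show "i y \<cdot> mor R x f y = mor P x f y \<cdot> i x" .
  qed
  note I = this
  have "vert U R P i \<cdot>\<^bsub>Exp C pb\<^esub> vert U P R s = Ide (Exp C pb) (U, P)"
    "vert U P R s \<cdot>\<^bsub>Exp C pb\<^esub> vert U R P i = Ide (Exp C pb) (U, R)"
    unfolding vertical_nat_comp(2)[OF s I] vertical_nat_comp(2)[OF I s] vert_ide(2)[OF S(2)]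
      vert_ide(2)[OF S(3)]
    using i by (auto intro!: vert_cong)
  then show ?thesis
    using vert_in_Hom[OF s] vert_in_Hom[OF I]
    by (intro E.isoI[of _ "vert U R P i"]) (simp_all add: vertical_def Hom_def)
qed

lemma vert_tens_left:
  assumes s: "vertical_nat U P R s" and Q: "(U, Q) \<in> exp_objs C"
  shows "vertical_nat U (comp_ftr (slice C U) P Q) (comp_ftr (slice C U) R Q) (\<lambda>z. s (onO Q z))"
    and "exp_tensA C (vert U P R s, Ide (Exp C pb) (U, Q)) =
      vert U (comp_ftr (slice C U) P Q) (comp_ftr (slice C U) R Q) (\<lambda>z. s (onO Q z))"
proof -
  note S = vertical_natD[OF s] and Q' = exp_objsD(2,1)[OF Q]
  note [simp] = S(1) slice_functor_obj[OF Q']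
  show "vertical_nat U (comp_ftr (slice C U) P Q) (comp_ftr (slice C U) R Q) (\<lambda>z. s (onO Q z))"
    unfolding vertical_nat_def
    using exp_objs_comp[OF S(2) Q] exp_objs_comp[OF S(3) Q] S(4) S(5)[OF slice_functor_mor[OF Q']]
      Q'(1) by simp
  show "exp_tensA C (vert U P R s, Ide (Exp C pb) (U, Q)) =
      vert U (comp_ftr (slice C U) P Q) (comp_ftr (slice C U) R Q) (\<lambda>z. s (onO Q z))"
    unfolding vert_def Ide_Exp[OF Q] exp_tensA_eq[OF vert_acts[OF s] acts_ide[OF Q]]
    using Q'(1) by simp (rule of_action_cong, simp_all)
qed

text \<open>Whiskering by \<open>P\<close>. With \<open>vert_tens_left\<close> and
  \<open>vertical_nat_comp\<close> it reduces composites of coherence arrows to composites of their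
  components.\<close>

lemma vert_tens_right:
  assumes s: "vertical_nat U Q R s" and P: "(U, P) \<in> exp_objs C"
  shows "vertical_nat U (comp_ftr (slice C U) P Q) (comp_ftr (slice C U) P R) (\<lambda>z. mor P (onO Q z)
    (s z) (onO R z))"
    and "exp_tensA C (Ide (Exp C pb) (U, P), vert U Q R s) =
      vert U (comp_ftr (slice C U) P Q) (comp_ftr (slice C U) P R) (\<lambda>z. mor P (onO Q z) (s z) (onO R
        z))"
proof -
  note S = vertical_natD[OF s] and P' = exp_objsD(2,1)[OF P]
  note [simp] = S(1) slice_functor_obj[OF P'] slice_functor_obj[OF S(6,1)] slice_functor_obj[OF
    S(7,1)]
  have e: "mor P (onO Q x) (s z \<cdot> mor Q x f z) (onO R z) =
       mor P (onO Q z) (s z) (onO R z) \<cdot> mor P (onO Q x) (mor Q x f z) (onO Q z)"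
    "mor P (onO Q x) (mor R x f z \<cdot> s x) (onO R z) =
       mor P (onO R x) (mor R x f z) (onO R z) \<cdot> mor P (onO Q x) (s x) (onO R x)"
    if f: "arr_over C (Ide C U) x f z" for x f z
    using slice_functor_comp[OF P' slice_functor_mor[OF S(6,1) f] S(4)] slice_functor_comp[OF P'
      S(4) slice_functor_mor[OF S(7,1) f]] arr_overD(2,3,5,6)[OF f]
    by simp_all
  show "vertical_nat U (comp_ftr (slice C U) P Q) (comp_ftr (slice C U) P R) (\<lambda>z. mor P (onO Q z) (s
    z) (onO R z))"
    unfolding vertical_nat_def
    using exp_objs_comp[OF P S(2)] exp_objs_comp[OF P S(3)] slice_functor_mor[OF P' S(4)] S(6,7)
      e(1) e(2)[symmetric] S(5)
    by simp
  show "exp_tensA C (Ide (Exp C pb) (U, P), vert U Q R s) =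
      vert U (comp_ftr (slice C U) P Q) (comp_ftr (slice C U) P R) (\<lambda>z. mor P (onO Q z) (s z) (onO R
        z))"
    unfolding vert_def Ide_Exp[OF P] exp_tensA_eq[OF acts_ide[OF P] vert_acts[OF s]]
    using S(6) e(1) by simp (rule of_action_cong, simp_all)
qed

end

section \<open>The star product\<close>

locale cartesian_monad_with_pullbacks = pullback_category C pb + cartesian_monad C T \<eta> \<mu>
  for C :: "('o, 'a) cat" (structure) and pb :: "'a \<Rightarrow> 'a \<Rightarrow> 'a \<times> 'a"
    and T :: "('o, 'a, 'o, 'a) ftr" and \<eta> \<mu> :: "'o \<Rightarrow> 'a"
begin

abbreviation "graphs \<equiv> gph_objs C T"
abbreviation "q1 \<equiv> star_pr1 pb T"
abbreviation "q2 \<equiv> star_pr2 pb T"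
abbreviation "sp \<equiv> star_pairing C pb T"
abbreviation "sO \<equiv> starO C pb T"
abbreviation "tO \<equiv> gph_tensO C pb T \<mu>"
abbreviation "gI \<equiv> gph_unitO C \<eta>"

lemma T_simps [simp]:
  "x \<in> Obj C \<Longrightarrow> onO T x \<in> Obj C"
  "f \<in> Arr C \<Longrightarrow> onA T f \<in> Arr C"
  "f \<in> Arr C \<Longrightarrow> Dom C (onA T f) = onO T (Dom C f)"
  "f \<in> Arr C \<Longrightarrow> Cod C (onA T f) = onO T (Cod C f)"
  "x \<in> Obj C \<Longrightarrow> onA T (Ide C x) = Ide C (onO T x)"
  "f \<in> Arr C \<Longrightarrow> g \<in> Arr C \<Longrightarrow> Dom C g = Cod C f \<Longrightarrow> onA T (g \<cdot> f) = onA T g \<cdot> onA T f"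
  using T.onO_Obj T.onA_Hom[of f "Dom C f" "Cod C f"] T.onA_Ide
    T.onA_Comp[of f "Dom C f" "Cod C f" g "Cod C g"]
  by (auto simp: Hom_def)

text \<open>As a simplification rule, functoriality of \<open>T\<close> breaks
  \<open>onA T (g \<cdot> f)\<close> apart, so an equation for \<open>g \<cdot> f\<close> has to be
  supplied in its image under \<open>T\<close>.\<close>

lemma T_Comp_reassoc:
  assumes "g \<cdot> f = h" "f \<in> Arr C" "g \<in> Arr C" "Dom C g = Cod C f"
  shows "onA T g \<cdot> onA T f = onA T h"
    and "k \<in> Arr C \<Longrightarrow> Cod C k = onO T (Dom C f) \<Longrightarrow> onA T g \<cdot> (onA T f \<cdot> k) = onA T h \<cdot> k"
proof -
  show e: "onA T g \<cdot> onA T f = onA T h" using assms(2-4) unfolding assms(1)[symmetric] by simp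
  show "k \<in> Arr C \<Longrightarrow> Cod C k = onO T (Dom C f) \<Longrightarrow> onA T g \<cdot> (onA T f \<cdot> k) = onA T h \<cdot> k"
    by (rule Comp_reassoc[OF e]) (use assms(2-4) in simp_all)
qed

lemma eta_simps [simp]:
  "x \<in> Obj C \<Longrightarrow> \<eta> x \<in> Arr C" "x \<in> Obj C \<Longrightarrow> Dom C (\<eta> x) = x" "x \<in> Obj C \<Longrightarrow> Cod C (\<eta> x) = onO T x"
  using unit.component[of x] by (auto simp: Hom_def id_ftr_def)

lemma mu_simps [simp]:
  "x \<in> Obj C \<Longrightarrow> \<mu> x \<in> Arr C" "x \<in> Obj C \<Longrightarrow> Dom C (\<mu> x) = onO T (onO T x)"
  "x \<in> Obj C \<Longrightarrow> Cod C (\<mu> x) = onO T x"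
  using mult.component[of x] by (auto simp: Hom_def comp_ftr_def)

text \<open>As simplification rules, naturality and the monad laws move \<open>\<mu>\<close> and \<open>\<eta>\<close>
  to the left.\<close>

lemma eta_natural [simp]:
  assumes "f \<in> Arr C" "Dom C f = x"
  shows "onA T f \<cdot> \<eta> x = \<eta> (Cod C f) \<cdot> f"
    and "k \<in> Arr C \<Longrightarrow> Cod C k = x \<Longrightarrow> onA T f \<cdot> (\<eta> x \<cdot> k) = \<eta> (Cod C f) \<cdot> (f \<cdot> k)"
proof -
  show e: "onA T f \<cdot> \<eta> x = \<eta> (Cod C f) \<cdot> f"
    using unit.natural[of f "Dom C f" "Cod C f"] assms by (simp add: Hom_def id_ftr_def)
  show "k \<in> Arr C \<Longrightarrow> Cod C k = x \<Longrightarrow> onA T f \<cdot> (\<eta> x \<cdot> k) = \<eta> (Cod C f) \<cdot> (f \<cdot> k)"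
    using Comp_reassoc[OF e, of k] assms by (simp add: Dom_Obj[OF assms(1), unfolded assms(2)])
qed

lemma mu_natural [simp]:
  assumes "f \<in> Arr C" "Dom C f = x"
  shows "onA T f \<cdot> \<mu> x = \<mu> (Cod C f) \<cdot> onA T (onA T f)"
    and "k \<in> Arr C \<Longrightarrow> Cod C k = onO T (onO T x) \<Longrightarrow>
      onA T f \<cdot> (\<mu> x \<cdot> k) = \<mu> (Cod C f) \<cdot> (onA T (onA T f) \<cdot> k)"
proof -
  show e: "onA T f \<cdot> \<mu> x = \<mu> (Cod C f) \<cdot> onA T (onA T f)"
    using mult.natural[of f "Dom C f" "Cod C f"] assms by (simp add: Hom_def comp_ftr_def)
  show "k \<in> Arr C \<Longrightarrow> Cod C k = onO T (onO T x) \<Longrightarrow>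
      onA T f \<cdot> (\<mu> x \<cdot> k) = \<mu> (Cod C f) \<cdot> (onA T (onA T f) \<cdot> k)"
    using Comp_reassoc[OF e, of k] assms by (simp add: Dom_Obj[OF assms(1), unfolded assms(2)])
qed

lemma monad_simps [simp]:
  assumes x: "x \<in> Obj C"
  shows "\<mu> x \<cdot> \<eta> (onO T x) = Ide C (onO T x)" "\<mu> x \<cdot> onA T (\<eta> x) = Ide C (onO T x)"
    "\<mu> x \<cdot> onA T (\<mu> x) = \<mu> x \<cdot> \<mu> (onO T x)"
    "k \<in> Arr C \<Longrightarrow> Cod C k = onO T x \<Longrightarrow> \<mu> x \<cdot> (\<eta> (onO T x) \<cdot> k) = k"
    "k \<in> Arr C \<Longrightarrow> Cod C k = onO T x \<Longrightarrow> \<mu> x \<cdot> (onA T (\<eta> x) \<cdot> k) = k"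
    "k \<in> Arr C \<Longrightarrow> Cod C k = onO T (onO T (onO T x)) \<Longrightarrow>
      \<mu> x \<cdot> (onA T (\<mu> x) \<cdot> k) = \<mu> x \<cdot> (\<mu> (onO T x) \<cdot> k)"
proof -
  show e: "\<mu> x \<cdot> \<eta> (onO T x) = Ide C (onO T x)" "\<mu> x \<cdot> onA T (\<eta> x) = Ide C (onO T x)"
    "\<mu> x \<cdot> onA T (\<mu> x) = \<mu> x \<cdot> \<mu> (onO T x)"
    using unit_left unit_right mult_assoc x by simp_all
  show "k \<in> Arr C \<Longrightarrow> Cod C k = onO T x \<Longrightarrow> \<mu> x \<cdot> (\<eta> (onO T x) \<cdot> k) = k"
    "k \<in> Arr C \<Longrightarrow> Cod C k = onO T x \<Longrightarrow> \<mu> x \<cdot> (onA T (\<eta> x) \<cdot> k) = k"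
    "k \<in> Arr C \<Longrightarrow> Cod C k = onO T (onO T (onO T x)) \<Longrightarrow>
      \<mu> x \<cdot> (onA T (\<mu> x) \<cdot> k) = \<mu> x \<cdot> (\<mu> (onO T x) \<cdot> k)"
    using x Comp_reassoc[OF e(1), of k] Comp_reassoc[OF e(2), of k] Comp_reassoc[OF e(3), of k]
      by simp_all
qed

text \<open>Writing \<open>f^# = \<mu> \<cdot> T f\<close>, this is
  \<open>f^# g^# = (f^# g)^#\<close> applied to \<open>h\<close>. It is needed for the leg
  \<open>\<delta>\<close> of a tensor, which applies \<open>\<delta>^#\<close> of the second factor
  to a projection.\<close>

lemma kleisli_assoc:
  assumes "f \<in> Arr C" "g \<in> Arr C" "h \<in> Arr C" "U \<in> Obj C" "Cod C f = onO T U" "Dom C f = X"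
    "Cod C g = onO T X" "Cod C h = onO T (Dom C g)"
  shows "\<mu> U \<cdot> (onA T f \<cdot> (\<mu> X \<cdot> (onA T g \<cdot> h))) = \<mu> U \<cdot> (onA T (\<mu> U \<cdot> (onA T f \<cdot> g)) \<cdot> h)"
proof -
  have [simp]: "X \<in> Obj C" using assms by auto
  show ?thesis using assms by simp
qed

lemma eta_pullback:
  assumes "f \<in> Arr C" shows "is_pullback C (\<eta> (Cod C f)) (onA T f) f (\<eta> (Dom C f))"
  using unit_cartesian assms by (simp add: cartesian_nat_trans_def id_ftr_def)

lemma mu_pullback:
  assumes "f \<in> Arr C" shows "is_pullback C (\<mu> (Cod C f)) (onA T f) (onA T (onA T f)) (\<mu> (Dom C f))"
  using mult_cartesian assms by (simp add: cartesian_nat_trans_def comp_ftr_def)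

lemma T_pullback: "is_pullback C f g p q \<Longrightarrow> is_pullback C (onA T f) (onA T g) (onA T p) (onA T q)"
  using T_pullbacks by (simp add: preserves_pullbacks_def)

lemma graph_simps [simp]:
  assumes "A \<in> graphs"
  shows "fst A \<in> Arr C" "snd A \<in> Arr C" "Dom C (snd A) = Dom C (fst A)"
    "Cod C (snd A) = onO T (Cod C (fst A))"
  using assms by (auto simp: gph_objs_def)

lemma graphI:
  "\<gamma> \<in> Arr C \<Longrightarrow> \<delta> \<in> Arr C \<Longrightarrow> Dom C \<delta> = Dom C \<gamma> \<Longrightarrow> Cod C \<delta> = onO T (Cod C \<gamma>) \<Longrightarrow> (\<gamma>, \<delta>) \<in> graphs"
  by (simp add: gph_objs_def)

lemma star_pullback:
  assumes "A \<in> graphs" "d \<in> Arr C" "Cod C d = Cod C (fst A)"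
  shows "is_pullback C (snd A) (onA T d) (q1 A d) (q2 A d)"
  using chosen_pullback[of "snd A" "onA T d"] assms by (simp add: star_pr1_def star_pr2_def)

lemma star_simps [simp]:
  assumes "A \<in> graphs" "d \<in> Arr C" "Cod C d = Cod C (fst A)"
  shows "q1 A d \<in> Arr C" "q2 A d \<in> Arr C" "Dom C (q2 A d) = Dom C (q1 A d)"
    "Cod C (q1 A d) = Dom C (fst A)" "Cod C (q2 A d) = onO T (Dom C d)"
    "onA T d \<cdot> q2 A d = snd A \<cdot> q1 A d"
    "k \<in> Arr C \<Longrightarrow> Cod C k = Dom C (q1 A d) \<Longrightarrow> onA T d \<cdot> (q2 A d \<cdot> k) = snd A \<cdot> (q1 A d \<cdot> k)"
    "sO A d \<in> Arr C" "Dom C (sO A d) = Dom C (q1 A d)" "Cod C (sO A d) = Cod C (fst A)"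
    "onA T (sO A d) = onA T (fst A) \<cdot> onA T (q1 A d)"
proof -
  note P = is_pullbackD[OF star_pullback[OF assms]]
  show *: "q1 A d \<in> Arr C" "q2 A d \<in> Arr C" "Dom C (q2 A d) = Dom C (q1 A d)"
    "Cod C (q1 A d) = Dom C (fst A)" "Cod C (q2 A d) = onO T (Dom C d)"
    "onA T d \<cdot> q2 A d = snd A \<cdot> q1 A d"
    using P assms by simp_all
  show "k \<in> Arr C \<Longrightarrow> Cod C k = Dom C (q1 A d) \<Longrightarrow> onA T d \<cdot> (q2 A d \<cdot> k) = snd A \<cdot> (q1 A d \<cdot> k)"
    using Comp_reassoc[OF *(6), of k] * assms by simp
  show "sO A d \<in> Arr C" "Dom C (sO A d) = Dom C (q1 A d)" "Cod C (sO A d) = Cod C (fst A)"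
    "onA T (sO A d) = onA T (fst A) \<cdot> onA T (q1 A d)"
    using * assms by (simp_all add: starO_def)
qed

text \<open>\<open>star_simps\<close> splits \<open>onA T (sO B d)\<close> into two factors, after
  which its equation for \<open>q2 A (sO B d)\<close> no longer matches; these are the split
  forms.\<close>

lemma star_star_simps [simp]:
  assumes "A \<in> graphs" "B \<in> graphs" "d \<in> Arr C" "Cod C d = Cod C (fst B)" "Cod C (fst A) =
    Cod C (fst B)"
  shows "onA T (fst B) \<cdot> (onA T (q1 B d) \<cdot> q2 A (sO B d)) = snd A \<cdot> q1 A (sO B d)"
    "k \<in> Arr C \<Longrightarrow> Cod C k = Dom C (q1 A (sO B d)) \<Longrightarrow>
      onA T (fst B) \<cdot> (onA T (q1 B d) \<cdot> (q2 A (sO B d) \<cdot> k)) = snd A \<cdot> (q1 A (sO B d) \<cdot> k)"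
  using star_simps(6)[of A "sO B d"] star_simps(7)[of A "sO B d" k] assms by simp_all

lemma sp_simps [simp]:
  assumes "A \<in> graphs" "d \<in> Arr C" "Cod C d = Cod C (fst A)"
    "a \<in> Arr C" "b \<in> Arr C" "Dom C b = Dom C a" "Cod C a = Dom C (fst A)" "Cod C b =
      onO T (Dom C d)"
    "snd A \<cdot> a = onA T d \<cdot> b"
  shows "sp A d a b \<in> Arr C" "Dom C (sp A d a b) = Dom C a" "Cod C (sp A d a b) = Dom C (q1 A d)"
    "q1 A d \<cdot> sp A d a b = a" "q2 A d \<cdot> sp A d a b = b"
    "k \<in> Arr C \<Longrightarrow> Cod C k = Dom C a \<Longrightarrow> q1 A d \<cdot> (sp A d a b \<cdot> k) = a \<cdot> k"
    "k \<in> Arr C \<Longrightarrow> Cod C k = Dom C a \<Longrightarrow> q2 A d \<cdot> (sp A d a b \<cdot> k) = b \<cdot> k"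
  using pairing_simps[of "snd A" "onA T d" a b] assms
  by (simp_all add: star_pr1_def star_pr2_def star_pairing_def)

lemma star_mono:
  assumes "A \<in> graphs" "d \<in> Arr C" "Cod C d = Cod C (fst A)"
    "m \<in> Arr C" "n \<in> Arr C" "Dom C m = Dom C n" "Cod C m = Dom C (q1 A d)" "Cod C n =
      Dom C (q1 A d)"
    "q1 A d \<cdot> m = q1 A d \<cdot> n" "q2 A d \<cdot> m = q2 A d \<cdot> n"
  shows "m = n"
  by (rule is_pullback_mono[OF star_pullback[OF assms(1-3)] assms(4-10)])

section \<open>Arrows of T-graphs and functoriality of the star product\<close>

definition gph_mor :: "'a \<Rightarrow> 'a gph_obj \<Rightarrow> 'a \<Rightarrow> 'a gph_obj \<Rightarrow> bool" where
  "gph_mor u A h B \<longleftrightarrow> A \<in> graphs \<and> B \<in> graphs \<and> arr_over C u (fst A) h (fst B) \<and>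
     snd B \<cdot> h = onA T u \<cdot> snd A"

lemma gph_morD:
  assumes "gph_mor u A h B"
  shows "A \<in> graphs" "B \<in> graphs" "arr_over C u (fst A) h (fst B)" "u \<in> Arr C" "h \<in> Arr C"
    "Cod C (fst A) = Dom C u" "Cod C (fst B) = Cod C u" "Dom C h = Dom C (fst A)" "Cod C h =
      Dom C (fst B)"
    "fst B \<cdot> h = u \<cdot> fst A" "snd B \<cdot> h = onA T u \<cdot> snd A"
    "k \<in> Arr C \<Longrightarrow> Cod C k = Dom C (fst A) \<Longrightarrow> fst B \<cdot> (h \<cdot> k) = u \<cdot> (fst A \<cdot> k)"
    "k \<in> Arr C \<Longrightarrow> Cod C k = Dom C (fst A) \<Longrightarrow> snd B \<cdot> (h \<cdot> k) = onA T u \<cdot> (snd A \<cdot> k)"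
proof -
  show *: "A \<in> graphs" "B \<in> graphs" "arr_over C u (fst A) h (fst B)" "snd B \<cdot> h = onA T u \<cdot> snd A"
    using assms by (simp_all add: gph_mor_def)
  note D = arr_overD[OF *(3)]
  show "u \<in> Arr C" "h \<in> Arr C"
    "Cod C (fst A) = Dom C u" "Cod C (fst B) = Cod C u" "Dom C h = Dom C (fst A)" "Cod C h =
      Dom C (fst B)"
    "fst B \<cdot> h = u \<cdot> fst A"
    "k \<in> Arr C \<Longrightarrow> Cod C k = Dom C (fst A) \<Longrightarrow> fst B \<cdot> (h \<cdot> k) = u \<cdot> (fst A \<cdot> k)"
    using D by simp_all
  show "k \<in> Arr C \<Longrightarrow> Cod C k = Dom C (fst A) \<Longrightarrow> snd B \<cdot> (h \<cdot> k) = onA T u \<cdot> (snd A \<cdot> k)"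
    using Comp_reassoc[OF *(4), of k] D(1-8) *(1,2) by simp
qed

lemma gph_morI:
  "A \<in> graphs \<Longrightarrow> B \<in> graphs \<Longrightarrow> arr_over C u (fst A) h (fst B) \<Longrightarrow>
     snd B \<cdot> h = onA T u \<cdot> snd A \<Longrightarrow> gph_mor u A h B"
  by (simp add: gph_mor_def)

lemma gph_mor_ide: "A \<in> graphs \<Longrightarrow> Cod C (fst A) = U \<Longrightarrow> gph_mor (Ide C U) A (Ide C (Dom C (fst A))) A"
  by (rule gph_morI) (auto intro: arr_over_ide)

lemma gph_mor_comp:
  assumes f: "gph_mor u A h B" and g: "gph_mor v B k D"
  shows "gph_mor (v \<cdot> u) A (k \<cdot> h) D"
  using gph_morD[OF f] gph_morD[OF g]
    by (intro gph_morI arr_over_comp[OF gph_morD(3)[OF f] gph_morD(3)[OF g]]) simp_all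

text \<open>One construction with three uses: with \<open>h\<close> an identity it is the functor
  \<open>st A\<close> on arrows; with \<open>f\<close> a pullback projection it underlies the
  components of \<open>rep\<close> on arrows; with \<open>x\<close>, \<open>z\<close>,
  \<open>f\<close> taken from an arrow of T-graphs it is the tensor of arrows
  (\<open>gph_tens_simps\<close>).\<close>

definition star_map :: "'a gph_obj \<Rightarrow> 'a \<Rightarrow> 'a gph_obj \<Rightarrow> 'a \<Rightarrow> 'a \<Rightarrow> 'a \<Rightarrow> 'a" where
  "star_map A x B z h f = sp B z (h \<cdot> q1 A x) (onA T f \<cdot> q2 A x)"

lemma star_map_simps:
  assumes h: "gph_mor u A h B" and f: "arr_over C u x f z"
  shows "star_map A x B z h f \<in> Arr C" "Dom C (star_map A x B z h f) = Dom C (q1 A x)"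
    "Cod C (star_map A x B z h f) = Dom C (q1 B z)"
    "q1 B z \<cdot> star_map A x B z h f = h \<cdot> q1 A x" "q2 B z \<cdot> star_map A x B z h f = onA T f \<cdot> q2 A x"
    "k \<in> Arr C \<Longrightarrow> Cod C k = Dom C (q1 A x) \<Longrightarrow> q1 B z \<cdot> (star_map A x B z h f \<cdot> k) = h \<cdot> (q1 A x \<cdot> k)"
    "k \<in> Arr C \<Longrightarrow> Cod C k = Dom C (q1 A x) \<Longrightarrow>
      q2 B z \<cdot> (star_map A x B z h f \<cdot> k) = onA T f \<cdot> (q2 A x \<cdot> k)"
    and star_map_over: "arr_over C u (sO A x) (star_map A x B z h f) (sO B z)"
proof -
  note [simp] = gph_morD[OF h] arr_overD[OF f] T_Comp_reassoc(2)[OF arr_overD(9)[OF f]]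
  show *: "star_map A x B z h f \<in> Arr C" "Dom C (star_map A x B z h f) = Dom C (q1 A x)"
    "Cod C (star_map A x B z h f) = Dom C (q1 B z)"
    "q1 B z \<cdot> star_map A x B z h f = h \<cdot> q1 A x" "q2 B z \<cdot> star_map A x B z h f = onA T f \<cdot> q2 A x"
    "k \<in> Arr C \<Longrightarrow> Cod C k = Dom C (q1 A x) \<Longrightarrow> q1 B z \<cdot> (star_map A x B z h f \<cdot> k) = h \<cdot> (q1 A x \<cdot> k)"
    "k \<in> Arr C \<Longrightarrow> Cod C k = Dom C (q1 A x) \<Longrightarrow>
      q2 B z \<cdot> (star_map A x B z h f \<cdot> k) = onA T f \<cdot> (q2 A x \<cdot> k)"
    by (simp_all add: star_map_def)
  show "arr_over C u (sO A x) (star_map A x B z h f) (sO B z)"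
    using *(1-4) by (intro arr_overI) (simp_all add: starO_def)
qed

text \<open>Interchange. It is the source of functoriality of \<open>st A\<close>, of
  \<open>rep\<close> and of the tensor of T-graphs, and of both equivariance laws in
  \<open>acts_star\<close>.\<close>

lemma star_map_comp:
  assumes h: "gph_mor u A h B" and f: "arr_over C u x f z"
    and k: "gph_mor v B k D" and g: "arr_over C v z g w"
  shows "star_map B z D w k g \<cdot> star_map A x B z h f = star_map A x D w (k \<cdot> h) (g \<cdot> f)"
proof -
  note [simp] = star_map_simps[OF h f] star_map_simps[OF k g]
    star_map_simps[OF gph_mor_comp[OF h k] arr_over_comp[OF f g]]
    gph_morD[OF h] arr_overD[OF f] gph_morD[OF k] arr_overD[OF g]
  show ?thesis by (rule star_mono[of D w]) simp_all
qed

lemma star_map_ide: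
  assumes "A \<in> graphs" "x \<in> Arr C" "Cod C x = Cod C (fst A)"
  shows "star_map A x A x (Ide C (Dom C (fst A))) (Ide C (Dom C x)) = Ide C (Dom C (q1 A x))"
proof -
  note [simp] = assms star_map_simps[OF gph_mor_ide[OF assms(1) refl] arr_over_ide[OF assms(2,3)
    refl]]
  show ?thesis by (rule star_mono[of A x]) simp_all
qed

lemma tO_simps [simp]:
  assumes "A \<in> graphs" "B \<in> graphs" "Cod C (fst A) = Cod C (fst B)"
  shows "fst (tO A B) = sO A (fst B)" "snd (tO A B) =
    \<mu> (Cod C (fst B)) \<cdot> (onA T (snd B) \<cdot> q2 A (fst B))"
    "tO A B \<in> graphs"
proof -
  show *: "fst (tO A B) = sO A (fst B)" "snd (tO A B) =
    \<mu> (Cod C (fst B)) \<cdot> (onA T (snd B) \<cdot> q2 A (fst B))"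
    using assms by (simp_all add: gph_tensO_def gph_pr1_def gph_pr2_def star_pr1_def[symmetric]
        star_pr2_def[symmetric] starO_def)
  have "(fst (tO A B), snd (tO A B)) \<in> graphs"
    unfolding * using assms by (intro graphI) simp_all
  then show "tO A B \<in> graphs" by simp
qed

lemma gI_simps [simp]:
  "fst (gI U) = Ide C U" "snd (gI U) = \<eta> U" "U \<in> Obj C \<Longrightarrow> gI U \<in> graphs"
  by (simp_all add: gph_unitO_def gph_objs_def)

lemma gph_mor_tens:
  assumes h: "gph_mor u A h A'" and k: "gph_mor u B k B'"
  shows "gph_mor u (tO A B) (star_map A (fst B) A' (fst B') h k) (tO A' B')"
proof -
  note [simp] = gph_morD[OF h] gph_morD[OF k]
  note s = star_map_simps[OF h gph_morD(3)[OF k]] star_map_over[OF h gph_morD(3)[OF k]]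
  note [simp] = s(1-7)
  show ?thesis
  proof (rule gph_morI)
    show "arr_over C u (fst (tO A B)) (star_map A (fst B) A' (fst B') h k) (fst (tO A' B'))"
      using s(8) by simp
    show "snd (tO A' B') \<cdot> star_map A (fst B) A' (fst B') h k = onA T u \<cdot> snd (tO A B)"
      by (simp add: T_Comp_reassoc(2)[OF gph_morD(11)[OF k]])
  qed simp_all
qed

lemma gph_mor_unit: "u \<in> Arr C \<Longrightarrow> gph_mor u (gI (Dom C u)) u (gI (Cod C u))"
  by (rule gph_morI) (auto intro: arr_overI)

text \<open>On generalised elements \<open>(a, (b, x)) \<mapsto> ((a, b), \<mu> x)\<close>: at \<open>d = fst D\<close>
  this underlies the associativity of T-graphs, for general \<open>d\<close> it is the component of
  \<open>\<phi>2\<close>.\<close>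

definition star_assoc :: "'a gph_obj \<Rightarrow> 'a gph_obj \<Rightarrow> 'a \<Rightarrow> 'a" where
  "star_assoc A B d = sp (tO A B) d (sp A (fst B) (q1 A (sO B d)) (onA T (q1 B d) \<cdot> q2 A (sO B d)))
     (\<mu> (Dom C d) \<cdot> (onA T (q2 B d) \<cdot> q2 A (sO B d)))"

lemma star_assoc_simps:
  assumes "A \<in> graphs" "B \<in> graphs" "Cod C (fst A) = Cod C (fst B)" "d \<in> Arr C" "Cod C d =
    Cod C (fst B)"
  shows "star_assoc A B d \<in> Arr C" "Dom C (star_assoc A B d) = Dom C (q1 A (sO B d))"
    "Cod C (star_assoc A B d) = Dom C (q1 (tO A B) d)"
    "q1 A (fst B) \<cdot> (q1 (tO A B) d \<cdot> star_assoc A B d) = q1 A (sO B d)"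
    "q2 A (fst B) \<cdot> (q1 (tO A B) d \<cdot> star_assoc A B d) = onA T (q1 B d) \<cdot> q2 A (sO B d)"
    "q2 (tO A B) d \<cdot> star_assoc A B d = \<mu> (Dom C d) \<cdot> (onA T (q2 B d) \<cdot> q2 A (sO B d))"
    "k \<in> Arr C \<Longrightarrow> Cod C k = Dom C (q1 A (sO B d)) \<Longrightarrow>
      q1 A (fst B) \<cdot> (q1 (tO A B) d \<cdot> (star_assoc A B d \<cdot> k)) = q1 A (sO B d) \<cdot> k"
    "k \<in> Arr C \<Longrightarrow> Cod C k = Dom C (q1 A (sO B d)) \<Longrightarrow>
      q2 A (fst B) \<cdot> (q1 (tO A B) d \<cdot> (star_assoc A B d \<cdot> k)) =
        onA T (q1 B d) \<cdot> (q2 A (sO B d) \<cdot> k)"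
    "k \<in> Arr C \<Longrightarrow> Cod C k = Dom C (q1 A (sO B d)) \<Longrightarrow>
      q2 (tO A B) d \<cdot> (star_assoc A B d \<cdot> k) = \<mu> (Dom C d) \<cdot> (onA T (q2 B d) \<cdot> (q2 A (sO B d) \<cdot> k))"
    and star_assoc_over: "arr_over C (Ide C (Cod C d)) (sO A (sO B d)) (star_assoc A B d) (sO (tO A
      B) d)"
proof -
  note [simp] = assms
  define i where "i = sp A (fst B) (q1 A (sO B d)) (onA T (q1 B d) \<cdot> q2 A (sO B d))"
  have i[simp]: "i \<in> Arr C" "Dom C i = Dom C (q1 A (sO B d))" "Cod C i = Dom C (q1 A (fst B))"
    "q1 A (fst B) \<cdot> i = q1 A (sO B d)" "q2 A (fst B) \<cdot> i = onA T (q1 B d) \<cdot> q2 A (sO B d)"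
    "k \<in> Arr C \<Longrightarrow> Cod C k = Dom C (q1 A (sO B d)) \<Longrightarrow> q1 A (fst B) \<cdot> (i \<cdot> k) = q1 A (sO B d) \<cdot> k"
    "k \<in> Arr C \<Longrightarrow> Cod C k = Dom C (q1 A (sO B d)) \<Longrightarrow>
       q2 A (fst B) \<cdot> (i \<cdot> k) = onA T (q1 B d) \<cdot> (q2 A (sO B d) \<cdot> k)" for k
    by (simp_all add: i_def)
  define j where "j = \<mu> (Dom C d) \<cdot> (onA T (q2 B d) \<cdot> q2 A (sO B d))"
  have j: "j \<in> Arr C" "Dom C j = Dom C (q1 A (sO B d))" "Cod C j = onO T (Dom C d)"
    by (simp_all add: j_def)
  \<comment> \<open>Compatibility for the outer pairing: \<open>\<mu>\<close> moves past
    \<open>T d\<close> by naturality, then \<open>T\<close> of the square defining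
    \<open>B \<star> d\<close> applies.\<close>
  have e: "snd (tO A B) \<cdot> i = onA T d \<cdot> j"
    by (simp add: j_def T_Comp_reassoc[OF star_simps(6)[of B d]])
  have star_assoc: "star_assoc A B d = sp (tO A B) d i j" by (simp add: star_assoc_def i_def j_def)
  have f: "tO A B \<in> graphs" "d \<in> Arr C" "Cod C d = Cod C (fst (tO A B))" "Dom C j = Dom C i"
    "Cod C i = Dom C (fst (tO A B))"
    by (simp_all add: j)
  note s = sp_simps[OF f(1-3) i(1) j(1) f(4,5) j(3) e, folded star_assoc, unfolded i(2)]
  note * = s(1-3)
  show "star_assoc A B d \<in> Arr C" "Dom C (star_assoc A B d) = Dom C (q1 A (sO B d))"
    "Cod C (star_assoc A B d) = Dom C (q1 (tO A B) d)"
    by (fact s)+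
  note q = s(4-7)
  show "q1 A (fst B) \<cdot> (q1 (tO A B) d \<cdot> star_assoc A B d) = q1 A (sO B d)"
    "q2 A (fst B) \<cdot> (q1 (tO A B) d \<cdot> star_assoc A B d) = onA T (q1 B d) \<cdot> q2 A (sO B d)"
    "q2 (tO A B) d \<cdot> star_assoc A B d = \<mu> (Dom C d) \<cdot> (onA T (q2 B d) \<cdot> q2 A (sO B d))"
    "k \<in> Arr C \<Longrightarrow> Cod C k = Dom C (q1 A (sO B d)) \<Longrightarrow>
      q1 A (fst B) \<cdot> (q1 (tO A B) d \<cdot> (star_assoc A B d \<cdot> k)) = q1 A (sO B d) \<cdot> k"
    "k \<in> Arr C \<Longrightarrow> Cod C k = Dom C (q1 A (sO B d)) \<Longrightarrow>
      q2 A (fst B) \<cdot> (q1 (tO A B) d \<cdot> (star_assoc A B d \<cdot> k)) =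
        onA T (q1 B d) \<cdot> (q2 A (sO B d) \<cdot> k)"
    "k \<in> Arr C \<Longrightarrow> Cod C k = Dom C (q1 A (sO B d)) \<Longrightarrow>
      q2 (tO A B) d \<cdot> (star_assoc A B d \<cdot> k) = \<mu> (Dom C d) \<cdot> (onA T (q2 B d) \<cdot> (q2 A (sO B d) \<cdot> k))"
    by (simp_all add: q) (simp_all add: j_def)
  show "arr_over C (Ide C (Cod C d)) (sO A (sO B d)) (star_assoc A B d) (sO (tO A B) d)"
    using * by (intro arr_overI) (simp_all add: starO_def q)
qed

text \<open>Elements of \<open>(A \<otimes> B) \<star> d\<close> are triples
  \<open>((a, b), x)\<close>; equations between coherence arrows are checked on these three
  coordinates.\<close>

lemma tens_mono:
  assumes A: "A \<in> graphs" "B \<in> graphs" "Cod C (fst A) = Cod C (fst B)" "d \<in> Arr C" "Cod C d =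
    Cod C (fst B)"
    and m: "m \<in> Arr C" "n \<in> Arr C" "Dom C m = Dom C n" "Cod C m = Dom C (q1 (tO A B) d)" "Cod C n =
      Dom C (q1 (tO A B) d)"
    and e: "q1 A (fst B) \<cdot> (q1 (tO A B) d \<cdot> m) = q1 A (fst B) \<cdot> (q1 (tO A B) d \<cdot> n)"
      "q2 A (fst B) \<cdot> (q1 (tO A B) d \<cdot> m) = q2 A (fst B) \<cdot> (q1 (tO A B) d \<cdot> n)"
      "q2 (tO A B) d \<cdot> m = q2 (tO A B) d \<cdot> n"
  shows "m = n"
proof -
  note [simp] = A m(1-5)
  have "q1 (tO A B) d \<cdot> m = q1 (tO A B) d \<cdot> n"
    by (rule star_mono[of A "fst B"]) (simp_all add: e)
  then show ?thesis by - (rule star_mono[of "tO A B" d], simp_all add: e)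
qed

text \<open>The condition on \<open>\<gamma>\<close> is that \<open>star_assoc\<close> lies over an
  identity. The condition on \<open>\<delta>\<close> compares two ways of iterating
  \<open>\<mu> \<cdot> T \<delta>\<close>, which is associativity of Kleisli composition.\<close>

lemma gph_mor_assoc:
  assumes "A \<in> graphs" "B \<in> graphs" "D \<in> graphs" "Cod C (fst A) = Cod C (fst D)" "Cod C (fst B) =
    Cod C (fst D)"
  shows "gph_mor (Ide C (Cod C (fst D))) (tO A (tO B D)) (star_assoc A B (fst D)) (tO (tO A B) D)"
proof -
  note [simp] = assms
  have c: "Cod C (fst A) = Cod C (fst B)" by simp
  note [simp] = star_assoc_simps[OF assms(1,2) c, of "fst D"]
  show ?thesis
  proof (rule gph_morI)
    show "arr_over C (Ide C (Cod C (fst D))) (fst (tO A (tO B D))) (star_assoc A B (fst D)) (fst (tO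
      (tO A B) D))"
      using star_assoc_over[OF assms(1,2) c, of "fst D"] by simp
    have "onA T (Ide C (Cod C (fst D))) \<cdot> snd (tO A (tO B D)) = snd (tO A (tO B D))"
    proof -
      have g: "tO A (tO B D) \<in> graphs" "Cod C (fst (tO A (tO B D))) = Cod C (fst D)" by simp_all
      show ?thesis
        using graph_simps[OF g(1)] g(2) by (simp del: tO_simps T_simps(6))
    qed
    \<comment> \<open>Here and in the next equation, functoriality of \<open>T\<close> and
      naturality of \<open>\<mu>\<close> are kept from the simplifier, so that the two sides stay in
      the shape of \<open>kleisli_assoc\<close>.\<close>
    moreover have "snd (tO A (tO B D)) =
      \<mu> (Cod C (fst D)) \<cdot> (onA T (\<mu> (Cod C (fst D)) \<cdot> (onA T (snd D) \<cdot> q2 B (fst D)))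
         \<cdot> q2 A (sO B (fst D)))"
      by (simp del: T_simps(6) mu_natural)
    moreover have "snd (tO (tO A B) D) \<cdot> star_assoc A B (fst D) =
        \<mu> (Cod C (fst D)) \<cdot> (onA T (snd D) \<cdot> (\<mu> (Dom C (fst D)) \<cdot> (onA T (q2 B (fst D))
          \<cdot> q2 A (sO B (fst D)))))"
      by (simp del: T_simps(6) mu_natural)
    ultimately show "snd (tO (tO A B) D) \<cdot> star_assoc A B (fst D) =
      onA T (Ide C (Cod C (fst D))) \<cdot> snd (tO A (tO B D))"
      by (simp only:) (rule kleisli_assoc; simp)
  qed simp_all
qed

section \<open>Associativity and unit of the star product\<close>

lemma T_Comp_reassoc3:
  assumes "h \<cdot> (g \<cdot> f) = e" "f \<in> Arr C" "g \<in> Arr C" "h \<in> Arr C" "Dom C g = Cod C f" "Dom C h =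
    Cod C g"
    "k \<in> Arr C" "Cod C k = onO T (Dom C f)"
  shows "onA T h \<cdot> (onA T g \<cdot> (onA T f \<cdot> k)) = onA T e \<cdot> k"
  unfolding assms(1)[symmetric] using assms(2-) by simp

text \<open>Naturality in \<open>A\<close>, \<open>B\<close> and \<open>d\<close> together. With
  \<open>f\<close> underlying an arrow of T-graphs it gives naturality of the associativity of
  \<open>Gph\<close>; with identities for \<open>h\<close> and \<open>k\<close>, naturality of the
  single transformation \<open>\<phi>2 A B\<close>; in full, naturality of
  \<open>\<phi>2\<close>.\<close>

lemma star_assoc_natural:
  assumes h: "gph_mor u A h A'" and k: "gph_mor u B k B'" and f: "arr_over C u d f d'"
    and A: "Cod C (fst A) = Cod C (fst B)" "Cod C (fst A') = Cod C (fst B')"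
  shows "star_assoc A' B' d' \<cdot> star_map A (sO B d) A' (sO B' d') h (star_map B d B' d' k f) =
    star_map (tO A B) d (tO A' B') d' (star_map A (fst B) A' (fst B') h k) f \<cdot> star_assoc A B d"
proof -
  note [simp] = gph_morD(1,2,4-9)[OF h] gph_morD(1,2,4-9)[OF k] arr_overD(1-8)[OF f]
  have cA: "Cod C d = Cod C (fst B)" "Cod C d' = Cod C (fst B')" by simp_all
  note a = star_assoc_simps[OF gph_morD(1)[OF h] gph_morD(1)[OF k] A(1) _ cA(1)]
  note a' = star_assoc_simps[OF gph_morD(2)[OF h] gph_morD(2)[OF k] A(2) _ cA(2)]
  note s1 = star_map_simps[OF k f] and s2 = star_map_simps[OF h star_map_over[OF k f]]
    and s3 = star_map_simps[OF h gph_morD(3)[OF k]] and s4 =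
      star_map_simps[OF gph_mor_tens[OF h k] f]
  note [simp] = a a' s1 s2 s3 s4
  show ?thesis
  proof (rule tens_mono[OF gph_morD(2)[OF h] gph_morD(2)[OF k] A(2) _ cA(2)])
    show "q2 A' (fst B') \<cdot> (q1 (tO A' B') d' \<cdot> (star_assoc A' B' d'
      \<cdot> star_map A (sO B d) A' (sO B' d') h (star_map B d B' d' k f))) =
      q2 A' (fst B') \<cdot> (q1 (tO A' B') d'
        \<cdot> (star_map (tO A B) d (tO A' B') d' (star_map A (fst B) A' (fst B') h k) f
          \<cdot> star_assoc A B d))"
      by (simp add: T_Comp_reassoc(2)[OF s1(4)])
    show "q2 (tO A' B') d' \<cdot> (star_assoc A' B' d'
      \<cdot> star_map A (sO B d) A' (sO B' d') h (star_map B d B' d' k f)) =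
      q2 (tO A' B') d' \<cdot> (star_map (tO A B) d (tO A' B') d' (star_map A (fst B) A' (fst B') h k) f
        \<cdot> star_assoc A B d)"
      by (simp add: T_Comp_reassoc(2)[OF s1(5)])
  qed simp_all
qed

text \<open>At the structure map \<open>d = fst E\<close> of a fourth graph \<open>E\<close> this is
  the pentagon; for every \<open>d\<close> it is the component at \<open>d\<close> of the
  associativity coherence of \<open>rep\<close>. Both sides rebracket
  \<open>(a, (b, (c, x)))\<close>, and the last coordinates agree by the associativity law of
  \<open>\<mu>\<close>.\<close>

lemma star_assoc_pentagon:
  assumes A: "A \<in> graphs" "B \<in> graphs" "D \<in> graphs" "d \<in> Arr C"
    and c: "Cod C (fst A) = Cod C d" "Cod C (fst B) = Cod C d" "Cod C (fst D) = Cod C d"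
  shows "star_assoc (tO A B) D d \<cdot> star_assoc A B (sO D d) =
    star_map (tO A (tO B D)) d (tO (tO A B) D) d (star_assoc A B (fst D)) (Ide C (Dom C d))
      \<cdot> star_assoc A (tO B D) d
      \<cdot> star_map A (sO B (sO D d)) A (sO (tO B D) d) (Ide C (Dom C (fst A))) (star_assoc B D d)"
proof -
  note [simp] = A c
  have e: "Cod C (fst A) = Cod C (fst B)" "Cod C (fst B) = Cod C (fst D)" "Cod C d = Cod C (fst D)"
    "Cod C (fst (tO A B)) = Cod C (fst D)" "Cod C (sO D d) = Cod C (fst B)"
    "Cod C (fst A) = Cod C (fst (tO B D))" "Cod C d =
      Cod C (fst (tO B D))" "tO A B \<in> graphs" "tO B D \<in> graphs"
    "sO D d \<in> Arr C" "Cod C (fst A) = Cod C (fst D)" "Cod C (fst D) \<in> Obj C"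
    by simp_all
  have u: "Ide C (Cod C d) = Ide C (Cod C (fst D))" by simp
  note a1 = star_assoc_simps[OF e(8) A(3) e(4) A(4) e(3)] and a2 =
    star_assoc_simps[OF A(1,2) e(1) e(10) e(5)]
    and a3 = star_assoc_simps[OF A(1) e(9) e(6) A(4) e(7)] and a4 =
      star_assoc_simps[OF A(2,3) e(2) A(4) e(3)]
  note a4o = star_assoc_over[OF A(2,3) e(2) A(4) e(3)]
  note g = gph_mor_assoc[OF A(1-3) e(11,2)]
  note i = arr_over_ide[OF A(4) e(3) refl] and j = gph_mor_ide[OF A(1) c(1)]
  have e5: "Cod C (fst D) = Cod C (fst B)" by simp
  note a5 = star_assoc_simps[OF A(1,2) e(1) _ e5]
  note s1 = star_map_simps[OF g i] and s2 = star_map_simps[OF j a4o]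
  note a3 = a3[unfolded tO_simps(1)[OF A(2,3) e(2)]]
  note [simp] = a1 a2 a3 a4 a5 s1 s2
  \<comment> \<open>\<open>T\<close> of the three coordinate equations of
    \<open>star_assoc B D d\<close>, in the right-nested form in which they meet
    \<open>q2 A\<close>.\<close>
  have t: "onA T (q1 B (fst D)) \<cdot> (onA T (q1 (tO B D) d) \<cdot> (onA T (star_assoc B D d)
    \<cdot> q2 A (sO B (sO D d)))) =
      onA T (q1 B (sO D d)) \<cdot> q2 A (sO B (sO D d))"
    "onA T (q2 B (fst D)) \<cdot> (onA T (q1 (tO B D) d) \<cdot> (onA T (star_assoc B D d)
      \<cdot> q2 A (sO B (sO D d)))) =
      onA T (onA T (q1 D d) \<cdot> q2 B (sO D d)) \<cdot> q2 A (sO B (sO D d))"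
    "onA T (q2 (tO B D) d) \<cdot> (onA T (star_assoc B D d) \<cdot> q2 A (sO B (sO D d))) =
      onA T (\<mu> (Dom C d) \<cdot> (onA T (q2 D d) \<cdot> q2 B (sO D d))) \<cdot> q2 A (sO B (sO D d))"
    by (rule T_Comp_reassoc3[OF a4(4)], simp_all del: T_simps(6)) (rule T_Comp_reassoc3[OF a4(5)],
      simp_all del: T_simps(6), rule T_Comp_reassoc(2)[OF a4(6)], simp_all del: T_simps(6))
  let ?R = "star_map (tO A (tO B D)) d (tO (tO A B) D) d (star_assoc A B (fst D)) (Ide C (Dom C d))
    \<cdot> star_assoc A (tO B D) d
      \<cdot> star_map A (sO B (sO D d)) A (sO (tO B D) d) (Ide C (Dom C (fst A))) (star_assoc B D d)"
  show ?thesis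
  proof (rule tens_mono[OF e(8) A(3) e(4) A(4) e(3)])
    show "q1 (tO A B) (fst D) \<cdot> (q1 (tO (tO A B) D) d \<cdot> (star_assoc (tO A B) D d
      \<cdot> star_assoc A B (sO D d))) =
      q1 (tO A B) (fst D) \<cdot> (q1 (tO (tO A B) D) d \<cdot> ?R)"
      by (rule star_mono[of A "fst B"]) (simp_all add: t)
    show "q2 (tO A B) (fst D) \<cdot> (q1 (tO (tO A B) D) d \<cdot> (star_assoc (tO A B) D d
      \<cdot> star_assoc A B (sO D d))) =
      q2 (tO A B) (fst D) \<cdot> (q1 (tO (tO A B) D) d \<cdot> ?R)"
      by (simp add: t)
    show "q2 (tO (tO A B) D) d \<cdot> (star_assoc (tO A B) D d \<cdot> star_assoc A B (sO D d)) =
      q2 (tO (tO A B) D) d \<cdot> ?R"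
      by (simp add: t)
  qed simp_all
qed

text \<open>On elements \<open>x \<mapsto> (d x, \<eta> x)\<close>: the component of
  \<open>\<phi>0\<close> at \<open>d\<close>, and at \<open>d = fst A\<close> the left unit of the
  T-graph \<open>A\<close>.\<close>

definition star_unit :: "'a \<Rightarrow> 'a" where
  "star_unit d = sp (gI (Cod C d)) d d (\<eta> (Dom C d))"

lemma star_unit_simps:
  assumes "d \<in> Arr C" "Cod C d = U"
  shows "star_unit d \<in> Arr C" "Dom C (star_unit d) = Dom C d" "Cod C (star_unit d) =
    Dom C (q1 (gI U) d)"
    "q1 (gI U) d \<cdot> star_unit d = d" "q2 (gI U) d \<cdot> star_unit d = \<eta> (Dom C d)"
    "k \<in> Arr C \<Longrightarrow> Cod C k = Dom C d \<Longrightarrow> q1 (gI U) d \<cdot> (star_unit d \<cdot> k) = d \<cdot> k"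
    "k \<in> Arr C \<Longrightarrow> Cod C k = Dom C d \<Longrightarrow> q2 (gI U) d \<cdot> (star_unit d \<cdot> k) = \<eta> (Dom C d) \<cdot> k"
    and star_unit_over: "arr_over C (Ide C U) d (star_unit d) (sO (gI U) d)"
proof -
  have [simp]: "U \<in> Obj C" using assms by auto
  note [simp] = assms
  show *: "star_unit d \<in> Arr C" "Dom C (star_unit d) = Dom C d" "Cod C (star_unit d) =
    Dom C (q1 (gI U) d)"
    "q1 (gI U) d \<cdot> star_unit d = d" "q2 (gI U) d \<cdot> star_unit d = \<eta> (Dom C d)"
    "k \<in> Arr C \<Longrightarrow> Cod C k = Dom C d \<Longrightarrow> q1 (gI U) d \<cdot> (star_unit d \<cdot> k) = d \<cdot> k"
    "k \<in> Arr C \<Longrightarrow> Cod C k = Dom C d \<Longrightarrow> q2 (gI U) d \<cdot> (star_unit d \<cdot> k) = \<eta> (Dom C d) \<cdot> k"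
    by (simp_all add: star_unit_def)
  show "arr_over C (Ide C U) d (star_unit d) (sO (gI U) d)"
    using *(1-4) by (intro arr_overI) (simp_all add: starO_def)
qed

lemma star_unit_natural:
  assumes f: "arr_over C u d f d'"
  shows "star_unit d' \<cdot> f = star_map (gI (Dom C u)) d (gI (Cod C u)) d' u f \<cdot> star_unit d"
proof -
  note [simp] = arr_overD[OF f] star_map_simps[OF gph_mor_unit[OF arr_overD(1)[OF f]] f]
    star_unit_simps[OF arr_overD(2,5)[OF f]] star_unit_simps[OF arr_overD(3,6)[OF f]]
  show ?thesis by (rule star_mono[of "gI (Cod C u)" d']) simp_all
qed

lemma gph_mor_lunit:
  assumes "A \<in> graphs" "Cod C (fst A) = U"
  shows "gph_mor (Ide C U) A (star_unit (fst A)) (tO (gI U) A)"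
proof -
  have [simp]: "U \<in> Obj C" using assms by auto
  note [simp] = assms star_unit_simps[OF graph_simps(1)[OF assms(1)] assms(2)]
  show ?thesis
    by (rule gph_morI) (use star_unit_over[OF graph_simps(1)[OF assms(1)] assms(2)] in simp_all)
qed

lemma gph_mor_runit:
  assumes "A \<in> graphs" "Cod C (fst A) = U"
  shows "gph_mor (Ide C U) (tO A (gI U)) (q1 A (Ide C U)) A"
proof -
  have [simp]: "U \<in> Obj C" using assms by auto
  note [simp] = assms
  \<comment> \<open>The structure map of the unit graph is an identity, which \<open>T\<close>
    keeps, so the pullback square reads \<open>q2 = \<delta> q1\<close>; a monad law then gives the
    condition on \<open>\<delta>\<close>.\<close>
  have "q2 A (Ide C U) = snd A \<cdot> q1 A (Ide C U)"
    using star_simps(6)[of A "Ide C U"] by simp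
  then show ?thesis
    by (intro gph_morI arr_overI) (simp_all add: starO_def)
qed

text \<open>At \<open>d = fst B\<close> this is the triangle axiom of \<open>Gph\<close>; for every
  \<open>d\<close> it is the right unit coherence of \<open>rep\<close>.\<close>

lemma triangle_star:
  assumes A: "A \<in> graphs" "d \<in> Arr C" and c: "Cod C (fst A) = U" "Cod C d = U"
  shows "star_map (tO A (gI U)) d A d (q1 A (Ide C U)) (Ide C (Dom C d)) \<cdot> star_assoc A (gI U) d
    \<cdot> star_map A d A (sO (gI U) d) (Ide C (Dom C (fst A))) (star_unit d) = Ide C (Dom C (q1 A d))"
proof -
  have U[simp]: "U \<in> Obj C" using assms by auto
  note [simp] = A c
  have e: "Cod C (fst A) = Cod C (fst (gI U))" "Cod C d = Cod C (fst (gI U))" by simp_all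
  note a = star_assoc_simps[OF A(1) gI_simps(3)[OF U] e(1) A(2) e(2), unfolded gI_simps(1)]
  note s1 = star_map_simps[OF gph_mor_runit[OF A(1) c(1)] arr_over_ide[OF A(2) c(2) refl]]
  note s2 = star_map_simps[OF gph_mor_ide[OF A(1) c(1)] star_unit_over[OF A(2) c(2)]]
  note [simp] = a s1 s2 star_unit_simps[OF A(2) c(2)] T_Comp_reassoc(2)[OF star_unit_simps(5)[OF
    A(2) c(2)]]
  show ?thesis by (rule star_mono[of A d]) simp_all
qed

text \<open>The left unit coherence of \<open>rep\<close> at \<open>d\<close>. Both sides send
  \<open>(a, x)\<close> to \<open>((\<gamma> a, \<eta> a), x)\<close>, the right one by naturality
  of \<open>\<eta>\<close> and the law \<open>\<mu> \<eta> = 1\<close>.\<close>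

lemma lunit_star:
  assumes A: "A \<in> graphs" "d \<in> Arr C" and c: "Cod C (fst A) = U" "Cod C d = U"
  shows "star_map A d (tO (gI U) A) d (star_unit (fst A)) (Ide C (Dom C d)) =
    star_assoc (gI U) A d \<cdot> star_unit (sO A d)"
proof -
  have U[simp]: "U \<in> Obj C" using assms by auto
  note [simp] = A c
  have e: "Cod C (fst (gI U)) = Cod C (fst A)" "Cod C d =
    Cod C (fst A)" "sO A d \<in> Arr C" "Cod C (sO A d) = U" by simp_all
  note a = star_assoc_simps[OF gI_simps(3)[OF U] A(1) e(1) A(2) e(2)]
  note s = star_map_simps[OF gph_mor_lunit[OF A(1) c(1)] arr_over_ide[OF A(2) c(2) refl]]
  note [simp] = a s star_unit_simps[OF graph_simps(1)[OF A(1)] c(1)] star_unit_simps[OF e(3,4)]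
  show ?thesis by (rule tens_mono[OF gI_simps(3)[OF U] A(1) e(1) A(2) e(2)]) (simp_all, simp add:
    starO_def)
qed

lemma unit_inverse_star:
  assumes U: "U \<in> Obj C"
  shows "q1 (gI U) (Ide C U) \<cdot> star_unit (Ide C U) = Ide C U"
    "star_unit (Ide C U) \<cdot> q1 (gI U) (Ide C U) = Ide C (Dom C (q1 (gI U) (Ide C U)))"
proof -
  note [simp] = U
  have l: "Ide C U \<in> Arr C" "Cod C (Ide C U) = U" by simp_all
  note [simp] = star_unit_simps[OF l]
  show "q1 (gI U) (Ide C U) \<cdot> star_unit (Ide C U) = Ide C U" by simp
  have "q2 (gI U) (Ide C U) = \<eta> U \<cdot> q1 (gI U) (Ide C U)"
    using star_simps(6)[of "gI U" "Ide C U"] by simp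
  then show "star_unit (Ide C U) \<cdot> q1 (gI U) (Ide C U) = Ide C (Dom C (q1 (gI U) (Ide C U)))"
    by - (rule star_mono[of "gI U" "Ide C U"], simp_all)
qed

text \<open>The domain of \<open>sO (gI U) d\<close> is the chosen pullback of
  \<open>\<eta> U\<close> and \<open>T d\<close>, and cartesianness of \<open>\<eta>\<close> says
  that \<open>d\<close> and \<open>\<eta> (Dom C d)\<close> form a pullback of the same
  cospan.\<close>

lemma iso_star_unit:
  assumes d: "d \<in> Arr C" "Cod C d = U"
  shows "iso C (star_unit d)"
proof -
  have U[simp]: "U \<in> Obj C" using assms by auto
  note [simp] = d star_unit_simps[OF d]
  note P = eta_pullback[OF d(1), unfolded d(2)]
  obtain s where s: "s \<in> Arr C" "Dom C s = Dom C (q1 (gI U) d)" "Cod C s = Dom C d"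
    "d \<cdot> s = q1 (gI U) d" "\<eta> (Dom C d) \<cdot> s = q2 (gI U) d"
    by (rule is_pullbackE[OF P, of "q1 (gI U) d" "q2 (gI U) d"]) simp_all
  note [simp] = s
  show ?thesis
  proof (rule isoI_mono[of _ s])
    show "star_unit d \<cdot> s = Ide C (Cod C (star_unit d))"
      by (rule star_mono[of "gI U" d]) simp_all
  next
    fix a b assume ab: "a \<in> Arr C" "b \<in> Arr C" "Dom C a = Dom C b" "Cod C a = Dom C (star_unit d)"
      "Cod C b = Dom C (star_unit d)" "star_unit d \<cdot> a = star_unit d \<cdot> b"
    have "q1 (gI U) d \<cdot> (star_unit d \<cdot> a) =
      q1 (gI U) d \<cdot> (star_unit d \<cdot> b)" "q2 (gI U) d \<cdot> (star_unit d \<cdot> a) =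
        q2 (gI U) d \<cdot> (star_unit d \<cdot> b)"
      by (simp_all only: ab(6))
    then show "a = b" using ab(1-5) by - (rule is_pullback_mono[OF P], simp_all)
  qed simp_all
qed

text \<open>An inverse exists because \<open>\<mu>\<close> is cartesian and \<open>T\<close> preserves the
  pullback \<open>B \<star> d\<close>.\<close>

lemma iso_star_assoc:
  assumes A: "A \<in> graphs" "B \<in> graphs" and c: "Cod C (fst A) =
    Cod C (fst B)" and d: "d \<in> Arr C" "Cod C d = Cod C (fst B)"
  shows "iso C (star_assoc A B d)"
proof -
  note [simp] = A c d star_assoc_simps[OF A c d]
  note M = mu_pullback[OF d(1), unfolded d(2)]
    and S = T_pullback[OF star_pullback[OF A(2) d]]
    and S' = star_pullback[OF A(1), of "sO B d"]
  let ?a = "q1 A (fst B) \<cdot> q1 (tO A B) d" and ?b = "q2 A (fst B) \<cdot> q1 (tO A B) d" and ?x =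
    "q2 (tO A B) d"
  have x: "onA T d \<cdot> ?x = \<mu> (Cod C (fst B)) \<cdot> (onA T (snd B) \<cdot> ?b)"
    using star_simps(6)[of "tO A B" d] by simp
  \<comment> \<open>Given \<open>((a, b), x)\<close>, cartesianness of \<open>\<mu>\<close> lifts
    \<open>x\<close> to a \<open>y\<close> two levels of \<open>T\<close> up; preservation of
    pullbacks combines \<open>y\<close> with \<open>b\<close> into an element \<open>z\<close> of
    \<open>T (B \<star> d)\<close>; the pullback \<open>A \<star> (B \<star> d)\<close> then takes
    in \<open>a\<close>.\<close>
  obtain y where y: "y \<in> Arr C" "Dom C y = Dom C (q1 (tO A B) d)" "Cod C y =
    onO T (onO T (Dom C d))"
    "onA T (onA T d) \<cdot> y = onA T (snd B) \<cdot> ?b" "\<mu> (Dom C d) \<cdot> y = ?x"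
    by (rule is_pullbackE[OF M, of "onA T (snd B) \<cdot> ?b" ?x]) (simp_all add: x)
  obtain z where z: "z \<in> Arr C" "Dom C z = Dom C (q1 (tO A B) d)" "Cod C z = onO T (Dom C (q1 B d))"
    "onA T (q1 B d) \<cdot> z = ?b" "onA T (q2 B d) \<cdot> z = y"
    by (rule is_pullbackE[OF S, of ?b y]) (simp_all add: y)
  have "onA T (sO B d) \<cdot> z = onA T (fst B) \<cdot> ?b"
    using z by simp
  also have "\<dots> = snd A \<cdot> ?a" by simp
  finally obtain s where s: "s \<in> Arr C" "Dom C s = Dom C (q1 (tO A B) d)" "Cod C s =
    Dom C (q1 A (sO B d))"
    "q1 A (sO B d) \<cdot> s = ?a" "q2 A (sO B d) \<cdot> s = z"
    by - (rule is_pullbackE[OF S', of ?a z], simp_all add: z(1-3))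
  note [simp] = s y(1-3,5) z
  show ?thesis
  proof (rule isoI_mono[of _ s])
    show "star_assoc A B d \<cdot> s = Ide C (Cod C (star_assoc A B d))"
      by (rule tens_mono[OF A c d]) simp_all
  next
    fix m n assume mn: "m \<in> Arr C" "n \<in> Arr C" "Dom C m = Dom C n" "Cod C m =
      Dom C (star_assoc A B d)"
      "Cod C n = Dom C (star_assoc A B d)" "star_assoc A B d \<cdot> m = star_assoc A B d \<cdot> n"
    note [simp] = mn(1-5)
    have q: "q1 A (fst B) \<cdot> (q1 (tO A B) d \<cdot> (star_assoc A B d \<cdot> m)) =
      q1 A (fst B) \<cdot> (q1 (tO A B) d \<cdot> (star_assoc A B d \<cdot> n))"
      "q2 A (fst B) \<cdot> (q1 (tO A B) d \<cdot> (star_assoc A B d \<cdot> m)) =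
        q2 A (fst B) \<cdot> (q1 (tO A B) d \<cdot> (star_assoc A B d \<cdot> n))"
      "q2 (tO A B) d \<cdot> (star_assoc A B d \<cdot> m) = q2 (tO A B) d \<cdot> (star_assoc A B d \<cdot> n)"
      by (simp_all only: mn(6))
    have q: "q1 A (sO B d) \<cdot> m = q1 A (sO B d) \<cdot> n"
      "onA T (q1 B d) \<cdot> (q2 A (sO B d) \<cdot> m) = onA T (q1 B d) \<cdot> (q2 A (sO B d) \<cdot> n)"
      "\<mu> (Dom C d) \<cdot> (onA T (q2 B d) \<cdot> (q2 A (sO B d) \<cdot> m)) =
        \<mu> (Dom C d) \<cdot> (onA T (q2 B d) \<cdot> (q2 A (sO B d) \<cdot> n))"
      using q by simp_all
    \<comment> \<open>The other projection of the pullback square of \<open>\<mu>\<close> is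
      determined by the coordinate in \<open>B\<close>, on which \<open>m\<close> and
      \<open>n\<close> already agree.\<close>
    have TT: "onA T (onA T d) \<cdot> (onA T (q2 B d) \<cdot> (q2 A (sO B d) \<cdot> k)) =
      onA T (snd B) \<cdot> (onA T (q1 B d) \<cdot> (q2 A (sO B d) \<cdot> k))"
      if "k \<in> Arr C" "Cod C k = Dom C (q1 A (sO B d))" for k
      using that by (simp add: T_Comp_reassoc(2)[OF star_simps(6)[OF A(2) d]])
    have "onA T (q2 B d) \<cdot> (q2 A (sO B d) \<cdot> m) = onA T (q2 B d) \<cdot> (q2 A (sO B d) \<cdot> n)"
      by (rule is_pullback_mono[OF M]) (simp_all add: TT q)
    then have "q2 A (sO B d) \<cdot> m = q2 A (sO B d) \<cdot> n"
      by - (rule is_pullback_mono[OF S], simp_all add: q)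
    then show "m = n"
      by - (rule star_mono[of A "sO B d"], simp_all add: q)
  qed simp_all
qed

text \<open>The given pullback lives in the second coordinate, where \<open>T\<close> preserves it;
  in the first coordinate the square consists of \<open>h\<close> twice and two identities and is a
  pullback anyway. With \<open>h\<close> an identity this makes \<open>st A\<close> preserve
  pullbacks, and for general \<open>h\<close> it makes the transformation of \<open>repA\<close>
  cartesian.\<close>

lemma star_map_pullback:
  assumes h: "gph_mor u A h B" and g: "arr_over C (Ide C (Dom C u)) x g x'" and g': "arr_over C (Ide
    C (Cod C u)) z g' z'"
    and f: "arr_over C u x f z" and f': "arr_over C u x' f' z'" and pbk: "is_pullback C g' f' f g"
  shows "is_pullback C (star_map B z B z' (Ide C (Dom C (fst B))) g') (star_map A x' B z' h f')
    (star_map A x B z h f) (star_map A x A x' (Ide C (Dom C (fst A))) g)"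
proof -
  note [simp] = gph_morD[OF h] arr_overD(1-9)[OF g] arr_overD(1-9)[OF g'] arr_overD(1-8)[OF f]
    arr_overD(1-8)[OF f']
  have iA: "gph_mor (Ide C (Dom C u)) A (Ide C (Dom C (fst A))) A" and iB: "gph_mor (Ide C (Cod C
    u)) B (Ide C (Dom C (fst B))) B"
    by (auto intro: gph_mor_ide)
  note s1 = star_map_simps[OF iB g'] and s2 = star_map_simps[OF h f'] and s3 =
    star_map_simps[OF h f] and s4 = star_map_simps[OF iA g]
  note [simp] = s1 s2 s3 s4
  note P = T_pullback[OF pbk] and eq = is_pullbackD(9)[OF pbk]
  note t = T_Comp_reassoc[OF arr_overD(9)[OF g]] T_Comp_reassoc[OF arr_overD(9)[OF g']]
  show ?thesis
  proof (rule is_pullbackI)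
    show "star_map B z B z' (Ide C (Dom C (fst B))) g' \<cdot> star_map A x B z h f =
      star_map A x' B z' h f' \<cdot> star_map A x A x' (Ide C (Dom C (fst A))) g"
      by (rule star_mono[of B z']) (simp_all add: T_Comp_reassoc(2)[OF eq])
  next
    fix a b assume ab: "a \<in> Arr C" "b \<in> Arr C" "Dom C a = Dom C b"
      "Cod C a = Dom C (star_map B z B z' (Ide C (Dom C (fst B))) g')" "Cod C b =
        Dom C (star_map A x' B z' h f')"
      "star_map B z B z' (Ide C (Dom C (fst B))) g' \<cdot> a = star_map A x' B z' h f' \<cdot> b"
    note [simp] = ab(1-5)
    have "q1 B z' \<cdot> (star_map B z B z' (Ide C (Dom C (fst B))) g' \<cdot> a) =
      q1 B z' \<cdot> (star_map A x' B z' h f' \<cdot> b)"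
      "q2 B z' \<cdot> (star_map B z B z' (Ide C (Dom C (fst B))) g' \<cdot> a) =
        q2 B z' \<cdot> (star_map A x' B z' h f' \<cdot> b)"
      by (simp_all only: ab(6))
    then have e1: "q1 B z \<cdot> a = h \<cdot> (q1 A x' \<cdot> b)" and e2: "onA T g' \<cdot> (q2 B z \<cdot> a) =
      onA T f' \<cdot> (q2 A x' \<cdot> b)"
      by simp_all
    obtain t where t: "t \<in> Arr C" "Dom C t = Dom C b" "Cod C t = onO T (Dom C x)"
      "onA T f \<cdot> t = q2 B z \<cdot> a" "onA T g \<cdot> t = q2 A x' \<cdot> b"
      by (rule is_pullbackE[OF P, of "q2 B z \<cdot> a" "q2 A x' \<cdot> b"]) (simp_all add: e2)
    have "onA T x \<cdot> t = onA T x' \<cdot> (onA T g \<cdot> t)"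
      using t(1-3) by (simp add: T_Comp_reassoc(2)[OF arr_overD(9)[OF g]])
    also have "\<dots> = snd A \<cdot> (q1 A x' \<cdot> b)" by (simp add: t(5))
    finally have tx: "snd A \<cdot> (q1 A x' \<cdot> b) = onA T x \<cdot> t" by (rule sym)
    let ?m = "sp A x (q1 A x' \<cdot> b) t"
    have m: "?m \<in> Arr C" "Dom C ?m = Dom C b" "Cod C ?m = Dom C (q1 A x)" "q1 A x \<cdot> ?m =
      q1 A x' \<cdot> b" "q2 A x \<cdot> ?m = t"
      using sp_simps[of A x "q1 A x' \<cdot> b" t] t(1-3) tx by simp_all
    note [simp] = m
    show "\<exists>m. m \<in> Arr C \<and> Dom C m = Dom C a \<and> Cod C m = Dom C (star_map A x B z h f) \<and>
       star_map A x B z h f \<cdot> m = a \<and> star_map A x A x' (Ide C (Dom C (fst A))) g \<cdot> m = b"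
    proof (intro exI[of _ ?m] conjI)
      show "star_map A x B z h f \<cdot> ?m = a"
        by (rule star_mono[of B z]) (simp_all add: t e1)
      show "star_map A x A x' (Ide C (Dom C (fst A))) g \<cdot> ?m = b"
        by (rule star_mono[of A x']) (simp_all add: t)
    qed simp_all
  next
    fix m n assume mn: "m \<in> Arr C" "n \<in> Arr C" "Dom C m = Dom C n" "Cod C m =
      Dom C (star_map A x B z h f)"
      "Cod C n = Dom C (star_map A x B z h f)" "star_map A x B z h f \<cdot> m = star_map A x B z h f \<cdot> n"
      "star_map A x A x' (Ide C (Dom C (fst A))) g \<cdot> m =
        star_map A x A x' (Ide C (Dom C (fst A))) g \<cdot> n"
    note [simp] = mn(1-5)
    have "q2 B z \<cdot> (star_map A x B z h f \<cdot> m) = q2 B z \<cdot> (star_map A x B z h f \<cdot> n)"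
      "q1 A x' \<cdot> (star_map A x A x' (Ide C (Dom C (fst A))) g \<cdot> m) =
        q1 A x' \<cdot> (star_map A x A x' (Ide C (Dom C (fst A))) g \<cdot> n)"
      "q2 A x' \<cdot> (star_map A x A x' (Ide C (Dom C (fst A))) g \<cdot> m) =
        q2 A x' \<cdot> (star_map A x A x' (Ide C (Dom C (fst A))) g \<cdot> n)"
      by (simp_all only: mn(6,7))
    then have e: "onA T f \<cdot> (q2 A x \<cdot> m) = onA T f \<cdot> (q2 A x \<cdot> n)" "q1 A x \<cdot> m = q1 A x \<cdot> n"
      "onA T g \<cdot> (q2 A x \<cdot> m) = onA T g \<cdot> (q2 A x \<cdot> n)"
      by simp_all
    have "q2 A x \<cdot> m = q2 A x \<cdot> n"
      by (rule is_pullback_mono[OF P]) (simp_all add: e)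
    then show "m = n"
      by - (rule star_mono[of A x], simp_all add: e)
  qed simp_all
qed

section \<open>The fibration of T-graphs\<close>

lemma Gph_simps [simp]:
  "A \<in> Obj (Gph C T) \<longleftrightarrow> A \<in> graphs"
  "Dom (Gph C T) (A, hu, B) = A" "Cod (Gph C T) (A, hu, B) = B"
  "onO (p_gph C) A = Cod C (fst A)" "onA (p_gph C) (A, (h, u), B) = u"
  "(B', (k, v), D) \<cdot>\<^bsub>Gph C T\<^esub> (A, (h, u), B) = (A, (k \<cdot> h, v \<cdot> u), D)"
  "Ide (Gph C T) A = (A, (Ide C (Dom C (fst A)), Ide C (Cod C (fst A))), A)"
  by (simp_all add: Gph_def p_gph_def split_beta)

lemma Arr_Gph: "(A, (h, u), B) \<in> Arr (Gph C T) \<longleftrightarrow> gph_mor u A h B"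
  by (cases A; cases B) (auto simp: Gph_def gph_mor_def arr_over_def Hom_def gph_objs_def)

lemma Arr_GphE:
  assumes "F \<in> Arr (Gph C T)"
  obtains A h u B where "F = (A, (h, u), B)" "gph_mor u A h B"
  using assms Arr_Gph by (cases F) (metis surj_pair)

lemma Hom_GphE:
  assumes "F \<in> Hom (Gph C T) A B"
  obtains h u where "F = (A, (h, u), B)" "gph_mor u A h B"
proof -
  have F: "F \<in> Arr (Gph C T)" "Dom (Gph C T) F = A" "Cod (Gph C T) F = B"
    using assms by (simp_all add: Hom_def)
  from F(1) obtain A' h u B' where "F = (A', (h, u), B')" "gph_mor u A' h B'" by (rule Arr_GphE)
  then show ?thesis using that F(2,3) by simp
qed

lemma Hom_Gph: "(A, (h, u), B) \<in> Hom (Gph C T) A' B' \<longleftrightarrow> A' = A \<and> B' = B \<and> gph_mor u A h B"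
  by (auto simp: Hom_def Arr_Gph)

lemma category_Gph: "category (Gph C T)"
proof
  fix F assume "F \<in> Arr (Gph C T)"
  then obtain A h u B where F: "F = (A, (h, u), B)" and h: "gph_mor u A h B" by (rule Arr_GphE)
  note [simp] = gph_morD[OF h]
  show "Dom (Gph C T) F \<in> Obj (Gph C T)" "Cod (Gph C T) F \<in> Obj (Gph C T)"
    "Ide (Gph C T) (Cod (Gph C T) F) \<cdot>\<^bsub>Gph C T\<^esub> F = F" "F \<cdot>\<^bsub>Gph C T\<^esub> Ide (Gph C T) (Dom (Gph C T) F) =
      F"
    by (simp_all add: F)
next
  fix A assume "A \<in> Obj (Gph C T)"
  then show "Ide (Gph C T) A \<in> Hom (Gph C T) A A"
    using gph_mor_ide[of A] by (simp add: Hom_Gph)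
next
  fix F G X Y Z assume "F \<in> Hom (Gph C T) X Y" "G \<in> Hom (Gph C T) Y Z"
  then show "G \<cdot>\<^bsub>Gph C T\<^esub> F \<in> Hom (Gph C T) X Z"
    by (elim Hom_GphE) (simp add: Hom_Gph gph_mor_comp)
next
  fix F G H W X Y Z assume "F \<in> Hom (Gph C T) W X" "G \<in> Hom (Gph C T) X Y" "H \<in> Hom (Gph C T) Y Z"
  then obtain h u k v l w where *: "F = (W, (h, u), X)" "G = (X, (k, v), Y)" "H = (Y, (l, w), Z)"
    and m: "gph_mor u W h X" "gph_mor v X k Y" "gph_mor w Y l Z"
    by (elim Hom_GphE) blast
  have "Dom C v = Cod C u" "Dom C w = Cod C v"
    using gph_morD(6,7)[OF m(1)] gph_morD(6,7)[OF m(2)] gph_morD(6,7)[OF m(3)] by simp_all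
  then show "(H \<cdot>\<^bsub>Gph C T\<^esub> G) \<cdot>\<^bsub>Gph C T\<^esub> F = H \<cdot>\<^bsub>Gph C T\<^esub> (G \<cdot>\<^bsub>Gph C T\<^esub> F)"
    using gph_morD(4,5,8,9)[OF m(1)] gph_morD(4,5,8,9)[OF m(2)] gph_morD(4,5,8,9)[OF m(3)]
      by (simp add: *)
qed

lemma is_functor_p_gph: "is_functor (Gph C T) C (p_gph C)"
proof (intro is_functor.intro is_functor_axioms.intro)
  show "category (Gph C T)" by (rule category_Gph)
  show "category C" by unfold_locales
  show "onO (p_gph C) A \<in> Obj C" if "A \<in> Obj (Gph C T)" for A using that by simp
  show "onA (p_gph C) F \<in> Hom C (onO (p_gph C) A) (onO (p_gph C) B)" if "F \<in> Hom (Gph C T) A B" for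
    F A B
    using that by (elim Hom_GphE) (simp add: Hom_def gph_morD(4-9))
  show "onA (p_gph C) (Ide (Gph C T) A) = Ide C (onO (p_gph C) A)" if "A \<in> Obj (Gph C T)" for A
    by simp
  show "onA (p_gph C) (G \<cdot>\<^bsub>Gph C T\<^esub> F) = onA (p_gph C) G \<cdot> onA (p_gph C) F"
    if "F \<in> Hom (Gph C T) X Y" "G \<in> Hom (Gph C T) Y Z" for F G X Y Z
    using that by (elim Hom_GphE) simp
qed

text \<open>The limit of the diagram formed by \<open>u\<close>, \<open>onA T u\<close> and the two
  legs of \<open>B\<close>. A cone has a leg \<open>c\<close> to the domain of \<open>u\<close>, a
  leg \<open>t\<close> to \<open>T\<close> of that domain, and a leg \<open>b\<close> to the apex of
  \<open>B\<close>; \<open>fibration_Gph\<close> builds the limit from two pullbacks.\<close>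

definition gph_limit :: "'a \<Rightarrow> 'a gph_obj \<Rightarrow> 'a \<Rightarrow> 'a gph_obj \<Rightarrow> bool" where
  "gph_limit u A h B \<longleftrightarrow> (\<forall>c t b. c \<in> Arr C \<and> t \<in> Arr C \<and> b \<in> Arr C \<and> Dom C t = Dom C c \<and>
    Dom C b = Dom C c \<and>
     Cod C c = Dom C u \<and> Cod C t = onO T (Dom C u) \<and> Cod C b = Dom C (fst B) \<and>
     fst B \<cdot> b = u \<cdot> c \<and> snd B \<cdot> b = onA T u \<cdot> t \<longrightarrow>
     (\<exists>!m. m \<in> Hom C (Dom C c) (Dom C (fst A)) \<and> fst A \<cdot> m = c \<and> snd A \<cdot> m = t \<and> h \<cdot> m = b))"

text \<open>A cone \<open>(c, t, b)\<close> is the same as an arrow of T-graphs over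
  \<open>u\<close> from \<open>(c, t)\<close> to \<open>B\<close>. Its factorisation through the
  prone arrow over an identity is the mediating arrow.\<close>

lemma prone_GphD:
  assumes "prone (Gph C T) C (p_gph C) (A, (h, u), B)"
  shows "gph_limit u A h B"
  unfolding gph_limit_def
proof (intro allI impI)
  have h: "gph_mor u A h B" using assms by (simp add: prone_def Arr_Gph)
  note D = gph_morD[OF h]
  fix c t b assume a: "c \<in> Arr C \<and> t \<in> Arr C \<and> b \<in> Arr C \<and> Dom C t = Dom C c \<and> Dom C b = Dom C c \<and>
     Cod C c = Dom C u \<and> Cod C t = onO T (Dom C u) \<and> Cod C b = Dom C (fst B) \<and>
     fst B \<cdot> b = u \<cdot> c \<and> snd B \<cdot> b = onA T u \<cdot> t"
  then have G: "gph_mor u (c, t) b B"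
    using D(1-9) by (intro gph_morI graphI arr_overI) simp_all
  have "\<exists>!H. H \<in> Hom (Gph C T) (Dom (Gph C T) ((c, t), (b, u), B)) (Dom (Gph C T) (A, (h, u), B)) \<and>
      onA (p_gph C) H = Ide C (Dom C u) \<and> (A, (h, u), B) \<cdot>\<^bsub>Gph C T\<^esub> H = ((c, t), (b, u), B)"
    by (rule proneD[OF assms]) (use G a D(4-7) in \<open>simp_all add: Arr_Gph Hom_def\<close>)
  then have ex1: "\<exists>!H. H \<in> Hom (Gph C T) (c, t) A \<and>
      onA (p_gph C) H = Ide C (Dom C u) \<and> (A, (h, u), B) \<cdot>\<^bsub>Gph C T\<^esub> H = ((c, t), (b, u), B)"
    by simp
  have iff: "((c, t), (m, Ide C (Dom C u)), A) \<in> Hom (Gph C T) (c, t) A \<and>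
      onA (p_gph C) ((c, t), (m, Ide C (Dom C u)), A) = Ide C (Dom C u) \<and>
      (A, (h, u), B) \<cdot>\<^bsub>Gph C T\<^esub> ((c, t), (m, Ide C (Dom C u)), A) = ((c, t), (b, u), B) \<longleftrightarrow>
      m \<in> Hom C (Dom C c) (Dom C (fst A)) \<and> fst A \<cdot> m = c \<and> snd A \<cdot> m = t \<and> h \<cdot> m = b" for m
  proof -
    have "gph_mor (Ide C (Dom C u)) (c, t) m A \<and> h \<cdot> m = b \<longleftrightarrow>
      m \<in> Hom C (Dom C c) (Dom C (fst A)) \<and> fst A \<cdot> m = c \<and> snd A \<cdot> m = t \<and> h \<cdot> m = b" (is "?L \<longleftrightarrow>
        ?R")
    proof
      assume ?L
      then have m: "gph_mor (Ide C (Dom C u)) (c, t) m A" and "h \<cdot> m = b" by blast+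
      then show ?R using gph_morD[OF m] a D(4) by (simp add: Hom_def)
    next
      assume ?R
      then have "m \<in> Arr C" "Dom C m = Dom C c" "Cod C m = Dom C (fst A)" "fst A \<cdot> m = c" "snd A \<cdot> m =
        t" "h \<cdot> m = b"
        by (simp_all add: Hom_def)
      then show ?L using a D(1,4,6) gph_morD(1)[OF G] by (intro conjI gph_morI arr_overI) simp_all
    qed
    then show ?thesis using a D(4) by (simp add: Hom_Gph)
  qed
  from ex1 obtain H where H: "H \<in> Hom (Gph C T) (c, t) A" "onA (p_gph C) H = Ide C (Dom C u)"
      "(A, (h, u), B) \<cdot>\<^bsub>Gph C T\<^esub> H = ((c, t), (b, u), B)" by blast
  from H(1) obtain m v where "H = ((c, t), (m, v), A)" by (rule Hom_GphE)
  then have Hm: "H = ((c, t), (m, Ide C (Dom C u)), A)" using H(2) by simp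
  show "\<exists>!m. m \<in> Hom C (Dom C c) (Dom C (fst A)) \<and> fst A \<cdot> m = c \<and> snd A \<cdot> m = t \<and> h \<cdot> m = b"
  proof (rule ex1I[of _ m])
    show "m \<in> Hom C (Dom C c) (Dom C (fst A)) \<and> fst A \<cdot> m = c \<and> snd A \<cdot> m = t \<and> h \<cdot> m = b"
      using H iff[of m] unfolding Hm by blast
    fix n assume "n \<in> Hom C (Dom C c) (Dom C (fst A)) \<and> fst A \<cdot> n = c \<and> snd A \<cdot> n = t \<and> h \<cdot> n = b"
    then have "((c, t), (n, Ide C (Dom C u)), A) = H"
      using iff[of n] H ex1 by blast
    then show "n = m" unfolding Hm by simp
  qed
qed

lemma gph_limitE:
  assumes l: "gph_limit u A h B" and a: "c \<in> Arr C" "t \<in> Arr C" "b \<in> Arr C" "Dom C t =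
    Dom C c" "Dom C b = Dom C c"
     "Cod C c = Dom C u" "Cod C t = onO T (Dom C u)" "Cod C b = Dom C (fst B)"
     "fst B \<cdot> b = u \<cdot> c" "snd B \<cdot> b = onA T u \<cdot> t"
  obtains m where "m \<in> Arr C" "Dom C m = Dom C c" "Cod C m = Dom C (fst A)" "fst A \<cdot> m =
    c" "snd A \<cdot> m = t" "h \<cdot> m = b"
proof -
  have "\<exists>!m. m \<in> Hom C (Dom C c) (Dom C (fst A)) \<and> fst A \<cdot> m = c \<and> snd A \<cdot> m = t \<and> h \<cdot> m = b"
    using l a unfolding gph_limit_def by simp
  then obtain m where "m \<in> Hom C (Dom C c) (Dom C (fst A))" "fst A \<cdot> m = c" "snd A \<cdot> m = t" "h \<cdot> m =
    b" by blast
  then show ?thesis using that[of m] unfolding Hom_def by blast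
qed

lemma gph_limit_mono:
  assumes l: "gph_limit u A h B" and h: "gph_mor u A h B"
    and m: "m \<in> Arr C" "n \<in> Arr C" "Dom C m = Dom C n" "Cod C m = Dom C (fst A)" "Cod C n =
      Dom C (fst A)"
    "fst A \<cdot> m = fst A \<cdot> n" "snd A \<cdot> m = snd A \<cdot> n" "h \<cdot> m = h \<cdot> n"
  shows "m = n"
proof -
  note D = gph_morD[OF h]
  have "\<exists>!k. k \<in> Hom C (Dom C (fst A \<cdot> m)) (Dom C (fst A)) \<and> fst A \<cdot> k = fst A \<cdot> m \<and>
    snd A \<cdot> k = snd A \<cdot> m \<and> h \<cdot> k = h \<cdot> m"
    by (rule l[unfolded gph_limit_def, rule_format]) (use D m(1-5) in simp)
  moreover have "m \<in> Hom C (Dom C (fst A \<cdot> m)) (Dom C (fst A))" "n \<in> Hom C (Dom C (fst A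
    \<cdot> m)) (Dom C (fst A))"
    using D(1) m(1-5) by (simp_all add: Hom_def)
  ultimately show ?thesis using m(6-8) by metis
qed

lemma prone_GphI:
  assumes h: "gph_mor u A h B" and l: "gph_limit u A h B"
  shows "prone (Gph C T) C (p_gph C) (A, (h, u), B)"
  unfolding prone_def
proof (intro conjI ballI impI)
  show "(A, (h, u), B) \<in> Arr (Gph C T)" using h by (simp add: Arr_Gph)
next
  note D = gph_morD[OF h]
  fix F w assume F: "F \<in> Arr (Gph C T)"
    and w: "w \<in> Hom C (onO (p_gph C) (Dom (Gph C T) F)) (onO (p_gph C) (Dom (Gph C T) (A, (h, u),
      B)))"
    and c: "Cod (Gph C T) F = Cod (Gph C T) (A, (h, u), B) \<and>
      onA (p_gph C) F = onA (p_gph C) (A, (h, u), B) \<cdot> w"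
  from F obtain G b t B' where F: "F = (G, (b, t), B')" and b: "gph_mor t G b B'" by (rule Arr_GphE)
  have [simp]: "B' = B" and t: "t = u \<cdot> w" using c by (simp_all add: F)
  have [simp]: "w \<in> Arr C" "Cod C w = Dom C u" using w D(6) by (simp_all add: F Hom_def)
  have b: "gph_mor (u \<cdot> w) G b B" using b by (simp add: t)
  note [simp] = D(1-9) gph_morD[OF b]
  obtain m where m: "m \<in> Arr C" "Dom C m = Dom C (w \<cdot> fst G)" "Cod C m = Dom C (fst A)"
    "fst A \<cdot> m = w \<cdot> fst G" "snd A \<cdot> m = onA T w \<cdot> snd G" "h \<cdot> m = b"
    by (rule gph_limitE[OF l, of "w \<cdot> fst G" "onA T w \<cdot> snd G" b]) simp_all
  have gm: "gph_mor w G m A"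
    using m by (intro gph_morI arr_overI) simp_all
  show "\<exists>!H. H \<in> Hom (Gph C T) (Dom (Gph C T) F) (Dom (Gph C T) (A, (h, u), B)) \<and>
    onA (p_gph C) H = w \<and>
     (A, (h, u), B) \<cdot>\<^bsub>Gph C T\<^esub> H = F"
  proof (rule ex1I[of _ "(G, (m, w), A)"])
    show "(G, (m, w), A) \<in> Hom (Gph C T) (Dom (Gph C T) F) (Dom (Gph C T) (A, (h, u), B)) \<and>
      onA (p_gph C) (G, (m, w), A) = w \<and> (A, (h, u), B) \<cdot>\<^bsub>Gph C T\<^esub> (G, (m, w), A) = F"
      using gm m(6) by (simp add: F Hom_Gph t)
    fix H assume "H \<in> Hom (Gph C T) (Dom (Gph C T) F) (Dom (Gph C T) (A, (h, u), B)) \<and>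
      onA (p_gph C) H = w \<and>
      (A, (h, u), B) \<cdot>\<^bsub>Gph C T\<^esub> H = F"
    then have H: "H \<in> Hom (Gph C T) G A" "onA (p_gph C) H = w" "(A, (h, u), B) \<cdot>\<^bsub>Gph C T\<^esub> H = F"
      by (simp_all add: F)
    from H(1) obtain n v where Hn: "H = (G, (n, v), A)" and n: "gph_mor v G n A" by (rule Hom_GphE)
    have [simp]: "v = w" and hn: "h \<cdot> n = b" using H(2,3) by (simp_all add: Hn F)
    have "n = m"
      by (rule gph_limit_mono[OF l h]) (use gph_morD[OF n] m hn in simp_all)
    then show "H = (G, (m, w), A)" by (simp add: Hn)
  qed
qed

lemma fibration_Gph: "fibration (Gph C T) C (p_gph C)"
  unfolding fibration_def
proof (intro conjI ballI impI)
  show "is_functor (Gph C T) C (p_gph C)" by (rule is_functor_p_gph)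
next
  fix B u assume "B \<in> Obj (Gph C T)" "u \<in> Arr C" "Cod C u = onO (p_gph C) B"
  then have [simp]: "B \<in> graphs" "u \<in> Arr C" "Cod C (fst B) = Cod C u" by simp_all
  \<comment> \<open>Two successive pullbacks: \<open>fst B\<close> is pulled back along
    \<open>u\<close>, then the remaining leg \<open>r\<close> along \<open>T u\<close>.\<close>
  define r where "r = snd B \<cdot> p2 u (fst B)"
  have r[simp]: "r \<in> Arr C" "Dom C r = Dom C (p1 u (fst B))" "Cod C r = onO T (Cod C u)"
    by (simp_all add: r_def)
  let ?c = "p1 u (fst B) \<cdot> p2 (onA T u) r" and ?t = "p1 (onA T u) r" and ?b =
    "p2 u (fst B) \<cdot> p2 (onA T u) r"
  have rr: "snd B \<cdot> (p2 u (fst B) \<cdot> p2 (onA T u) r) = onA T u \<cdot> p1 (onA T u) r"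
  proof -
    have "r \<cdot> k = snd B \<cdot> (p2 u (fst B) \<cdot> k)" if "k \<in> Arr C" "Cod C k = Dom C (p1 u (fst B))" for k
      using that by (simp add: r_def)
    from this[of "p2 (onA T u) r"] show ?thesis using projections(6)[of "onA T u" r] by simp
  qed
  have m: "gph_mor u (?c, ?t) ?b B"
    by (intro gph_morI graphI arr_overI) (simp_all add: rr)
  have "gph_limit u (?c, ?t) ?b B"
    unfolding gph_limit_def
  proof (intro allI impI)
    fix c t b assume "c \<in> Arr C \<and> t \<in> Arr C \<and> b \<in> Arr C \<and> Dom C t = Dom C c \<and> Dom C b = Dom C c \<and>
     Cod C c = Dom C u \<and> Cod C t = onO T (Dom C u) \<and> Cod C b = Dom C (fst B) \<and>
     fst B \<cdot> b = u \<cdot> c \<and> snd B \<cdot> b = onA T u \<cdot> t"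
    then have [simp]: "c \<in> Arr C" "t \<in> Arr C" "b \<in> Arr C" "Dom C t = Dom C c" "Dom C b = Dom C c"
     "Cod C c = Dom C u" "Cod C t = onO T (Dom C u)" "Cod C b = Dom C (fst B)"
     "fst B \<cdot> b = u \<cdot> c" "snd B \<cdot> b = onA T u \<cdot> t" by simp_all
    define k where "k = pr u (fst B) c b"
    have k[simp]: "k \<in> Arr C" "Dom C k = Dom C c" "Cod C k = Dom C (p1 u (fst B))"
      "p1 u (fst B) \<cdot> k = c" "p2 u (fst B) \<cdot> k = b"
      by (simp_all add: k_def)
    have rk[simp]: "r \<cdot> k = onA T u \<cdot> t" by (simp add: r_def)
    define m where "m = pr (onA T u) r t k"
    have m[simp]: "m \<in> Arr C" "Dom C m = Dom C c" "Cod C m = Dom C ?t" "?t \<cdot> m =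
      t" "p2 (onA T u) r \<cdot> m = k"
      by (simp_all add: m_def)
    show "\<exists>!m. m \<in> Hom C (Dom C c) (Dom C (fst (?c, ?t))) \<and> fst (?c, ?t) \<cdot> m = c \<and>
      snd (?c, ?t) \<cdot> m = t \<and> ?b \<cdot> m = b"
    proof (rule ex1I[of _ m])
      show "m \<in> Hom C (Dom C c) (Dom C (fst (?c, ?t))) \<and> fst (?c, ?t) \<cdot> m = c \<and> snd (?c, ?t) \<cdot> m = t \<and>
        ?b \<cdot> m = b"
        by (simp add: Hom_def)
      fix n assume "n \<in> Hom C (Dom C c) (Dom C (fst (?c, ?t))) \<and> fst (?c, ?t) \<cdot> n = c \<and>
        snd (?c, ?t) \<cdot> n = t \<and> ?b \<cdot> n = b"
      then have n: "n \<in> Arr C" "Dom C n = Dom C c" "Cod C n = Dom C ?t" "?c \<cdot> n = c" "?t \<cdot> n =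
        t" "?b \<cdot> n = b"
        by (simp_all add: Hom_def)
      have "p2 (onA T u) r \<cdot> n = k"
        by (rule projections_mono[of u "fst B"]) (use n in simp_all)
      then show "n = m"
        by - (rule projections_mono[of "onA T u" r], use n in simp_all)
    qed
  qed
  then show "\<exists>f. prone (Gph C T) C (p_gph C) f \<and> Cod (Gph C T) f = B \<and> onA (p_gph C) f = u"
    using prone_GphI[OF m] by (intro exI[of _ "((?c, ?t), (?b, u), B)"]) simp
qed

text \<open>The supine lift has the same apex, with \<open>\<gamma>\<close> composed with
  \<open>u\<close> and \<open>\<delta>\<close> with \<open>T u\<close>. Its underlying arrow is an
  identity, which is why \<open>h\<close> is invertible in every supine arrow.\<close>

lemma gph_mor_push:
  assumes "A \<in> graphs" "u \<in> Arr C" "Cod C (fst A) = Dom C u"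
  shows "gph_mor u A (Ide C (Dom C (fst A))) (u \<cdot> fst A, onA T u \<cdot> snd A)"
  using assms by (intro gph_morI graphI arr_overI) simp_all

lemma opfibration_Gph: "opfibration (Gph C T) C (p_gph C)"
  unfolding opfibration_def
proof (intro conjI ballI impI)
  show "is_functor (Gph C T) C (p_gph C)" by (rule is_functor_p_gph)
next
  fix A u assume "A \<in> Obj (Gph C T)" "u \<in> Arr C" "Dom C u = onO (p_gph C) A"
  then have A[simp]: "A \<in> graphs" "u \<in> Arr C" "Cod C (fst A) = Dom C u" by simp_all
  let ?i = "Ide C (Dom C (fst A))" and ?B = "(u \<cdot> fst A, onA T u \<cdot> snd A)"
  note i = gph_mor_push[OF A]
  have "supine (Gph C T) C (p_gph C) (A, (?i, u), ?B)"
    unfolding supine_def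
  proof (intro conjI ballI impI)
    show "(A, (?i, u), ?B) \<in> Arr (Gph C T)" using i by (simp add: Arr_Gph)
    fix F w assume F: "F \<in> Arr (Gph C T)"
      and w: "w \<in> Hom C (onO (p_gph C) (Cod (Gph C T) (A, (?i, u), ?B))) (onO (p_gph C) (Cod (Gph C
        T) F))"
      and d: "Dom (Gph C T) F = Dom (Gph C T) (A, (?i, u), ?B) \<and>
        onA (p_gph C) F = w \<cdot> onA (p_gph C) (A, (?i, u), ?B)"
    from F obtain A' k t D where F: "F = (A', (k, t), D)" and k: "gph_mor t A' k D"
      by (rule Arr_GphE)
    have [simp]: "A' = A" and t: "t = w \<cdot> u" using d by (simp_all add: F)
    have [simp]: "w \<in> Arr C" "Dom C w = Cod C u" using w by (simp_all add: F Hom_def)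
    have k: "gph_mor (w \<cdot> u) A k D" using k by (simp add: t)
    note [simp] = gph_morD[OF k]
    have gm: "gph_mor w ?B k D" using gph_morD(2)[OF i] by (intro gph_morI arr_overI) simp_all
    show "\<exists>!H. H \<in> Hom (Gph C T) (Cod (Gph C T) (A, (?i, u), ?B)) (Cod (Gph C T) F) \<and>
      onA (p_gph C) H = w \<and>
      H \<cdot>\<^bsub>Gph C T\<^esub> (A, (?i, u), ?B) = F"
    proof (rule ex1I[of _ "(?B, (k, w), D)"])
      show "(?B, (k, w), D) \<in> Hom (Gph C T) (Cod (Gph C T) (A, (?i, u), ?B)) (Cod (Gph C T) F) \<and>
        onA (p_gph C) (?B, (k, w), D) = w \<and> (?B, (k, w), D) \<cdot>\<^bsub>Gph C T\<^esub> (A, (?i, u), ?B) = F"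
        using gm by (simp add: F t Hom_Gph)
      fix H assume "H \<in> Hom (Gph C T) (Cod (Gph C T) (A, (?i, u), ?B)) (Cod (Gph C T) F) \<and>
        onA (p_gph C) H = w \<and>
        H \<cdot>\<^bsub>Gph C T\<^esub> (A, (?i, u), ?B) = F"
      then have H: "H \<in> Hom (Gph C T) ?B D" "onA (p_gph C) H = w" "H \<cdot>\<^bsub>Gph C T\<^esub> (A, (?i, u), ?B) =
        F"
        by (simp_all add: F)
      from H(1) obtain n v where Hn: "H = (?B, (n, v), D)" and n: "gph_mor v ?B n D"
        by (rule Hom_GphE)
      show "H = (?B, (k, w), D)"
        using H(2,3) gph_morD(5,8)[OF n] by (simp add: Hn F)
    qed
  qed
  then show "\<exists>f. supine (Gph C T) C (p_gph C) f \<and> Dom (Gph C T) f = A \<and> onA (p_gph C) f = u"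
    by (intro exI[of _ "(A, (?i, u), ?B)"]) simp
qed

text \<open>Comparison with the arrow of \<open>gph_mor_push\<close> yields \<open>k\<close> with
  \<open>k h = 1\<close>. Both \<open>h k\<close> and the identity solve the factorisation problem
  of the arrow through itself, so uniqueness gives \<open>h k = 1\<close>.\<close>

lemma supine_GphD:
  assumes "supine (Gph C T) C (p_gph C) (A, (h, u), B)"
  shows "iso C h"
proof -
  have h: "gph_mor u A h B" using assms by (simp add: supine_def Arr_Gph)
  note [simp] = gph_morD[OF h]
  have U[simp]: "Cod C u \<in> Obj C" by simp
  let ?i = "Ide C (Dom C (fst A))" and ?B = "(u \<cdot> fst A, onA T u \<cdot> snd A)"
  have p: "gph_mor u A ?i ?B" by (rule gph_mor_push) simp_all
  have ex1: "\<exists>!H. H \<in> Hom (Gph C T) B (Cod (Gph C T) F) \<and> onA (p_gph C) H = Ide C (Cod C u) \<and>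
      H \<cdot>\<^bsub>Gph C T\<^esub> (A, (h, u), B) = F" if "F = (A, (k, u), D)" "gph_mor u A k D" for F k D
    using supineD[OF assms, of F "Ide C (Cod C u)"] that gph_morD(7)[OF that(2)]
      by (simp add: Arr_Gph Hom_def[of C])
  have "\<exists>!H. H \<in> Hom (Gph C T) B ?B \<and> onA (p_gph C) H = Ide C (Cod C u) \<and>
      H \<cdot>\<^bsub>Gph C T\<^esub> (A, (h, u), B) = (A, (?i, u), ?B)"
    using ex1[OF refl p] by simp
  then obtain H where H: "H \<in> Hom (Gph C T) B ?B" "onA (p_gph C) H = Ide C (Cod C u)"
      "H \<cdot>\<^bsub>Gph C T\<^esub> (A, (h, u), B) = (A, (?i, u), ?B)" by blast
  from H(1) obtain k v where Hk: "H = (B, (k, v), ?B)" and k: "gph_mor v B k ?B" by (rule Hom_GphE)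
  have [simp]: "v = Ide C (Cod C u)" and kh: "k \<cdot> h = ?i" using H(2,3) by (simp_all add: Hk)
  have k: "gph_mor (Ide C (Cod C u)) B k ?B" using k by simp
  note K = gph_morD[OF k]
  have "gph_mor (Ide C (Cod C u)) ?B h B"
    using gph_morD(2)[OF p] by (intro gph_morI arr_overI) simp_all
  from gph_mor_comp[OF k this] have hk: "gph_mor (Ide C (Cod C u)) B (h \<cdot> k) B" by simp
  have [simp]: "k \<in> Arr C" "Dom C k = Dom C (fst B)" "Cod C k = Dom C (fst A)" using K by simp_all
  have "\<exists>!H. H \<in> Hom (Gph C T) B B \<and> onA (p_gph C) H = Ide C (Cod C u) \<and>
      H \<cdot>\<^bsub>Gph C T\<^esub> (A, (h, u), B) = (A, (h, u), B)"
    using ex1[OF refl h] by simp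
  moreover have "(B, (h \<cdot> k, Ide C (Cod C u)), B) \<in> Hom (Gph C T) B B \<and>
      onA (p_gph C) (B, (h \<cdot> k, Ide C (Cod C u)), B) = Ide C (Cod C u) \<and>
      (B, (h \<cdot> k, Ide C (Cod C u)), B) \<cdot>\<^bsub>Gph C T\<^esub> (A, (h, u), B) = (A, (h, u), B)"
    using hk by (simp add: Hom_Gph kh)
  moreover have "(B, (Ide C (Dom C (fst B)), Ide C (Cod C u)), B) \<in> Hom (Gph C T) B B \<and>
      onA (p_gph C) (B, (Ide C (Dom C (fst B)), Ide C (Cod C u)), B) = Ide C (Cod C u) \<and>
      (B, (Ide C (Dom C (fst B)), Ide C (Cod C u)), B) \<cdot>\<^bsub>Gph C T\<^esub> (A, (h, u), B) = (A, (h, u), B)"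
    using gph_mor_ide[of B "Cod C u"] by (simp add: Hom_Gph)
  ultimately have "(B, (h \<cdot> k, Ide C (Cod C u)), B) =
    (B, (Ide C (Dom C (fst B)), Ide C (Cod C u)), B)"
    by blast
  then show ?thesis
    using kh by (intro isoI[of h k]) simp_all
qed

section \<open>The lax monoidal structure of T-graphs\<close>

lemma gph_tens_simps [simp]:
  "gph_tensA C pb T \<mu> ((A, (h, u), A'), (B, (k, v), B')) =
    (tO A B, (star_map A (fst B) A' (fst B') h k, u), tO A' B')"
  by (simp add: gph_tensA.simps star_map_def gph_pairing_def gph_pr1_def gph_pr2_def star_pr1_def
    star_pr2_def star_pairing_def)

lemma gph_assoc_eq:
  assumes "A \<in> graphs" "B \<in> graphs" "D \<in> graphs" "Cod C (fst A) = Cod C (fst D)" "Cod C (fst B) =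
    Cod C (fst D)"
  shows "gph_assoc C pb T \<mu> A B D =
    (tO A (tO B D), (star_assoc A B (fst D), Ide C (Cod C (fst A))), tO (tO A B) D)"
proof -
  note [simp] = assms
  have f: "fst (tO B D) = sO B (fst D)" by simp
  have e: "(\<mu> (Dom C (fst D)) \<cdot> onA T (q2 B (fst D))) \<cdot> q2 A (sO B (fst D)) =
    \<mu> (Dom C (fst D)) \<cdot> (onA T (q2 B (fst D)) \<cdot> q2 A (sO B (fst D)))"
    by (simp del: mu_natural)
  show ?thesis
    using e unfolding gph_assoc_def star_assoc_def gph_pairing_def gph_pr1_def gph_pr2_def
      star_pr1_def star_pr2_def
      star_pairing_def f[unfolded starO_def star_pr1_def] starO_def
    by (simp only:)
qed

lemma gph_lunit_eq: "gph_lunit C pb T \<eta> \<mu> A =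
    (A, (star_unit (fst A), Ide C (Cod C (fst A))), tO (gI (Cod C (fst A))) A)"
  by (simp add: gph_lunit_def star_unit_def Let_def gph_pairing_def star_pairing_def)

lemma gph_runit_eq: "gph_runit C pb T \<eta> \<mu> A =
    (tO A (gI (Cod C (fst A))), (q1 A (Ide C (Cod C (fst A))), Ide C (Cod C (fst A))), A)"
  by (simp add: gph_runit_def Let_def gph_pr1_def star_pr1_def)

lemma Gph_lmf_simps [simp]:
  "base (Gph_lmf C pb T \<eta> \<mu>) = C" "total (Gph_lmf C pb T \<eta> \<mu>) = Gph C T" "proj (Gph_lmf C pb T \<eta> \<mu>) =
    p_gph C"
  "onO (tensor (Gph_lmf C pb T \<eta> \<mu>)) (A, B) = tO A B"
  "onA (tensor (Gph_lmf C pb T \<eta> \<mu>)) = gph_tensA C pb T \<mu>"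
  "onO (unit (Gph_lmf C pb T \<eta> \<mu>)) U = gI U"
  "onA (unit (Gph_lmf C pb T \<eta> \<mu>)) u = (gI (Dom C u), (u, u), gI (Cod C u))"
  "assoc (Gph_lmf C pb T \<eta> \<mu>) = gph_assoc C pb T \<mu>"
  "lunit (Gph_lmf C pb T \<eta> \<mu>) = gph_lunit C pb T \<eta> \<mu>" "runit (Gph_lmf C pb T \<eta> \<mu>) =
    gph_runit C pb T \<eta> \<mu>"
  by (simp_all add: Gph_lmf_def gph_unit_def)

lemma fib_Gph: "A \<in> fib (Gph_lmf C pb T \<eta> \<mu>) U \<longleftrightarrow> A \<in> graphs \<and> Cod C (fst A) = U"
  by (auto simp: fib_def)

lemma vertical_Gph: "F \<in> vertical (Gph_lmf C pb T \<eta> \<mu>) A B \<longleftrightarrow>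
    (\<exists>h. F = (A, (h, Ide C (Cod C (fst A))), B) \<and> gph_mor (Ide C (Cod C (fst A))) A h B)"
  by (cases F) (auto simp: vertical_def Hom_Gph)

lemma is_functor_gph_tens:
  "is_functor (fibre_product (Gph C T) (p_gph C)) (Gph C T) (tensor (Gph_lmf C pb T \<eta> \<mu>))"
proof (intro is_functor.intro is_functor_axioms.intro)
  let ?D = "fibre_product (Gph C T) (p_gph C)" and ?T = "tensor (Gph_lmf C pb T \<eta> \<mu>)"
  show "category ?D" by (rule category_fibre_product[OF is_functor_p_gph])
  show "category (Gph C T)" by (rule category_Gph)
  show "onO ?T X \<in> Obj (Gph C T)" if "X \<in> Obj ?D" for X
    using that by (cases X) simp
  show "onA ?T F \<in> Hom (Gph C T) (onO ?T X) (onO ?T Y)"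
    if FH: "F \<in> Hom ?D X Y" for F X Y
  proof -
    obtain F1 F2 X1 X2 Y1 Y2 where *: "F = (F1, F2)" "X = (X1, X2)" "Y = (Y1, Y2)"
      by (cases F, cases X, cases Y)
    have H: "F1 \<in> Hom (Gph C T) X1 Y1" "F2 \<in> Hom (Gph C T) X2 Y2" and eq: "onA (p_gph C) F1 =
      onA (p_gph C) F2"
      using FH by (simp_all add: * Hom_fibre_product)
    obtain h u where 1: "F1 = (X1, (h, u), Y1)" and h: "gph_mor u X1 h Y1" using H(1)
      by (rule Hom_GphE)
    obtain k u' where 2: "F2 = (X2, (k, u'), Y2)" and k: "gph_mor u' X2 k Y2" using H(2)
      by (rule Hom_GphE)
    have [simp]: "u' = u" using eq by (simp add: 1 2)
    show ?thesis using gph_mor_tens[OF h k[simplified]] by (simp add: * 1 2 Hom_Gph)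
  qed
  show "onA ?T (Ide ?D X) =
      Ide (Gph C T) (onO ?T X)"
    if X: "X \<in> Obj ?D" for X
  proof -
    obtain A B where [simp]: "X = (A, B)" "A \<in> graphs" "B \<in> graphs" "Cod C (fst A) = Cod C (fst B)"
      using X by (cases X) simp
    show ?thesis using star_map_ide[of A "fst B"] by simp
  qed
  show "onA ?T (G \<cdot>\<^bsub>?D\<^esub> F) =
      onA ?T G \<cdot>\<^bsub>Gph C T\<^esub> onA ?T F"
    if FG: "F \<in> Hom ?D X Y" "G \<in> Hom ?D Y Z" for F G X Y Z
  proof -
    obtain F1 F2 X1 X2 Y1 Y2 G1 G2 Z1 Z2 where *: "F = (F1, F2)" "X = (X1, X2)" "Y = (Y1, Y2)" "G =
      (G1, G2)" "Z = (Z1, Z2)"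
      by (cases F, cases X, cases Y, cases G, cases Z)
    have H: "F1 \<in> Hom (Gph C T) X1 Y1" "F2 \<in> Hom (Gph C T) X2 Y2" "G1 \<in> Hom (Gph C T) Y1 Z1" "G2 \<in>
      Hom (Gph C T) Y2 Z2"
      and eq: "onA (p_gph C) F1 = onA (p_gph C) F2" "onA (p_gph C) G1 = onA (p_gph C) G2"
      using FG by (simp_all add: * Hom_fibre_product)
    obtain h u where 1: "F1 = (X1, (h, u), Y1)" and h: "gph_mor u X1 h Y1" using H(1)
      by (rule Hom_GphE)
    obtain k u' where 2: "F2 = (X2, (k, u'), Y2)" and k: "gph_mor u' X2 k Y2" using H(2)
      by (rule Hom_GphE)
    obtain h' v where 3: "G1 = (Y1, (h', v), Z1)" and h': "gph_mor v Y1 h' Z1" using H(3)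
      by (rule Hom_GphE)
    obtain k' v' where 4: "G2 = (Y2, (k', v'), Z2)" and k': "gph_mor v' Y2 k' Z2" using H(4)
      by (rule Hom_GphE)
    have [simp]: "u' = u" "v' = v" using eq by (simp_all add: 1 2 3 4)
    show ?thesis
      using star_map_comp[OF h _ h', of "fst X2" k "fst Y2" k' "fst Z2"] gph_morD(3)[OF k]
        gph_morD(3)[OF k']
      by (simp add: * 1 2 3 4)
  qed
qed

lemma is_functor_gph_unit: "is_functor C (Gph C T) (unit (Gph_lmf C pb T \<eta> \<mu>))"
proof (intro is_functor.intro is_functor_axioms.intro)
  show "category C" by unfold_locales
  show "category (Gph C T)" by (rule category_Gph)
qed (auto simp: Hom_Gph gph_mor_unit Hom_def[of C])

lemma lax_monoidal_fibration_Gph: "lax_monoidal_fibration (Gph_lmf C pb T \<eta> \<mu>)"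
proof (rule lax_monoidal_fibration.intro)
  let ?M = "Gph_lmf C pb T \<eta> \<mu>"
  show "fibration (total ?M) (base ?M) (proj ?M)" by (simp add: fibration_Gph)
  show "is_functor (fibre_product (total ?M) (proj ?M)) (total ?M) (tensor ?M)"
    using is_functor_gph_tens by simp
  show "is_functor (base ?M) (total ?M) (unit ?M)"
    using is_functor_gph_unit by simp
  show "onO (tensor ?M) (A, B) \<in> fib ?M U" if "A \<in> fib ?M U" "B \<in> fib ?M U" for A B U
    using that by (auto simp: fib_Gph)
  show "onA (proj ?M) (onA (tensor ?M) (F, G)) = onA (proj ?M) F"
    if "F \<in> Arr (total ?M)" "G \<in> Arr (total ?M)" for F G
    using that by (auto elim!: Arr_GphE)
  show "onO (unit ?M) U \<in> fib ?M U" if "U \<in> Obj (base ?M)" for U using that by (simp add: fib_Gph)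
  show "onA (proj ?M) (onA (unit ?M) u) = u" for u by simp
  show "assoc ?M A B D \<in> vertical ?M (onO (tensor ?M) (A, onO (tensor ?M) (B, D))) (onO (tensor ?M)
    (onO (tensor ?M) (A, B), D))"
    if "A \<in> fib ?M U" "B \<in> fib ?M U" "D \<in> fib ?M U" for A B D U
    using that gph_mor_assoc[of A B D] by (auto simp: fib_Gph vertical_Gph gph_assoc_eq)
  show "assoc ?M A' B' D' \<cdot>\<^bsub>total ?M\<^esub> onA (tensor ?M) (F, onA (tensor ?M) (G, H)) =
      onA (tensor ?M) (onA (tensor ?M) (F, G), H) \<cdot>\<^bsub>total ?M\<^esub> assoc ?M A B D"
    if FGH: "F \<in> Hom (total ?M) A A'" "G \<in> Hom (total ?M) B B'" "H \<in> Hom (total ?M) D D'"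
      "onA (proj ?M) F = onA (proj ?M) G" "onA (proj ?M) G =
        onA (proj ?M) H" for F G H A A' B B' D D'
  proof -
    obtain h u where 1: "F = (A, (h, u), A')" and h: "gph_mor u A h A'" using FGH(1)[simplified]
      by (rule Hom_GphE)
    obtain k v where 2: "G = (B, (k, v), B')" and k: "gph_mor v B k B'" using FGH(2)[simplified]
      by (rule Hom_GphE)
    obtain l w where 3: "H = (D, (l, w), D')" and l: "gph_mor w D l D'" using FGH(3)[simplified]
      by (rule Hom_GphE)
    have [simp]: "v = u" "w = u" using FGH(4,5) by (simp_all add: 1 2 3)
    note k = k[simplified] and l = l[simplified]
    note [simp] = gph_morD(1,2,4,6,7)[OF h] gph_morD(1,2,4,6,7)[OF k] gph_morD(1,2,4,6,7)[OF l]
    show ?thesis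
      using star_assoc_natural[OF h k gph_morD(3)[OF l]] by (simp add: 1 2 3 gph_assoc_eq)
  qed
  show "lunit ?M A \<in> vertical ?M A (onO (tensor ?M) (onO (unit ?M) U, A))" if "A \<in> fib ?M U" for A U
    using that gph_mor_lunit[of A U] by (auto simp: fib_Gph vertical_Gph gph_lunit_eq)
  show "lunit ?M A' \<cdot>\<^bsub>total ?M\<^esub> F =
    onA (tensor ?M) (onA (unit ?M) (onA (proj ?M) F), F) \<cdot>\<^bsub>total ?M\<^esub> lunit ?M A"
    if F: "F \<in> Hom (total ?M) A A'" for F A A'
  proof -
    obtain h u where 1: "F = (A, (h, u), A')" and h: "gph_mor u A h A'" using F[simplified]
      by (rule Hom_GphE)
    show ?thesis
      using star_unit_natural[OF gph_morD(3)[OF h]] gph_morD(4,6,7)[OF h]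
        by (simp add: 1 gph_lunit_eq)
  qed
  show "runit ?M A \<in> vertical ?M (onO (tensor ?M) (A, onO (unit ?M) U)) A" if "A \<in> fib ?M U" for A U
    using that gph_mor_runit[of A U] by (auto simp: fib_Gph vertical_Gph gph_runit_eq)
  show "runit ?M A' \<cdot>\<^bsub>total ?M\<^esub> onA (tensor ?M) (F, onA (unit ?M) (onA (proj ?M) F)) =
    F \<cdot>\<^bsub>total ?M\<^esub> runit ?M A"
    if F: "F \<in> Hom (total ?M) A A'" for F A A'
  proof -
    obtain h u where 1: "F = (A, (h, u), A')" and h: "gph_mor u A h A'" using F[simplified]
      by (rule Hom_GphE)
    note [simp] = gph_morD(4,6,7)[OF h]
    have "arr_over C u (Ide C (Dom C u)) u (Ide C (Cod C u))" by (intro arr_overI) simp_all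
    then show ?thesis
      using star_map_simps(4)[OF h] by (simp add: 1 gph_runit_eq)
  qed
  show "assoc ?M (onO (tensor ?M) (W, A)) B D \<cdot>\<^bsub>total ?M\<^esub> assoc ?M W A (onO (tensor ?M) (B, D)) =
      onA (tensor ?M) (assoc ?M W A B, Ide (total ?M) D) \<cdot>\<^bsub>total ?M\<^esub> assoc ?M W (onO (tensor ?M) (A,
        B)) D
        \<cdot>\<^bsub>total ?M\<^esub> onA (tensor ?M) (Ide (total ?M) W, assoc ?M A B D)"
    if o: "W \<in> fib ?M U" "A \<in> fib ?M U" "B \<in> fib ?M U" "D \<in> fib ?M U" for W A B D U
  proof -
    have [simp]: "W \<in> graphs" "A \<in> graphs" "B \<in> graphs" "D \<in> graphs" "Cod C (fst W) =
      U" "Cod C (fst A) = U"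
      "Cod C (fst B) = U" "Cod C (fst D) = U" and U[simp]: "U \<in> Obj C"
      using o by (auto simp: fib_Gph)
    note p = star_assoc_pentagon[of W A B "fst D"]
    have g: "gph_mor (Ide C U) (tO W (tO A B)) (star_assoc W A (fst B)) (tO (tO W A) B)"
      "gph_mor (Ide C U) (tO A (tO B D)) (star_assoc A B (fst D)) (tO (tO A B) D)"
      "gph_mor (Ide C U) (tO W (tO (tO A B) D)) (star_assoc W (tO A B) (fst D)) (tO (tO W (tO A B))
        D)"
      using gph_mor_assoc[of W A B] gph_mor_assoc[of A B D] gph_mor_assoc[of W "tO A B" D]
        by simp_all
    show ?thesis
      using p by (simp add: gph_assoc_eq)
  qed
  show "onA (tensor ?M) (runit ?M A, Ide (total ?M) B) \<cdot>\<^bsub>total ?M\<^esub> assoc ?M A (onO (unit ?M) U) B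
        \<cdot>\<^bsub>total ?M\<^esub> onA (tensor ?M) (Ide (total ?M) A, lunit ?M B) =
          Ide (total ?M) (onO (tensor ?M) (A, B))"
    if o: "A \<in> fib ?M U" "B \<in> fib ?M U" for A B U
  proof -
    have [simp]: "A \<in> graphs" "B \<in> graphs" "Cod C (fst A) = U" "Cod C (fst B) =
      U" and U[simp]: "U \<in> Obj C"
      using o by (auto simp: fib_Gph)
    show ?thesis
      using triangle_star[of A "fst B" U] by (simp add: gph_assoc_eq gph_lunit_eq gph_runit_eq)
  qed
  show "runit ?M (onO (unit ?M) U) \<cdot>\<^bsub>total ?M\<^esub> lunit ?M (onO (unit ?M) U) =
    Ide (total ?M) (onO (unit ?M) U)"
    "lunit ?M (onO (unit ?M) U) \<cdot>\<^bsub>total ?M\<^esub> runit ?M (onO (unit ?M) U) =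
      Ide (total ?M) (onO (tensor ?M) (onO (unit ?M) U, onO (unit ?M) U))"
    if "U \<in> Obj (base ?M)" for U
    using that unit_inverse_star[of U] by (simp_all add: gph_lunit_eq gph_runit_eq)
qed

section \<open>The representation functor\<close>

abbreviation "st \<equiv> star C pb T"

lemma star_onO [simp]: "d \<in> Arr C \<Longrightarrow> Cod C d = Cod C (fst A) \<Longrightarrow> onO (st A) d = sO A d"
  by (simp add: star_def)

lemma star_slice_ftr: "st A = slice_ftr C (Cod C (fst A)) (sO A) (\<lambda>d f d'. sp A d' (q1 A d) (onA T f
  \<cdot> q2 A d))"
  by (simp add: star_def slice_ftr_def)

lemma star_mor [simp]:
  assumes A: "A \<in> graphs" and f: "arr_over C (Ide C (Cod C (fst A))) d f d'"
  shows "mor (st A) d f d' = star_map A d A d' (Ide C (Dom C (fst A))) f"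
  using A f arr_overD[OF f] by (simp add: star_slice_ftr star_map_def)

lemma is_functor_star:
  assumes A: "A \<in> graphs"
  shows "is_functor (slice C (Cod C (fst A))) (slice C (Cod C (fst A))) (st A)"
proof (rule is_functor_sliceI)
  note i = gph_mor_ide[OF A refl]
  note [simp] = A
  fix x f y assume f: "arr_over C (Ide C (Cod C (fst A))) x f y"
  note [simp] = arr_overD[OF f]
  show "onA (st A) (x, f, y) = (onO (st A) x, mor (st A) x f y, onO (st A) y) \<and>
      arr_over C (Ide C (Cod C (fst A))) (onO (st A) x) (mor (st A) x f y) (onO (st A) y)"
    using f star_map_over[OF i f] by (simp add: star_slice_ftr slice_ftr_onA star_map_def)
  fix g z assume g: "arr_over C (Ide C (Cod C (fst A))) y g z"
  have gf: "arr_over C (Ide C (Cod C (fst A))) x (g \<cdot> f) z"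
    using arr_over_comp_left[OF f] g by simp
  show "mor (st A) x (g \<cdot> f) z = mor (st A) y g z \<cdot> mor (st A) x f y"
    unfolding star_mor[OF A f] star_mor[OF A g] star_mor[OF A gf] star_map_comp[OF i f i g] by simp
next
  fix x assume x: "x \<in> Arr C" "Cod C x = Cod C (fst A)"
  show "mor (st A) x (Ide C (Dom C x)) x = Ide C (Dom C (onO (st A) x))"
    unfolding star_mor[OF A arr_over_ide[OF x refl]] star_map_ide[OF A x] using A x by simp
qed (use A in simp_all)

lemma exp_objs_star: "A \<in> graphs \<Longrightarrow> (Cod C (fst A), st A) \<in> exp_objs C"
  using is_functor_star[of A] by (simp add: star_slice_ftr exp_objs_slice_ftr)

lemma acts_star:
  assumes h: "gph_mor u A h B"
  shows "acts (st A) u (st B) (\<lambda>x f z. star_map A x B z h f)"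
proof -
  note [simp] = gph_morD[OF h]
  note iA = gph_mor_ide[OF gph_morD(1)[OF h] refl] and iB = gph_mor_ide[OF gph_morD(2)[OF h] refl]
  have "action C (st A) u (st B) (\<lambda>x f z. star_map A x B z h f)"
    unfolding action_def
  proof (intro conjI allI impI)
    fix x f z assume f: "arr_over C u x f z"
    note [simp] = arr_overD[OF f]
    show "arr_over C u (onO (st A) x) (star_map A x B z h f) (onO (st B) z)"
      using star_map_over[OF h f] by simp
    show "star_map A x' B z h (f \<cdot> g) = star_map A x B z h f \<cdot> mor (st A) x' g x"
      if "arr_over C (Ide C (Dom C u)) x' g x" for x' g
    proof -
      have g: "arr_over C (Ide C (Cod C (fst A))) x' g x" using that by simp
      show ?thesis unfolding star_mor[OF gph_morD(1)[OF h] g] star_map_comp[OF iA g h f] by simp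
    qed
    show "star_map A x B z' h (g \<cdot> f) = mor (st B) z g z' \<cdot> star_map A x B z h f"
      if "arr_over C (Ide C (Cod C u)) z g z'" for g z'
    proof -
      have g: "arr_over C (Ide C (Cod C (fst B))) z g z'" using that by simp
      show ?thesis unfolding star_mor[OF gph_morD(2)[OF h] g] star_map_comp[OF h f iB g] by simp
    qed
  qed
  then show ?thesis using exp_objs_star[of A] exp_objs_star[of B] by (simp add: acts_def)
qed

text \<open>The concrete definition of \<open>rep\<close> on arrows is literally the encoding of an
  action. Later proofs remove \<open>repA.simps\<close> from the simplifier so as to go through this
  equation.\<close>

lemma repA_eq:
  assumes h: "gph_mor u A h B"
  shows "repA C pb T (A, (h, u), B) = oa (st A) u (st B) (\<lambda>x f z. star_map A x B z h f)"
  using gph_morD(4,6,7)[OF h]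
  by (simp add: repO_def of_action_def star_map_def restrict_def fun_eq_iff)

lemma is_functor_rep: "is_functor (Gph C T) (Exp C pb) (rep C pb T)"
proof (intro is_functor.intro is_functor_axioms.intro)
  show "category (Gph C T)" by (rule category_Gph)
  show "category (Exp C pb)" by (rule category_Exp)
  show "onO (rep C pb T) A \<in> Obj (Exp C pb)" if "A \<in> Obj (Gph C T)" for A
    using that exp_objs_star[of A] by (simp add: rep_def repO_def)
  show "onA (rep C pb T) F \<in> Hom (Exp C pb) (onO (rep C pb T) A) (onO (rep C pb T) B)"
    if AB: "F \<in> Hom (Gph C T) A B" for F A B
  proof -
    obtain h u where F: "F = (A, (h, u), B)" and h: "gph_mor u A h B" using AB by (rule Hom_GphE)
    show ?thesis
      using of_action_in_Arr[OF acts_star[OF h]] gph_morD(6,7)[OF h]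
      by (simp add: F rep_def repA_eq[OF h] repO_def Hom_def del: repA.simps)
  qed
  show "onA (rep C pb T) (Ide (Gph C T) A) =
    Ide (Exp C pb) (onO (rep C pb T) A)" if "A \<in> Obj (Gph C T)" for A
  proof -
    have A: "A \<in> graphs" using that by simp
    then show ?thesis
      using repA_eq[OF gph_mor_ide[OF A refl]] Ide_Exp[OF exp_objs_star[OF A]]
      by (simp add: rep_def repO_def del: repA.simps) (intro of_action_cong, simp_all)
  qed
  show "onA (rep C pb T) (G \<cdot>\<^bsub>Gph C T\<^esub> F) = onA (rep C pb T) G \<cdot>\<^bsub>Exp C pb\<^esub> onA (rep C pb T) F"
    if FG: "F \<in> Hom (Gph C T) X Y" "G \<in> Hom (Gph C T) Y Z" for F G X Y Z
  proof -
    obtain h u where F: "F = (X, (h, u), Y)" and h: "gph_mor u X h Y" using FG(1) by (rule Hom_GphE)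
    obtain k v where G: "G = (Y, (k, v), Z)" and k: "gph_mor v Y k Z" using FG(2) by (rule Hom_GphE)
    have uv: "Dom C v = Cod C u" using gph_morD(7)[OF h] gph_morD(6)[OF k] by simp
    note a = acts_star[OF h] and b = acts_star[OF k]
    have "star_map X x Z z (k \<cdot> h) f =
      comp_action C pb u v (\<lambda>x f z. star_map Y x Z z k f) (\<lambda>x f z. star_map X x Y z h f) x f z"
      if f: "arr_over C (v \<cdot> u) x f z" for x f z
    proof -
      obtain y p q where p: "arr_over C u x p y" and q: "arr_over C v y q z" and f: "f = q \<cdot> p"
        using f by (rule arr_over_factorE) (use uv gph_morD(4)[OF h] gph_morD(4)[OF k] in simp_all)
      show ?thesis
        unfolding f comp_action_acts_eq[OF a b uv p q] star_map_comp[OF h p k q] ..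
    qed
    then have "oa (st X) (v \<cdot> u) (st Z) (\<lambda>x f z. star_map X x Z z (k \<cdot> h) f) =
      oa (st X) (v \<cdot> u) (st Z)
       (comp_action C pb u v (\<lambda>x f z. star_map Y x Z z k f) (\<lambda>x f z. star_map X x Y z h f))"
      using uv gph_morD(4)[OF h] gph_morD(4)[OF k] by (intro of_action_cong) simp_all
    then show ?thesis
      using repA_eq[OF gph_mor_comp[OF h k]]
      by (simp add: F G rep_def repA_eq[OF h] repA_eq[OF k] Exp_comp(1)[OF a b uv] del: repA.simps)
  qed
qed

lemma functor_over_rep: "functor_over C (Gph C T) (p_gph C) (Exp C pb) p_exp (rep C pb T)"
  unfolding functor_over_def
  using is_functor_p_gph is_functor_p_exp is_functor_rep
  by (auto simp: rep_def repO_def repA_eq simp del: repA.simps elim!: Arr_GphE)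

text \<open>An element of \<open>B \<star> (u x)\<close> is a pair \<open>(b, y)\<close> with
  \<open>\<delta> b = T (u x) y\<close>. A cone \<open>(c, (b, y))\<close> for the square of
  \<open>prone_Exp\<close> thus gives the cone of \<open>gph_limit\<close> with legs
  \<open>c\<close>, \<open>T x \<cdot> y\<close> and \<open>b\<close>, whose mediating arrow pairs
  with \<open>y\<close> to an element of \<open>A \<star> x\<close>.\<close>

lemma rep_prone:
  assumes "prone (Gph C T) C (p_gph C) F"
  shows "prone (Exp C pb) C p_exp (onA (rep C pb T) F)"
proof -
  obtain A h u B where F: "F = (A, (h, u), B)" and h: "gph_mor u A h B"
    using assms unfolding prone_def by (auto elim: Arr_GphE)
  have l: "gph_limit u A h B" using assms by (intro prone_GphD) (simp add: F)
  note [simp] = gph_morD[OF h]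
  have "prone (Exp C pb) C p_exp (oa (st A) u (st B) (\<lambda>x f z. star_map A x B z h f))"
  proof (rule prone_Exp[OF acts_star[OF h]])
    fix x assume x[simp]: "x \<in> Arr C" "Cod C x = Dom C u"
    let ?s = "star_map A x B (u \<cdot> x) h (Ide C (Dom C x))"
    have f: "arr_over C u x (Ide C (Dom C x)) (u \<cdot> x)" by (rule arr_over_post) simp_all
    note [simp] = star_map_simps[OF h f] and o = arr_overD(9)[OF star_map_over[OF h f]]
    have "is_pullback C u (sO B (u \<cdot> x)) (sO A x) ?s"
    proof (rule is_pullbackI)
      show "u \<cdot> sO A x = sO B (u \<cdot> x) \<cdot> ?s" using o by simp
    next
      fix c m assume cm: "c \<in> Arr C" "m \<in> Arr C" "Dom C c = Dom C m" "Cod C c = Dom C u"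
        "Cod C m = Dom C (sO B (u \<cdot> x))" "u \<cdot> c = sO B (u \<cdot> x) \<cdot> m"
      note [simp] = cm(1-5)
      have c: "fst B \<cdot> (q1 B (u \<cdot> x) \<cdot> m) = u \<cdot> c"
        using cm(6) by (simp add: starO_def)
      have t: "snd B \<cdot> (q1 B (u \<cdot> x) \<cdot> m) = onA T u \<cdot> (onA T x \<cdot> (q2 B (u \<cdot> x) \<cdot> m))"
        using star_simps(7)[of B "u \<cdot> x" m] by simp
      obtain k where k: "k \<in> Arr C" "Dom C k = Dom C c" "Cod C k = Dom C (fst A)" "fst A \<cdot> k = c"
        "snd A \<cdot> k = onA T x \<cdot> (q2 B (u \<cdot> x) \<cdot> m)" "h \<cdot> k = q1 B (u \<cdot> x) \<cdot> m"
        by (rule gph_limitE[OF l, of c "onA T x \<cdot> (q2 B (u \<cdot> x) \<cdot> m)" "q1 B (u \<cdot> x)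
          \<cdot> m"]) (simp_all add: c t)
      let ?n = "sp A x k (q2 B (u \<cdot> x) \<cdot> m)"
      have n: "?n \<in> Arr C" "Dom C ?n = Dom C m" "Cod C ?n = Dom C (q1 A x)" "q1 A x \<cdot> ?n = k"
        "q2 A x \<cdot> ?n = q2 B (u \<cdot> x) \<cdot> m"
        using sp_simps[of A x k "q2 B (u \<cdot> x) \<cdot> m"] k by simp_all
      show "\<exists>n. n \<in> Arr C \<and> Dom C n = Dom C c \<and> Cod C n = Dom C (sO A x) \<and> sO A x \<cdot> n = c \<and>
        ?s \<cdot> n = m"
      proof (intro exI[of _ ?n] conjI)
        show "sO A x \<cdot> ?n = c" using n k(1-4) by (simp add: starO_def)
        show "?s \<cdot> ?n = m"
          by (rule star_mono[of B "u \<cdot> x"]) (use n k(6) in simp_all)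
      qed (use n in simp_all)
    next
      fix m n assume mn: "m \<in> Arr C" "n \<in> Arr C" "Dom C m = Dom C n" "Cod C m = Dom C (sO A x)"
        "Cod C n = Dom C (sO A x)" "sO A x \<cdot> m = sO A x \<cdot> n" "?s \<cdot> m = ?s \<cdot> n"
      note [simp] = mn(1-5)
      have "q1 B (u \<cdot> x) \<cdot> (?s \<cdot> m) = q1 B (u \<cdot> x) \<cdot> (?s \<cdot> n)" "q2 B (u \<cdot> x) \<cdot> (?s \<cdot> m) =
        q2 B (u \<cdot> x) \<cdot> (?s \<cdot> n)"
        by (simp_all only: mn(7))
      then have e: "h \<cdot> (q1 A x \<cdot> m) = h \<cdot> (q1 A x \<cdot> n)" "q2 A x \<cdot> m = q2 A x \<cdot> n" by simp_all
      have e1: "fst A \<cdot> (q1 A x \<cdot> m) = fst A \<cdot> (q1 A x \<cdot> n)"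
        using mn(6) by (simp add: starO_def)
      have e2: "snd A \<cdot> (q1 A x \<cdot> m) = snd A \<cdot> (q1 A x \<cdot> n)"
        using star_simps(7)[of A x m] star_simps(7)[of A x n] by (simp add: e(2))
      have "q1 A x \<cdot> m = q1 A x \<cdot> n"
        by (rule gph_limit_mono[OF l h]) (simp_all add: e(1) e1 e2)
      then show "m = n"
        by - (rule star_mono[of A x], simp_all add: e(2))
    qed simp_all
    then show "is_pullback C u (onO (st B) (u \<cdot> x)) (onO (st A) x) ?s" by simp
  qed
  then show ?thesis by (simp add: F rep_def repA_eq[OF h] del: repA.simps)
qed

text \<open>By \<open>supine_Exp\<close> the map from \<open>A \<star> u^* z\<close> to
  \<open>B \<star> z\<close> has to be invertible. Its first coordinate is inverted by the inverse
  of \<open>h\<close>; the second is lifted through \<open>T\<close> of the chosen pullback of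
  \<open>u\<close> and \<open>z\<close>, whose other leg is fixed by the first coordinate.\<close>

lemma rep_supine:
  assumes "supine (Gph C T) C (p_gph C) F"
  shows "supine (Exp C pb) C p_exp (onA (rep C pb T) F)"
proof -
  obtain A h u B where F: "F = (A, (h, u), B)" and h: "gph_mor u A h B"
    using assms unfolding supine_def by (auto elim: Arr_GphE)
  have "iso C h" using assms by (intro supine_GphD) (simp add: F)
  then obtain k where k: "h \<in> Arr C" "k \<in> Arr C" "Dom C k = Cod C h" "Cod C k = Dom C h"
    "k \<cdot> h = Ide C (Dom C h)" "h \<cdot> k = Ide C (Cod C h)" by (rule isoE)
  note [simp] = gph_morD[OF h] k(2-6) Comp_reassoc[OF k(5)] Comp_reassoc[OF k(6)]
  have "supine (Exp C pb) C p_exp (oa (st A) u (st B) (\<lambda>x f z. star_map A x B z h f))"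
  proof (rule supine_Exp[OF acts_star[OF h]])
    fix z assume z[simp]: "z \<in> Arr C" "Cod C z = Cod C u"
    let ?x = "p1 u z" and ?f = "p2 u z"
    let ?s = "star_map A ?x B z h ?f"
    have f: "arr_over C u ?x ?f z" by (rule arr_over_projection) simp_all
    note [simp] = star_map_simps[OF h f]
    note P = T_pullback[OF chosen_pullback[of u z]]
    have "onA T u \<cdot> (snd A \<cdot> (k \<cdot> q1 B z)) = snd B \<cdot> (h \<cdot> (k \<cdot> q1 B z))"
      by (rule gph_morD(13)[OF h, symmetric]) simp_all
    also have "\<dots> = onA T z \<cdot> q2 B z" by (simp del: gph_morD(13)[OF h])
    finally obtain t where t: "t \<in> Arr C" "Dom C t = Dom C (q1 B z)" "Cod C t = onO T (Dom C ?x)"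
      "onA T ?x \<cdot> t = snd A \<cdot> (k \<cdot> q1 B z)" "onA T ?f \<cdot> t = q2 B z"
      by - (rule is_pullbackE[OF P, of "snd A \<cdot> (k \<cdot> q1 B z)" "q2 B z"], simp_all)
    let ?n = "sp A ?x (k \<cdot> q1 B z) t"
    have n: "?n \<in> Arr C" "Dom C ?n = Dom C (q1 B z)" "Cod C ?n = Dom C (q1 A ?x)" "q1 A ?x \<cdot> ?n =
      k \<cdot> q1 B z" "q2 A ?x \<cdot> ?n = t"
      using sp_simps[of A ?x "k \<cdot> q1 B z" t] t by simp_all
    show "iso C ?s"
    proof (rule isoI_mono[of _ ?n])
      show "?s \<cdot> ?n = Ide C (Cod C ?s)"
        by (rule star_mono[of B z]) (use n t in simp_all)
    next
      fix a b assume ab: "a \<in> Arr C" "b \<in> Arr C" "Dom C a = Dom C b" "Cod C a = Dom C ?s"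
        "Cod C b = Dom C ?s" "?s \<cdot> a = ?s \<cdot> b"
      note [simp] = ab(1-5)
      have "k \<cdot> (q1 B z \<cdot> (?s \<cdot> a)) = k \<cdot> (q1 B z \<cdot> (?s \<cdot> b))" "q2 B z \<cdot> (?s \<cdot> a) =
        q2 B z \<cdot> (?s \<cdot> b)"
        by (simp_all only: ab(6))
      then have e: "q1 A ?x \<cdot> a = q1 A ?x \<cdot> b" "onA T ?f \<cdot> (q2 A ?x \<cdot> a) = onA T ?f \<cdot> (q2 A ?x \<cdot> b)"
        by simp_all
      have "q2 A ?x \<cdot> a = q2 A ?x \<cdot> b"
        by (rule is_pullback_mono[OF P]) (simp_all add: e)
      then show "a = b"
        by - (rule star_mono[of A ?x], simp_all add: e)
    qed (use n in simp_all)
  qed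
  then show ?thesis by (simp add: F rep_def repA_eq[OF h] del: repA.simps)
qed

lemma bifibration_morphism_rep: "bifibration_morphism C (Gph C T) (p_gph C) (Exp C pb) p_exp (rep C
  pb T)"
  using fibration_Gph opfibration_Gph bifibration_Exp functor_over_rep rep_prone rep_supine
  by (simp add: bifibration_morphism_def bifibration_def preserves_prone_def preserves_supine_def)

section \<open>The image of \<open>rep\<close> lies in \<open>Cart\<close>\<close>

lemma rep_Obj_Cart:
  assumes A: "A \<in> graphs"
  shows "(Cod C (fst A), st A) \<in> Obj (Cart C pb)"
proof -
  have "preserves_pullbacks (slice C (Cod C (fst A))) (slice C (Cod C (fst A))) (st A)"
  proof (rule preserves_pullbacks_sliceI[OF is_functor_star[OF A]])
    fix x f z y g w p q
    assume f: "arr_over C (Ide C (Cod C (fst A))) x f z" and g: "arr_over C (Ide C (Cod C (fst A)))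
      y g z"
      and p: "arr_over C (Ide C (Cod C (fst A))) w p x" and q: "arr_over C (Ide C (Cod C (fst A))) w
        q y"
      and pbk: "is_pullback C f g p q"
    have "is_pullback C (star_map A x A z (Ide C (Dom C (fst A))) f) (star_map A y A z (Ide C (Dom C
      (fst A))) g)
        (star_map A w A x (Ide C (Dom C (fst A))) p) (star_map A w A y (Ide C (Dom C (fst A))) q)"
      by (rule star_map_pullback[OF gph_mor_ide[OF A refl]]) (use A f g p q pbk in simp_all)
    then show "is_pullback C (mor (st A) x f z) (mor (st A) y g z) (mor (st A) w p x) (mor (st A) w
      q y)"
      using A f g p q by simp
  qed (use A in simp_all)
  then show ?thesis using exp_objs_star[OF A] by (simp add: Obj_Cart)
qed

lemma rep_Arr_Cart:
  assumes h: "gph_mor u A h B"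
  shows "repA C pb T (A, (h, u), B) \<in> Arr (Cart C pb)"
proof -
  note [simp] = gph_morD[OF h]
  have "cart_action (st A) u (st B) (\<lambda>x f z. star_map A x B z h f)"
    unfolding cart_action_def
  proof (intro allI impI)
    fix z g z' assume g: "arr_over C (Ide C (Cod C u)) z g z'"
    note [simp] = arr_overD(1-8)[OF g]
    have l: "arr_over C (Ide C (Dom C u)) (p1 u z) (pr u z' (p1 u z) (g \<cdot> p2 u z)) (p1 u z')"
      by (rule arr_over_proj_left[OF _ g]) simp
    \<comment> \<open>The square fed to \<open>star_map_pullback\<close> is the pullback of
      \<open>g\<close> along the projection \<open>p2 u z'\<close>, from
      \<open>is_pullback_pull\<close>.\<close>
    have "is_pullback C (star_map B z B z' (Ide C (Dom C (fst B))) g) (star_map A (p1 u z') B z' h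
      (p2 u z'))
       (star_map A (p1 u z) B z h (p2 u z)) (star_map A (p1 u z) A (p1 u z') (Ide C (Dom C (fst A)))
         (pr u z' (p1 u z) (g \<cdot> p2 u z)))"
      by (rule star_map_pullback[OF h l g]) (simp_all add: arr_over_projection is_pullback_pull[OF _
        g])
    then show "is_pullback C (mor (st B) z g z') (star_map A (p1 u z') B z' h (p2 u z')) (star_map A
      (p1 u z) B z h (p2 u z))
        (mor (st A) (p1 u z) (pr u z' (p1 u z) (g \<cdot> p2 u z)) (p1 u z'))"
      using g l by simp
  qed
  then show ?thesis
    using Arr_Cart[OF acts_star[OF h]] rep_Obj_Cart[of A] rep_Obj_Cart[of B]
    by (simp add: repA_eq[OF h] del: repA.simps)
qed

section \<open>The structure maps of \<open>rep\<close> and their coherence\<close>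

lemma rep_vert:
  assumes h: "gph_mor (Ide C U) A h B" and U: "U \<in> Obj C"
  shows "vertical_nat U (st A) (st B) (\<lambda>z. star_map A z B z h (Ide C (Dom C z)))"
    and "repA C pb T (A, (h, Ide C U), B) =
      vert U (st A) (st B) (\<lambda>z. star_map A z B z h (Ide C (Dom C z)))"
proof -
  note [simp] = U gph_morD[OF h]
  have iA: "gph_mor (Ide C U) A (Ide C (Dom C (fst A))) A" and iB: "gph_mor (Ide C U) B (Ide C (Dom
    C (fst B))) B"
    using gph_mor_ide[of A U] gph_mor_ide[of B U] by simp_all
  have id: "arr_over C (Ide C U) z (Ide C (Dom C z)) z" if "z \<in> Arr C" "Cod C z = U" for z
    using that by (intro arr_over_ide) simp_all
  \<comment> \<open>Both composites are the value at \<open>f\<close> of the action of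
    \<open>h\<close>, the diagonal of the naturality square; this identifies the encoding in
    \<open>repA_eq\<close> with that of \<open>vert\<close>.\<close>
  have e: "star_map A z B z h (Ide C (Dom C z)) \<cdot> mor (st A) x f z = star_map A x B z h f"
    "mor (st B) x f z \<cdot> star_map A x B x h (Ide C (Dom C x)) = star_map A x B z h f"
    if f: "arr_over C (Ide C U) x f z" for x f z
  proof -
    note [simp] = arr_overD(1-8)[OF f]
    have m: "mor (st A) x f z = star_map A x A z (Ide C (Dom C (fst A))) f" "mor (st B) x f z =
      star_map B x B z (Ide C (Dom C (fst B))) f"
      using f by simp_all
    show "star_map A z B z h (Ide C (Dom C z)) \<cdot> mor (st A) x f z = star_map A x B z h f"
      "mor (st B) x f z \<cdot> star_map A x B x h (Ide C (Dom C x)) = star_map A x B z h f"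
      unfolding m using star_map_comp[OF iA f h id[of z]] star_map_comp[OF h id[of x] iB f]
        by simp_all
  qed
  show "vertical_nat U (st A) (st B) (\<lambda>z. star_map A z B z h (Ide C (Dom C z)))"
    unfolding vertical_nat_def using exp_objs_star[of A] exp_objs_star[of B] star_map_over[OF h id]
      e by simp
  show "repA C pb T (A, (h, Ide C U), B) =
    vert U (st A) (st B) (\<lambda>z. star_map A z B z h (Ide C (Dom C z)))"
    unfolding repA_eq[OF h] vert_def by (rule of_action_cong) (simp, simp only: e)
qed

lemma phi0_vert:
  assumes U: "U \<in> Obj C"
  shows "vertical_nat U (id_ftr (slice C U)) (st (gI U)) star_unit"
    and "rep_phi0 C pb T \<eta> U = vert U (id_ftr (slice C U)) (st (gI U)) star_unit"
proof -
  note [simp] = U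
  have s: "mor (st (gI U)) x f y = star_map (gI U) x (gI U) y (Ide C U) f" if "arr_over C (Ide C U)
    x f y" for x f y
    using star_mor[of "gI U" x f y] that by simp
  show n: "vertical_nat U (id_ftr (slice C U)) (st (gI U)) star_unit"
    unfolding vertical_nat_def
    using exp_objs_id[OF U] exp_objs_star[of "gI U"] star_unit_over star_unit_natural[of "Ide C U"]
      s by simp
  show "rep_phi0 C pb T \<eta> U = vert U (id_ftr (slice C U)) (st (gI U)) star_unit"
    unfolding rep_phi0_def by (rule exp_vert_vert[OF n]) (simp add: star_unit_def)
qed

lemma phi2_vert:
  assumes A: "A \<in> graphs" "B \<in> graphs" "Cod C (fst A) = U" "Cod C (fst B) = U"
  shows "vertical_nat U (comp_ftr (slice C U) (st A) (st B)) (st (tO A B)) (star_assoc A B)"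
    and "rep_phi2 C pb T \<mu> A B = vert U (comp_ftr (slice C U) (st A) (st B)) (st (tO A B))
      (star_assoc A B)"
proof -
  have U: "U \<in> Obj C" using A by auto
  note [simp] = A U
  have e: "Cod C (fst A) = Cod C (fst B)" by simp
  have iA: "gph_mor (Ide C U) A (Ide C (Dom C (fst A))) A" and iB: "gph_mor (Ide C U) B (Ide C (Dom
    C (fst B))) B"
    using gph_mor_ide[of A U] gph_mor_ide[of B U] by simp_all
  have F: "is_functor (slice C U) (slice C U) (st B)" "is_functor (slice C U) (slice C U) (st A)"
    using is_functor_star[of B] is_functor_star[of A] by simp_all
  have o: "arr_over C (Ide C U) (sO A (sO B d)) (star_assoc A B d) (sO (tO A B) d)" if "d \<in> Arr C"
    "Cod C d = U" for d
    using star_assoc_over[OF A(1,2) e, of d] that by simp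
  have nat: "star_assoc A B y \<cdot> mor (comp_ftr (slice C U) (st A) (st B)) x f y =
    mor (st (tO A B)) x f y \<cdot> star_assoc A B x"
    if f: "arr_over C (Ide C U) x f y" for x f y
  proof -
    note [simp] = arr_overD(1-8)[OF f]
    have 1: "mor (st B) x f y = star_map B x B y (Ide C (Dom C (fst B))) f" using f by simp
    have "mor (st A) (sO B x) (star_map B x B y (Ide C (Dom C (fst B))) f) (sO B y) =
      star_map A (sO B x) A (sO B y) (Ide C (Dom C (fst A))) (star_map B x B y (Ide C (Dom C (fst
        B))) f)"
      using star_map_over[OF iB f] by (intro star_mor) simp_all
    then have 2: "mor (comp_ftr (slice C U) (st A) (st B)) x f y =
      star_map A (sO B x) A (sO B y) (Ide C (Dom C (fst A))) (star_map B x B y (Ide C (Dom C (fst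
        B))) f)"
      using f F(1) 1 by simp
    have 3: "mor (st (tO A B)) x f y =
      star_map (tO A B) x (tO A B) y (Ide C (Dom C (q1 A (fst B)))) f"
      using f star_mor[of "tO A B" x f y] by simp
    show ?thesis
      unfolding 2 3 using star_assoc_natural[OF iA iB f e e] star_map_ide[of A "fst B"] by simp
  qed
  have s: "(U, st (tO A B)) \<in> exp_objs C" using exp_objs_star[of "tO A B"] by simp
  have s': "(U, comp_ftr (slice C U) (st A) (st B)) \<in> exp_objs C"
    using exp_objs_comp[of U "st A" "st B"] exp_objs_star[of A] exp_objs_star[of B] by simp
  show n: "vertical_nat U (comp_ftr (slice C U) (st A) (st B)) (st (tO A B)) (star_assoc A B)"
    unfolding vertical_nat_def using s s' nat o by simp
  \<comment> \<open>The definition of \<open>rep_phi2\<close> nests this composite to the left,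
    \<open>star_assoc\<close> to the right.\<close>
  have "(\<mu> (Dom C d) \<cdot> onA T (q2 B d)) \<cdot> q2 A (sO B d) =
    \<mu> (Dom C d) \<cdot> (onA T (q2 B d) \<cdot> q2 A (sO B d))"
    if "d \<in> Arr C" "Cod C d = U" for d
    using that by (simp del: mu_natural)
  then have "exp_vert C pb U (comp_ftr (slice C U) (st A) (st B)) (\<lambda>d. (sO A (sO B d),
          sp (tO A B) d (gph_pairing C pb T A B (q1 A (sO B d)) (onA T (q1 B d) \<cdot> q2 A (sO B d)))
            ((\<mu> (Dom C d) \<cdot> onA T (q2 B d)) \<cdot> q2 A (sO B d)),
          sO (tO A B) d)) (st (tO A B)) = vert U (comp_ftr (slice C U) (st A) (st B)) (st (tO A B))
            (star_assoc A B)"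
    by (intro exp_vert_vert[OF n]) (simp add: star_assoc_def gph_pairing_def star_pairing_def del:
      mu_natural)
  then show "rep_phi2 C pb T \<mu> A B =
    vert U (comp_ftr (slice C U) (st A) (st B)) (st (tO A B)) (star_assoc A B)"
    by (simp add: rep_phi2_def Let_def)
qed

lemma lax_monoidal_fibration_morphism_rep:
  "lax_monoidal_fibration_morphism (Gph_lmf C pb T \<eta> \<mu>) (Exp_lmf C pb)
     (rep C pb T) (rep_phi0 C pb T \<eta>) (rep_phi2 C pb T \<mu>)"
proof (intro lax_monoidal_fibration_morphism.intro lax_monoidal_fibration_morphism_axioms.intro
    lax_monoidal_fibration_Gph lax_monoidal_fibration_Exp)
  interpret E: category "Exp C pb" by (rule category_Exp)
  let ?M = "Gph_lmf C pb T \<eta> \<mu>" and ?N = "Exp_lmf C pb"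
  let ?F = "rep C pb T" and ?p0 = "rep_phi0 C pb T \<eta>" and ?p2 = "rep_phi2 C pb T \<mu>"
  have repO: "onO ?F A = (Cod C (fst A), st A)" for A by (simp add: rep_def repO_def)
  have repA: "onA ?F G = repA C pb T G" for G by (simp add: rep_def)
  show "base ?N = base ?M" by simp
  show "functor_over (base ?M) (total ?M) (proj ?M) (total ?N) (proj ?N) ?F"
    using functor_over_rep by simp
  show "?p0 U \<in> vertical ?N (onO (unit ?N) U) (onO ?F (onO (unit ?M) U))" if "U \<in> Obj (base ?M)" for
    U
    using that vert_in_Hom[OF phi0_vert(1)[of U]] by (simp add: phi0_vert(2) repO)
  show "?p0 V \<cdot>\<^bsub>total ?N\<^esub> onA (unit ?N) u = onA ?F (onA (unit ?M) u) \<cdot>\<^bsub>total ?N\<^esub> ?p0 U"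
    if u: "u \<in> Hom (base ?M) U V" for u U V
  proof -
    have [simp]: "u \<in> Arr C" "U = Dom C u" "V = Cod C u" using u by (simp_all add: Hom_def)
    have g: "gph_mor u (gI (Dom C u)) u (gI (Cod C u))" by (rule gph_mor_unit) simp
    have a: "acts (st (gI (Dom C u))) u (st (gI (Cod C u))) (\<lambda>x f z. star_map (gI (Dom C u)) x (gI
      (Cod C u)) z u f)"
      by (rule acts_star[OF g])
    have "oa (id_ftr (slice C (Dom C u))) u (st (gI (Cod C u))) (\<lambda>x f z. star_unit z \<cdot> f) =
      oa (id_ftr (slice C (Dom C u))) u (st (gI (Cod C u))) (\<lambda>x f z. star_map (gI (Dom C u)) x (gI
        (Cod C u)) z u f \<cdot> star_unit x)"
      by (rule of_action_cong) (simp_all add: star_unit_natural)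
    then show ?thesis
      using vert_comp_left[OF phi0_vert(1) acts_unit[of u]] vert_comp_right[OF phi0_vert(1) a]
      by (simp add: phi0_vert(2) repA repA_eq[OF g] exp_unit_eq del: repA.simps)
  qed
  show "?p2 A B \<in> vertical ?N (onO (tensor ?N) (onO ?F A, onO ?F B)) (onO ?F (onO (tensor ?M) (A,
    B)))"
    if "A \<in> fib ?M U" "B \<in> fib ?M U" for A B U
  proof -
    have o: "A \<in> graphs" "B \<in> graphs" "Cod C (fst A) = U" "Cod C (fst B) = U"
      using that by (simp_all add: fib_Gph)
    show ?thesis
      using vert_in_Hom[OF phi2_vert(1)[OF o]] o by (simp add: phi2_vert(2)[OF o] repO)
  qed
  show "?p2 A' B' \<cdot>\<^bsub>total ?N\<^esub> onA (tensor ?N) (onA ?F G, onA ?F H) =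
      onA ?F (onA (tensor ?M) (G, H)) \<cdot>\<^bsub>total ?N\<^esub> ?p2 A B"
    if GH: "G \<in> Hom (total ?M) A A'" "H \<in> Hom (total ?M) B B'" "onA (proj ?M) G =
      onA (proj ?M) H" for G H A A' B B'
  proof -
    obtain h u where 1: "G = (A, (h, u), A')" and h: "gph_mor u A h A'" using GH(1)[simplified]
      by (rule Hom_GphE)
    obtain k v where 2: "H = (B, (k, v), B')" and k: "gph_mor v B k B'" using GH(2)[simplified]
      by (rule Hom_GphE)
    have [simp]: "v = u" using GH(3) by (simp add: 1 2)
    note k = k[simplified]
    note D = gph_morD(1,2,4,6,7)[OF h] gph_morD(1,2,4,6,7)[OF k]
    note s = phi2_vert[OF D(1,6,4,9)] and s' = phi2_vert[OF D(2,7,5,10)]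
    note t = gph_mor_tens[OF h k]
    note a = acts_tens[OF acts_star[OF h] acts_star[OF k]]
    have "oa (comp_ftr (slice C (Dom C u)) (st A) (st B)) u (st (tO A' B'))
        (\<lambda>x f z. star_assoc A' B' z \<cdot> star_map A (onO (st B) x) A' (onO (st B') z) h (star_map B x
          B' z k f)) =
      oa (comp_ftr (slice C (Dom C u)) (st A) (st B)) u (st (tO A' B'))
        (\<lambda>x f z. star_map (tO A B) x (tO A' B') z (star_map A (fst B) A' (fst B') h k) f
          \<cdot> star_assoc A B x)"
    proof (rule of_action_cong[OF D(3)])
      fix x f z assume f: "arr_over C u x f z"
      show "star_assoc A' B' z \<cdot> star_map A (onO (st B) x) A' (onO (st B') z) h (star_map B x B' z k
        f) =
        star_map (tO A B) x (tO A' B') z (star_map A (fst B) A' (fst B') h k) f \<cdot> star_assoc A B x"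
        using star_assoc_natural[OF h k f] arr_overD(2,3,5,6)[OF f] D by simp
    qed
    then show ?thesis
      using vert_comp_left[OF s'(1) a] vert_comp_right[OF s(1) acts_star[OF t]]
      by (simp add: 1 2 s(2) s'(2) repA repA_eq[OF h] repA_eq[OF k] repA_eq[OF t]
          exp_tensA_eq[OF acts_star[OF h] acts_star[OF k]] del: repA.simps)
  qed
  show "onA ?F (lunit ?M A) = ?p2 (onO (unit ?M) U) A \<cdot>\<^bsub>total ?N\<^esub>
      onA (tensor ?N) (?p0 U, Ide (total ?N) (onO ?F A)) \<cdot>\<^bsub>total ?N\<^esub> lunit ?N (onO ?F A)"
    if "A \<in> fib ?M U" for A U
  proof -
    have A: "A \<in> graphs" "Cod C (fst A) = U" using that by (simp_all add: fib_Gph)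
    then have U: "U \<in> Obj C" by auto
    note [simp] = A U
    have eA: "(U, st A) \<in> exp_objs C" using exp_objs_star[OF A(1)] by simp
    note r = rep_vert[OF gph_mor_lunit[OF A] U]
    have "gI U \<in> graphs" "Cod C (fst (gI U)) = U" by simp_all
    note s = phi2_vert[OF this(1) A(1) this(2) A(2)]
    note t = vert_tens_left[OF phi0_vert(1)[OF U] eA]
    \<comment> \<open>Strictness lets the composite of the identity functor with \<open>st A\<close>
      be read as \<open>st A\<close>; the left unit of \<open>Exp\<close> is then an identity that
      drops out, and the law reduces to \<open>lunit_star\<close> at each \<open>z\<close>.\<close>
    note t' = t[unfolded comp_ftr_id(2)[OF eA]]
    note c = vertical_nat_comp[OF t'(1) s(1)]
    have "vert U (st A) (st (tO (gI U) A)) (\<lambda>z. star_map A z (tO (gI U) A) z (star_unit (fst A))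
      (Ide C (Dom C z))) =
       vert U (st A) (st (tO (gI U) A)) (\<lambda>z. star_assoc (gI U) A z \<cdot> star_unit (onO (st A) z))"
      by (rule vert_cong) (simp_all add: lunit_star)
    then show ?thesis
      using eA c(2) vert_in_Hom[OF c(1)] vert_in_Hom[OF t'(1)]
      by (simp add: repO repA gph_lunit_eq r(2) s(2) phi0_vert(2) t'(2) vertical_def Hom_def del:
        repA.simps)
  qed
  show "onA ?F (runit ?M A) \<cdot>\<^bsub>total ?N\<^esub> ?p2 A (onO (unit ?M) U) \<cdot>\<^bsub>total ?N\<^esub>
      onA (tensor ?N) (Ide (total ?N) (onO ?F A), ?p0 U) = runit ?N (onO ?F A)"
    if "A \<in> fib ?M U" for A U
  proof -
    have A: "A \<in> graphs" "Cod C (fst A) = U" using that by (simp_all add: fib_Gph)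
    then have U: "U \<in> Obj C" by auto
    note [simp] = A U
    have eA: "(U, st A) \<in> exp_objs C" using exp_objs_star[OF A(1)] by simp
    note r = rep_vert[OF gph_mor_runit[OF A] U]
    have "gI U \<in> graphs" "Cod C (fst (gI U)) = U" by simp_all
    note s = phi2_vert[OF A(1) this(1) A(2) this(2)]
    note t = vert_tens_right[OF phi0_vert(1)[OF U] eA]
    note t' = t[unfolded comp_ftr_id(1)[OF eA]]
    note c = vertical_nat_comp[OF s(1) r(1)] and c' =
      vertical_nat_comp[OF t'(1) vertical_nat_comp(1)[OF s(1) r(1)]]
    have "vert U (st A) (st A) (\<lambda>z. (star_map (tO A (gI U)) z A z (q1 A (Ide C U)) (Ide C (Dom C z))
      \<cdot> star_assoc A (gI U) z) \<cdot>
         mor (st A) (onO (id_ftr (slice C U)) z) (star_unit z) (onO (st (gI U)) z)) =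
       vert U (st A) (st A) (\<lambda>z. Ide C (Dom C (onO (st A) z)))"
    proof (rule vert_cong)
      fix z assume z: "z \<in> Arr C" "Cod C z = U"
      have l: "arr_over C (Ide C (Cod C (fst A))) z (star_unit z) (sO (gI U) z)"
        using star_unit_over[OF z] by simp
      show "(star_map (tO A (gI U)) z A z (q1 A (Ide C U)) (Ide C (Dom C z))
        \<cdot> star_assoc A (gI U) z) \<cdot>
         mor (st A) (onO (id_ftr (slice C U)) z) (star_unit z) (onO (st (gI U)) z) =
           Ide C (Dom C (onO (st A) z))"
        using triangle_star[OF A(1) z(1) A(2) z(2)] z star_mor[OF A(1) l] by simp
    qed simp
    then show ?thesis
      using eA c(2) c'(2) vert_ide(2)[OF eA, symmetric]
      by (simp add: repO repA gph_runit_eq r(2) s(2) phi0_vert(2) t'(2) del: repA.simps)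
  qed
  show "onA ?F (assoc ?M A B D) \<cdot>\<^bsub>total ?N\<^esub> ?p2 A (onO (tensor ?M) (B, D)) \<cdot>\<^bsub>total ?N\<^esub>
      onA (tensor ?N) (Ide (total ?N) (onO ?F A), ?p2 B D) =
     ?p2 (onO (tensor ?M) (A, B)) D \<cdot>\<^bsub>total ?N\<^esub> onA (tensor ?N) (?p2 A B, Ide (total ?N) (onO ?F D))
       \<cdot>\<^bsub>total ?N\<^esub>
      assoc ?N (onO ?F A) (onO ?F B) (onO ?F D)"
    if "A \<in> fib ?M U" "B \<in> fib ?M U" "D \<in> fib ?M U" for A B D U
  proof -
    have A: "A \<in> graphs" "B \<in> graphs" "D \<in> graphs" "Cod C (fst A) = U" "Cod C (fst B) =
      U" "Cod C (fst D) = U"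
      using that by (simp_all add: fib_Gph)
    then have U: "U \<in> Obj C" by auto
    note [simp] = A U
    have e: "(U, st A) \<in> exp_objs C" "(U, st B) \<in> exp_objs C" "(U, st D) \<in> exp_objs C"
      using exp_objs_star[OF A(1)] exp_objs_star[OF A(2)] exp_objs_star[OF A(3)] by simp_all
    have g: "gph_mor (Ide C U) (tO A (tO B D)) (star_assoc A B (fst D)) (tO (tO A B) D)"
      using gph_mor_assoc[OF A(1-3)] by simp
    have tt: "tO A B \<in> graphs" "tO B D \<in> graphs" "Cod C (fst (tO A B)) = U" "Cod C (fst (tO B D)) =
      U" by simp_all
    note r = rep_vert[OF g U]
    note s1 = phi2_vert[OF A(1) tt(2) A(4) tt(4)] and s2 = phi2_vert[OF A(2,3,5,6)]
      and s3 = phi2_vert[OF tt(1) A(3) tt(3) A(6)] and s4 = phi2_vert[OF A(1,2,4,5)]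
    note t2 = vert_tens_right[OF s2(1) e(1)] and t4 = vert_tens_left[OF s4(1) e(3)]
    note a = exp_tensO_assoc[OF e]
    \<comment> \<open>The source is rebracketed by strict associativity, so the associativity arrow
      of \<open>Exp\<close> becomes an identity on it and \<open>star_assoc_pentagon\<close>
      compares the components.\<close>
    note t4' = t4[folded a]
    note c1 = vertical_nat_comp[OF t2(1) vertical_nat_comp(1)[OF s1(1) r(1)]]
      and c2 = vertical_nat_comp[OF s1(1) r(1)] and c3 = vertical_nat_comp[OF t4'(1) s3(1)]
    let ?Q = "comp_ftr (slice C U) (st B) (st D)"
    have "vert U (comp_ftr (slice C U) (st A) ?Q) (st (tO (tO A B) D))
       (\<lambda>z. (star_map (tO A (tO B D)) z (tO (tO A B) D) z (star_assoc A B (fst D)) (Ide C (Dom C z))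
         \<cdot> star_assoc A (tO B D) z) \<cdot>
         mor (st A) (onO ?Q z) (star_assoc B D z) (onO (st (tO B D)) z)) =
      vert U (comp_ftr (slice C U) (st A) ?Q) (st (tO (tO A B) D)) (\<lambda>z. star_assoc (tO A B) D z
        \<cdot> star_assoc A B (onO (st D) z))"
    proof (rule vert_cong)
      fix z assume z: "z \<in> Arr C" "Cod C z = U"
      have l: "arr_over C (Ide C (Cod C (fst A))) (sO B (sO D z)) (star_assoc B D z) (sO (tO B D)
        z)"
        using star_assoc_over[of B D z] z by simp
      show "(star_map (tO A (tO B D)) z (tO (tO A B) D) z (star_assoc A B (fst D)) (Ide C (Dom C z))
        \<cdot> star_assoc A (tO B D) z) \<cdot>
         mor (st A) (onO ?Q z) (star_assoc B D z) (onO (st (tO B D)) z) =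
           star_assoc (tO A B) D z \<cdot> star_assoc A B (onO (st D) z)"
        using star_assoc_pentagon[OF A(1-3) z(1)] z star_mor[OF A(1) l] by simp
    qed simp
    then show ?thesis
      using e c1(2) c2(2) c3(2) vert_in_Hom[OF c3(1)] exp_objs_comp[OF e(1) exp_objs_comp[OF
        e(2,3)]]
      by (simp add: repO repA gph_assoc_eq r(2) s1(2) s2(2) s3(2) s4(2) t2(2) t4'(2) vertical_def
        Hom_def del: repA.simps)
  qed
qed

lemma strong_lax_monoidal_fibration_morphism_rep:
  "strong_lax_monoidal_fibration_morphism (Gph_lmf C pb T \<eta> \<mu>) (Exp_lmf C pb)
     (rep C pb T) (rep_phi0 C pb T \<eta>) (rep_phi2 C pb T \<mu>)"
proof (intro strong_lax_monoidal_fibration_morphism.intro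
  strong_lax_monoidal_fibration_morphism_axioms.intro
    lax_monoidal_fibration_morphism_rep)
  let ?M = "Gph_lmf C pb T \<eta> \<mu>" and ?N = "Exp_lmf C pb"
  show "iso (total ?N) (rep_phi0 C pb T \<eta> U)" if "U \<in> Obj (base ?M)" for U
    using that iso_vert[OF phi0_vert(1) iso_star_unit] by (simp add: phi0_vert(2))
  show "iso (total ?N) (rep_phi2 C pb T \<mu> A B)" if "A \<in> fib ?M U" "B \<in> fib ?M U" for A B U
  proof -
    have o: "A \<in> graphs" "B \<in> graphs" "Cod C (fst A) = U" "Cod C (fst B) = U"
      using that by (simp_all add: fib_Gph)
    show ?thesis
      using iso_vert[OF phi2_vert(1)[OF o] iso_star_assoc[OF o(1,2)]] o
        by (simp add: phi2_vert(2)[OF o])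
  qed
  show "preserves_prone (base ?M) (total ?M) (proj ?M) (total ?N) (proj ?N) (rep C pb T)"
    using rep_prone by (simp add: preserves_prone_def)
qed

end

theorem proposition5p2:
  fixes C :: "('o, 'a) cat" and pb :: "'a \<Rightarrow> 'a \<Rightarrow> 'a \<times> 'a"
    and T :: "('o, 'a, 'o, 'a) ftr" and \<eta> \<mu> :: "'o \<Rightarrow> 'a"
  assumes "category_with_pullbacks C pb"
    and "cartesian_monad C T \<eta> \<mu>"
  shows "strong_lax_monoidal_fibration_morphism (Gph_lmf C pb T \<eta> \<mu>) (Exp_lmf C pb)
           (rep C pb T) (rep_phi0 C pb T \<eta>) (rep_phi2 C pb T \<mu>)
       \<and> bifibration_morphism C (Gph C T) (p_gph C) (Exp C pb) p_exp (rep C pb T)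
       \<and> subcategory (Cart C pb) (Exp C pb)
       \<and> onO (rep C pb T) ` Obj (Gph C T) \<subseteq> Obj (Cart C pb)
       \<and> onA (rep C pb T) ` Arr (Gph C T) \<subseteq> Arr (Cart C pb)"
proof -
  interpret cartesian_monad_with_pullbacks C pb T \<eta> \<mu>
    by (intro cartesian_monad_with_pullbacks.intro pullback_category.intro assms)
  have "onO (rep C pb T) ` Obj (Gph C T) \<subseteq> Obj (Cart C pb)"
    using rep_Obj_Cart by (auto simp: rep_def repO_def)
  moreover have "onA (rep C pb T) ` Arr (Gph C T) \<subseteq> Arr (Cart C pb)"
    using rep_Arr_Cart by (auto simp: rep_def simp del: repA.simps elim!: Arr_GphE)
  ultimately show ?thesis
    using strong_lax_monoidal_fibration_morphism_rep bifibration_morphism_rep subcategory_Cart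
      by blast
qed

end
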